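(* There is a dynamic algorithm that maintains a maximal clique of a decremental graph with $n$ vertices and $m$ initial edges in $\tilde O(n+m)$ expected total update time against an oblivious adversary.
   Context: All graphs are undirected and unweighted. A decremental graph undergoes a sequence of edge deletions; after each update the algorithm must output a maximal clique (a clique not contained in a larger clique) of the current graph. An oblivious adversary fixes the update sequence in advance, independently of the algorithm's outputs and randomness. Total update time includes initialization; $\tilde O$ hides polylogarithmic factors in $n$. *)

theory Defs
  imports "HOL-Probability.Probability" "HOL-Library.Log_Nat"
begin

definition simple_graph :: "'a set \<Rightarrow> 'a set set \<Rightarrow> bool" where
  "simple_graph V E \<longleftrightarrow> finite V \<and> (\<forall>e\<in>E. e \<subseteq> V \<and> card e = 2)"

definition clique :: "'a set \<Rightarrow> 'a set set \<Rightarrow> 'a set \<Rightarrow> bool" where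
  "clique V E C \<longleftrightarrow> C \<subseteq> V \<and> (\<forall>x\<in>C. \<forall>y\<in>C. x \<noteq> y \<longrightarrow> {x, y} \<in> E)"

definition maximal_clique :: "'a set \<Rightarrow> 'a set set \<Rightarrow> 'a set \<Rightarrow> bool" where
  "maximal_clique V E C \<longleftrightarrow> clique V E C \<and> \<not> (\<exists>D. clique V E D \<and> C \<subset> D)"

text \<open>
  Inputs are transmitted as ordered pairs of endpoints; the order carries no meaning, so a deletion
  may name an edge in the orientation opposite to that in the initial edge list.
\<close>

definition undirected :: "'a \<times> 'a \<Rightarrow> 'a set" where
  "undirected p = {fst p, snd p}"

text \<open>\<open>es\<close> lists every edge of \<open>E\<close> exactly once.\<close>

definition enumerates :: "('a \<times> 'a) list \<Rightarrow> 'a set set \<Rightarrow> bool" where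
  "enumerates es E \<longleftrightarrow> distinct (map undirected es) \<and> undirected ` set es = E"

text \<open>Each update deletes an edge that is still present; not all edges need be deleted.\<close>

definition deletion_sequence :: "('a \<times> 'a) list \<Rightarrow> 'a set set \<Rightarrow> bool" where
  "deletion_sequence us E \<longleftrightarrow> distinct (map undirected us) \<and> undirected ` set us \<subseteq> E"

definition graph_after :: "'a set set \<Rightarrow> ('a \<times> 'a) list \<Rightarrow> 'a set set" where
  "graph_after E us = E - undirected ` set us"

text \<open>
  Programs of a while language over \<open>w\<close>-bit words.  The store consists of registers and of arrays
  indexed by words.  A program mentions only finitely many names, so interleaving its arrays in one
  memory turns it into an ordinary word RAM program, up to constant factors in the running time.
\<close>

type_synonym vname = string

datatype aexp =
    Const nat
  | Reg vname
  | Read vname aexp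
  | Plus aexp aexp
  | Minus aexp aexp
  | Times aexp aexp
  | Div aexp aexp

datatype bexp =
    Less aexp aexp
  | Equal aexp aexp
  | Not bexp
  | And bexp bexp

datatype com =
    Skip
  | Assign vname aexp
  | Write vname aexp aexp
  | Random vname aexp
  | Seq com com
  | Cond bexp com com
  | While bexp com

record store =
  reg :: "vname \<Rightarrow> nat"
  arr :: "vname \<Rightarrow> nat \<Rightarrow> nat"

text \<open>
  Words are the numbers below \<open>2 ^ w\<close>, and every intermediate result is reduced modulo \<open>2 ^ w\<close>.
  Subtraction is cut off at \<open>0\<close>, and division by \<open>0\<close> yields \<open>0\<close>.
\<close>

primrec aval :: "nat \<Rightarrow> aexp \<Rightarrow> store \<Rightarrow> nat" where
  "aval w (Const k) s = k mod 2 ^ w"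
| "aval w (Reg x) s = reg s x"
| "aval w (Read a e) s = arr s a (aval w e s)"
| "aval w (Plus e f) s = (aval w e s + aval w f s) mod 2 ^ w"
| "aval w (Minus e f) s = aval w e s - aval w f s"
| "aval w (Times e f) s = (aval w e s * aval w f s) mod 2 ^ w"
| "aval w (Div e f) s = aval w e s div aval w f s"

primrec bval :: "nat \<Rightarrow> bexp \<Rightarrow> store \<Rightarrow> bool" where
  "bval w (Less e f) s \<longleftrightarrow> aval w e s < aval w f s"
| "bval w (Equal e f) s \<longleftrightarrow> aval w e s = aval w f s"
| "bval w (Not b) s \<longleftrightarrow> \<not> bval w b s"
| "bval w (And b c) s \<longleftrightarrow> bval w b s \<and> bval w c s"

definition set_reg :: "vname \<Rightarrow> nat \<Rightarrow> store \<Rightarrow> store" where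
  "set_reg x k s = s\<lparr>reg := (reg s)(x := k)\<rparr>"

definition set_arr :: "vname \<Rightarrow> nat \<Rightarrow> nat \<Rightarrow> store \<Rightarrow> store" where
  "set_arr a i k s = s\<lparr>arr := (arr s)(a := (arr s a)(i := k))\<rparr>"

text \<open>A uniformly random number below \<open>k\<close>, where \<open>k = 0\<close> yields \<open>0\<close>.\<close>

definition uniform_below :: "nat \<Rightarrow> nat spmf" where
  "uniform_below k = (if k = 0 then return_spmf 0 else spmf_of_set {..<k})"

text \<open>
  The result of an execution is the joint distribution of the final store and the number of steps.
  Missing probability mass is the probability of divergence.  An atomic command and the evaluation
  of a guard take one step each; as the expressions of a fixed program have bounded size, this is
  proportional to the number of word operations.
\<close>

partial_function (spmf) while_steps ::
  "('s \<Rightarrow> bool) \<Rightarrow> ('s \<Rightarrow> ('s \<times> nat) spmf) \<Rightarrow> 's \<Rightarrow> ('s \<times> nat) spmf"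
where
  "while_steps b body s =
     (if b s then
        bind_spmf (body s) (\<lambda>(s', t).
        bind_spmf (while_steps b body s') (\<lambda>(s'', t').
        return_spmf (s'', 1 + t + t')))
      else return_spmf (s, 1))"

primrec exec :: "nat \<Rightarrow> com \<Rightarrow> store \<Rightarrow> (store \<times> nat) spmf" where
  "exec w Skip = (\<lambda>s. return_spmf (s, 1))"
| "exec w (Assign x e) = (\<lambda>s. return_spmf (set_reg x (aval w e s) s, 1))"
| "exec w (Write a e f) = (\<lambda>s. return_spmf (set_arr a (aval w e s) (aval w f s) s, 1))"
| "exec w (Random x e) =
     (\<lambda>s. map_spmf (\<lambda>k. (set_reg x k s, 1)) (uniform_below (aval w e s)))"
| "exec w (Seq c d) =
     (\<lambda>s. bind_spmf (exec w c s) (\<lambda>(s', t).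
          bind_spmf (exec w d s') (\<lambda>(s'', t').
          return_spmf (s'', t + t'))))"
| "exec w (Cond b c d) =
     (\<lambda>s. bind_spmf (if bval w b s then exec w c s else exec w d s) (\<lambda>(s', t).
          return_spmf (s', 1 + t)))"
| "exec w (While b c) = while_steps (bval w b) (exec w c)"

text \<open>
  A dynamic algorithm is a pair of programs working on the same store: one is run once on the
  initial graph, the other after each update.
\<close>

record dynamic_algorithm =
  initialize :: com
  update :: com

text \<open>
  Initially, registers \<open>n\<close> and \<open>m\<close> hold the numbers of vertices and edges, and the arrays \<open>U\<close> and
  \<open>V\<close> hold the endpoints of the edges; everything else is \<open>0\<close>.  An update arrives in registers \<open>u\<close>
  and \<open>v\<close>.
\<close>

definition initial_store :: "nat \<Rightarrow> (nat \<times> nat) list \<Rightarrow> store" where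
  "initial_store n es =
     \<lparr>reg = (\<lambda>_. 0)(''n'' := n, ''m'' := length es),
      arr = (\<lambda>_ _. 0)
        (''U'' := (\<lambda>i. if i < length es then fst (es ! i) else 0),
         ''V'' := (\<lambda>i. if i < length es then snd (es ! i) else 0))\<rparr>"

definition load_update :: "nat \<times> nat \<Rightarrow> store \<Rightarrow> store" where
  "load_update p s = set_reg ''v'' (snd p) (set_reg ''u'' (fst p) s)"

text \<open>
  The output is kept in the store as an explicit list: register \<open>k\<close> holds its length and array \<open>C\<close>
  its entries.  It is maintained between updates and not copied out anew after each of them, which
  could not be done in near-linear total time.
\<close>

definition output_list :: "store \<Rightarrow> nat list" where
  "output_list s = map (arr s ''C'') [0..<reg s ''k'']"

text \<open>Each update is loaded only when the processing of its predecessor is complete.\<close>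

primrec run_updates ::
  "nat \<Rightarrow> com \<Rightarrow> (nat \<times> nat) list \<Rightarrow> store \<Rightarrow> (nat list list \<times> nat) spmf"
where
  "run_updates w c [] s = return_spmf ([], 0)"
| "run_updates w c (p # us) s =
     bind_spmf (exec w c (load_update p s)) (\<lambda>(s', t).
     bind_spmf (run_updates w c us s') (\<lambda>(outs, t').
     return_spmf (output_list s' # outs, t + t')))"

text \<open>
  The joint distribution of the outputs after initialization and after each update, and of the total
  number of steps, initialization included.
\<close>

definition run ::
  "nat \<Rightarrow> dynamic_algorithm \<Rightarrow> nat \<Rightarrow> (nat \<times> nat) list \<Rightarrow> (nat \<times> nat) list \<Rightarrow>
     (nat list list \<times> nat) spmf"
where
  "run w A n es us =
     bind_spmf (exec w (initialize A) (initial_store n es)) (\<lambda>(s, t).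
     bind_spmf (run_updates w (update A) us s) (\<lambda>(outs, t').
     return_spmf (output_list s # outs, t + t')))"

text \<open>
  This is the expected running time only if the run terminates almost surely; diverging runs, whose
  mass is missing, do not contribute.
\<close>

definition expected_total_time :: "(nat list list \<times> nat) spmf \<Rightarrow> ennreal" where
  "expected_total_time D = (\<integral>\<^sup>+ x. of_nat (snd x) \<partial>measure_spmf D)"

text \<open>Output number \<open>i\<close> is a repetition-free list of a maximal clique after the first \<open>i\<close> deletions.\<close>

definition maintains_maximal_clique ::
  "nat \<Rightarrow> nat set set \<Rightarrow> (nat \<times> nat) list \<Rightarrow> nat list list \<Rightarrow> bool"
where
  "maintains_maximal_clique n E us outs \<longleftrightarrow>
     length outs = Suc (length us) \<and>
     (\<forall>i\<le>length us. distinct (outs ! i) \<and>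
        maximal_clique {..<n} (graph_after E (take i us)) (set (outs ! i)))"

end

theory Submission
  imports Defs "HOL-Analysis.Harmonic_Numbers" "HOL-Combinatorics.Multiset_Permutations" "HOL-Combinatorics.Transposition"
begin

text \<open>
  A uniformly random vertex \<open>r\<close> belongs to the clique throughout, so that only \<open>r\<close> and its \<open>d\<close> initial
  neighbours matter, and as the expectation of \<open>d\<^sup>2\<close> is \<open>O(m)\<close>, time quadratic in \<open>d\<close> is affordable.
  On these vertices a maximal clique is a maximal independent set of the complement, which only gains
  edges.  We maintain the lexicographically first one with respect to a random order in which \<open>r\<close> comes
  first.  When an edge is inserted, the expected number of vertices whose membership changes is
  \<open>O(log d)\<close>, except that insertions at \<open>r\<close> may change \<open>O(d log d)\<close> of them, but there are at most \<open>d\<close>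
  such insertions.  The key of a vertex is the rank of the first member of the set that dominates it; among
  vertices undominated by the first \<open>\<kappa>\<close> ranks the degrees are \<open>O(d log d / \<kappa>)\<close> with high probability,
  so that neighbourhoods organised by keys can be searched and updated cheaply.
\<close>


text \<open>Counting the changed vertices is not enough. A change at rank \<open>\<kappa>\<close>
  touches about \<open>d / \<kappa>\<close> neighbours, each with about as many of its own, and
  costs about \<open>(d / \<kappa>)\<^sup>2\<close>. The decisive bound is rank-sensitive: the
  expected number of changes of rank at most \<open>\<theta>\<close> is at most twice the
  probability that both ends of the new edge have rank at most \<open>\<theta>\<close>, about
  \<open>(\<theta> / d)\<^sup>2\<close>, or \<open>\<theta> / d\<close> if one end is the root,
  whose rank is 0. Summation by parts over \<open>\<theta>\<close> then leaves a harmonic sum. Of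
  the four logarithms two come from the squared degree bound, one from this sum and one from the
  trees. The initial complement is built by the same insertions, from the edgeless graph on, in an
  order given by the input and not by the random order. So the whole sequence of insertions is fixed
  while the order varies, and each insertion can be averaged over all orders separately. The average
  of \<open>d\<^sup>2\<close> over the root is linear because \<open>d < n\<close> and the degrees
  sum to \<open>2 m\<close>.\<close>

notation Seq (infixr ";;" 55)

section \<open>Weakest preconditions with running time\<close>

text \<open>Total correctness for executions without random choice: the outcome is a point mass, and
  the postcondition sees the exact number of steps. Randomness occurs only in drawing the root and
  the order, so nearly all of the program is verified with this predicate and probability enters
  only through \<open>cpl\<close>.\<close>

definition wp :: "nat \<Rightarrow> com \<Rightarrow> (store \<Rightarrow> nat \<Rightarrow> bool) \<Rightarrow> store \<Rightarrow> bool" where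
  "wp w c Q s \<longleftrightarrow> (\<exists>s' t. exec w c s = return_spmf (s', t) \<and> Q s' t)"

definition same :: "vname set \<Rightarrow> vname set \<Rightarrow> store \<Rightarrow> store \<Rightarrow> bool" where
  "same R A s s' \<longleftrightarrow> (\<forall>x. x \<notin> R \<longrightarrow> reg s' x = reg s x) \<and> (\<forall>a. a \<notin> A \<longrightarrow> arr s' a = arr s a)"

lemma reg_set_reg [simp]: "reg (set_reg x k s) y = (if y = x then k else reg s y)"
  and arr_set_reg [simp]: "arr (set_reg x k s) = arr s"
  and reg_set_arr [simp]: "reg (set_arr a i k s) = reg s"
  and arr_set_arr [simp]: "arr (set_arr a i k s) b = (if b = a then (arr s a)(i := k) else arr s b)"
  by (auto simp: set_reg_def set_arr_def)

lemma set_reg_set_reg [simp]: "set_reg x k (set_reg x l s) = set_reg x k s"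
  by (simp add: set_reg_def)

lemma same_refl [simp]: "same R A s s"
  by (simp add: same_def)

lemma same_mono: "same R A s s' \<Longrightarrow> R \<subseteq> R' \<Longrightarrow> A \<subseteq> A' \<Longrightarrow> same R' A' s s'"
  unfolding same_def by blast

lemma same_trans: "same R A s s' \<Longrightarrow> same R A s' s'' \<Longrightarrow> same R A s s''"
  by (simp add: same_def)

lemma same_reg: "same R A s s' \<Longrightarrow> x \<notin> R \<Longrightarrow> reg s' x = reg s x"
  and same_arr: "same R A s s' \<Longrightarrow> a \<notin> A \<Longrightarrow> arr s' a = arr s a"
  by (auto simp: same_def)

lemma same_set_reg [simp]: "x \<in> R \<Longrightarrow> same R A s (set_reg x k s') = same R A s s'"
  and same_set_arr [simp]: "a \<in> A \<Longrightarrow> same R A s (set_arr a i k s') = same R A s s'"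
  and same_set_reg' [simp]: "x \<in> R \<Longrightarrow> same R A (set_reg x k s) s' = same R A s s'"
  and same_set_arr' [simp]: "a \<in> A \<Longrightarrow> same R A (set_arr a i k s) s' = same R A s s'"
  by (auto simp: same_def)

lemma wp_mono: "wp w c Q s \<Longrightarrow> (\<And>s' t. Q s' t \<Longrightarrow> Q' s' t) \<Longrightarrow> wp w c Q' s"
  unfolding wp_def by blast

lemma wp_Seq: "wp w c (\<lambda>s' t. wp w d (\<lambda>s'' t'. Q s'' (t + t')) s') s \<Longrightarrow> wp w (c ;; d) Q s"
  unfolding wp_def by (force simp: bind_return_spmf)

lemma wp_SeqI:
  assumes "wp w c R s" "\<And>s' t. R s' t \<Longrightarrow> wp w d (\<lambda>s'' t'. Q s'' (t + t')) s'"
  shows "wp w (c ;; d) Q s"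
  by (rule wp_Seq, rule wp_mono[OF assms(1)], rule assms(2))

text \<open>Adding a constant to the step count is injective, so a point mass after the shift was
  one before it. This turns \<open>wp_map\<close> into an equivalence, whose instances can serve as
  rewrite rules.\<close>

lemma map_spmf_eq_return_inj:
  assumes "inj f" "map_spmf f p = return_spmf y"
  obtains x where "p = return_spmf x" "y = f x"
proof -
  have m: "map_option f ` set_pmf p = {Some y}"
    using assms(2) by (metis pmf.set_map set_return_pmf)
  have *: "\<exists>x. z = Some x \<and> f x = y" if "z \<in> set_pmf p" for z
    using m that by (cases z) auto
  obtain z where z: "z \<in> set_pmf p"
    using set_pmf_not_empty by fast
  then obtain x where x: "z = Some x" "f x = y"
    using * by blast
  have "set_pmf p \<subseteq> {Some x}"
    using * x assms(1) by (auto dest: injD)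
  then have "p = return_spmf x"
    by (simp add: set_pmf_subset_singleton)
  then show thesis using that x by simp
qed

lemma wp_map:
  assumes "exec w c s = map_spmf (\<lambda>(s', t). (s', n + t)) (exec w d s2)"
  shows "wp w c Q s = wp w d (\<lambda>s' t. Q s' (n + t)) s2"
proof -
  have inj: "inj (\<lambda>(s' :: store, t :: nat). (s', n + t))"
    by (auto intro: injI)
  let ?f = "\<lambda>(s', t). (s', n + t)"
  show ?thesis
  proof
    assume "wp w c Q s"
    then obtain s' t where 1: "map_spmf ?f (exec w d s2) = return_spmf (s', t)" "Q s' t"
      unfolding wp_def assms by blast
    obtain x where x: "exec w d s2 = return_spmf x" "(s', t) = ?f x"
      using map_spmf_eq_return_inj[OF inj 1(1)] by blast
    then have "exec w d s2 = return_spmf (fst x, snd x)" "Q (fst x) (n + snd x)"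
      using 1(2) by (auto simp: case_prod_unfold)
    then show "wp w d (\<lambda>s' t. Q s' (n + t)) s2"
      unfolding wp_def by blast
  next
    assume "wp w d (\<lambda>s' t. Q s' (n + t)) s2"
    then obtain s' t where "exec w d s2 = return_spmf (s', t)" "Q s' (n + t)"
      unfolding wp_def by blast
    then show "wp w c Q s"
      unfolding wp_def assms by (intro exI[of _ s'] exI[of _ "n + t"]) simp
  qed
qed

lemma wp_simps [simp]:
  "wp w Skip Q s = Q s 1"
  "wp w (Assign x e) Q s = Q (set_reg x (aval w e s) s) 1"
  "wp w (Write a e f) Q s = Q (set_arr a (aval w e s) (aval w f s) s) 1"
  by (auto simp: wp_def)

lemma wp_Seq_simps [simp]:
  "wp w (Skip ;; d) Q s = wp w d (\<lambda>s' t. Q s' (1 + t)) s"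
  "wp w (Assign x e ;; d) Q s = wp w d (\<lambda>s' t. Q s' (1 + t)) (set_reg x (aval w e s) s)"
  "wp w (Write a e f ;; d) Q s = wp w d (\<lambda>s' t. Q s' (1 + t)) (set_arr a (aval w e s) (aval w f s) s)"
  by (rule wp_map; simp add: bind_return_spmf map_spmf_conv_bind_spmf case_prod_unfold)+

lemma wp_Cond [simp]:
  "wp w (Cond b c d) Q s = (if bval w b s then wp w c (\<lambda>s' t. Q s' (1 + t)) s else wp w d (\<lambda>s' t. Q s' (1 + t)) s)"
proof (cases "bval w b s")
  case True
  then have "wp w (Cond b c d) Q s = wp w c (\<lambda>s' t. Q s' (1 + t)) s"
    by (intro wp_map) (simp add: map_spmf_conv_bind_spmf case_prod_unfold)
  with True show ?thesis by simp
next
  case False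
  then have "wp w (Cond b c d) Q s = wp w d (\<lambda>s' t. Q s' (1 + t)) s"
    by (intro wp_map) (simp add: map_spmf_conv_bind_spmf case_prod_unfold)
  with False show ?thesis by simp
qed

text \<open>Pushes the continuation into both branches. Together with the other rewrite rules it
  lets the simplifier execute loop-free code symbolically.\<close>

lemma wp_Seq_Cond [simp]:
  "wp w (Cond b c c' ;; d) Q s =
     (if bval w b s then wp w (c ;; d) (\<lambda>s' t. Q s' (1 + t)) s else wp w (c' ;; d) (\<lambda>s' t. Q s' (1 + t)) s)"
proof (cases "bval w b s")
  case True
  then have "wp w (Cond b c c' ;; d) Q s = wp w (c ;; d) (\<lambda>s' t. Q s' (1 + t)) s"
    by (intro wp_map) (simp add: map_spmf_conv_bind_spmf case_prod_unfold)
  with True show ?thesis by simp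
next
  case False
  then have "wp w (Cond b c c' ;; d) Q s = wp w (c' ;; d) (\<lambda>s' t. Q s' (1 + t)) s"
    by (intro wp_map) (simp add: map_spmf_conv_bind_spmf case_prod_unfold)
  with False show ?thesis by simp
qed

lemma wp_Seq_assoc [simp]: "wp w ((c ;; d) ;; e) Q s = wp w (c ;; d ;; e) Q s"
proof -
  have "exec w ((c ;; d) ;; e) s = exec w (c ;; d ;; e) s"
    by (simp add: case_prod_unfold add.assoc)
  then show ?thesis by (simp add: wp_def)
qed

text \<open>\<open>g\<close> is a ghost state and \<open>\<Phi> g\<close> the time still to be paid
  for. The potential falls by the cost of the body plus 1 for the guard, so it gives termination and
  the time bound at once; the 1 in the conclusion is the last, failing guard.\<close>

lemma wp_while:
  assumes "Inv g s"
    and step: "\<And>g s. Inv g s \<Longrightarrow> bval w b s \<Longrightarrow> wp w c (\<lambda>s' t. \<exists>g'. Inv g' s' \<and> t + 1 + \<Phi> g' \<le> \<Phi> g) s"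
  shows "wp w (While b c) (\<lambda>s' t. \<exists>g'. Inv g' s' \<and> \<not> bval w b s' \<and> t + \<Phi> g' \<le> \<Phi> g + (1 :: nat)) s"
  using assms(1)
proof (induction "\<Phi> g" arbitrary: g s rule: less_induct)
  case less
  have unf: "exec w (While b c) s = (if bval w b s then
        bind_spmf (exec w c s) (\<lambda>(s', t). bind_spmf (exec w (While b c) s') (\<lambda>(s'', t').
        return_spmf (s'', 1 + t + t'))) else return_spmf (s, 1))"
    by (subst exec.simps(7), subst while_steps.simps) simp
  show ?case
  proof (cases "bval w b s")
    case False
    with less.prems show ?thesis
      unfolding wp_def unf by auto
  next
    case True
    from step[OF less.prems True] obtain s1 t1 g1 where 1: "exec w c s = return_spmf (s1, t1)"
      "Inv g1 s1" "t1 + 1 + \<Phi> g1 \<le> \<Phi> g"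
      unfolding wp_def by blast
    have "\<Phi> g1 < \<Phi> g" using 1(3) by simp
    from less.hyps[OF this 1(2)] obtain s2 t2 g2 where 2: "exec w (While b c) s1 = return_spmf (s2, t2)"
      "Inv g2 s2" "\<not> bval w b s2" "t2 + \<Phi> g2 \<le> \<Phi> g1 + 1"
      unfolding wp_def by blast
    have "exec w (While b c) s = return_spmf (s2, 1 + t1 + t2)"
      unfolding unf using True by (simp add: 1 2 bind_return_spmf del: exec.simps)
    with 2 1(3) show ?thesis
      unfolding wp_def by (intro exI[of _ s2] exI[of _ "1 + t1 + t2"]) (auto intro!: exI[of _ g2])
  qed
qed

section \<open>Segment trees\<close>

text \<open>All trees share the array \<open>T\<close>. Row \<open>a\<close> starts at
  \<open>a * D\<close> and is a complete binary tree of maxima with root 1, children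
  \<open>2 f\<close> and \<open>2 f + 1\<close> of node \<open>f\<close>, and leaf \<open>b\<close>
  at \<open>P + b\<close>. The loop recomputes the maxima on the path from a changed leaf to the
  root.\<close>

definition tset_loop :: com where
  "tset_loop =
     While (Less (Const (Suc 0)) (Reg ''f''))
       (Assign ''f'' (Div (Reg ''f'') (Const 2)) ;;
        Assign ''g'' (Plus (Reg ''e'') (Times (Const 2) (Reg ''f''))) ;;
        Cond (Less (Read ''T'' (Reg ''g'')) (Read ''T'' (Plus (Reg ''g'') (Const (Suc 0)))))
          (Write ''T'' (Plus (Reg ''e'') (Reg ''f'')) (Read ''T'' (Plus (Reg ''g'') (Const (Suc 0)))))
          (Write ''T'' (Plus (Reg ''e'') (Reg ''f'')) (Read ''T'' (Reg ''g''))))"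

definition tset :: com where
  "tset =
     Assign ''e'' (Times (Reg ''a'') (Reg ''D'')) ;;
     Assign ''f'' (Plus (Reg ''P'') (Reg ''b'')) ;;
     Write ''T'' (Plus (Reg ''e'') (Reg ''f'')) (Reg ''c'') ;;
     tset_loop"

text \<open>The descent goes right only if the maximum of the left child is below \<open>c\<close>,
  so it ends at the leftmost leaf that reaches \<open>c\<close>.\<close>

definition tfirst_loop :: com where
  "tfirst_loop =
     While (Less (Reg ''f'') (Reg ''P''))
       (Assign ''f'' (Times (Const 2) (Reg ''f'')) ;;
        Cond (Less (Read ''T'' (Plus (Reg ''e'') (Reg ''f''))) (Reg ''c''))
          (Assign ''f'' (Plus (Reg ''f'') (Const (Suc 0)))) Skip)"

definition tfirst :: com where
  "tfirst =
     Assign ''e'' (Times (Reg ''a'') (Reg ''D'')) ;;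
     Assign ''f'' (Const (Suc 0)) ;;
     tfirst_loop ;;
     Assign ''b'' (Minus (Reg ''f'') (Reg ''P''))"

text \<open>Rows 0 to \<open>N\<close> hold the neighbourhoods of the ranks and row
  \<open>N + 1\<close> the queue. The bound on the word size leaves room for one further row of
  \<open>2 * 2 ^ lg\<close> entries, so that the indices computed below are never reduced modulo
  \<open>2 ^ w\<close>.\<close>

locale ram =
  fixes w N lg :: nat
  assumes N_less: "N < 2 ^ lg"
    and word_size: "(N + 3) * (2 * 2 ^ lg) < 2 ^ w"
begin

abbreviation P :: nat where "P \<equiv> 2 ^ lg"

definition env :: "store \<Rightarrow> bool" where
  "env s \<longleftrightarrow> reg s ''P'' = P \<and> reg s ''D'' = 2 * P \<and> reg s ''N'' = N"

definition row :: "store \<Rightarrow> nat \<Rightarrow> nat \<Rightarrow> nat" where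
  "row s u i = arr s ''T'' (u * (2 * P) + i)"

definition heap :: "(nat \<Rightarrow> nat) \<Rightarrow> bool" where
  "heap f \<longleftrightarrow> (\<forall>i. 1 \<le> i \<and> i < P \<longrightarrow> f i = max (f (2 * i)) (f (2 * i + 1)))"

definition tree :: "(nat \<Rightarrow> nat \<Rightarrow> nat) \<Rightarrow> store \<Rightarrow> bool" where
  "tree L s \<longleftrightarrow> (\<forall>u\<le>N + 1. heap (row s u) \<and> (\<forall>z<P. row s u (P + z) = L u z))"

lemma P_pos [simp]: "0 < P" by simp

lemma word_gt: "x < (N + 3) * (2 * P) \<Longrightarrow> x mod 2 ^ w = x" "6 * P < 2 ^ w"
proof -
  have "6 * P \<le> (N + 3) * (2 * P)" by (simp add: algebra_simps)
  then show "6 * P < 2 ^ w" using word_size by linarith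
qed (use word_size in simp)

lemma index_less: "u \<le> N + 1 \<Longrightarrow> i < 4 * P \<Longrightarrow> u * (2 * P) + i < 2 ^ w"
proof -
  assume "u \<le> N + 1" "i < 4 * P"
  then have "u * (2 * P) + i < (N + 1) * (2 * P) + 4 * P"
    by (intro add_le_less_mono mult_right_mono) auto
  also have "\<dots> = (N + 3) * (2 * P)" by (simp add: algebra_simps)
  finally show ?thesis using word_size by linarith
qed

lemma index_mod: "u \<le> N + 1 \<Longrightarrow> i < 4 * P \<Longrightarrow> (u * (2 * P) + i) mod 2 ^ w = u * (2 * P) + i"
  using index_less by simp

lemma small_mod: "i < 6 * P \<Longrightarrow> i mod 2 ^ w = i"
  using word_gt(2) by simp

lemma w_pos [simp]: "0 < w" and two_mod [simp]: "2 mod 2 ^ w = (2 :: nat)" and Suc_0_mod [simp]: "Suc 0 mod 2 ^ w = Suc 0"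
proof -
  have "(1 :: nat) \<le> P" by simp
  with word_gt(2) have "(6 :: nat) < 2 ^ w" by linarith
  then show "0 < w" "2 mod 2 ^ w = (2 :: nat)" "Suc 0 mod 2 ^ w = Suc 0"
    by (auto intro!: gr0I)
qed

lemma index_eq: "i < 2 * P \<Longrightarrow> j < 2 * P \<Longrightarrow> u * (2 * P) + i = v * (2 * P) + j \<longleftrightarrow> u = v \<and> i = j"
proof
  assume a: "i < 2 * P" "j < 2 * P" "u * (2 * P) + i = v * (2 * P) + j"
  have "(u * (2 * P) + i) div (2 * P) = u" "(v * (2 * P) + j) div (2 * P) = v"
    using a(1,2) by simp_all
  with a(3) show "u = v \<and> i = j" by auto
qed auto

lemma row_set_arr:
  "i < 2 * P \<Longrightarrow> j < 2 * P \<Longrightarrow> row (set_arr ''T'' (u * (2 * P) + i) x s) v j = (if v = u \<and> j = i then x else row s v j)"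
  using index_eq by (auto simp: row_def)

lemma row_set_reg [simp]: "row (set_reg x k s) = row s"
  by (simp add: row_def fun_eq_iff)

lemma tree_set_reg [simp]: "tree L (set_reg x k s) = tree L s"
  by (simp add: tree_def)

lemma tree_set_arr [simp]: "a \<noteq> ''T'' \<Longrightarrow> tree L (set_arr a i k s) = tree L s"
  by (simp add: tree_def row_def heap_def)

lemma env_set_arr [simp]: "env (set_arr a i k s) = env s"
  by (simp add: env_def)

lemma env_set_reg [simp]: "x \<notin> {''P'', ''D'', ''N''} \<Longrightarrow> env (set_reg x k s) = env s"
  by (auto simp: env_def)

lemma tree_same: "same R A s s' \<Longrightarrow> tree L s \<Longrightarrow> ''T'' \<notin> A \<Longrightarrow> tree L s'"
  by (simp add: tree_def row_def same_def heap_def)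

lemma tree_cong: "(\<And>u z. u \<le> N + 1 \<Longrightarrow> z < P \<Longrightarrow> L u z = L' u z) \<Longrightarrow> tree L s = tree L' s"
  unfolding tree_def by (auto)

lemma heap_ancestor:
  assumes "heap f" "q < 2 * P" "1 \<le> q div 2 ^ m"
  shows "f q \<le> f (q div 2 ^ m)"
  using assms(3)
proof (induction m)
  case (Suc m)
  let ?i = "q div 2 ^ Suc m"
  have i: "?i = (q div 2 ^ m) div 2"
    by (metis div_mult2_eq power_Suc2)
  have "?i * 2 \<le> q div 2 ^ m" "q div 2 ^ m \<le> q"
    unfolding i by simp_all
  then have "?i < P" using assms(2) by linarith
  then have "f ?i = max (f (2 * ?i)) (f (2 * ?i + 1))"
    using assms(1) Suc.prems by (simp add: heap_def)
  moreover have "q div 2 ^ m = 2 * ?i \<or> q div 2 ^ m = 2 * ?i + 1"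
    unfolding i by linarith
  moreover have "1 \<le> q div 2 ^ m" using \<open>?i * 2 \<le> q div 2 ^ m\<close> Suc.prems by linarith
  ultimately show ?case using Suc.IH by (metis max.coboundedI1 max.coboundedI2)
qed simp

text \<open>The invariant lets only the proper ancestors \<open>f div 2 ^ Suc m\<close> of the
  current node \<open>f\<close> violate the heap condition. Each iteration repairs the parent, which
  shortens this chain, and at the root nothing is left to repair.\<close>

lemma tset_correct:
  assumes "env s" "tree L s" and a: "reg s ''a'' \<le> N + 1" and b: "reg s ''b'' < P"
  shows "wp w tset (\<lambda>s' t. same {''e'', ''f'', ''g''} {''T''} s s' \<and>
     tree (L(reg s ''a'' := (L (reg s ''a''))(reg s ''b'' := reg s ''c''))) s' \<and> t \<le> 5 * (lg + 2)) s"
proof -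
  define a b c where "a = reg s ''a''" and "b = reg s ''b''" and "c = reg s ''c''"
  note defs = a_def[symmetric] b_def[symmetric] c_def[symmetric]
  have aN: "a \<le> N + 1" and bP: "b < P" using a b defs by auto
  have regs: "reg s ''P'' = P" "reg s ''D'' = 2 * P"
    using assms(1) by (auto simp: env_def)
  have e_mod: "a * (2 * P) mod 2 ^ w = a * (2 * P)"
    using index_mod[OF aN, of 0] by simp
  define Inv where "Inv = (\<lambda>j s1. same {''e'', ''f'', ''g''} {''T''} s s1 \<and> reg s1 ''e'' = a * (2 * P) \<and>
     1 \<le> reg s1 ''f'' \<and> reg s1 ''f'' < 2 ^ Suc j \<and> reg s1 ''f'' < 2 * P \<and>
     (\<forall>u\<le>N + 1. u \<noteq> a \<longrightarrow> (\<forall>i<2 * P. row s1 u i = row s u i)) \<and>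
     (\<forall>z<P. row s1 a (P + z) = ((L a)(b := c)) z) \<and>
     (\<forall>i. 1 \<le> i \<and> i < P \<and> (\<forall>m. i \<noteq> reg s1 ''f'' div 2 ^ Suc m) \<longrightarrow>
        row s1 a i = max (row s1 a (2 * i)) (row s1 a (2 * i + 1))))"
  have heap0: "heap (row s u)" "z < P \<Longrightarrow> row s u (P + z) = L u z" if "u \<le> N + 1" for u z
    using assms(2) that by (auto simp: tree_def)
  let ?s1 = "set_arr ''T'' (a * (2 * P) + (P + b)) c
              (set_reg ''f'' (P + b) (set_reg ''e'' (a * (2 * P)) s))"
  have Inv0: "Inv lg ?s1"
  proof -
    have *: "row ?s1 u i = (if u = a \<and> i = P + b then c else row s u i)" if "i < 2 * P" for u i
      using bP that by (subst row_set_arr) auto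
    have 1: "row ?s1 a i = max (row ?s1 a (2 * i)) (row ?s1 a (2 * i + 1))"
      if i: "1 \<le> i" "i < P" "\<forall>m. i \<noteq> (P + b) div 2 ^ Suc m" for i
    proof -
      have "i \<noteq> (P + b) div 2" using i(3)[rule_format, of 0] by simp
      then have "2 * i \<noteq> P + b" "2 * i + 1 \<noteq> P + b" by linarith+
      with i heap0(1)[OF aN] show ?thesis
        unfolding heap_def by (subst (1 2 3) *) (auto)
    qed
    show ?thesis
      unfolding Inv_def using bP heap0 aN 1 by (auto simp: *)
  qed
  have step: "wp w (Assign ''f'' (Div (Reg ''f'') (Const 2)) ;;
        Assign ''g'' (Plus (Reg ''e'') (Times (Const 2) (Reg ''f''))) ;;
        Cond (Less (Read ''T'' (Reg ''g'')) (Read ''T'' (Plus (Reg ''g'') (Const (Suc 0)))))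
          (Write ''T'' (Plus (Reg ''e'') (Reg ''f'')) (Read ''T'' (Plus (Reg ''g'') (Const (Suc 0)))))
          (Write ''T'' (Plus (Reg ''e'') (Reg ''f'')) (Read ''T'' (Reg ''g''))))
        (\<lambda>s' t. \<exists>j'. Inv j' s' \<and> t + 1 + 5 * j' \<le> 5 * j) s1"
    if inv: "Inv j s1" and gd: "bval w (Less (Const (Suc 0)) (Reg ''f'')) s1" for j s1
  proof -
    define f where "f = reg s1 ''f''"
    define h where "h = f div 2"
    have f1: "1 < f" using gd by (simp add: f_def)
    have f2: "f < 2 * P" "f < 2 ^ Suc j" and e: "reg s1 ''e'' = a * (2 * P)"
      using inv by (auto simp: Inv_def f_def)
    from f1 f2(2) obtain j' where j: "j = Suc j'" by (cases j) auto
    have h: "1 \<le> h" "h < P" "h < 2 ^ Suc j'" using f1 f2 by (auto simp: h_def j)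
    have mods: "(2 * h) mod 2 ^ w = 2 * h"
      "(a * (2 * P) + 2 * h) mod 2 ^ w = a * (2 * P) + 2 * h"
      "(a * (2 * P) + 2 * h + 1) mod 2 ^ w = a * (2 * P) + 2 * h + 1"
      "Suc (a * (2 * P) + 2 * h) mod 2 ^ w = a * (2 * P) + 2 * h + 1"
      "(a * (2 * P) + h) mod 2 ^ w = a * (2 * P) + h"
      using small_mod[of "2 * h"] h
        index_mod[OF aN, of "2 * h"] index_mod[OF aN, of "2 * h + 1"] index_mod[OF aN, of h]
      by (auto simp: add.assoc)
    let ?m = "max (row s1 a (2 * h)) (row s1 a (2 * h + 1))"
    define s2 where "s2 = set_arr ''T'' (a * (2 * P) + h) ?m (set_reg ''g'' (a * (2 * P) + 2 * h) (set_reg ''f'' h s1))"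
    have r: "row s2 u i = (if u = a \<and> i = h then ?m else row s1 u i)" if "i < 2 * P" for u i
      using h that unfolding s2_def by (subst row_set_arr) auto
    have "Inv j' s2"
    proof -
      have 1: "row s2 a i = max (row s2 a (2 * i)) (row s2 a (2 * i + 1))"
        if i: "1 \<le> i" "i < P" "\<forall>m. i \<noteq> h div 2 ^ Suc m" for i
      proof (cases "i = h")
        case True
        then show ?thesis using h by (subst (1 2 3) r) auto
      next
        case False
        have "i \<noteq> f div 2 ^ Suc m" for m
        proof (cases m)
          case 0
          then show ?thesis using False by (simp add: h_def)
        next
          case (Suc k)
          then show ?thesis using i(3)[rule_format, of k]
            by (simp add: h_def div_mult2_eq[symmetric])
        qed
        then have "row s1 a i = max (row s1 a (2 * i)) (row s1 a (2 * i + 1))"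
          using inv i(1,2) by (simp add: Inv_def f_def)
        moreover have "2 * i \<noteq> h" "2 * i + 1 \<noteq> h"
          using i(3)[rule_format, of 0] by auto
        ultimately show ?thesis using i(2) False by (subst (1 2 3) r) auto
      qed
      have sm: "same {''e'', ''f'', ''g''} {''T''} s s2"
        using inv by (simp add: Inv_def s2_def)
      have oth: "\<forall>u\<le>N + 1. u \<noteq> a \<longrightarrow> (\<forall>i<2 * P. row s2 u i = row s u i)"
        using inv unfolding Inv_def by (simp add: r)
      have lf: "\<forall>z<P. row s2 a (P + z) = ((L a)(b := c)) z"
        using inv h unfolding Inv_def by (simp add: r)
      have fh: "reg s2 ''f'' = h" "reg s2 ''e'' = a * (2 * P)"
        using e by (simp_all add: s2_def)
      have h2: "h < 2 * P" using h by simp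
      show ?thesis
        unfolding Inv_def fh using sm oth lf h h2 1 by blast
    qed
    then have I2: "Inv j' (set_arr ''T'' (a * (2 * P) + h) (max (row s1 a (2 * h)) (row s1 a (2 * h + 1)))
       (set_reg ''g'' (a * (2 * P) + 2 * h) (set_reg ''f'' h s1)))"
      by (simp only: s2_def)
    have row1: "arr s1 ''T'' (a * (2 * P) + 2 * h) = row s1 a (2 * h)"
      "arr s1 ''T'' (Suc (a * (2 * P) + 2 * h)) = row s1 a (2 * h + 1)"
      by (simp_all add: row_def)
    show ?thesis
    proof (cases "row s1 a (2 * h) < row s1 a (2 * h + 1)")
      case True
      then show ?thesis
        using I2 by (simp add: e f_def[symmetric] h_def[symmetric] mods row1) (auto simp: j max_def)
    next
      case False
      then show ?thesis
        using I2 by (simp add: e f_def[symmetric] h_def[symmetric] mods row1) (auto simp: j max_def)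
    qed
  qed
  have fm: "(P + b) mod 2 ^ w = P + b" using bP by (intro small_mod) auto
  have efm: "(a * (2 * P) + (P + b)) mod 2 ^ w = a * (2 * P) + (P + b)"
    using bP by (intro index_mod aN) auto
  have fin: "tree (L(a := (L a)(b := c))) s'"
    if inv: "Inv j s'" and ng: "\<not> bval w (Less (Const (Suc 0)) (Reg ''f'')) s'" for j s'
  proof -
    have f: "reg s' ''f'' = 1" using inv ng by (auto simp: Inv_def)
    have d: "Suc 0 div (2 * 2 ^ m) = 0" for m
      using one_le_power[of "2 :: nat" m] by (intro div_less) linarith
    have inv1: "\<And>u i. u \<le> N + 1 \<Longrightarrow> u \<noteq> a \<Longrightarrow> i < 2 * P \<Longrightarrow> row s' u i = row s u i"
      "\<And>z. z < P \<Longrightarrow> row s' a (P + z) = ((L a)(b := c)) z"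
      "\<And>i. 1 \<le> i \<Longrightarrow> i < P \<Longrightarrow> row s' a i = max (row s' a (2 * i)) (row s' a (2 * i + 1))"
      using inv d by (auto simp: Inv_def f)
    have h: "heap (row s' a)"
      using inv1(3) by (simp add: heap_def)
    have "heap (row s' u)" if u: "u \<le> N + 1" "u \<noteq> a" for u
      using heap0(1)[OF u(1)] by (simp add: heap_def inv1(1)[OF u])
    moreover have "row s' u (P + z) = (L(a := (L a)(b := c))) u z" if "u \<le> N + 1" "z < P" for u z
      using that inv1(1)[of u "P + z"] inv1(2)[of z] heap0(2)[of u z] by (cases "u = a") simp_all
    ultimately show ?thesis
      unfolding tree_def using h by metis
  qed
  have loop: "wp w tset_loop (\<lambda>s' t. same {''e'', ''f'', ''g''} {''T''} s s' \<and>
     tree (L(a := (L a)(b := c))) s' \<and> t \<le> 5 * lg + 1) ?s1"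
    unfolding tset_loop_def
    apply (rule wp_mono)
     apply (rule wp_while[where Inv = Inv and \<Phi> = "\<lambda>j. 5 * j"])
      apply (rule Inv0)
     apply (erule (1) step)
    using fin by (auto simp: Inv_def)
  show ?thesis
    unfolding tset_def defs
    using regs a_def[symmetric] b_def[symmetric] c_def[symmetric]
    by (simp add: e_mod fm efm) (rule wp_mono[OF loop], simp)
qed

text \<open>At height \<open>j\<close> the subtree of node \<open>f\<close> consists of the leaves
  whose array positions are \<open>f * 2 ^ j\<close> up to \<open>(f + 1) * 2 ^ j - 1\<close>. The
  invariant says that its maximum reaches \<open>c\<close> and that no leaf to its left
  does.\<close>

lemma tfirst_correct:
  assumes "env s" "tree L s" and a: "reg s ''a'' \<le> N + 1"
    and root: "reg s ''c'' \<le> row s (reg s ''a'') 1"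
  shows "wp w tfirst (\<lambda>s' t. same {''b'', ''e'', ''f''} {} s s' \<and> reg s' ''b'' < P \<and>
     reg s ''c'' \<le> L (reg s ''a'') (reg s' ''b'') \<and> (\<forall>z<reg s' ''b''. L (reg s ''a'') z < reg s ''c'') \<and>
     t \<le> 5 * (lg + 2)) s"
proof -
  define a c where "a = reg s ''a''" and "c = reg s ''c''"
  note defs = a_def[symmetric] c_def[symmetric]
  have aN: "a \<le> N + 1" using a defs by auto
  have regs: "reg s ''P'' = P" "reg s ''D'' = 2 * P"
    using assms(1) by (auto simp: env_def)
  have e_mod: "a * (2 * P) mod 2 ^ w = a * (2 * P)"
    using index_mod[OF aN, of 0] by simp
  have heap: "heap (row s a)" and leaf: "\<And>z. z < P \<Longrightarrow> row s a (P + z) = L a z"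
    using assms(2) aN by (auto simp: tree_def)
  define Inv where "Inv = (\<lambda>j s1. same {''e'', ''f''} {} s s1 \<and> reg s1 ''e'' = a * (2 * P) \<and>
     1 \<le> reg s1 ''f'' \<and> P \<le> reg s1 ''f'' * 2 ^ j \<and> (reg s1 ''f'' + 1) * 2 ^ j \<le> 2 * P \<and> c \<le> row s a (reg s1 ''f'') \<and>
     (\<forall>z<P. c \<le> L a z \<longrightarrow> reg s1 ''f'' * 2 ^ j \<le> P + z))"
  have Inv0: "Inv lg (set_reg ''f'' 1 (set_reg ''e'' (a * (2 * P)) s))"
    using root by (auto simp: Inv_def defs)
  have step: "wp w (Assign ''f'' (Times (Const 2) (Reg ''f'')) ;;
        Cond (Less (Read ''T'' (Plus (Reg ''e'') (Reg ''f''))) (Reg ''c''))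
          (Assign ''f'' (Plus (Reg ''f'') (Const (Suc 0)))) Skip)
        (\<lambda>s' t. \<exists>j'. Inv j' s' \<and> t + 1 + 5 * j' \<le> 5 * j) s1"
    if inv: "Inv j s1" and gd: "bval w (Less (Reg ''f'') (Reg ''P'')) s1" for j s1
  proof -
    define f where "f = reg s1 ''f''"
    have r1: "reg s1 ''P'' = P" "reg s1 ''c'' = c" "row s1 = row s"
      using inv regs by (auto simp: Inv_def same_def c_def row_def fun_eq_iff)
    have f1: "f < P" using gd by (simp add: f_def r1)
    have f2: "1 \<le> f" "P \<le> f * 2 ^ j" "(f + 1) * 2 ^ j \<le> 2 * P" "c \<le> row s a f" and e: "reg s1 ''e'' = a * (2 * P)"
      and least: "\<And>z. z < P \<Longrightarrow> c \<le> L a z \<Longrightarrow> f * 2 ^ j \<le> P + z"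
      using inv by (auto simp: Inv_def f_def)
    from f1 f2(2) obtain j' where j: "j = Suc j'" by (cases j) auto
    have hp: "row s a f = max (row s a (2 * f)) (row s a (2 * f + 1))"
      using heap f1 f2(1) by (simp add: heap_def)
    have mods: "(2 * f) mod 2 ^ w = 2 * f" "(2 * f + 1) mod 2 ^ w = 2 * f + 1" "Suc (2 * f) mod 2 ^ w = Suc (2 * f)"
      "(a * (2 * P) + 2 * f) mod 2 ^ w = a * (2 * P) + 2 * f"
      using small_mod[of "2 * f"] small_mod[of "2 * f + 1"] f1
        index_mod[OF aN, of "2 * f"]
      by (auto simp: add.assoc)
    show ?thesis
    proof (cases "row s a (2 * f) < c")
      case False
      then have "Inv j' (set_reg ''f'' (2 * f) s1)"
        using inv f2 least by (auto simp: Inv_def j f_def ac_simps)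
      then show ?thesis
        using False by (auto simp: e f_def[symmetric] mods r1 row_def[symmetric] j intro!: exI[of _ j'])
    next
      case True
      \<comment> \<open>A leaf of the left half that reaches \<open>c\<close> would have
        \<open>2 f\<close> as an ancestor, and by \<open>heap_ancestor\<close> the maximum there
        would reach \<open>c\<close> too.\<close>
      have *: "(2 * f + 1) * 2 ^ j' \<le> P + z" if z: "z < P" "c \<le> L a z" for z
      proof (rule ccontr)
        assume n: "\<not> ?thesis"
        have "2 * f * 2 ^ j' \<le> P + z" using least[OF z] by (simp add: j ac_simps)
        then have "(P + z) div 2 ^ j' = 2 * f"
          using n by (intro div_nat_eqI) (auto simp: algebra_simps)
        then show False
          using heap_ancestor[OF heap, of "P + z" j'] f2(1) z leaf[OF z(1)] True by auto
      qed
      have "Inv j' (set_reg ''f'' (2 * f + 1) s1)"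
        using inv f2 * True hp by (auto simp: Inv_def j f_def algebra_simps max_def split: if_splits)
      then show ?thesis
        using True by (auto simp: e f_def[symmetric] mods r1 row_def[symmetric] j intro!: exI[of _ j'])
    qed
  qed
  have fin: "P \<le> f \<and> f < 2 * P \<and> c \<le> L a (f - P) \<and> (\<forall>z<f - P. L a z < c)"
    if inv: "Inv j s'" and ng: "\<not> bval w (Less (Reg ''f'') (Reg ''P'')) s'" and f: "f = reg s' ''f''" for j s' f
  proof -
    have r: "reg s' ''P'' = P" using inv regs by (auto simp: Inv_def same_def)
    have f1: "P \<le> f" using ng r f by simp
    have f2: "(f + 1) * 2 ^ j \<le> 2 * P" "c \<le> row s a f" "\<And>z. z < P \<Longrightarrow> c \<le> L a z \<Longrightarrow> f * 2 ^ j \<le> P + z"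
      using inv f by (auto simp: Inv_def)
    have "f \<le> f * 2 ^ j" by simp
    have "(f + 1) * 1 \<le> (f + 1) * 2 ^ j" by (intro mult_le_mono) simp_all
    from le_trans[OF this f2(1)] have f3: "f < 2 * P" by simp
    moreover have "c \<le> L a (f - P)" using f2(2) leaf[of "f - P"] f1 f3 by simp
    moreover have "L a z < c" if "z < f - P" for z
      using f2(3)[of z] that f3 \<open>f \<le> f * 2 ^ j\<close> by linarith
    ultimately show ?thesis using f1 by simp
  qed
  have loop: "wp w tfirst_loop (\<lambda>s' t. same {''e'', ''f''} {} s s' \<and> P \<le> reg s' ''f'' \<and> reg s' ''f'' < 2 * P \<and>
     c \<le> L a (reg s' ''f'' - P) \<and> (\<forall>z<reg s' ''f'' - P. L a z < c) \<and> t \<le> 5 * lg + 1)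
     (set_reg ''f'' 1 (set_reg ''e'' (a * (2 * P)) s))"
    unfolding tfirst_loop_def
    apply (rule wp_mono)
     apply (rule wp_while[where Inv = Inv and \<Phi> = "\<lambda>j. 5 * j"])
      apply (rule Inv0)
     apply (erule (1) step)
    apply (elim exE conjE)
    subgoal for s' t j
      using fin[of j s' "reg s' ''f''", OF _ _ refl] by (simp add: Inv_def)
    done
  show ?thesis
    unfolding tfirst_def defs
    using regs a_def[symmetric] c_def[symmetric]
    apply (simp add: e_mod)
    apply (rule wp_SeqI[OF loop[simplified]])
    apply (simp add: same_def less_diff_conv2)
    done
qed

text \<open>For the first direction the leaf comes from the search program itself: by its
  specification it returns a leaf of value at least \<open>c\<close> whenever the root reaches
  \<open>c\<close>. This spares an induction over the tree.\<close>

lemma root_iff: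
  assumes "env s" "tree L s" "a \<le> N + 1"
  shows "c \<le> row s a 1 \<longleftrightarrow> (\<exists>z<P. c \<le> L a z)"
proof
  assume r: "c \<le> row s a 1"
  let ?s = "set_reg ''a'' a (set_reg ''c'' c s)"
  have "wp w tfirst (\<lambda>s' t. reg s' ''b'' < P \<and> c \<le> L a (reg s' ''b'')) ?s"
    using assms r by (intro wp_mono[OF tfirst_correct[of ?s L]]) auto
  then show "\<exists>z<P. c \<le> L a z"
    unfolding wp_def by blast
next
  assume "\<exists>z<P. c \<le> L a z"
  then obtain z where z: "z < P" "c \<le> L a z" by blast
  have "(P + z) div 2 ^ lg = 1"
    using z by (intro div_nat_eqI) auto
  moreover have "heap (row s a)" "row s a (P + z) = L a z"
    using assms z by (auto simp: tree_def)
  ultimately show "c \<le> row s a 1"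
    using heap_ancestor[of "row s a" "P + z" lg] z by simp
qed

end

section \<open>Collecting neighbours and changing keys\<close>

text \<open>Extraction is destructive: a leaf that has been found is set to 0, so that the next
  search finds another one. Only the copy of the edge in row \<open>i\<close> is erased;
  \<open>restore_loop\<close> rewrites the copies in both rows.\<close>

definition extract_loop :: "vname \<Rightarrow> com" where
  "extract_loop A =
     While (Not (Less (Read ''T'' (Plus (Times (Reg ''i'') (Reg ''D'')) (Const (Suc 0)))) (Reg ''t'')))
       (Assign ''a'' (Reg ''i'') ;;
        Assign ''c'' (Reg ''t'') ;;
        tfirst ;;
        Write A (Reg ''j'') (Reg ''b'') ;;
        Assign ''j'' (Plus (Reg ''j'') (Const (Suc 0))) ;;
        Assign ''c'' (Const 0) ;;
        tset)"

definition restore_loop :: "vname \<Rightarrow> com" where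
  "restore_loop A =
     While (Less (Reg ''l'') (Reg ''j''))
       (Assign ''b'' (Read A (Reg ''l'')) ;;
        Assign ''c'' (Plus (Read ''K'' (Reg ''b'')) (Const (Suc 0))) ;;
        Cond (Less (Read ''K'' (Reg ''i'')) (Read ''K'' (Reg ''b'')))
          (Assign ''c'' (Plus (Read ''K'' (Reg ''i'')) (Const (Suc 0)))) Skip ;;
        Assign ''a'' (Reg ''i'') ;;
        tset ;;
        Assign ''a'' (Reg ''b'') ;;
        Assign ''b'' (Reg ''i'') ;;
        tset ;;
        Assign ''l'' (Plus (Reg ''l'') (Const (Suc 0))))"

definition best_loop :: com where
  "best_loop =
     While (Less (Reg ''l'') (Reg ''j''))
       (Assign ''b'' (Read ''F'' (Reg ''l'')) ;;
        Cond (And (Less (Const 0) (Read ''J'' (Reg ''b''))) (And (Equal (Read ''K'' (Reg ''b'')) (Reg ''b'')) (Less (Reg ''b'') (Reg ''s''))))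
          (Assign ''s'' (Reg ''b'')) Skip ;;
        Assign ''l'' (Plus (Reg ''l'') (Const (Suc 0))))"

text \<open>The threshold \<open>t\<close> exceeds neither the old nor the new key of
  \<open>i\<close> by more than 1 wherever this is called. The extracted neighbours are then the
  only ones whose leaves depend on the change.\<close>

definition rekey :: com where
  "rekey =
     Assign ''j'' (Const 0) ;;
     extract_loop ''F'' ;;
     Assign ''l'' (Const 0) ;;
     best_loop ;;
     Write ''K'' (Reg ''i'') (Reg ''s'') ;;
     Assign ''l'' (Const 0) ;;
     restore_loop ''F''"

text \<open>The list gets the array \<open>G\<close> to itself because \<open>hit_loop\<close> walks
  through it while calling \<open>rekey\<close>, which overwrites \<open>F\<close>.\<close>

definition collect :: com where
  "collect =
     Assign ''j'' (Const 0) ;;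
     extract_loop ''G'' ;;
     Assign ''l'' (Const 0) ;;
     restore_loop ''G''"

context ram
begin

definition enum :: "vname \<Rightarrow> nat list \<Rightarrow> store \<Rightarrow> bool" where
  "enum A ds s \<longleftrightarrow> distinct ds \<and> set ds \<subseteq> {..N} \<and> reg s ''j'' = length ds \<and> (\<forall>l<length ds. arr s A l = ds ! l)"

lemma enum_length: "enum A ds s \<Longrightarrow> length ds \<le> N + 1"
  unfolding enum_def by (metis card_atMost card_mono distinct_card finite_atMost Suc_eq_plus1)

lemma enum_cong: "reg s' ''j'' = reg s ''j'' \<Longrightarrow> arr s' A = arr s A \<Longrightarrow> enum A ds s' = enum A ds s"
  by (simp add: enum_def)

lemma nat_mod: "i \<le> N + 2 \<Longrightarrow> i mod 2 ^ w = i"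
  using N_less by (intro small_mod) (use one_le_power[of "2::nat" lg] in linarith)

lemma Suc_mod: "i \<le> N + 1 \<Longrightarrow> Suc i mod 2 ^ w = Suc i"
  using nat_mod[of "Suc i"] by simp

lemma P_gt: "i \<le> N \<Longrightarrow> i < P"
  using N_less by simp

lemma P_gt4: "Suc 0 < 4 * P"
  using one_le_power[of "2 :: nat" lg] by linarith

text \<open>The potential is the number of elements of \<open>S\<close> not yet found. The cost is
  thus proportional to the size of the output and not to the degree of \<open>i\<close>.\<close>

lemma extract_correct:
  assumes env: "env s" and tr: "tree L s" and i: "reg s ''i'' \<le> N" and j: "reg s ''j'' = 0"
    and t: "1 \<le> reg s ''t''" and A: "A \<noteq> ''T''"
    and sub: "\<And>z. z < P \<Longrightarrow> reg s ''t'' \<le> L (reg s ''i'') z \<Longrightarrow> z \<le> N"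
  shows "wp w (extract_loop A) (\<lambda>s' t. \<exists>ds. enum A ds s' \<and> set ds = {z. z < P \<and> reg s ''t'' \<le> L (reg s ''i'') z} \<and>
     tree (L(reg s ''i'' := (\<lambda>z. if z \<in> set ds then 0 else L (reg s ''i'') z))) s' \<and>
     same {''a'', ''b'', ''c'', ''e'', ''f'', ''g'', ''j''} {''T'', A} s s' \<and>
     t \<le> 13 * (lg + 2) * length ds + 1) s"
proof -
  define i \<theta> where "i = reg s ''i''" and "\<theta> = reg s ''t''"
  note defs = i_def[symmetric] \<theta>_def[symmetric]
  have iN: "i \<le> N" and \<theta>1: "1 \<le> \<theta>" using i t defs by auto
  define S where "S = {z. z < P \<and> \<theta> \<le> L i z}"
  have finS: "finite S" and SN: "S \<subseteq> {..N}"
    using sub by (auto simp: S_def i_def \<theta>_def)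
  define L' where "L' = (\<lambda>ds. L(i := (\<lambda>z. if z \<in> set ds then 0 else L i z)))"
  define Inv where "Inv = (\<lambda>ds s1. enum A ds s1 \<and> set ds \<subseteq> S \<and> tree (L' ds) s1 \<and>
     same {''a'', ''b'', ''c'', ''e'', ''f'', ''g'', ''j''} {''T'', A} s s1)"
  have root: "bval w (Not (Less (Read ''T'' (Plus (Times (Reg ''i'') (Reg ''D'')) (Const (Suc 0)))) (Reg ''t''))) s1 \<longleftrightarrow>
     (\<exists>z\<in>S. z \<notin> set ds)" if inv: "Inv ds s1" for ds s1
  proof -
    have s1: "env s1" "reg s1 ''i'' = i" "reg s1 ''t'' = \<theta>" "tree (L' ds) s1"
      using inv env by (auto simp: Inv_def same_def i_def \<theta>_def env_def)
    then have D: "reg s1 ''D'' = 2 * P" by (simp add: env_def)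
    have m: "(i * (2 * P)) mod 2 ^ w = i * (2 * P)" "Suc (i * (2 * P)) mod 2 ^ w = i * (2 * P) + 1"
      using index_mod[of i 0] index_mod[of i 1] iN P_gt4 by auto
    have "bval w (Not (Less (Read ''T'' (Plus (Times (Reg ''i'') (Reg ''D'')) (Const (Suc 0)))) (Reg ''t''))) s1 \<longleftrightarrow>
       \<theta> \<le> row s1 i 1"
      by (simp add: s1 D m row_def not_less)
    also have "\<dots> \<longleftrightarrow> (\<exists>z<P. \<theta> \<le> L' ds i z)"
      using iN by (intro root_iff s1) simp
    also have "\<dots> \<longleftrightarrow> (\<exists>z\<in>S. z \<notin> set ds)"
      using \<theta>1 by (auto simp: L'_def S_def split: if_splits)
    finally show ?thesis .
  qed
  have Inv0: "Inv [] s"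
    using tr j by (simp add: Inv_def L'_def enum_def)
  have step: "wp w (Assign ''a'' (Reg ''i'') ;;
        Assign ''c'' (Reg ''t'') ;;
        tfirst ;;
        Write A (Reg ''j'') (Reg ''b'') ;;
        Assign ''j'' (Plus (Reg ''j'') (Const (Suc 0))) ;;
        Assign ''c'' (Const 0) ;;
        tset)
        (\<lambda>s' t. \<exists>ds'. Inv ds' s' \<and> t + 1 + 13 * (lg + 2) * (card S - length ds') \<le> 13 * (lg + 2) * (card S - length ds)) s1"
    if inv: "Inv ds s1" and gd: "bval w (Not (Less (Read ''T'' (Plus (Times (Reg ''i'') (Reg ''D'')) (Const (Suc 0)))) (Reg ''t''))) s1"
    for ds s1
  proof -
    have s1: "env s1" "reg s1 ''i'' = i" "reg s1 ''t'' = \<theta>" "tree (L' ds) s1" "reg s1 ''j'' = length ds"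
      and en: "enum A ds s1" and sm: "same {''a'', ''b'', ''c'', ''e'', ''f'', ''g'', ''j''} {''T'', A} s s1"
      and dS: "set ds \<subseteq> S"
      using inv env by (auto simp: Inv_def same_def i_def \<theta>_def enum_def env_def)
    have ex: "\<exists>z\<in>S. z \<notin> set ds" using root[OF inv] gd by blast
    then have rt: "\<theta> \<le> row s1 i 1"
      using root_iff[OF s1(1,4), of i \<theta>] iN by (auto simp: L'_def S_def)
    have len: "length ds \<le> N + 1" by (rule enum_length[OF en])
    have less: "length ds < card S"
    proof -
      have "set ds \<subset> S" using dS ex by blast
      then have "card (set ds) < card S" by (rule psubset_card_mono[OF finS])
      then show ?thesis using en by (simp add: enum_def distinct_card)
    qed
    obtain m where "card S - length ds = Suc m" using less by (cases "card S - length ds") auto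
    then have m: "card S - length ds = Suc m" "card S - Suc (length ds) = m" by simp_all
    let ?s1 = "set_reg ''c'' \<theta> (set_reg ''a'' i s1)"
    show ?thesis
      apply (simp add: s1)
      apply (rule wp_SeqI[OF tfirst_correct[of ?s1 "L' ds"]])
          apply (simp add: s1)
         apply (simp add: s1)
        apply (simp add: s1 iN le_SucI)
       apply (simp add: s1 rt[simplified])
      subgoal for s2 t2
      proof -
        assume a: "same {''b'', ''e'', ''f''} {} ?s1 s2 \<and> reg s2 ''b'' < P \<and>
           reg ?s1 ''c'' \<le> L' ds (reg ?s1 ''a'') (reg s2 ''b'') \<and>
           (\<forall>z<reg s2 ''b''. L' ds (reg ?s1 ''a'') z < reg ?s1 ''c'') \<and> t2 \<le> 5 * (lg + 2)"
        define b where "b = reg s2 ''b''"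
        have r2: "reg s2 ''j'' = length ds" "reg s2 ''i'' = i" "reg s2 ''a'' = i" "reg s2 ''t'' = \<theta>" "arr s2 = arr s1"
          "reg s2 ''b'' = b"
          using a s1 by (auto simp: same_def b_def)
        have bL: "b < P" "\<theta> \<le> L' ds i b" using a by (auto simp: b_def)
        then have b: "b \<in> S" "b \<notin> set ds" using \<theta>1 by (auto simp: L'_def S_def split: if_splits)
        have e2: "env s2" using a s1(1) by (simp add: env_def same_def)
        have tr2: "tree (L' ds) s2" using tree_same[of _ _ ?s1 s2 "L' ds"] a s1 by auto
        let ?s3 = "set_reg ''c'' 0 (set_reg ''j'' (Suc (length ds)) (set_arr A (length ds) b s2))"
        have en3: "enum A (ds @ [b]) ?s3"
          using en b SN r2 by (auto simp: enum_def nth_append less_Suc_eq)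
        have L3: "(L' ds)(i := (L' ds i)(b := 0)) = L' (ds @ [b])"
          by (auto simp: L'_def fun_eq_iff)
        have sm3: "same {''a'', ''b'', ''c'', ''e'', ''f'', ''g'', ''j''} {''T'', A} s ?s3"
          using sm a by (simp add: same_def)
        show ?thesis
          apply (simp add: r2 Suc_mod[OF len])
          apply (rule wp_mono[OF tset_correct[of ?s3 "L' ds"]])
              apply (simp add: e2)
             apply (simp add: tr2 A)
            apply (simp add: r2 iN le_SucI)
           apply (simp add: r2 bL)
          subgoal for s4 t4
            apply (rule exI[of _ "ds @ [b]"])
            using a less en3 b dS
            apply (simp add: r2 L3 Inv_def)
            apply (intro conjI)
               apply (subst enum_cong[of _ ?s3]; simp add: same_def A)
              subgoal using sm by (simp add: same_def)
             subgoal by (simp add: m algebra_simps)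
            done
          done
      qed
      done
  qed
  show ?thesis
    unfolding extract_loop_def defs
    apply (rule wp_mono)
     apply (rule wp_while[where Inv = Inv and \<Phi> = "\<lambda>ds. 13 * (lg + 2) * (card S - length ds)"])
      apply (rule Inv0)
     apply (erule (1) step)
    apply (elim exE conjE)
    subgoal for s' t ds
    proof -
      assume a: "Inv ds s'" "\<not> bval w (Not (Less (Read ''T'' (Plus (Times (Reg ''i'') (Reg ''D'')) (Const (Suc 0)))) (Reg ''t''))) s'"
        "t + 13 * (lg + 2) * (card S - length ds) \<le> 13 * (lg + 2) * (card S - length []) + 1"
      have S: "set ds = S" using root[OF a(1)] a by (auto simp: Inv_def)
      then have "card S = length ds" using a(1) by (metis Inv_def enum_def distinct_card)
      then show ?thesis
        using a S by (intro exI[of _ ds]) (simp add: Inv_def S_def L'_def)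
    qed
    done
qed

lemma restore_correct:
  assumes env: "env s" and tr: "tree L s" and i: "reg s ''i'' \<le> N" and l: "reg s ''l'' = 0"
    and en: "enum A ds s" and A: "A \<noteq> ''T''"
    and K: "\<And>z. z \<le> N \<Longrightarrow> arr s ''K'' z = k z" and k: "\<And>z. z \<le> N \<Longrightarrow> k z \<le> N"
  shows "wp w (restore_loop A) (\<lambda>s' t.
     tree (\<lambda>u z. if u = reg s ''i'' \<and> z \<in> set ds \<or> z = reg s ''i'' \<and> u \<in> set ds then min (k u) (k z) + 1 else L u z) s' \<and>
     same {''a'', ''b'', ''c'', ''e'', ''f'', ''g'', ''l''} {''T''} s s' \<and>
     t \<le> 16 * (lg + 2) * length ds + 1) s"
proof -
  define i where "i = reg s ''i''"
  have iN: "i \<le> N" using i i_def by simp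
  define L' where "L' = (\<lambda>l u z. if u = i \<and> z \<in> set (take l ds) \<or> z = i \<and> u \<in> set (take l ds) then min (k u) (k z) + 1 else L u z)"
  define Inv where "Inv = (\<lambda>l s1. l \<le> length ds \<and> reg s1 ''l'' = l \<and> tree (L' l) s1 \<and>
     same {''a'', ''b'', ''c'', ''e'', ''f'', ''g'', ''l''} {''T''} s s1)"
  have Inv0: "Inv 0 s"
    using tr l by (simp add: Inv_def L'_def)
  have len: "length ds \<le> N + 1" by (rule enum_length[OF en])
  have step: "wp w (Assign ''b'' (Read A (Reg ''l'')) ;;
        Assign ''c'' (Plus (Read ''K'' (Reg ''b'')) (Const (Suc 0))) ;;
        Cond (Less (Read ''K'' (Reg ''i'')) (Read ''K'' (Reg ''b'')))
          (Assign ''c'' (Plus (Read ''K'' (Reg ''i'')) (Const (Suc 0)))) Skip ;;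
        Assign ''a'' (Reg ''i'') ;;
        tset ;;
        Assign ''a'' (Reg ''b'') ;;
        Assign ''b'' (Reg ''i'') ;;
        tset ;;
        Assign ''l'' (Plus (Reg ''l'') (Const (Suc 0))))
        (\<lambda>s' t. \<exists>l'. Inv l' s' \<and> t + 1 + 16 * (lg + 2) * (length ds - l') \<le> 16 * (lg + 2) * (length ds - l)) s1"
    if inv: "Inv l s1" and gd: "bval w (Less (Reg ''l'') (Reg ''j'')) s1" for l s1
  proof -
    have sm: "same {''a'', ''b'', ''c'', ''e'', ''f'', ''g'', ''l''} {''T''} s s1" and tr1: "tree (L' l) s1"
      using inv by (auto simp: Inv_def)
    have r1: "env s1" "reg s1 ''i'' = i" "reg s1 ''j'' = length ds" "reg s1 ''l'' = l" "arr s1 A = arr s A" "arr s1 ''K'' = arr s ''K''"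
      using inv env en A by (auto simp: Inv_def same_def i_def enum_def env_def)
    have l: "l < length ds" using gd r1 by simp
    define b where "b = ds ! l"
    have b: "b \<in> set ds" "b \<le> N" using en l nth_mem[OF l] by (auto simp: b_def enum_def subset_iff)
    have rb: "arr s A l = b" using en l by (simp add: b_def enum_def)
    have kb: "arr s ''K'' b = k b" "arr s ''K'' i = k i" using K b iN by auto
    have km: "Suc (k b) mod 2 ^ w = Suc (k b)" "Suc (k i) mod 2 ^ w = Suc (k i)"
      using k[OF b(2)] k[OF iN] by (auto intro!: Suc_mod)
    define c where "c = min (k i) (k b) + 1"
    let ?s1 = "set_reg ''a'' i (set_reg ''c'' c (set_reg ''b'' b s1))"
    have lm: "Suc l mod 2 ^ w = Suc l" using l len by (intro Suc_mod) simp
    have L2: "(L' l)(i := (L' l i)(b := c), b := (((L' l)(i := (L' l i)(b := c))) b)(i := c)) = L' (Suc l)"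
      using l by (auto simp: L'_def c_def b_def take_Suc_conv_app_nth fun_eq_iff min.commute)
    have main: "wp w (tset ;; Assign ''a'' (Reg ''b'') ;;
        Assign ''b'' (Reg ''i'') ;;
        tset ;;
        Assign ''l'' (Plus (Reg ''l'') (Const (Suc 0))))
        (\<lambda>s' t. \<exists>l'. Inv l' s' \<and> t + 6 + 16 * (lg + 2) * (length ds - l') \<le> 16 * (lg + 2) * (length ds - l)) ?s1"
      apply (rule wp_SeqI[OF tset_correct[of ?s1 "L' l"]])
          apply (simp add: r1)
         apply (simp add: tr1)
        apply (simp add: iN le_SucI)
       apply (simp add: P_gt b)
      subgoal for s2 t2
      proof -
        assume a: "same {''e'', ''f'', ''g''} {''T''} ?s1 s2 \<and>
          tree ((L' l)(reg ?s1 ''a'' := (L' l (reg ?s1 ''a''))(reg ?s1 ''b'' := reg ?s1 ''c''))) s2 \<and> t2 \<le> 5 * (lg + 2)"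
        have r2: "reg s2 ''b'' = b" "reg s2 ''i'' = i" "reg s2 ''c'' = c" "reg s2 ''l'' = l"
          using a r1 by (auto simp: same_def)
        have e2: "env s2" using a r1(1) by (simp add: env_def same_def)
        let ?s3 = "set_reg ''b'' i (set_reg ''a'' b s2)"
        have sm3: "same {''a'', ''b'', ''c'', ''e'', ''f'', ''g'', ''l''} {''T''} s ?s3"
          using sm a by (simp add: same_def)
        show ?thesis
          apply (simp add: r2)
          apply (rule wp_SeqI[OF tset_correct[of ?s3 "(L' l)(i := (L' l i)(b := c))"]])
              apply (simp add: e2)
             using a apply simp
            apply (simp add: b le_SucI)
           apply (simp add: P_gt iN)
          subgoal for s4 t4
          proof -
            assume a4: "same {''e'', ''f'', ''g''} {''T''} ?s3 s4 \<and>
              tree ((L' l)(i := (L' l i)(b := c), reg ?s3 ''a'' := (((L' l)(i := (L' l i)(b := c))) (reg ?s3 ''a''))(reg ?s3 ''b'' := reg ?s3 ''c''))) s4 \<and> t4 \<le> 5 * (lg + 2)"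
            have tr4: "tree (L' (Suc l)) s4"
              using a4 by (simp add: r2 L2[symmetric])
            have r4: "reg s4 ''l'' = l" using a4 r2 by (auto simp: same_def)
            have sm4: "same {''a'', ''b'', ''c'', ''e'', ''f'', ''g'', ''l''} {''T''} s s4"
              by (rule same_trans[OF sm3], rule same_mono[of "{''e'', ''f'', ''g''}" "{''T''}"]) (use a4 in auto)
            obtain m where m: "length ds - l = Suc m" using l by (cases "length ds - l") auto
            then have m': "length ds - Suc l = m" by simp
            show ?thesis
              using a a4 l
              by (simp add: r4 lm) (rule exI[of _ "Suc l"], simp add: Inv_def tr4 sm4 m m' algebra_simps)
          qed
          done
      qed
      done
    show ?thesis
    proof (cases "k i < k b")
      case True
      then have c: "c = Suc (k i)" by (simp add: c_def)
      show ?thesis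
        using True
        apply (simp add: r1 rb kb km)
        apply (rule wp_mono[OF main[unfolded c]])
        apply (elim exE)
        subgoal for s' t l' by (rule exI[of _ l']) simp
        done
    next
      case False
      then have c: "c = Suc (k b)" by (simp add: c_def)
      show ?thesis
        using False
        apply (simp add: r1 rb kb km)
        apply (rule wp_mono[OF main[unfolded c]])
        apply (elim exE)
        subgoal for s' t l' by (rule exI[of _ l']) simp
        done
    qed
  qed
  show ?thesis
    unfolding restore_loop_def i_def[symmetric]
    apply (rule wp_mono)
     apply (rule wp_while[where Inv = Inv and \<Phi> = "\<lambda>l. 16 * (lg + 2) * (length ds - l)"])
      apply (rule Inv0)
     apply (erule (1) step)
    apply (elim exE conjE)
    subgoal for s' t l
    proof -
      assume a: "Inv l s'" "\<not> bval w (Less (Reg ''l'') (Reg ''j'')) s'"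
        "t + 16 * (lg + 2) * (length ds - l) \<le> 16 * (lg + 2) * (length ds - 0) + 1"
      have "l = length ds" using a(1,2) en by (auto simp: Inv_def same_def enum_def)
      then show ?thesis
        using a by (simp add: Inv_def L'_def)
    qed
    done
qed

lemma best_correct:
  assumes l: "reg s ''l'' = 0" and en: "enum ''F'' ds s"
  shows "wp w best_loop (\<lambda>s' t.
     reg s' ''s'' = Min (insert (reg s ''s'') {z \<in> set ds. 0 < arr s ''J'' z \<and> arr s ''K'' z = z}) \<and>
     same {''b'', ''l'', ''s''} {} s s' \<and> t \<le> 5 * length ds + 1) s"
proof -
  define B where "B = (\<lambda>l. insert (reg s ''s'') {z \<in> set (take l ds). 0 < arr s ''J'' z \<and> arr s ''K'' z = z})"
  define Inv where "Inv = (\<lambda>l s1. l \<le> length ds \<and> reg s1 ''l'' = l \<and> reg s1 ''s'' = Min (B l) \<and>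
     same {''b'', ''l'', ''s''} {} s s1)"
  have Inv0: "Inv 0 s" using l by (simp add: Inv_def B_def)
  have len: "length ds \<le> N + 1" by (rule enum_length[OF en])
  have step: "wp w (Assign ''b'' (Read ''F'' (Reg ''l'')) ;;
        Cond (And (Less (Const 0) (Read ''J'' (Reg ''b''))) (And (Equal (Read ''K'' (Reg ''b'')) (Reg ''b'')) (Less (Reg ''b'') (Reg ''s''))))
          (Assign ''s'' (Reg ''b'')) Skip ;;
        Assign ''l'' (Plus (Reg ''l'') (Const (Suc 0))))
        (\<lambda>s' t. \<exists>l'. Inv l' s' \<and> t + 1 + 5 * (length ds - l') \<le> 5 * (length ds - l)) s1"
    if inv: "Inv l s1" and gd: "bval w (Less (Reg ''l'') (Reg ''j'')) s1" for l s1
  proof -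
    have r1: "reg s1 ''l'' = l" "arr s1 = arr s" "reg s1 ''s'' = Min (B l)"
      and l: "l < length ds" and sm: "same {''b'', ''l'', ''s''} {} s s1"
      using inv gd en by (auto simp: Inv_def same_def enum_def)
    have rb: "arr s ''F'' l = ds ! l" using en l by (simp add: enum_def)
    have lm: "Suc l mod 2 ^ w = Suc l" using l len by (intro Suc_mod) simp
    have fin: "finite (B l)" "B l \<noteq> {}" by (simp_all add: B_def)
    have B: "B (Suc l) = (if 0 < arr s ''J'' (ds ! l) \<and> arr s ''K'' (ds ! l) = ds ! l then insert (ds ! l) (B l) else B l)"
      using l by (auto simp: B_def take_Suc_conv_app_nth)
    then have M: "Min (B (Suc l)) = (if 0 < arr s ''J'' (ds ! l) \<and> arr s ''K'' (ds ! l) = ds ! l \<and> ds ! l < Min (B l) then ds ! l else Min (B l))"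
      using Min_insert[OF fin, of "ds ! l"] by (simp add: min_def)
    obtain m where m: "length ds - l = Suc m" using l by (cases "length ds - l") auto
    then have m': "length ds - Suc l = m" by simp
    show ?thesis
      using l m m' sm
      by (simp add: r1 rb lm) (auto simp: Inv_def M r1 intro!: exI[of _ "Suc l"])
  qed
  show ?thesis
    unfolding best_loop_def
    apply (rule wp_mono)
     apply (rule wp_while[where Inv = Inv and \<Phi> = "\<lambda>l. 5 * (length ds - l)"])
      apply (rule Inv0)
     apply (erule (1) step)
    apply (elim exE conjE)
    subgoal for s' t l
    proof -
      assume a: "Inv l s'" "\<not> bval w (Less (Reg ''l'') (Reg ''j'')) s'"
        "t + 5 * (length ds - l) \<le> 5 * (length ds - 0) + 1"
      have "l = length ds" using a(1,2) en by (auto simp: Inv_def same_def enum_def)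
      then show ?thesis
        using a by (simp add: Inv_def B_def)
    qed
    done
qed

text \<open>The core of the data structure. For a vertex \<open>u\<close> the leaf is at least
  \<open>\<kappa> + 1\<close> exactly if the edge is present and both keys are at least
  \<open>\<kappa>\<close>; by \<open>rlive_key\<close>, for correct keys, this means that both ends
  are undominated by the first \<open>\<kappa>\<close> ranks. A threshold search in a row therefore
  lists a neighbourhood in a sparse graph. The shift by 1 reserves 0 for missing edges, as a key may
  itself be 0.\<close>

definition lf :: "(nat \<Rightarrow> nat \<Rightarrow> bool) \<Rightarrow> (nat \<Rightarrow> nat) \<Rightarrow> nat set \<Rightarrow> nat \<Rightarrow> nat \<Rightarrow> nat" where
  "lf h k Q u z = (if u = N + 1 then of_bool (z \<in> Q) else if h u z then min (k u) (k z) + 1 else 0)"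

definition graph :: "(nat \<Rightarrow> nat \<Rightarrow> bool) \<Rightarrow> bool" where
  "graph h \<longleftrightarrow> (\<forall>u z. h u z \<longrightarrow> u \<le> N \<and> z \<le> N \<and> u \<noteq> z \<and> h z u)"

definition keys :: "(nat \<Rightarrow> nat) \<Rightarrow> store \<Rightarrow> bool" where
  "keys k s \<longleftrightarrow> (\<forall>z\<le>N. arr s ''K'' z = k z)"

definition nbs :: "(nat \<Rightarrow> nat \<Rightarrow> bool) \<Rightarrow> (nat \<Rightarrow> nat) \<Rightarrow> nat \<Rightarrow> nat \<Rightarrow> nat set" where
  "nbs h k i \<theta> = {z. h i z \<and> \<theta> \<le> min (k i) (k z) + 1}"

lemma nbs_lf:
  assumes "graph h" "i \<le> N" "1 \<le> \<theta>"
  shows "{z. z < P \<and> \<theta> \<le> lf h k Q i z} = nbs h k i \<theta>"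
  using assms P_gt by (auto simp: nbs_def lf_def graph_def split: if_splits)

text \<open>A neighbour outside \<open>D\<close> has a key below \<open>\<theta> - 1\<close>, while
  the old and the new key of \<open>i\<close> are at least \<open>\<theta> - 1\<close>. Its own key
  is the minimum both times, so its leaf is right already. This is why a change of key costs a live
  degree only and not a full degree.\<close>

lemma lf_restore:
  assumes h: "graph h" and i: "i \<le> N" and t: "1 \<le> \<theta>" and D: "D = nbs h k i \<theta>"
    and k: "\<And>z. z \<noteq> i \<Longrightarrow> k' z = k z" and ki: "\<theta> \<le> k i + 1" "\<theta> \<le> k' i + 1"
  shows "(\<lambda>u z. if u = i \<and> z \<in> D \<or> z = i \<and> u \<in> D then min (k' u) (k' z) + 1
     else ((lf h k Q)(i := \<lambda>z. if z \<in> D then 0 else lf h k Q i z)) u z) = lf h k' Q"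
proof (intro ext)
  fix u z
  have Dh: "x \<in> D \<Longrightarrow> h i x \<and> h x i \<and> x \<le> N \<and> x \<noteq> i" for x
    using h by (auto simp: D nbs_def graph_def)
  have same: "min (k i) (k x) = min (k' i) (k x)" if "h i x" "x \<notin> D" for x
    using that ki by (auto simp: D nbs_def)
  have sym: "h x i \<Longrightarrow> h i x" "h i x \<Longrightarrow> x \<noteq> i" for x using h by (auto simp: graph_def)
  show "(if u = i \<and> z \<in> D \<or> z = i \<and> u \<in> D then min (k' u) (k' z) + 1
     else ((lf h k Q)(i := \<lambda>z. if z \<in> D then 0 else lf h k Q i z)) u z) = lf h k' Q u z"
  proof (cases "u = N + 1")
    case True
    then show ?thesis using i Dh[of u] by (auto simp: lf_def)
  next
    case uN: False
    show ?thesis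
    proof (cases "u = i")
      case True
      show ?thesis
        using Dh[of z] Dh[of i] same[of z] sym[of z] k[of z] uN by (auto simp: True lf_def)
    next
      case False
      show ?thesis
        using Dh[of u] same[of u] sym[of u] k[of u] k[of z] uN False
        by (cases "z = i") (auto simp: lf_def min.commute)
    qed
  qed
qed

lemma collect_correct:
  assumes env: "env s" and h: "graph h" and tr: "tree (lf h k Q) s" and K: "keys k s"
    and k: "\<And>z. z \<le> N \<Longrightarrow> k z \<le> z" and i: "reg s ''i'' \<le> N" and t: "1 \<le> reg s ''t''"
    and kt: "reg s ''t'' \<le> k (reg s ''i'') + 1"
  shows "wp w collect (\<lambda>s' t. \<exists>ds. enum ''G'' ds s' \<and> set ds = nbs h k (reg s ''i'') (reg s ''t'') \<and>
     tree (lf h k Q) s' \<and> same {''a'', ''b'', ''c'', ''e'', ''f'', ''g'', ''j'', ''l''} {''T'', ''G''} s s' \<and>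
     t \<le> 40 * (lg + 2) * (1 + length ds)) s"
proof -
  define i \<theta> where "i = reg s ''i''" and "\<theta> = reg s ''t''"
  have iN: "i \<le> N" "1 \<le> \<theta>" using i t by (simp_all add: i_def \<theta>_def)
  have kN: "z \<le> N \<Longrightarrow> k z \<le> N" for z using k[of z] by simp
  note S = nbs_lf[OF h iN, of k Q]
  let ?s1 = "set_reg ''j'' 0 s"
  have sub: "z \<le> N" if "z < P" "\<theta> \<le> lf h k Q i z" for z
    using that S h by (auto simp: nbs_def graph_def)
  show ?thesis
    unfolding collect_def
    apply simp
    apply (rule wp_SeqI[OF extract_correct[of ?s1 "lf h k Q"]])
          apply (simp add: env)
         apply (simp add: tr)
        using i apply simp
       apply simp
      using t apply simp
     apply simp
     apply (rule sub; simp add: i_def \<theta>_def)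
    apply (elim exE conjE)
    subgoal for s2 t2 ds
    proof -
      assume a: "enum ''G'' ds s2" "set ds = {z. z < P \<and> reg ?s1 ''t'' \<le> lf h k Q (reg ?s1 ''i'') z}"
        "tree ((lf h k Q)(reg ?s1 ''i'' := \<lambda>z. if z \<in> set ds then 0 else lf h k Q (reg ?s1 ''i'') z)) s2"
        "same {''a'', ''b'', ''c'', ''e'', ''f'', ''g'', ''j''} {''T'', ''G''} ?s1 s2"
        "t2 \<le> 13 * (lg + 2) * length ds + 1"
      have ds: "set ds = nbs h k i \<theta>" using a(2) S by (simp add: i_def \<theta>_def)
      let ?s3 = "set_reg ''l'' 0 s2"
      have r3: "reg s2 ''i'' = i" using a by (simp add: same_def i_def)
      have en3: "enum ''G'' ds ?s3" using a(1) by (simp add: enum_def)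
      have e2: "env s2" using a env by (simp add: env_def same_def)
      have K2: "arr s2 ''K'' z = k z" if "z \<le> N" for z using a(4) K that by (simp add: same_def keys_def)
      show ?thesis
        apply simp
        apply (rule wp_mono[OF restore_correct[of ?s3 _ "''G''" ds k]])
                apply (simp add: e2)
               using a(3) apply simp
              apply (simp add: r3 iN)
             apply simp
            apply (rule en3)
           apply simp
          apply (simp add: K2)
         apply (simp add: kN)
        apply (elim conjE)
        subgoal for s4 t4
          apply (intro exI[of _ ds] conjI)
          subgoal using en3 by (subst enum_cong[of _ ?s3]) (simp_all add: same_def)
          subgoal using ds by (simp add: i_def \<theta>_def)
          subgoal
            apply (erule back_subst[of "\<lambda>L. tree L s4"])
            using lf_restore[OF h iN(1,2) ds, of k Q] kt by (simp add: r3 \<theta>_def i_def[symmetric] cong: if_cong)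
          subgoal using a(4) by (simp add: same_def)
          subgoal using a(5) by (simp add: algebra_simps)
          done
        done
    qed
    done
qed

text \<open>The default in \<open>s\<close> is at least \<open>t - 1\<close>, and so is every
  candidate in \<open>D\<close>, whose rank equals its key. Hence the new key satisfies the
  threshold condition of \<open>lf_restore\<close>.\<close>

lemma rekey_correct:
  assumes env: "env s" and h: "graph h" and tr: "tree (lf h k Q) s" and K: "keys k s"
    and k: "\<And>z. z \<le> N \<Longrightarrow> k z \<le> z" and i: "reg s ''i'' \<le> N" and t: "1 \<le> reg s ''t''"
    and bt: "reg s ''t'' \<le> reg s ''s'' + 1" "reg s ''t'' \<le> k (reg s ''i'') + 1" "reg s ''s'' \<le> N"
    and D: "D = nbs h k (reg s ''i'') (reg s ''t'')"
    and best: "best = Min (insert (reg s ''s'') {z \<in> D. 0 < arr s ''J'' z \<and> k z = z})"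
  shows "wp w rekey (\<lambda>s' t. tree (lf h (k(reg s ''i'' := best)) Q) s' \<and> keys (k(reg s ''i'' := best)) s' \<and>
     same {''a'', ''b'', ''c'', ''e'', ''f'', ''g'', ''j'', ''l'', ''s''} {''T'', ''F'', ''K''} s s' \<and>
     t \<le> 40 * (lg + 2) * (1 + card D)) s"
proof -
  define i \<theta> where "i = reg s ''i''" and "\<theta> = reg s ''t''"
  have iN: "i \<le> N" "1 \<le> \<theta>" using i t by (simp_all add: i_def \<theta>_def)
  have kN: "z \<le> N \<Longrightarrow> k z \<le> N" for z using k[of z] by simp
  note S = nbs_lf[OF h iN, of k Q]
  have DN: "D \<subseteq> {..N}" using h by (auto simp: D nbs_def graph_def)
  have finD: "finite D" using DN finite_subset by blast
  \<comment> \<open>The minimum is attained, so \<open>best\<close> inherits its bounds from the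
    default or from a member of \<open>D\<close>.\<close>
  have bestin: "best \<in> insert (reg s ''s'') {z \<in> D. 0 < arr s ''J'' z \<and> k z = z}"
    unfolding best using finD by (intro Min_in) auto
  then have bestN: "best \<le> N" and best\<theta>: "\<theta> \<le> best + 1"
    using DN bt by (auto simp: \<theta>_def D nbs_def)
  let ?s1 = "set_reg ''j'' 0 s"
  have sub: "z \<le> N" if "z < P" "\<theta> \<le> lf h k Q i z" for z
    using that S h by (auto simp: nbs_def graph_def)
  show ?thesis
    unfolding rekey_def
    apply simp
    apply (rule wp_SeqI[OF extract_correct[of ?s1 "lf h k Q"]])
          apply (simp add: env)
         apply (simp add: tr)
        using i apply simp
       apply simp
      using t apply simp
     apply simp
     apply (rule sub; simp add: i_def \<theta>_def)
    apply (elim exE conjE)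
    subgoal for s2 t2 ds
    proof -
      assume a: "enum ''F'' ds s2" "set ds = {z. z < P \<and> reg ?s1 ''t'' \<le> lf h k Q (reg ?s1 ''i'') z}"
        "tree ((lf h k Q)(reg ?s1 ''i'' := \<lambda>z. if z \<in> set ds then 0 else lf h k Q (reg ?s1 ''i'') z)) s2"
        "same {''a'', ''b'', ''c'', ''e'', ''f'', ''g'', ''j''} {''T'', ''F''} ?s1 s2"
        "t2 \<le> 13 * (lg + 2) * length ds + 1"
      have ds: "set ds = D" using a(2) S by (simp add: i_def \<theta>_def D)
      have len: "length ds = card D" using a(1) ds by (metis enum_def distinct_card)
      let ?s3 = "set_reg ''l'' 0 s2"
      have r3: "reg s2 ''i'' = i" "arr s2 ''J'' = arr s ''J''" "arr s2 ''K'' = arr s ''K''" "reg s2 ''s'' = reg s ''s''"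
        using a by (simp_all add: same_def i_def)
      have en3: "enum ''F'' ds ?s3" using a(1) by (simp add: enum_def)
      have e2: "env s2" using a env by (simp add: env_def same_def)
      have B: "Min (insert (reg ?s3 ''s'') {z \<in> set ds. 0 < arr ?s3 ''J'' z \<and> arr ?s3 ''K'' z = z}) = best"
        unfolding best ds using K DN by (intro arg_cong[where f = Min]) (auto simp: r3 keys_def)
      show ?thesis
        apply simp
        apply (rule wp_SeqI[OF best_correct[of ?s3 ds]])
          apply simp
         apply (rule en3)
        subgoal for s4 t4
        proof -
          assume a4: "reg s4 ''s'' = Min (insert (reg ?s3 ''s'') {z \<in> set ds. 0 < arr ?s3 ''J'' z \<and> arr ?s3 ''K'' z = z}) \<and>
            same {''b'', ''l'', ''s''} {} ?s3 s4 \<and> t4 \<le> 5 * length ds + 1"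
          have r4: "reg s4 ''i'' = i" "reg s4 ''s'' = best" using a4 r3 B by (simp_all add: same_def)
          define s5 where "s5 = set_reg ''l'' 0 (set_arr ''K'' i best s4)"
          have e5: "env s5" using e2 a4 by (simp add: s5_def env_def same_def)
          have a3: "tree ((lf h k Q)(i := \<lambda>z. if z \<in> set ds then 0 else lf h k Q i z)) s2"
            using a(3) by (simp add: i_def cong: if_cong)
          have tr5: "tree ((lf h k Q)(i := \<lambda>z. if z \<in> set ds then 0 else lf h k Q i z)) s5"
            using tree_same[of "{''b'', ''l'', ''s''}" "{}" s2 s4, OF _ a3] a4 by (simp add: s5_def)
          have r5: "reg s5 ''i'' = i" "reg s5 ''l'' = 0" using r4 by (simp_all add: s5_def)
          have en5: "enum ''F'' ds s5" using en3 a4 by (simp add: enum_def s5_def same_def)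
          have K5: "arr s5 ''K'' z = (k(i := best)) z" if "z \<le> N" for z
            using a(4) a4 K that by (simp add: same_def keys_def s5_def)
          have k5: "(k(i := best)) z \<le> N" if "z \<le> N" for z using kN that bestN by simp
          show ?thesis
            apply (simp add: r4)
            apply (rule wp_mono[OF restore_correct[of s5 _ "''F''" ds "k(i := best)", OF e5 tr5 _ r5(2) en5 _ K5 k5,
              unfolded s5_def]])
               apply (simp add: r4 iN)
              apply simp
             apply assumption
            apply assumption
            apply (elim conjE)
            subgoal for s6 t6
              apply (intro conjI)
              subgoal
                apply (erule back_subst[of "\<lambda>L. tree L s6"])
                using lf_restore[OF h iN(1,2), of D k "k(i := best)" Q] best\<theta> bt(2) D
                by (simp add: r4 i_def[symmetric] \<theta>_def[symmetric] ds cong: if_cong)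
              subgoal using K5 by (simp add: keys_def same_def s5_def i_def)
              subgoal using a(4) a4 by (simp add: same_def)
              subgoal using a(5) a4 by (simp add: algebra_simps len)
              done
            done
        qed
        done
    qed
    done
qed

end

section \<open>Greedy maximal independent sets\<close>

text \<open>The lexicographically first maximal independent set for the ranks \<open>r\<close>. Only
  neighbours of strictly smaller rank are consulted, so the recursion is well founded for every
  \<open>r\<close>, injective or not.\<close>

function mis :: "('a \<Rightarrow> 'a \<Rightarrow> bool) \<Rightarrow> ('a \<Rightarrow> nat) \<Rightarrow> 'a \<Rightarrow> bool" where
  "mis h r v \<longleftrightarrow> (\<forall>u \<in> {u. r u < r v}. h u v \<longrightarrow> \<not> mis h r u)"
  by auto
termination by (relation "Wellfounded.measure (\<lambda>(h, r, v). r v)") auto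

declare mis.simps [simp del]

lemma mis_iff: "mis h r v \<longleftrightarrow> (\<forall>u. r u < r v \<longrightarrow> h u v \<longrightarrow> \<not> mis h r u)"
  by (subst mis.simps) blast

text \<open>The vertices that survive the first \<open>\<kappa>\<close> rounds of the greedy
  process. Degrees among them are what \<open>good\<close> bounds and what the running time depends
  on.\<close>

definition live :: "('a \<Rightarrow> 'a \<Rightarrow> bool) \<Rightarrow> ('a \<Rightarrow> nat) \<Rightarrow> nat \<Rightarrow> 'a \<Rightarrow> bool" where
  "live h r \<kappa> v \<longleftrightarrow> \<kappa> \<le> r v \<and> (\<forall>u. r u < \<kappa> \<longrightarrow> h u v \<longrightarrow> \<not> mis h r u)"

definition good :: "('a \<Rightarrow> 'a \<Rightarrow> bool) \<Rightarrow> ('a \<Rightarrow> nat) \<Rightarrow> (nat \<Rightarrow> nat) \<Rightarrow> bool" where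
  "good h r B \<longleftrightarrow> (\<forall>w \<kappa>. live h r \<kappa> w \<longrightarrow> card {z. h w z \<and> live h r \<kappa> z} \<le> B \<kappa>)"

definition add_edge :: "('a \<Rightarrow> 'a \<Rightarrow> bool) \<Rightarrow> 'a \<Rightarrow> 'a \<Rightarrow> 'a \<Rightarrow> 'a \<Rightarrow> bool" where
  "add_edge h x y u v \<longleftrightarrow> h u v \<or> u = x \<and> v = y \<or> u = y \<and> v = x"

definition flips :: "('a \<Rightarrow> 'a \<Rightarrow> bool) \<Rightarrow> ('a \<Rightarrow> 'a \<Rightarrow> bool) \<Rightarrow> ('a \<Rightarrow> nat) \<Rightarrow> 'a set" where
  "flips h h' r = {v. mis h r v \<noteq> mis h' r v}"

text \<open>The program works with ranks in place of vertices, so that the order is the identity;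
  the probabilistic part works with vertices and a rank function. The locale \<open>ranked\<close>
  translates between the two.\<close>

definition rmis :: "(nat \<Rightarrow> nat \<Rightarrow> bool) \<Rightarrow> nat \<Rightarrow> bool" where
  "rmis h = mis h (\<lambda>x. x)"

definition rlive :: "(nat \<Rightarrow> nat \<Rightarrow> bool) \<Rightarrow> nat \<Rightarrow> nat \<Rightarrow> bool" where
  "rlive h = live h (\<lambda>x. x)"

definition rgood :: "(nat \<Rightarrow> nat \<Rightarrow> bool) \<Rightarrow> (nat \<Rightarrow> nat) \<Rightarrow> bool" where
  "rgood h = good h (\<lambda>x. x)"

lemma rmis_iff: "rmis h v \<longleftrightarrow> (\<forall>u<v. h u v \<longrightarrow> \<not> rmis h u)"
  unfolding rmis_def by (subst mis_iff) simp

lemma rlive_def': "rlive h \<kappa> v \<longleftrightarrow> \<kappa> \<le> v \<and> (\<forall>u<\<kappa>. h u v \<longrightarrow> \<not> rmis h u)"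
  by (simp add: rlive_def live_def rmis_def)

lemma rgood_def': "rgood h B \<longleftrightarrow> (\<forall>w \<kappa>. rlive h \<kappa> w \<longrightarrow> card {z. h w z \<and> rlive h \<kappa> z} \<le> B \<kappa>)"
  by (simp add: rgood_def good_def rlive_def)

text \<open>The disjunct \<open>j = z\<close> gives a vertex without an earlier dominating member
  its own rank. Membership and liveness thereby both become comparisons with the key, in
  \<open>key_eq_iff\<close> and \<open>rlive_key\<close>.\<close>

definition key :: "(nat \<Rightarrow> nat \<Rightarrow> bool) \<Rightarrow> nat \<Rightarrow> nat" where
  "key h z = (LEAST j. j = z \<or> j < z \<and> h j z \<and> rmis h j)"

lemma key_le: "key h z \<le> z"
  unfolding key_def by (rule Least_le) simp

lemma key_less: "key h z < z \<Longrightarrow> h (key h z) z \<and> rmis h (key h z)"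
  using LeastI[of "\<lambda>j. j = z \<or> j < z \<and> h j z \<and> rmis h j" z] unfolding key_def by auto

lemma key_le_mis: "j < z \<Longrightarrow> h j z \<Longrightarrow> rmis h j \<Longrightarrow> key h z \<le> j"
  unfolding key_def by (rule Least_le) simp

lemma key_eq_iff: "key h z = z \<longleftrightarrow> rmis h z"
proof
  assume k: "key h z = z"
  show "rmis h z"
    unfolding rmis_iff[of h z] using key_le_mis[of _ z h] unfolding k by force
next
  assume m: "rmis h z"
  show "key h z = z"
  proof (rule ccontr)
    assume "key h z \<noteq> z"
    then have "key h z < z" using key_le[of h z] by simp
    with key_less[OF this] m show False unfolding rmis_iff[of h z] by auto
  qed
qed

lemma rlive_key: "rlive h \<kappa> z \<longleftrightarrow> \<kappa> \<le> key h z"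
proof
  assume l: "rlive h \<kappa> z"
  show "\<kappa> \<le> key h z"
  proof (rule ccontr)
    assume n: "\<not> \<kappa> \<le> key h z"
    then have "key h z < z" using l by (simp add: rlive_def')
    with key_less[OF this] l n show False unfolding rlive_def' by auto
  qed
next
  assume k: "\<kappa> \<le> key h z"
  have "\<not> rmis h u" if "u < \<kappa>" "h u z" for u
    using key_le_mis[of u z h] key_le[of h z] that k by fastforce
  then show "rlive h \<kappa> z"
    using k key_le[of h z] by (simp add: rlive_def')
qed

section \<open>Repairing the greedy set\<close>

context ram
begin

text \<open>
  Invariant of the repair phase after inserting an edge: \<open>h0\<close> and \<open>h\<close> are the old and the new graph, all ranks
  below \<open>cur\<close> are final, \<open>k\<close> are the current keys, \<open>I\<close> is the current vertex set and \<open>Q\<close> the queue.  The queue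
  holds the members that must leave and the non-members whose key is only a lower bound.
\<close>

definition inv :: "(nat \<Rightarrow> nat \<Rightarrow> bool) \<Rightarrow> (nat \<Rightarrow> nat \<Rightarrow> bool) \<Rightarrow> nat \<Rightarrow> (nat \<Rightarrow> nat) \<Rightarrow> nat set \<Rightarrow> nat set \<Rightarrow> bool" where
  "inv h0 h cur k I Q \<longleftrightarrow> I \<subseteq> {..N} \<and> Q \<subseteq> {..N} \<and>
     (\<forall>z\<le>N. k z \<le> z) \<and>
     (\<forall>z\<le>N. z \<notin> Q - I \<longrightarrow> k z < z \<longrightarrow> h (k z) z \<and> k z \<in> I) \<and>
     (\<forall>z\<le>N. \<forall>j<z. h j z \<longrightarrow> j \<in> I \<longrightarrow> k j = j \<longrightarrow> k z \<le> j) \<and>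
     (\<forall>z\<in>Q. cur \<le> z \<and> k z < z \<and> k z < cur) \<and>
     (\<forall>j\<le>N. cur \<le> j \<longrightarrow> (j \<in> I \<longleftrightarrow> rmis h0 j)) \<and>
     (\<forall>z\<le>N. z \<notin> Q \<longrightarrow> (z \<in> I \<longleftrightarrow> k z = z)) \<and>
     (\<forall>z\<le>N. cur \<le> k z \<longrightarrow> k z = key h0 z)"

lemma invD:
  assumes "inv h0 h cur k I Q"
  shows "I \<subseteq> {..N}" "Q \<subseteq> {..N}" "\<And>z. z \<le> N \<Longrightarrow> k z \<le> z"
    "\<And>z. z \<le> N \<Longrightarrow> z \<notin> Q - I \<Longrightarrow> k z < z \<Longrightarrow> h (k z) z"
    "\<And>z. z \<le> N \<Longrightarrow> z \<notin> Q - I \<Longrightarrow> k z < z \<Longrightarrow> k z \<in> I"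
    "\<And>z j. z \<le> N \<Longrightarrow> j < z \<Longrightarrow> h j z \<Longrightarrow> j \<in> I \<Longrightarrow> k j = j \<Longrightarrow> k z \<le> j"
    "\<And>z. z \<in> Q \<Longrightarrow> cur \<le> z" "\<And>z. z \<in> Q \<Longrightarrow> k z < z" "\<And>z. z \<in> Q \<Longrightarrow> k z < cur"
    "\<And>j. j \<le> N \<Longrightarrow> cur \<le> j \<Longrightarrow> j \<in> I \<longleftrightarrow> rmis h0 j"
    "\<And>z. z \<le> N \<Longrightarrow> z \<notin> Q \<Longrightarrow> z \<in> I \<longleftrightarrow> k z = z"
    "\<And>z. z \<le> N \<Longrightarrow> cur \<le> k z \<Longrightarrow> k z = key h0 z"
  using assms unfolding inv_def by simp_all

lemma rgoodD: "rgood h B \<Longrightarrow> rlive h \<kappa> v \<Longrightarrow> card {z. h v z \<and> rlive h \<kappa> z} \<le> B \<kappa>"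
  unfolding rgood_def' by blast

lemma graph_le: "graph h \<Longrightarrow> h u z \<Longrightarrow> u \<le> N \<and> z \<le> N \<and> u \<noteq> z"
  and graph_sym: "graph h \<Longrightarrow> h u z \<Longrightarrow> h z u"
  unfolding graph_def by blast+

text \<open>Induction on the rank. An unqueued vertex is a member exactly if its key is its own
  rank; a smaller key is witnessed by an earlier member, correct by induction; and an adjacent
  earlier member would have pushed the key down.\<close>

lemma inv_final:
  assumes h: "graph h" and inv: "inv h0 h cur k I Q" and Q: "\<forall>z\<in>Q. u \<le> z" and j: "j < u" "j \<le> N"
  shows "j \<in> I \<longleftrightarrow> rmis h j"
  using j
proof (induction j rule: less_induct)
  case (less j)
  note D = invD[OF inv]
  have jQ: "j \<notin> Q" using bspec[OF Q, of j] less.prems by auto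
  show ?case
  proof (cases "j \<in> I")
    case True
    then have kj: "k j = j" using D(11) jQ less.prems by blast
    have "\<not> rmis h i" if i: "i < j" "h i j" for i
    proof
      assume "rmis h i"
      then have "i \<in> I" using less.IH[of i] i less.prems by simp
      moreover have "i \<notin> Q" using bspec[OF Q, of i] i less.prems by auto
      ultimately have "k i = i" using D(11) i less.prems by simp
      then have "k j \<le> i" using D(6)[of j i] i less.prems \<open>i \<in> I\<close> by simp
      then show False using kj i by simp
    qed
    then show ?thesis using True by (subst rmis_iff) simp
  next
    case False
    then have "k j < j" using D(3,11)[of j] jQ less.prems by (simp add: le_neq_implies_less)
    then have "h (k j) j" "k j \<in> I" using D(4,5)[of j] jQ less.prems by auto
    moreover have "rmis h (k j)" using less.IH[of "k j"] \<open>k j < j\<close> \<open>k j \<in> I\<close> less.prems by simp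
    ultimately show ?thesis using False \<open>k j < j\<close> by (subst rmis_iff) auto
  qed
qed

text \<open>Membership is settled by \<open>inv_final\<close>. A key is then at most the true one
  because every adjacent member bounds it from above, and at least the true one because a key below
  the own rank is a member that dominates.\<close>

lemma inv_done:
  assumes h: "graph h" and inv: "inv h0 h cur k I {}"
  shows "I = {z. z \<le> N \<and> rmis h z}" "\<And>z. z \<le> N \<Longrightarrow> k z = key h z"
proof -
  have I: "j \<in> I \<longleftrightarrow> rmis h j" if "j \<le> N" for j
    using inv_final[OF h inv, of "N + 1" j] that by simp
  then show "I = {z. z \<le> N \<and> rmis h z}" using invD(1)[OF inv] by auto
  note D = invD[OF inv]
  show "k z = key h z" if z: "z \<le> N" for z
  proof (rule antisym)
    show "k z \<le> key h z"
    proof (cases "key h z < z")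
      case True
      from key_less[OF True] have "h (key h z) z" "rmis h (key h z)" by auto
      then show ?thesis using D(6)[of z "key h z"] D(11)[of "key h z"] I[of "key h z"] True z by simp
    next
      case False
      then show ?thesis using D(3)[OF z] by simp
    qed
    show "key h z \<le> k z"
    proof (cases "k z < z")
      case True
      then show ?thesis using key_le_mis[OF True] D(4,5)[OF z _ True] I[of "k z"] z by simp
    next
      case False
      then show ?thesis using key_le[of h z] by simp
    qed
  qed
qed

text \<open>A key that is merely a lower bound still certifies liveness up to its own value: an
  adjacent member \<open>j < \<kappa>\<close> of the new set is already final and would have forced
  the key down to \<open>j\<close>.\<close>

lemma live_cur:
  assumes h: "graph h" and inv: "inv h0 h cur k I Q" and Q: "\<forall>z\<in>Q. u \<le> z"
    and z: "z \<le> N" "\<kappa> \<le> k z" "\<kappa> \<le> u"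
  shows "rlive h \<kappa> z"
  unfolding rlive_def'
proof (intro conjI allI impI notI)
  note D = invD[OF inv]
  show "\<kappa> \<le> z" using D(3)[OF z(1)] z(2) by simp
  fix j assume j: "j < \<kappa>" "h j z" "rmis h j"
  have jz: "j < z" using D(3)[OF z(1)] z(2) j(1) by simp
  have "j \<notin> Q" using bspec[OF Q, of j] j(1) z(3) by auto
  moreover have "j \<in> I" using inv_final[OF h inv Q, of j] j z jz by simp
  ultimately have "k z \<le> j" using D(6)[of z j] D(11)[of j] z jz j by simp
  then show False using j z by simp
qed

text \<open>Bounds a search in the middle of the repair, when the keys may belong neither to the old
  nor to the new graph.\<close>

lemma card_nbs:
  assumes h: "graph h" and inv: "inv h0 h cur k I Q" and Q: "\<forall>z\<in>Q. u \<le> z"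
    and B: "rgood h B" and z: "z \<le> N" "\<kappa> \<le> k z" "\<kappa> \<le> u"
  shows "card (nbs h k z (\<kappa> + 1)) \<le> B \<kappa>"
proof -
  have "nbs h k z (\<kappa> + 1) \<subseteq> {y. h z y \<and> rlive h \<kappa> y}"
  proof
    fix y assume "y \<in> nbs h k z (\<kappa> + 1)"
    then have y: "h z y" "\<kappa> \<le> k y" by (auto simp: nbs_def)
    then have "rlive h \<kappa> y"
      using graph_le[OF h y(1)] z(3) by (intro live_cur[OF h inv Q]) auto
    with y show "y \<in> {y. h z y \<and> rlive h \<kappa> y}" by simp
  qed
  moreover have "finite {y. h z y \<and> rlive h \<kappa> y}"
    by (rule finite_subset[of _ "{..N}"]) (auto dest: graph_le[OF h])
  ultimately have "card (nbs h k z (\<kappa> + 1)) \<le> card {y. h z y \<and> rlive h \<kappa> y}"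
    by (rule card_mono[rotated])
  also have "\<dots> \<le> B \<kappa>"
  proof -
    have "rlive h \<kappa> z" by (rule live_cur[OF h inv Q z])
    with B show ?thesis by (rule rgoodD)
  qed
  finally show ?thesis .
qed

text \<open>The vertices with key \<open>u\<close> lose their dominator and are queued;
  \<open>u\<close> remains a lower bound for their keys. Their number is bounded in the old graph:
  keys from \<open>cur\<close> on are still the old ones, edges among ranks from \<open>cur\<close>
  on are old, and \<open>u\<close>, an old member, was live at level \<open>u\<close>.\<close>

lemma inv_leave:
  assumes h: "graph h" and inv: "inv h0 h cur k I Q" and Q: "\<forall>z\<in>Q. u \<le> z" and u: "u \<in> Q" "u \<in> I"
    and sub: "\<forall>v z. h v z \<longrightarrow> h0 v z \<or> v < cur \<or> z < cur" and h0: "\<forall>v z. h0 v z \<longrightarrow> h v z"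
    and M: "M = {z \<in> nbs h k u (k u + 1). k z = u}"
  shows "inv h0 h (u + 1) k (I - {u}) (Q - {u} \<union> M)"
    and "rmis h0 u" "\<not> rmis h u" and "rgood h0 B \<Longrightarrow> card M \<le> B u"
proof -
  note D = invD[OF inv]
  have uN: "u \<le> N" and cu: "cur \<le> u" and ku: "k u < u" "k u < cur" using D(2,7,8,9) u by auto
  show m0: "rmis h0 u" using D(10)[OF uN cu] u by simp
  have hk: "h (k u) u" "k u \<in> I" using D(4,5)[OF uN _ ku(1)] u by auto
  have "rmis h (k u)" using inv_final[OF h inv Q, of "k u"] ku uN hk by simp
  then show "\<not> rmis h u" using hk ku by (subst rmis_iff) auto
  have MN: "z \<le> N \<and> h u z \<and> u < z" if "z \<in> M" for z
  proof -
    have "h u z" "k z = u" using that by (auto simp: M nbs_def)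
    then have "z \<le> N" "z \<noteq> u" using graph_le[OF h, of u z] by auto
    then show ?thesis using D(3)[of z] \<open>h u z\<close> \<open>k z = u\<close> by auto
  qed
  have inM: "z \<in> M" if z: "z \<le> N" "k z = u" "z \<noteq> u" for z
  proof -
    have "u < z" using D(3)[of z] z by simp
    have "z \<notin> Q" using D(9)[of z] z cu by auto
    then have "h u z" using D(4)[of z] z \<open>u < z\<close> by simp
    then show ?thesis using z ku by (simp add: M nbs_def)
  qed
  have nI: "z \<notin> I" if "z \<in> M" for z
  proof
    assume "z \<in> I"
    have "k z = u" "u < z" "z \<le> N" using that MN by (auto simp: M)
    then have "z \<notin> Q" using D(9)[of z] cu by auto
    then show False using D(11)[of z] \<open>z \<in> I\<close> \<open>k z = u\<close> \<open>u < z\<close> \<open>z \<le> N\<close> by simp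
  qed
  show "inv h0 h (u + 1) k (I - {u}) (Q - {u} \<union> M)"
    unfolding inv_def
  proof (intro conjI allI impI ballI)
    show "I - {u} \<subseteq> {..N}" "Q - {u} \<union> M \<subseteq> {..N}" using D(1,2) MN by auto
    show "k z \<le> z" if "z \<le> N" for z using D(3) that by simp
    fix z assume z: "z \<le> N"
    {
      assume a: "z \<notin> Q - {u} \<union> M - (I - {u})" and kz: "k z < z"
      have "k z \<noteq> u" using inM[OF z] nI[of z] a kz by auto
      moreover have "z \<notin> Q - I" using a u by auto
      ultimately show "h (k z) z" "k z \<in> I - {u}" using D(4,5)[OF z _ kz] by auto
    }
    {
      fix j assume "j < z" "h j z" "j \<in> I - {u}" "k j = j"
      then show "k z \<le> j" using D(6)[OF z] by blast
    }
    show "z \<in> I - {u} \<longleftrightarrow> rmis h0 z" if "u + 1 \<le> z" using D(10)[OF z] cu that by auto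
    show "z \<in> I - {u} \<longleftrightarrow> k z = z" if "z \<notin> Q - {u} \<union> M"
      using that D(11)[OF z] ku by (cases "z = u") auto
    show "k z = key h0 z" if "u + 1 \<le> k z" using D(12)[OF z] cu that by auto
  next
    fix z assume z: "z \<in> Q - {u} \<union> M"
    then show "u + 1 \<le> z" using bspec[OF Q, of z] MN[of z] by (cases "z = u") auto
    show "k z < z" using z D(8)[of z] MN[of z] by (auto simp: M)
    show "k z < u + 1" using z D(9)[of z] cu by (auto simp: M)
  qed
  assume B: "rgood h0 B"
  have key0: "key h0 u = u" using m0 key_eq_iff by blast
  have "M \<subseteq> {z. h0 u z \<and> rlive h0 u z}"
  proof
    fix z assume z: "z \<in> M"
    then have "k z = key h0 z" "k z = u" using D(12)[of z] MN[of z] cu by (auto simp: M)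
    moreover have "h0 u z" using sub[rule_format, of u z] MN[OF z] cu by auto
    ultimately show "z \<in> {z. h0 u z \<and> rlive h0 u z}" by (simp add: rlive_key)
  qed
  moreover have "finite {z. h0 u z \<and> rlive h0 u z}"
    by (rule finite_subset[of _ "{..N}"]) (auto dest!: h0[rule_format] graph_le[OF h])
  ultimately have "card M \<le> card {z. h0 u z \<and> rlive h0 u z}" by (rule card_mono[rotated])
  also have "\<dots> \<le> B u" using rgoodD[OF B, of u u] key0 by (simp add: rlive_key)
  finally show "card M \<le> B u" .
qed

text \<open>As \<open>k u\<close> is a lower bound for the true key, a search with threshold
  \<open>k u + 1\<close> sees every possible dominator. The default \<open>u\<close> in the minimum
  stands for the case that no earlier member is adjacent, which \<open>inv_join\<close>
  treats.\<close>

lemma inv_stay: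
  assumes h: "graph h" and inv: "inv h0 h cur k I Q" and Q: "\<forall>z\<in>Q. u \<le> z" and u: "u \<in> Q" "u \<notin> I"
    and best: "best = Min (insert u {z \<in> nbs h k u (k u + 1). z \<in> I \<and> k z = z})"
  shows "best \<le> N" "best \<le> u" "best < u \<Longrightarrow> best \<in> I" "best < u \<Longrightarrow> h best u"
    "\<And>j. j < u \<Longrightarrow> h j u \<Longrightarrow> j \<in> I \<Longrightarrow> k j = j \<Longrightarrow> best \<le> j"
    "best < u \<Longrightarrow> inv h0 h (u + 1) (k(u := best)) I (Q - {u})"
proof -
  note D = invD[OF inv]
  have uN: "u \<le> N" and cu: "cur \<le> u" and ku: "k u < u" "k u < cur" using D(2,7,8,9) u by auto
  let ?A = "{z \<in> nbs h k u (k u + 1). z \<in> I \<and> k z = z}"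
  have fin: "finite (insert u ?A)"
    by (rule finite_subset[of _ "{..N}"]) (auto simp: nbs_def uN dest: graph_le[OF h])
  have bin: "best \<in> insert u ?A" unfolding best using fin by (intro Min_in) auto
  show bu: "best \<le> u" unfolding best using fin by simp
  then show "best \<le> N" using uN by simp
  show bI: "best < u \<Longrightarrow> best \<in> I" "best < u \<Longrightarrow> h best u"
    using bin graph_sym[OF h, of u best] by (auto simp: nbs_def)
  show low: "best \<le> j" if "j < u" "h j u" "j \<in> I" "k j = j" for j
  proof -
    have "k u \<le> j" using D(6)[OF uN] that by blast
    then have "j \<in> ?A" using that graph_sym[OF h, of j u] by (auto simp: nbs_def)
    then show ?thesis unfolding best using fin by simp
  qed
  assume less: "best < u"
  show "inv h0 h (u + 1) (k(u := best)) I (Q - {u})"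
    unfolding inv_def
  proof (intro conjI allI impI ballI)
    show "I \<subseteq> {..N}" "Q - {u} \<subseteq> {..N}" using D(1,2) by auto
    fix z assume z: "z \<le> N"
    show "(k(u := best)) z \<le> z" using D(3)[OF z] bu by simp
    {
      assume a: "z \<notin> Q - {u} - I" and kz: "(k(u := best)) z < z"
      then show "h ((k(u := best)) z) z" "(k(u := best)) z \<in> I"
        using D(4,5)[OF z] bI less by (auto split: if_splits)
    }
    {
      fix j assume "j < z" "h j z" "j \<in> I" "(k(u := best)) j = j"
      then show "(k(u := best)) z \<le> j" using D(6)[OF z, of j] low[of j] u less by (auto split: if_splits)
    }
    show "z \<in> I \<longleftrightarrow> rmis h0 z" if "u + 1 \<le> z" using D(10)[OF z] cu that by auto
    show "z \<in> I \<longleftrightarrow> (k(u := best)) z = z" if "z \<notin> Q - {u}"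
      using that D(11)[OF z] less u by (cases "z = u") auto
    show "(k(u := best)) z = key h0 z" if "u + 1 \<le> (k(u := best)) z" using D(12)[OF z] cu that bu by (auto split: if_splits)
  next
    fix z assume z: "z \<in> Q - {u}"
    then show "u + 1 \<le> z" using bspec[OF Q, of z] by (cases "z = u") auto
    show "(k(u := best)) z < z" "(k(u := best)) z < u + 1" using z D(8,9)[of z] cu by auto
  qed
qed

text \<open>The vertices of \<open>Z\<close> receive the key \<open>u\<close>, and the members among
  them are queued because they have to leave. None of them was queued before, since queued keys lie
  below \<open>cur\<close>, and none had key \<open>u\<close>, since \<open>u\<close> was no member.
  The last claim bounds the cost of changing the key of one vertex of \<open>Z\<close>.\<close>

lemma inv_join:
  assumes h: "graph h" and inv: "inv h0 h cur k I Q" and Q: "\<forall>z\<in>Q. u \<le> z" and u: "u \<in> Q" "u \<notin> I"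
    and low: "\<forall>j<u. h j u \<longrightarrow> j \<in> I \<longrightarrow> k j = j \<longrightarrow> u \<le> j"
    and Z: "Z = nbs h (k(u := u)) u (u + 1)"
  shows "inv h0 h (u + 1) (\<lambda>z. if z \<in> Z then u else (k(u := u)) z) (insert u I) (Q - {u} \<union> Z \<inter> I)"
    and "\<not> rmis h0 u" "rmis h u" and "rgood h B \<Longrightarrow> card Z \<le> B u"
    and "\<And>z. z \<in> Z \<Longrightarrow> u < z \<and> z \<le> N \<and> h u z \<and> u < k z \<and> z \<notin> Q"
    and "\<And>z. rgood h B \<Longrightarrow> z \<in> Z \<Longrightarrow> card {y. h z y \<and> (y = u \<or> u \<le> k y)} \<le> B u"
proof -
  note D = invD[OF inv]
  have uN: "u \<le> N" and cu: "cur \<le> u" and ku: "k u < u" "k u < cur" using D(2,7,8,9) u by auto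
  show nm0: "\<not> rmis h0 u" using D(10)[OF uN cu] u by simp
  have nolow: "\<not> rmis h j" if j: "j < u" "h j u" for j
  proof
    assume "rmis h j"
    then have "j \<in> I" using inv_final[OF h inv Q, of j] j uN by simp
    moreover have "j \<notin> Q" using bspec[OF Q, of j] j by auto
    ultimately show False using low[rule_format, OF j] D(11)[of j] j uN by simp
  qed
  then show m: "rmis h u" by (subst rmis_iff) simp
  have liveu: "rlive h u u" using nolow by (simp add: rlive_def')
  have livek: "rlive h u z" if "z \<le> N" "u \<le> k z" for z
    using live_cur[OF h inv Q] that by blast
  show Zp: "u < z \<and> z \<le> N \<and> h u z \<and> u < k z \<and> z \<notin> Q" if "z \<in> Z" for z
  proof -
    have hz: "h u z" "z \<le> N" "z \<noteq> u" using that graph_le[OF h, of u z] by (auto simp: Z nbs_def)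
    then have kz: "u \<le> k z" using that by (simp add: Z nbs_def)
    then have zQ: "z \<notin> Q" using D(9)[of z] cu by auto
    have uz: "u < z" using kz D(3)[of z] hz by simp
    have "k z \<noteq> u" using D(5)[of z] hz zQ u uz by auto
    then show ?thesis using hz kz zQ uz by simp
  qed
  have notZ: "k z < u" if "h u z" "z \<notin> Z" for z
    using that graph_le[OF h, of u z] by (auto simp: Z nbs_def)
  have fin: "finite {z. h y z \<and> R z}" for R y
    by (rule finite_subset[of _ "{..N}"]) (auto dest: graph_le[OF h])
  show "inv h0 h (u + 1) (\<lambda>z. if z \<in> Z then u else (k(u := u)) z) (insert u I) (Q - {u} \<union> Z \<inter> I)"
    unfolding inv_def
  proof (intro conjI allI impI ballI)
    show "insert u I \<subseteq> {..N}" "Q - {u} \<union> Z \<inter> I \<subseteq> {..N}" using D(1,2) uN by auto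
    fix z assume z: "z \<le> N"
    show "(if z \<in> Z then u else (k(u := u)) z) \<le> z" using D(3)[OF z] Zp[of z] by auto
    {
      assume a: "z \<notin> Q - {u} \<union> Z \<inter> I - insert u I" and kz: "(if z \<in> Z then u else (k(u := u)) z) < z"
      then show "h (if z \<in> Z then u else (k(u := u)) z) z" "(if z \<in> Z then u else (k(u := u)) z) \<in> insert u I"
        using D(4,5)[OF z] Zp[of z] by (auto split: if_splits)
    }
    {
      fix j assume j: "j < z" "h j z" "j \<in> insert u I" "(if j \<in> Z then u else (k(u := u)) j) = j"
      have jZ: "j \<notin> Z" using j(4) Zp[of j] by auto
      show "(if z \<in> Z then u else (k(u := u)) z) \<le> j"
      proof (cases "j = u")
        case True
        then show ?thesis using notZ[of z] j by auto
      next
        case False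
        then have j': "j \<in> I" "k j = j" using j jZ by auto
        then have "k z \<le> j" using D(6)[OF z] j by blast
        then show ?thesis using Zp[of z] low[rule_format, of j] j j' by auto
      qed
    }
    show "z \<in> insert u I \<longleftrightarrow> rmis h0 z" if "u + 1 \<le> z" using D(10)[OF z] cu that by auto
    show "z \<in> insert u I \<longleftrightarrow> (if z \<in> Z then u else (k(u := u)) z) = z" if "z \<notin> Q - {u} \<union> Z \<inter> I"
      using that D(11)[OF z] u Zp[of z] by (cases "z = u") auto
    show "(if z \<in> Z then u else (k(u := u)) z) = key h0 z" if "u + 1 \<le> (if z \<in> Z then u else (k(u := u)) z)"
      using D(12)[OF z] cu that by (auto split: if_splits)
  next
    fix z assume z: "z \<in> Q - {u} \<union> Z \<inter> I"
    then show "u + 1 \<le> z" using bspec[OF Q, of z] Zp[of z] by (cases "z = u") auto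
    show "(if z \<in> Z then u else (k(u := u)) z) < z" "(if z \<in> Z then u else (k(u := u)) z) < u + 1"
      using z D(8,9)[of z] cu Zp[of z] by auto
  qed
  assume B: "rgood h B"
  have "Z \<subseteq> {z. h u z \<and> rlive h u z}" using Zp by (force intro: livek)
  then have "card Z \<le> card {z. h u z \<and> rlive h u z}" by (rule card_mono[OF fin])
  then show "card Z \<le> B u" using rgoodD[OF B liveu] by (rule le_trans)
  fix z assume z: "z \<in> Z"
  have "{y. h z y \<and> (y = u \<or> u \<le> k y)} \<subseteq> {y. h z y \<and> rlive h u y}"
    using livek liveu by (auto dest: graph_le[OF h])
  then have "card {y. h z y \<and> (y = u \<or> u \<le> k y)} \<le> card {y. h z y \<and> rlive h u y}" by (rule card_mono[OF fin])
  moreover have "rlive h u z" using livek Zp[OF z] by simp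
  ultimately show "card {y. h z y \<and> (y = u \<or> u \<le> k y)} \<le> B u" using rgoodD[OF B, of u z] by (meson le_trans)
qed

end

section \<open>One step of the repair: output list, queue and amortised cost\<close>

definition leave_out :: com where
  "leave_out =
     Assign ''e'' (Minus (Read ''J'' (Reg ''o'')) (Const (Suc 0))) ;;
     Assign ''k'' (Minus (Reg ''k'') (Const (Suc 0))) ;;
     Write ''C'' (Reg ''e'') (Read ''C'' (Reg ''k'')) ;;
     Assign ''f'' (Read ''Z'' (Reg ''k'')) ;;
     Write ''Z'' (Reg ''e'') (Reg ''f'') ;;
     Write ''J'' (Reg ''f'') (Plus (Reg ''e'') (Const (Suc 0))) ;;
     Write ''J'' (Reg ''o'') (Const 0)"

definition join_out :: com where
  "join_out =
     Write ''C'' (Reg ''k'') (Read ''X'' (Reg ''o'')) ;;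
     Write ''Z'' (Reg ''k'') (Reg ''o'') ;;
     Assign ''k'' (Plus (Reg ''k'') (Const (Suc 0))) ;;
     Write ''J'' (Reg ''o'') (Reg ''k'')"

definition enqueue :: com where
  "enqueue =
     Assign ''a'' (Plus (Reg ''N'') (Const (Suc 0))) ;;
     Assign ''b'' (Reg ''q'') ;;
     Assign ''c'' (Const (Suc 0)) ;;
     tset"

definition mark_loop :: com where
  "mark_loop =
     While (Less (Const 0) (Reg ''p''))
       (Assign ''p'' (Minus (Reg ''p'') (Const (Suc 0))) ;;
        Assign ''q'' (Read ''G'' (Reg ''p'')) ;;
        Cond (Equal (Read ''K'' (Reg ''q'')) (Reg ''o'')) enqueue Skip)"

definition hit_loop :: com where
  "hit_loop =
     While (Less (Const 0) (Reg ''p''))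
       (Assign ''p'' (Minus (Reg ''p'') (Const (Suc 0))) ;;
        Assign ''q'' (Read ''G'' (Reg ''p'')) ;;
        Assign ''i'' (Reg ''q'') ;;
        Assign ''t'' (Plus (Reg ''o'') (Const (Suc 0))) ;;
        Assign ''s'' (Reg ''o'') ;;
        rekey ;;
        Cond (Less (Const 0) (Read ''J'' (Reg ''q''))) enqueue Skip)"

text \<open>The branches correspond to \<open>inv_leave\<close>, to \<open>inv_stay\<close> and, if
  \<open>rekey\<close> returns the own rank, to \<open>inv_join\<close>. In the last case the
  neighbours are listed only after the key has been set, with the higher threshold
  \<open>o + 1\<close>.\<close>

definition turn :: com where
  "turn =
     Assign ''a'' (Plus (Reg ''N'') (Const (Suc 0))) ;;
     Assign ''b'' (Reg ''o'') ;;
     Assign ''c'' (Const 0) ;;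
     tset ;;
     Assign ''i'' (Reg ''o'') ;;
     Assign ''t'' (Plus (Read ''K'' (Reg ''o'')) (Const (Suc 0))) ;;
     Cond (Less (Const 0) (Read ''J'' (Reg ''o'')))
       (collect ;; leave_out ;; Assign ''p'' (Reg ''j'') ;; mark_loop)
       (Assign ''s'' (Reg ''o'') ;;
        rekey ;;
        Cond (Equal (Read ''K'' (Reg ''o'')) (Reg ''o''))
          (join_out ;;
           Assign ''t'' (Plus (Reg ''o'') (Const (Suc 0))) ;;
           collect ;; Assign ''p'' (Reg ''j'') ;; hit_loop)
          Skip)"

context ram
begin

text \<open>\<open>Z\<close> lists the member ranks in the order of the output \<open>C\<close>, and
  \<open>J\<close> is the inverse of \<open>Z\<close> shifted by 1, so that 0 marks a non-member and
  the zeroed memory describes an empty list.\<close>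

definition outp :: "(nat \<Rightarrow> nat) \<Rightarrow> nat set \<Rightarrow> store \<Rightarrow> bool" where
  "outp X I s \<longleftrightarrow> I \<subseteq> {..N} \<and> reg s ''k'' = card I \<and> (\<forall>i\<le>N. arr s ''X'' i = X i) \<and>
     (\<forall>p<card I. arr s ''Z'' p \<in> I \<and> arr s ''J'' (arr s ''Z'' p) = Suc p \<and> arr s ''C'' p = X (arr s ''Z'' p)) \<and>
     (\<forall>i\<in>I. 0 < arr s ''J'' i \<and> arr s ''J'' i \<le> card I \<and> arr s ''Z'' (arr s ''J'' i - 1) = i) \<and>
     (\<forall>i\<le>N. i \<notin> I \<longrightarrow> arr s ''J'' i = 0)"

definition ds :: "(nat \<Rightarrow> nat) \<Rightarrow> (nat \<Rightarrow> nat \<Rightarrow> bool) \<Rightarrow> (nat \<Rightarrow> nat) \<Rightarrow> nat set \<Rightarrow> nat set \<Rightarrow> store \<Rightarrow> bool" where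
  "ds X h k I Q s \<longleftrightarrow> env s \<and> tree (lf h k Q) s \<and> keys k s \<and> outp X I s"

lemma outp_cong:
  assumes "reg s' ''k'' = reg s ''k''" "arr s' ''X'' = arr s ''X''" "arr s' ''Z'' = arr s ''Z''"
    "arr s' ''J'' = arr s ''J''" "arr s' ''C'' = arr s ''C''"
  shows "outp X I s' = outp X I s"
  using assms by (simp add: outp_def)

lemma outp_member: "outp X I s \<Longrightarrow> i \<le> N \<Longrightarrow> 0 < arr s ''J'' i \<longleftrightarrow> i \<in> I"
  by (auto simp: outp_def)

lemma card_le: "I \<subseteq> {..N} \<Longrightarrow> card I \<le> N + 1"
  by (metis card_atMost card_mono finite_atMost Suc_eq_plus1)

text \<open>The last entry \<open>f\<close> fills the gap at position \<open>e\<close>. Clearing the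
  entry of \<open>u\<close> in \<open>J\<close> is the final write, which makes the code right also
  when \<open>u\<close> itself is the last entry.\<close>

lemma leave_out_correct:
  assumes o: "outp X I s" and u: "reg s ''o'' = u" "u \<in> I"
  shows "wp w leave_out (\<lambda>s' t. outp X (I - {u}) s' \<and> same {''e'', ''f'', ''k''} {''C'', ''Z'', ''J''} s s' \<and> t = 7) s"
proof -
  define Z J C where "Z = arr s ''Z''" and "J = arr s ''J''" and "C = arr s ''C''"
  note sym = Z_def[symmetric] J_def[symmetric] C_def[symmetric]
  have IN: "I \<subseteq> {..N}" and k: "reg s ''k'' = card I" and X: "\<And>i. i \<le> N \<Longrightarrow> arr s ''X'' i = X i"
    and Zp: "\<And>p. p < card I \<Longrightarrow> Z p \<in> I" "\<And>p. p < card I \<Longrightarrow> J (Z p) = Suc p" "\<And>p. p < card I \<Longrightarrow> C p = X (Z p)"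
    and Ji: "\<And>i. i \<in> I \<Longrightarrow> 0 < J i" "\<And>i. i \<in> I \<Longrightarrow> J i \<le> card I" "\<And>i. i \<in> I \<Longrightarrow> Z (J i - 1) = i"
    and J0: "\<And>i. i \<le> N \<Longrightarrow> i \<notin> I \<Longrightarrow> J i = 0"
    using o unfolding outp_def sym by auto
  define e n f where "e = J u - 1" and "n = card I - 1" and "f = Z n"
  have fin: "finite I" using IN finite_subset by blast
  have n: "card I = Suc n" using u fin by (cases "card I") (auto simp: n_def)
  have cI: "card (I - {u}) = n" using n u fin by simp
  have e: "J u = Suc e" "e \<le> n" "Z e = u" using Ji[OF u(2)] n by (auto simp: e_def)
  have em: "Suc e mod 2 ^ w = Suc e" using e(2) n card_le[OF IN] by (intro Suc_mod) simp
  have f: "f \<in> I" "J f = Suc n" "C n = X f" using Zp[of n] n by (auto simp: f_def)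
  let ?s = "set_arr ''J'' u 0 (set_arr ''J'' f (Suc e) (set_arr ''Z'' e f (set_reg ''f'' f (set_arr ''C'' e (C n)
    (set_reg ''k'' n (set_reg ''e'' e s))))))"
  have "outp X (I - {u}) ?s"
    unfolding outp_def cI
  proof (intro conjI allI impI ballI)
    show "I - {u} \<subseteq> {..N}" using IN by auto
    show "reg ?s ''k'' = n" by simp
    show "arr ?s ''X'' i = X i" if "i \<le> N" for i using X that by simp
    {
      fix p assume p: "p < n"
      have fu: "f \<noteq> u" if "p = e" using that p e f by auto
      have 1: "Z p \<noteq> u" "Z p \<noteq> f" if "p \<noteq> e" using that p e f Zp(2)[of p] n by auto
      show "arr ?s ''Z'' p \<in> I - {u}" using Zp(1)[of p] 1 fu p n f by (simp add: sym)
      show "arr ?s ''J'' (arr ?s ''Z'' p) = Suc p" using Zp(2)[of p] 1 fu p n f by (simp add: sym)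
      show "arr ?s ''C'' p = X (arr ?s ''Z'' p)" using Zp(3)[of p] 1 fu p n f by (simp add: sym)
    }
    {
      fix i assume i: "i \<in> I - {u}"
      have ne: "J i - 1 \<noteq> e" using Ji(3)[of i] e i by auto
      have nn: "J i - 1 \<noteq> n" if "i \<noteq> f" using Ji(3)[of i] i that by (auto simp: f_def)
      have en: "e < n" if "i = f" using that e i f f_def by (cases "e = n") auto
      show "0 < arr ?s ''J'' i" using i Ji(1) by (simp add: sym)
      show "arr ?s ''J'' i \<le> n" using i Ji(1,2)[of i] n nn en by (auto simp: sym)
      show "arr ?s ''Z'' (arr ?s ''J'' i - 1) = i" using i Ji(3)[of i] ne by (auto simp: sym)
    }
    fix i assume "i \<le> N" "i \<notin> I - {u}"
    then show "arr ?s ''J'' i = 0" using J0[of i] f by (auto simp: sym)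
  qed
  moreover have "same {''e'', ''f'', ''k''} {''C'', ''Z'', ''J''} s ?s" by simp
  ultimately show ?thesis
    unfolding leave_out_def by (simp add: u k n sym e em f_def)
qed

lemma join_out_correct:
  assumes o: "outp X I s" and u: "reg s ''o'' = u" "u \<notin> I" "u \<le> N"
  shows "wp w join_out (\<lambda>s' t. outp X (insert u I) s' \<and> same {''k''} {''C'', ''Z'', ''J''} s s' \<and> t = 4) s"
proof -
  define Z J C where "Z = arr s ''Z''" and "J = arr s ''J''" and "C = arr s ''C''"
  note sym = Z_def[symmetric] J_def[symmetric] C_def[symmetric]
  have IN: "I \<subseteq> {..N}" and k: "reg s ''k'' = card I" and X: "\<And>i. i \<le> N \<Longrightarrow> arr s ''X'' i = X i"
    and Zp: "\<And>p. p < card I \<Longrightarrow> Z p \<in> I" "\<And>p. p < card I \<Longrightarrow> J (Z p) = Suc p" "\<And>p. p < card I \<Longrightarrow> C p = X (Z p)"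
    and Ji: "\<And>i. i \<in> I \<Longrightarrow> 0 < J i" "\<And>i. i \<in> I \<Longrightarrow> J i \<le> card I" "\<And>i. i \<in> I \<Longrightarrow> Z (J i - 1) = i"
    and J0: "\<And>i. i \<le> N \<Longrightarrow> i \<notin> I \<Longrightarrow> J i = 0"
    using o unfolding outp_def sym by auto
  define n where "n = card I"
  have fin: "finite I" using IN finite_subset by blast
  have cI: "card (insert u I) = Suc n" using u fin by (simp add: n_def)
  have km: "Suc n mod 2 ^ w = Suc n" using card_le[OF IN] by (intro Suc_mod) (simp add: n_def)
  let ?s = "set_arr ''J'' u (Suc n) (set_reg ''k'' (Suc n) (set_arr ''Z'' n u (set_arr ''C'' n (X u) s)))"
  have "outp X (insert u I) ?s"
    unfolding outp_def cI
  proof (intro conjI allI impI ballI)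
    show "insert u I \<subseteq> {..N}" using IN u by auto
    show "reg ?s ''k'' = Suc n" by simp
    show "arr ?s ''X'' i = X i" if "i \<le> N" for i using X that by simp
    {
      fix p assume p: "p < Suc n"
      have 1: "Z p \<noteq> u" if "p \<noteq> n" using that p Zp(1)[of p] u by (auto simp: n_def)
      show "arr ?s ''Z'' p \<in> insert u I" using Zp(1)[of p] p by (auto simp: sym n_def)
      show "arr ?s ''J'' (arr ?s ''Z'' p) = Suc p" using Zp(2)[of p] 1 p by (auto simp: sym n_def)
      show "arr ?s ''C'' p = X (arr ?s ''Z'' p)" using Zp(3)[of p] p by (auto simp: sym n_def)
    }
    {
      fix i assume i: "i \<in> insert u I"
      show "0 < arr ?s ''J'' i" using i Ji(1) by (auto simp: sym)
      show "arr ?s ''J'' i \<le> Suc n" using i Ji(2)[of i] by (auto simp: sym n_def)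
      show "arr ?s ''Z'' (arr ?s ''J'' i - 1) = i" using i Ji(1,2,3)[of i] by (auto simp: sym n_def)
    }
    fix i assume "i \<le> N" "i \<notin> insert u I"
    then show "arr ?s ''J'' i = 0" using J0[of i] by (auto simp: sym)
  qed
  moreover have "same {''k''} {''C'', ''Z'', ''J''} s ?s" by simp
  ultimately show ?thesis
    unfolding join_out_def by (simp add: u k sym X n_def[symmetric] km)
qed

lemma lf_insert: "(lf h k Q)(N + 1 := (lf h k Q (N + 1))(u := 1)) = lf h k (insert u Q)"
  and lf_remove: "(lf h k Q)(N + 1 := (lf h k Q (N + 1))(u := 0)) = lf h k (Q - {u})"
  by (auto simp: lf_def fun_eq_iff)

lemma ds_set_reg [simp]: "x \<notin> {''P'', ''D'', ''N'', ''k''} \<Longrightarrow> ds X h k I Q (set_reg x y s) = ds X h k I Q s"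
  by (simp add: ds_def keys_def) (metis arr_set_reg outp_cong reg_set_reg)

lemma N1_mod: "Suc N mod 2 ^ w = Suc N"
  by (rule Suc_mod) simp

lemma enqueue_correct:
  assumes "ds X h k I Q s" "reg s ''q'' \<le> N"
  shows "wp w enqueue (\<lambda>s' t. ds X h k I (insert (reg s ''q'') Q) s' \<and>
     same {''a'', ''b'', ''c'', ''e'', ''f'', ''g''} {''T''} s s' \<and> t \<le> 5 * (lg + 2) + 3) s"
proof -
  have N: "reg s ''N'' = N" using assms by (simp add: ds_def env_def)
  let ?s = "set_reg ''c'' (Suc 0) (set_reg ''b'' (reg s ''q'') (set_reg ''a'' (Suc N) s))"
  have d: "ds X h k I Q ?s" using assms by simp
  show ?thesis
    unfolding enqueue_def
    apply (simp add: N N1_mod)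
    apply (rule wp_mono[OF tset_correct[of ?s "lf h k Q"]])
    using d apply (simp add: ds_def)
    using d apply (simp add: ds_def)
      apply simp
     apply (simp add: P_gt assms)
    subgoal for s' t
      using d lf_insert[of h k Q "reg s ''q''"]
      by (auto simp: ds_def env_def keys_def same_def outp_cong[of s' ?s])
    done
qed

lemma mark_loop_correct:
  assumes d: "ds X h k I Q s" and xs: "reg s ''p'' = length xs" "set xs \<subseteq> {..N}" "\<forall>l<length xs. arr s ''G'' l = xs ! l"
  shows "wp w mark_loop (\<lambda>s' t. ds X h k I (Q \<union> {z \<in> set xs. k z = reg s ''o''}) s' \<and>
     same {''a'', ''b'', ''c'', ''e'', ''f'', ''g'', ''p'', ''q''} {''T''} s s' \<and> t \<le> 10 * (lg + 2) * length xs + 1) s"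
proof -
  define Inv where "Inv = (\<lambda>l s1. l \<le> length xs \<and> reg s1 ''p'' = l \<and>
     ds X h k I (Q \<union> {z \<in> set (drop l xs). k z = reg s ''o''}) s1 \<and>
     same {''a'', ''b'', ''c'', ''e'', ''f'', ''g'', ''p'', ''q''} {''T''} s s1)"
  have Inv0: "Inv (length xs) s" using assms by (simp add: Inv_def)
  have step: "wp w (Assign ''p'' (Minus (Reg ''p'') (Const (Suc 0))) ;;
        Assign ''q'' (Read ''G'' (Reg ''p'')) ;;
        Cond (Equal (Read ''K'' (Reg ''q'')) (Reg ''o'')) enqueue Skip)
        (\<lambda>s' t. \<exists>l'. Inv l' s' \<and> t + 1 + 10 * (lg + 2) * l' \<le> 10 * (lg + 2) * l) s1"
    if inv: "Inv l s1" and gd: "bval w (Less (Const 0) (Reg ''p'')) s1" for l s1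
  proof -
    obtain m where m: "l = Suc m" using inv gd by (cases l) (auto simp: Inv_def)
    have r: "reg s1 ''p'' = Suc m" "arr s1 ''G'' m = xs ! m" "reg s1 ''o'' = reg s ''o''" "m < length xs"
      using inv xs by (auto simp: Inv_def same_def m)
    let ?z = "xs ! m"
    have z: "?z \<le> N" using subsetD[OF xs(2) nth_mem[OF r(4)]] by simp
    let ?Q = "Q \<union> {z \<in> set (drop l xs). k z = reg s ''o''}"
    have d1: "ds X h k I ?Q s1" and sm: "same {''a'', ''b'', ''c'', ''e'', ''f'', ''g'', ''p'', ''q''} {''T''} s s1"
      using inv by (auto simp: Inv_def)
    have K: "arr s1 ''K'' ?z = k ?z" using d1 z by (simp add: ds_def keys_def)
    let ?s2 = "set_reg ''q'' ?z (set_reg ''p'' m s1)"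
    have dr: "drop m xs = ?z # drop l xs" using r m by (simp add: Cons_nth_drop_Suc)
    show ?thesis
    proof (cases "k ?z = reg s ''o''")
      case True
      then have Q: "Q \<union> {z \<in> set (drop m xs). k z = reg s ''o''} = insert ?z ?Q" unfolding dr by auto
      have e: "wp w enqueue (\<lambda>s' t. ds X h k I (insert ?z ?Q) s' \<and>
         same {''a'', ''b'', ''c'', ''e'', ''f'', ''g''} {''T''} ?s2 s' \<and> t \<le> 5 * (lg + 2) + 3) ?s2"
        using enqueue_correct[of X h k I ?Q ?s2] d1 z by simp
      show ?thesis
        apply (simp add: r True K)
        apply (rule wp_mono[OF e])
        subgoal for s' t
          apply (rule exI[of _ m])
          unfolding Inv_def Q using r sm by (simp add: same_def m)
        done
    next
      case False
      then have Q: "Q \<union> {z \<in> set (drop m xs). k z = reg s ''o''} = ?Q" unfolding dr by auto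
      have "Inv m ?s2" unfolding Inv_def Q using r d1 sm by simp
      then show ?thesis using False by (simp add: r K) (rule exI[of _ m], simp add: m)
    qed
  qed
  show ?thesis
    unfolding mark_loop_def
    apply (rule wp_mono)
     apply (rule wp_while[where Inv = Inv and \<Phi> = "\<lambda>l. 10 * (lg + 2) * l"])
      apply (rule Inv0)
     apply (erule (1) step)
    apply (elim exE conjE)
    subgoal for s' t l by (simp add: Inv_def)
    done
qed

text \<open>The list is processed from its end, so the keys are mixed on the way: vertices in
  \<open>drop l xs\<close> already have key \<open>u\<close>, the others still a larger one. In
  either case a neighbour found with threshold \<open>u + 1\<close> is among those counted by
  \<open>b\<close>.\<close>

lemma hit_loop_correct:
  assumes h: "graph h" and d: "ds X h k I Q s" and k: "\<And>z. z \<le> N \<Longrightarrow> k z \<le> z"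
    and xs: "reg s ''p'' = length xs" "distinct xs" "\<forall>l<length xs. arr s ''G'' l = xs ! l"
    and Z: "\<And>z. z \<in> set xs \<Longrightarrow> u < z \<and> z \<le> N \<and> h u z \<and> u < k z" and u: "reg s ''o'' = u" "u \<le> N" "k u = u"
    and b: "\<And>z. z \<in> set xs \<Longrightarrow> card {y. h z y \<and> (y = u \<or> u \<le> k y)} \<le> b"
  shows "wp w hit_loop (\<lambda>s' t. ds X h (\<lambda>z. if z \<in> set xs then u else k z) I (Q \<union> set xs \<inter> I) s' \<and>
     same {''a'', ''b'', ''c'', ''e'', ''f'', ''g'', ''i'', ''j'', ''l'', ''s'', ''t'', ''p'', ''q''} {''T'', ''F'', ''K''} s s' \<and>
     t \<le> 60 * (lg + 2) * (1 + b) * length xs + 1) s"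
proof -
  let ?R = "{''a'', ''b'', ''c'', ''e'', ''f'', ''g'', ''i'', ''j'', ''l'', ''s'', ''t'', ''p'', ''q''}"
  let ?A = "{''T'', ''F'', ''K''}"
  define kl where "kl = (\<lambda>l z. if z \<in> set (drop l xs) then u else k z)"
  define Inv where "Inv = (\<lambda>l s1. l \<le> length xs \<and> reg s1 ''p'' = l \<and>
     ds X h (kl l) I (Q \<union> set (drop l xs) \<inter> I) s1 \<and> same ?R ?A s s1)"
  have Inv0: "Inv (length xs) s" using assms by (simp add: Inv_def kl_def)
  let ?c = "60 * (lg + 2) * (1 + b)"
  have step: "wp w (Assign ''p'' (Minus (Reg ''p'') (Const (Suc 0))) ;;
        Assign ''q'' (Read ''G'' (Reg ''p'')) ;;
        Assign ''i'' (Reg ''q'') ;;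
        Assign ''t'' (Plus (Reg ''o'') (Const (Suc 0))) ;;
        Assign ''s'' (Reg ''o'') ;;
        rekey ;;
        Cond (Less (Const 0) (Read ''J'' (Reg ''q''))) enqueue Skip)
        (\<lambda>s' t. \<exists>l'. Inv l' s' \<and> t + 1 + ?c * l' \<le> ?c * l) s1"
    if inv: "Inv l s1" and gd: "bval w (Less (Const 0) (Reg ''p'')) s1" for l s1
  proof -
    obtain m where m: "l = Suc m" using inv gd by (cases l) (auto simp: Inv_def)
    have sm: "same ?R ?A s s1" using inv by (simp add: Inv_def)
    have r: "reg s1 ''p'' = Suc m" "arr s1 ''G'' m = xs ! m" "reg s1 ''o'' = u" "m < length xs"
      using inv xs u by (auto simp: Inv_def same_def m)
    define z where "z = xs ! m"
    have z: "z \<in> set xs" using r by (simp add: z_def)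
    note Zz = Z[OF z]
    let ?Q = "Q \<union> set (drop l xs) \<inter> I"
    have d1: "ds X h (kl l) I ?Q s1" using inv by (auto simp: Inv_def)
    have dr: "drop m xs = z # drop l xs" using r m by (simp add: Cons_nth_drop_Suc z_def)
    have zl: "z \<notin> set (drop l xs)"
      using distinct_drop[OF xs(2), of m] unfolding dr by simp
    have um: "Suc u mod 2 ^ w = Suc u" using u by (intro Suc_mod) simp
    let ?s2 = "set_reg ''s'' u (set_reg ''t'' (Suc u) (set_reg ''i'' z (set_reg ''q'' z (set_reg ''p'' m s1))))"
    have d2: "ds X h (kl l) I ?Q ?s2" using d1 by simp
    have kl_le: "kl l y \<le> y" if "y \<le> N" for y using k[OF that] Z[of y] by (auto simp: kl_def dest: in_set_dropD)
    define D where "D = nbs h (kl l) z (u + 1)"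
    have Dy: "h z y \<and> (y = u \<or> u \<le> k y) \<and> u \<le> kl l y" if "y \<in> D" for y
      using that Z[of y] by (auto simp: D_def nbs_def kl_def dest: in_set_dropD split: if_splits)
    have fin: "finite {y. h z y \<and> R y}" for R by (rule finite_subset[of _ "{..N}"]) (auto dest: graph_le[OF h])
    have "card D \<le> card {y. h z y \<and> (y = u \<or> u \<le> k y)}" using Dy by (intro card_mono[OF fin]) auto
    then have cD: "card D \<le> b" using b[OF z] by simp
    have "finite {y \<in> D. 0 < arr ?s2 ''J'' y \<and> kl l y = y}" using finite_subset[OF _ fin[of "\<lambda>_. True"]] Dy by (metis (no_types, lifting) mem_Collect_eq subsetI)
    \<comment> \<open>\<open>u\<close> is the default, and a candidate has a key of at least
      \<open>u\<close> that equals its rank.\<close>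
    then have best: "u = Min (insert (reg ?s2 ''s'') {y \<in> D. 0 < arr ?s2 ''J'' y \<and> kl l y = y})"
      using Dy by (intro Min_eqI[symmetric]) (auto, metis)
    have kl': "(kl l)(z := u) = kl m" unfolding kl_def dr by auto
    have rk: "wp w rekey (\<lambda>s' t. tree (lf h (kl m) ?Q) s' \<and> keys (kl m) s' \<and>
       same {''a'', ''b'', ''c'', ''e'', ''f'', ''g'', ''j'', ''l'', ''s''} {''T'', ''F'', ''K''} ?s2 s' \<and>
       t \<le> 40 * (lg + 2) * (1 + card D)) ?s2"
    proof -
      have i: "reg ?s2 ''i'' = z" "reg ?s2 ''t'' = u + 1" "reg ?s2 ''s'' = u" by simp_all
      have kz: "kl l z = k z" using zl by (simp add: kl_def)
      show ?thesis
        using rekey_correct[where s = ?s2 and h = h and k = "kl l" and Q = ?Q and D = D and best = u]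
          d2 Zz u h kl_le kz D_def best kl' unfolding ds_def i by simp
    qed
    show ?thesis
      apply (simp add: r z_def[symmetric] um)
      apply (rule wp_SeqI[OF rk])
      subgoal for s3 t3
      proof -
        assume a: "tree (lf h (kl m) ?Q) s3 \<and> keys (kl m) s3 \<and>
          same {''a'', ''b'', ''c'', ''e'', ''f'', ''g'', ''j'', ''l'', ''s''} {''T'', ''F'', ''K''} ?s2 s3 \<and>
          t3 \<le> 40 * (lg + 2) * (1 + card D)"
        have r3: "reg s3 ''q'' = z" "reg s3 ''p'' = m" "arr s3 ''J'' = arr s1 ''J''" using a by (auto simp: same_def)
        have sm3: "same ?R ?A s s3" using a sm by (simp add: same_def)
        have d3: "ds X h (kl m) I ?Q s3"
          using a d2 by (auto simp: ds_def env_def same_def outp_cong[of s3 ?s2])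
        have J: "0 < arr s1 ''J'' z \<longleftrightarrow> z \<in> I" using outp_member[of X I s1 z] d1 Zz by (simp add: ds_def)
        have t3: "t3 \<le> 40 * (lg + 2) * (1 + b)"
          using a cD by (meson add_left_mono le_trans mult_le_mono2)
        have c60: "60 * (lg + 2) * (1 + b) = 40 * (lg + 2) * (1 + b) + 20 * (lg + 2) * (1 + b)" by (simp add: algebra_simps)
        have c20: "20 * (lg + 2) \<le> 20 * (lg + 2) * (1 + b)" by simp
        show ?thesis
        proof (cases "z \<in> I")
          case True
          have Q: "Q \<union> set (drop m xs) \<inter> I = insert z ?Q" unfolding dr using True by auto
          have e: "wp w enqueue (\<lambda>s' t. ds X h (kl m) I (insert z ?Q) s' \<and>
             same {''a'', ''b'', ''c'', ''e'', ''f'', ''g''} {''T''} s3 s' \<and> t \<le> 5 * (lg + 2) + 3) s3"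
            using enqueue_correct[OF d3] r3 Zz by simp
          show ?thesis
            apply (simp add: r3 J True)
            apply (rule wp_mono[OF e])
            subgoal for s' t
              apply (rule exI[of _ m])
              apply (intro conjI)
              subgoal unfolding Inv_def Q using r r3 sm3 by (simp add: same_def)
              subgoal using t3 c60 c20 unfolding m by simp
              done
            done
        next
          case False
          have Q: "Q \<union> set (drop m xs) \<inter> I = ?Q" unfolding dr using False by auto
          have "Inv m s3" unfolding Inv_def Q using r r3 sm3 d3 by simp
          then show ?thesis
            using False t3 c60 c20 by (simp add: r3 J) (rule exI[of _ m], simp add: m)
        qed
      qed
      done
  qed
  show ?thesis
    unfolding hit_loop_def
    apply (rule wp_mono)
     apply (rule wp_while[where Inv = Inv and \<Phi> = "\<lambda>l. ?c * l"])
      apply (rule Inv0)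
     apply (erule (1) step)
    apply (elim exE conjE)
    subgoal for s' t l by (simp add: Inv_def kl_def)
    done
qed

end

section \<open>The repair loop and the insertion of an edge\<close>

definition main_loop :: com where
  "main_loop =
     While (Not (Less (Read ''T'' (Plus (Times (Plus (Reg ''N'') (Const (Suc 0))) (Reg ''D'')) (Const (Suc 0)))) (Const (Suc 0))))
       (Assign ''a'' (Plus (Reg ''N'') (Const (Suc 0))) ;;
        Assign ''c'' (Const (Suc 0)) ;;
        tfirst ;;
        Assign ''o'' (Reg ''b'') ;;
        turn)"

definition insert_queue :: com where
  "insert_queue =
     Cond (And (Less (Const 0) (Read ''J'' (Reg ''y''))) (Less (Read ''K'' (Reg ''y'')) (Reg ''y'')))
       (Assign ''q'' (Reg ''y'') ;; enqueue) Skip ;;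
     main_loop"

text \<open>With \<open>x\<close> before \<open>y\<close> only the key of \<open>y\<close> can be
  affected at once. The two leaves of the new edge are first written for the old keys, so that the
  change of key is an ordinary call of \<open>rekey\<close> on a consistent tree.\<close>

definition insert_sorted :: com where
  "insert_sorted =
     Assign ''c'' (Plus (Read ''K'' (Reg ''y'')) (Const (Suc 0))) ;;
     Cond (Less (Read ''K'' (Reg ''x'')) (Read ''K'' (Reg ''y'')))
       (Assign ''c'' (Plus (Read ''K'' (Reg ''x'')) (Const (Suc 0)))) Skip ;;
     Assign ''a'' (Reg ''x'') ;;
     Assign ''b'' (Reg ''y'') ;;
     tset ;;
     Assign ''a'' (Reg ''y'') ;;
     Assign ''b'' (Reg ''x'') ;;
     tset ;;
     Cond (And (Less (Const 0) (Read ''J'' (Reg ''x''))) (Less (Reg ''x'') (Read ''K'' (Reg ''y''))))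
       (Assign ''i'' (Reg ''y'') ;;
        Assign ''t'' (Plus (Reg ''x'') (Const (Suc 0))) ;;
        Assign ''s'' (Reg ''x'') ;;
        rekey) Skip ;;
     insert_queue"

definition insert_edge :: com where
  "insert_edge =
     Cond (Less (Reg ''y'') (Reg ''x''))
       (Assign ''d'' (Reg ''x'') ;; Assign ''x'' (Reg ''y'') ;; Assign ''y'' (Reg ''d'')) Skip ;;
     insert_sorted"

abbreviation turn_regs :: "vname set" where
  "turn_regs \<equiv> {''a'', ''b'', ''c'', ''e'', ''f'', ''g'', ''i'', ''j'', ''k'', ''l'', ''p'', ''q'', ''s'', ''t''}"

abbreviation turn_arrs :: "vname set" where
  "turn_arrs \<equiv> {''T'', ''F'', ''G'', ''K'', ''C'', ''Z'', ''J''}"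

context ram
begin

text \<open>The credit stored in the queue: each entry has prepaid its own search, which costs at
  most the live degree at the level of its current key.\<close>

definition weight :: "(nat \<Rightarrow> nat) \<Rightarrow> (nat \<Rightarrow> nat) \<Rightarrow> nat set \<Rightarrow> nat" where
  "weight B k Q = (\<Sum>z\<in>Q. 1 + B (k z))"

lemma weight_remove: "finite Q \<Longrightarrow> u \<in> Q \<Longrightarrow> weight B k Q = weight B k (Q - {u}) + 1 + B (k u)"
  unfolding weight_def by (subst sum.remove[of Q u]) auto

lemma weight_cong: "(\<And>z. z \<in> Q \<Longrightarrow> k z = k' z) \<Longrightarrow> weight B k Q = weight B k' Q"
  unfolding weight_def by (intro sum.cong) auto

lemma weight_union:
  assumes "finite Q" "finite M" "\<And>z. z \<in> M \<Longrightarrow> k z = u" "card M \<le> B u"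
  shows "weight B k (Q \<union> M) \<le> weight B k Q + B u * (1 + B u)"
proof -
  have "weight B k (Q \<union> M) \<le> weight B k Q + weight B k M"
    unfolding weight_def using sum.union_inter[OF assms(1,2), of "\<lambda>z. 1 + B (k z)"] by linarith
  moreover have "weight B k M = card M * (1 + B u)"
    unfolding weight_def using assms(3) by simp
  ultimately show ?thesis using mult_le_mono1[OF assms(4), of "1 + B u"] by linarith
qed

lemma ds_out:
  assumes d: "ds X h k I Q s" and sm: "same R A s s'" and "''P'' \<notin> R" "''D'' \<notin> R" "''N'' \<notin> R" "''T'' \<notin> A" "''K'' \<notin> A"
    and o: "outp X I' s'"
  shows "ds X h k I' Q s'"
proof -
  have "env s'" using assms by (simp add: ds_def env_def same_def)
  moreover have "tree (lf h k Q) s'" using tree_same[OF sm] assms by (simp add: ds_def)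
  moreover have "keys k s'" using assms by (simp add: ds_def keys_def same_def)
  ultimately show ?thesis using o by (simp add: ds_def)
qed

text \<open>Removing \<open>u\<close> from the queue releases \<open>1 + B (k u)\<close>, which pays
  for the search at \<open>u\<close>. If the status of \<open>u\<close> changes, at most
  \<open>B u\<close> vertices are queued with credit \<open>1 + B u\<close> each, and in the case of
  a join the keys of at most \<open>B u\<close> vertices are changed at a cost of order
  \<open>1 + B u\<close> each; the charge of twice \<open>(1 + B u)\<^sup>2\<close> covers both. The
  surplus \<open>10 * (lg + 2)\<close> is left to the surrounding loop for its search in the
  queue.\<close>

lemma turn_correct:
  assumes h: "graph h" and inv: "inv h0 h cur k I Q" and d: "ds X h k I Q s"
    and u: "reg s ''o'' = u" "u \<in> Q" and Q: "\<forall>z\<in>Q. u \<le> z"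
    and sub: "\<forall>v z. h v z \<longrightarrow> h0 v z \<or> v < cur \<or> z < cur" and h0: "\<forall>v z. h0 v z \<longrightarrow> h v z"
    and B: "rgood h0 B" "rgood h B"
  shows "wp w turn (\<lambda>s' t. \<exists>k' I' Q'. inv h0 h (u + 1) k' I' Q' \<and> ds X h k' I' Q' s' \<and> same turn_regs turn_arrs s s' \<and>
     t + 10 * (lg + 2) + 100 * (lg + 2) * weight B k' Q' \<le>
       100 * (lg + 2) * (weight B k Q + (if rmis h0 u \<noteq> rmis h u then 2 * (1 + B u)\<^sup>2 else 0))) s"
proof -
  note D = invD[OF inv]
  have uN: "u \<le> N" and cu: "cur \<le> u" and ku: "k u < u" "k u < cur" using D(2,7,8,9) u by auto
  have finQ: "finite Q" using D(2) finite_subset by blast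
  have kN: "k u \<le> N" using ku uN by simp
  note wr = weight_remove[OF finQ u(2), of B k]
  have reg: "reg s ''N'' = N" "arr s ''K'' u = k u" using d uN by (auto simp: ds_def env_def keys_def)
  let ?s0 = "set_reg ''c'' 0 (set_reg ''b'' u (set_reg ''a'' (Suc N) s))"
  have d0: "ds X h k I Q ?s0" using d by simp
  have t1: "wp w tset (\<lambda>s' t. ds X h k I (Q - {u}) s' \<and> same {''e'', ''f'', ''g''} {''T''} ?s0 s' \<and> t \<le> 5 * (lg + 2)) ?s0"
    apply (rule wp_mono[OF tset_correct[of ?s0 "lf h k Q"]])
    using d0 apply (simp add: ds_def)
    using d0 apply (simp add: ds_def)
      apply simp
     apply (simp add: P_gt uN)
    subgoal for s' t
      using d0 lf_remove[of h k Q u]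
      by (auto simp: ds_def env_def keys_def same_def outp_cong[of s' ?s0])
    done
  have Jm: "0 < arr s ''J'' u \<longleftrightarrow> u \<in> I" using outp_member[of X I s u] d uN by (simp add: ds_def)
  have um: "Suc (k u) mod 2 ^ w = Suc (k u)" "Suc u mod 2 ^ w = Suc u" using kN uN by (auto intro!: Suc_mod)
  have cN: "card (nbs h k u (k u + 1)) \<le> B (k u)"
    using card_nbs[OF h inv Q B(2) uN] ku by simp
  define R where "R = 100 * (lg + 2) * (weight B k Q + (if rmis h0 u \<noteq> rmis h u then 2 * (1 + B u)\<^sup>2 else 0))"
  define Post where "Post = (\<lambda>s' t. \<exists>k' I' Q'. inv h0 h (u + 1) k' I' Q' \<and> ds X h k' I' Q' s' \<and> same turn_regs turn_arrs s s' \<and>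
     t + 10 * (lg + 2) + 100 * (lg + 2) * weight B k' Q' \<le> R)"
  have PostI: "Post s' t" if "inv h0 h (u + 1) k' I' Q'" "ds X h k' I' Q' s'" "same turn_regs turn_arrs s s'"
     "t + 10 * (lg + 2) + 100 * (lg + 2) * weight B k' Q' \<le> R" for s' t k' I' Q'
    using that unfolding Post_def by blast
  have "wp w turn Post s"
    unfolding turn_def
    apply (simp add: reg u N1_mod)
    apply (rule wp_SeqI[OF t1])
    subgoal for s1 t1
    proof -
      assume a1: "ds X h k I (Q - {u}) s1 \<and> same {''e'', ''f'', ''g''} {''T''} ?s0 s1 \<and> t1 \<le> 5 * (lg + 2)"
      have r1: "reg s1 ''o'' = u" "arr s1 ''K'' u = k u" "arr s1 ''J'' = arr s ''J''"
        using a1 u reg by (auto simp: same_def)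
      let ?s2 = "set_reg ''t'' (Suc (k u)) (set_reg ''i'' u s1)"
      have d2: "ds X h k I (Q - {u}) ?s2" using a1 by simp
      have r2: "reg ?s2 ''i'' = u" "reg ?s2 ''t'' = k u + 1" by simp_all
      have sm2: "same turn_regs turn_arrs s ?s2" using a1 by (simp add: same_def)
      show ?thesis
      proof (cases "u \<in> I")
        case True
        note L = inv_leave[OF h inv Q u(2) True sub h0 refl]
        let ?M = "{z \<in> nbs h k u (k u + 1). k z = u}"
        have fl: "rmis h0 u \<noteq> rmis h u" using L(2,3) by simp
        have col: "wp w collect (\<lambda>s' t. \<exists>xs. enum ''G'' xs s' \<and> set xs = nbs h k u (k u + 1) \<and>
           ds X h k I (Q - {u}) s' \<and> same {''a'', ''b'', ''c'', ''e'', ''f'', ''g'', ''j'', ''l''} {''T'', ''G''} ?s2 s' \<and>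
           t \<le> 40 * (lg + 2) * (1 + length xs)) ?s2"
          apply (rule wp_mono[OF collect_correct[of ?s2 h k "Q - {u}"]])
          using d2 apply (simp add: ds_def)
          using h apply simp
          using d2 apply (simp add: ds_def)
          using d2 apply (simp add: ds_def)
          using D(3) apply simp
          using uN apply simp
            apply simp
           apply simp
          apply (elim exE)
          subgoal for s' t xs
            apply (rule exI[of _ xs])
            using d2 by (auto simp: ds_def env_def keys_def same_def outp_cong[of s' ?s2])
          done
        show ?thesis
          using True
          apply (simp add: r1 um Jm)
          apply (rule wp_SeqI[OF col])
          apply (elim exE)
          subgoal for s3 t3 xs
          proof -
            assume a3: "enum ''G'' xs s3 \<and> set xs = nbs h k u (k u + 1) \<and>
              ds X h k I (Q - {u}) s3 \<and> same {''a'', ''b'', ''c'', ''e'', ''f'', ''g'', ''j'', ''l''} {''T'', ''G''} ?s2 s3 \<and>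
              t3 \<le> 40 * (lg + 2) * (1 + length xs)"
            have en: "enum ''G'' xs s3" and d3: "ds X h k I (Q - {u}) s3" using a3 by auto
            have xs: "length xs \<le> B (k u)"
              using a3 cN distinct_card[of xs] by (simp add: enum_def)
            have r3: "reg s3 ''o'' = u" using a3 r1 by (auto simp: same_def)
            have o3: "outp X I s3" using d3 by (simp add: ds_def)
            show ?thesis
              apply (rule wp_SeqI[OF leave_out_correct[OF o3 r3 True]])
              subgoal for s4 t4
              proof -
                assume a4: "outp X (I - {u}) s4 \<and> same {''e'', ''f'', ''k''} {''C'', ''Z'', ''J''} s3 s4 \<and> t4 = 7"
                let ?s5 = "set_reg ''p'' (length xs) s4"
                have j: "reg s4 ''j'' = length xs" using a4 en by (simp add: enum_def same_def)
                have "ds X h k (I - {u}) (Q - {u}) s4"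
                  by (rule ds_out[OF d3, of "{''e'', ''f'', ''k''}" "{''C'', ''Z'', ''J''}"]) (use a4 in simp_all)
                then have d5: "ds X h k (I - {u}) (Q - {u}) ?s5" by simp
                have r5: "reg ?s5 ''o'' = u" using a4 r3 by (simp add: same_def)
                have g5: "\<forall>l<length xs. arr ?s5 ''G'' l = xs ! l" using en a4 by (simp add: enum_def same_def)
                have xsN: "set xs \<subseteq> {..N}" using en by (simp add: enum_def)
                have ml: "wp w mark_loop (\<lambda>s' t. ds X h k (I - {u}) (Q - {u} \<union> ?M) s' \<and>
                  same {''a'', ''b'', ''c'', ''e'', ''f'', ''g'', ''p'', ''q''} {''T''} ?s5 s' \<and> t \<le> 10 * (lg + 2) * length xs + 1) ?s5"
                  using mark_loop_correct[OF d5 _ xsN g5] a3 r5 by simp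
                show ?thesis
                  apply (simp add: j)
                  apply (rule wp_mono[OF ml])
                  subgoal for s6 t6
                    apply (rule PostI[of k "I - {u}" "Q - {u} \<union> ?M"])
                    subgoal using L(1) by simp
                    subgoal by simp
                    subgoal using sm2 a3 a4 by (simp add: same_def)
                    subgoal
                    proof -
                      assume a6: "ds X h k (I - {u}) (Q - {u} \<union> ?M) s6 \<and>
                        same {''a'', ''b'', ''c'', ''e'', ''f'', ''g'', ''p'', ''q''} {''T''} ?s5 s6 \<and> t6 \<le> 10 * (lg + 2) * length xs + 1"
                      have "finite ?M" using a3 by (metis (no_types, lifting) List.finite_set finite_subset mem_Collect_eq subsetI)
                      then have W: "weight B k (Q - {u} \<union> ?M) \<le> weight B k (Q - {u}) + B u * (1 + B u)"
                        using finQ L(4)[OF B(1)] by (intro weight_union) auto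
                      have b2: "B u * (1 + B u) \<le> 2 * (1 + B u)\<^sup>2" by (simp add: power2_eq_square)
                      define lt where "lt = lg + 2"
                      have lt: "2 \<le> lt" by (simp add: lt_def)
                      have "t3 \<le> 40 * lt * (1 + B (k u))" "t6 \<le> 10 * lt * B (k u) + 1"
                        using a3 a6 xs unfolding lt_def[symmetric] by (meson add_le_mono1 add_left_mono le_trans mult_le_mono2)+
                      then have "t1 + t3 + t4 + t6 + 10 + 10 * lt \<le> 100 * lt * (1 + B (k u))"
                        using a1 a4 lt unfolding lt_def[symmetric] by (simp add: algebra_simps)
                      moreover have "100 * lt * weight B k (Q - {u} \<union> ?M) \<le> 100 * lt * (weight B k (Q - {u}) + 2 * (1 + B u)\<^sup>2)"
                        using W b2 by (intro mult_le_mono2) linarith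
                      ultimately show ?thesis
                        using fl unfolding R_def wr lt_def[symmetric] by (simp add: distrib_left)
                    qed
                    done
                  done
              qed
              done
          qed
          done
      next
        \<comment> \<open>The key of a non-member in the queue is raised to the first member found
          by \<open>rekey\<close>; only if there is none does the status of \<open>u\<close>
          change.\<close>
        case False
        define best where "best = Min (insert u {z \<in> nbs h k u (k u + 1). z \<in> I \<and> k z = z})"
        note S = inv_stay[OF h inv Q u(2) False best_def]
        have kuu: "\<And>z. z \<le> N \<Longrightarrow> k z \<le> z" using D(3) by simp
        let ?s3 = "set_reg ''s'' u ?s2"
        have d3: "ds X h k I (Q - {u}) ?s3" using d2 by simp
        have bst: "best = Min (insert u {z \<in> nbs h k u (k u + 1). 0 < arr ?s3 ''J'' z \<and> k z = z})"
        proof -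
          have "0 < arr ?s3 ''J'' z \<longleftrightarrow> z \<in> I" if "z \<in> nbs h k u (k u + 1)" for z
            using that graph_le[OF h, of u z] outp_member[of X I ?s3 z] d3 by (auto simp: ds_def nbs_def)
          then show ?thesis unfolding best_def by (intro arg_cong[where f = Min]) auto
        qed
        have rk: "wp w rekey (\<lambda>s' t. ds X h (k(u := best)) I (Q - {u}) s' \<and>
          same {''a'', ''b'', ''c'', ''e'', ''f'', ''g'', ''j'', ''l'', ''s''} {''T'', ''F'', ''K''} ?s3 s' \<and>
          t \<le> 40 * (lg + 2) * (1 + card (nbs h k u (k u + 1)))) ?s3"
        proof -
          have i: "reg ?s3 ''i'' = u" "reg ?s3 ''t'' = k u + 1" "reg ?s3 ''s'' = u" by simp_all
          show ?thesis
            apply (rule wp_mono[OF rekey_correct[where s = ?s3 and h = h and k = k and Q = "Q - {u}" and D = "nbs h k u (k u + 1)" and best = best]])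
            using d3 kuu h bst uN ku unfolding ds_def i apply simp_all[12]
            subgoal for s' t
              using d3 by (auto simp: ds_def env_def same_def outp_cong[of s' ?s3])
            done
        qed
        define lt where "lt = lg + 2"
        have lt: "2 \<le> lt" by (simp add: lt_def)
        have kc: "weight B (k(u := best)) (Q - {u}) = weight B k (Q - {u})" by (rule weight_cong) auto
        show ?thesis
          using False
          apply (simp add: r1 um Jm)
          apply (rule wp_SeqI[OF rk])
          subgoal for s4 t4
          proof -
            assume a4: "ds X h (k(u := best)) I (Q - {u}) s4 \<and>
              same {''a'', ''b'', ''c'', ''e'', ''f'', ''g'', ''j'', ''l'', ''s''} {''T'', ''F'', ''K''} ?s3 s4 \<and>
              t4 \<le> 40 * (lg + 2) * (1 + card (nbs h k u (k u + 1)))"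
            have d4: "ds X h (k(u := best)) I (Q - {u}) s4" using a4 by simp
            have r4: "reg s4 ''o'' = u" "arr s4 ''K'' u = best" "reg s4 ''i'' = u"
              using a4 r1 uN by (auto simp: same_def ds_def keys_def)
            have sm4: "same turn_regs turn_arrs s s4" using a4 sm2 by (simp add: same_def)
            have T4: "t1 + t4 + 20 + 10 * lt \<le> 100 * lt * (1 + B (k u))"
            proof -
              have "t4 \<le> 40 * lt * (1 + B (k u))"
                using a4 cN unfolding lt_def by (meson add_left_mono le_trans mult_le_mono2)
              then show ?thesis using a1 lt unfolding lt_def[symmetric] by (simp add: algebra_simps)
            qed
            show ?thesis
            proof (cases "best = u")
              case bu: False
              then have less: "best < u" using S(2) by simp
              show ?thesis
                using bu
                apply (simp add: r4)
                apply (rule PostI[of "k(u := best)" I "Q - {u}"])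
                subgoal using S(6)[OF less] by simp
                subgoal using d4 by simp
                subgoal using sm4 by simp
                subgoal using T4 unfolding R_def wr lt_def[symmetric] by (simp add: kc distrib_left)
                done
            next
              case bu: True
              define Z where "Z = nbs h (k(u := u)) u (u + 1)"
              have low: "\<forall>j<u. h j u \<longrightarrow> j \<in> I \<longrightarrow> k j = j \<longrightarrow> u \<le> j" using S(5) unfolding bu by blast
              note Jn = inv_join[OF h inv Q u(2) False low Z_def]
              have fl: "rmis h0 u \<noteq> rmis h u" using Jn(2,3) by simp
              have ku': "\<And>z. z \<le> N \<Longrightarrow> (k(u := u)) z \<le> z" using D(3) by simp
              have o4: "outp X I s4" using d4 by (simp add: ds_def)
              show ?thesis
                using bu
                apply (simp add: r4)
                apply (rule wp_SeqI[OF join_out_correct[OF o4 r4(1) False uN]])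
                subgoal for s5 t5
                proof -
                  assume a5: "outp X (insert u I) s5 \<and> same {''k''} {''C'', ''Z'', ''J''} s4 s5 \<and> t5 = 4"
                  have r5: "reg s5 ''o'' = u" "reg s5 ''i'' = u" using a5 r4 by (auto simp: same_def)
                  let ?s6 = "set_reg ''t'' (Suc u) s5"
                  have "ds X h (k(u := u)) (insert u I) (Q - {u}) s5"
                    by (rule ds_out[OF d4[unfolded bu], of "{''k''}" "{''C'', ''Z'', ''J''}"]) (use a5 in simp_all)
                  then have d6: "ds X h (k(u := u)) (insert u I) (Q - {u}) ?s6" by simp
                  have i6: "reg ?s6 ''i'' = u" "reg ?s6 ''t'' = u + 1" using r5 by simp_all
                  have sm6: "same turn_regs turn_arrs s ?s6" using a5 sm4 by (simp add: same_def)
                  have col: "wp w collect (\<lambda>s' t. \<exists>xs. enum ''G'' xs s' \<and> set xs = Z \<and>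
                     ds X h (k(u := u)) (insert u I) (Q - {u}) s' \<and> same {''a'', ''b'', ''c'', ''e'', ''f'', ''g'', ''j'', ''l''} {''T'', ''G''} ?s6 s' \<and>
                     t \<le> 40 * (lg + 2) * (1 + length xs)) ?s6"
                    apply (rule wp_mono[OF collect_correct[of ?s6 h "k(u := u)" "Q - {u}"]])
                    using d6 apply (simp add: ds_def)
                    using h apply simp
                    using d6 apply (simp add: ds_def)
                    using d6 apply (simp add: ds_def)
                    using ku' apply simp
                    using uN i6 apply simp
                      apply simp
                     using i6 apply simp
                    apply (elim exE)
                    subgoal for s' t xs
                      apply (rule exI[of _ xs])
                      using d6 i6 by (auto simp: ds_def env_def keys_def same_def Z_def outp_cong[of s' ?s6])
                    done
                  show ?thesis
                    apply (simp add: r5 um)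
                    apply (rule wp_SeqI[OF col])
                    apply (elim exE)
                    subgoal for s7 t7 xs
                    proof -
                      assume a7: "enum ''G'' xs s7 \<and> set xs = Z \<and>
                        ds X h (k(u := u)) (insert u I) (Q - {u}) s7 \<and> same {''a'', ''b'', ''c'', ''e'', ''f'', ''g'', ''j'', ''l''} {''T'', ''G''} ?s6 s7 \<and>
                        t7 \<le> 40 * (lg + 2) * (1 + length xs)"
                      have en: "enum ''G'' xs s7" using a7 by simp
                      have xs: "length xs \<le> B u"
                        using a7 Jn(4)[OF B(2)] distinct_card[of xs] by (simp add: enum_def)
                      let ?s8 = "set_reg ''p'' (length xs) s7"
                      have j: "reg s7 ''j'' = length xs" using en by (simp add: enum_def)
                      have d8: "ds X h (k(u := u)) (insert u I) (Q - {u}) ?s8" using a7 by simp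
                      have r8: "reg ?s8 ''o'' = u" using a7 r5 by (simp add: same_def)
                      have g8: "distinct xs" "\<forall>l<length xs. arr ?s8 ''G'' l = xs ! l" using en by (simp_all add: enum_def)
                      have Zx: "u < z \<and> z \<le> N \<and> h u z \<and> u < (k(u := u)) z" if "z \<in> set xs" for z
                        using Jn(5)[of z] that a7 by auto
                      have bx: "card {y. h z y \<and> (y = u \<or> u \<le> (k(u := u)) y)} \<le> B u" if "z \<in> set xs" for z
                      proof -
                        have "{y. h z y \<and> (y = u \<or> u \<le> (k(u := u)) y)} = {y. h z y \<and> (y = u \<or> u \<le> k y)}" by auto
                        then show ?thesis using Jn(6)[OF B(2), of z] that a7 by simp
                      qed
                      let ?k' = "\<lambda>z. if z \<in> Z then u else (k(u := u)) z"
                      have QZ: "Q - {u} \<union> Z \<inter> insert u I = Q - {u} \<union> Z \<inter> I"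
                        using Jn(5)[of u] by auto
                      have hl: "wp w hit_loop (\<lambda>s' t. ds X h ?k' (insert u I) (Q - {u} \<union> Z \<inter> I) s' \<and>
                        same {''a'', ''b'', ''c'', ''e'', ''f'', ''g'', ''i'', ''j'', ''l'', ''s'', ''t'', ''p'', ''q''} {''T'', ''F'', ''K''} ?s8 s' \<and>
                        t \<le> 60 * (lg + 2) * (1 + B u) * length xs + 1) ?s8"
                      proof -
                        have pl: "reg ?s8 ''p'' = length xs" by simp
                        have kk: "(k(u := u)) u = u" by simp
                        show ?thesis
                          using hit_loop_correct[OF h d8 ku' pl g8 Zx r8 uN kk bx] a7 unfolding QZ[symmetric] by simp
                      qed
                      show ?thesis
                        apply (simp add: j)
                        apply (rule wp_mono[OF hl])
                        subgoal for s9 t9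
                          apply (rule PostI[of ?k' "insert u I" "Q - {u} \<union> Z \<inter> I"])
                          subgoal using Jn(1) by simp
                          subgoal by simp
                          subgoal using sm6 a7 by (simp add: same_def)
                          subgoal
                          proof -
                            assume a9: "ds X h ?k' (insert u I) (Q - {u} \<union> Z \<inter> I) s9 \<and>
                              same {''a'', ''b'', ''c'', ''e'', ''f'', ''g'', ''i'', ''j'', ''l'', ''s'', ''t'', ''p'', ''q''} {''T'', ''F'', ''K''} ?s8 s9 \<and>
                              t9 \<le> 60 * (lg + 2) * (1 + B u) * length xs + 1"
                            have fZ: "finite Z" using a7 by (metis List.finite_set)
                            have "card (Z \<inter> I) \<le> card Z" using fZ by (intro card_mono) auto
                            then have cZ: "card (Z \<inter> I) \<le> B u" using Jn(4)[OF B(2)] by simp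
                            have W: "weight B ?k' (Q - {u} \<union> Z \<inter> I) \<le> weight B ?k' (Q - {u}) + B u * (1 + B u)"
                              using finQ fZ cZ by (intro weight_union) auto
                            have W2: "weight B ?k' (Q - {u}) = weight B k (Q - {u})"
                              using Jn(5) by (intro weight_cong) auto
                            have "t7 \<le> 40 * lt * (1 + B u)"
                              using a7 xs unfolding lt_def[symmetric] by (meson add_left_mono le_trans mult_le_mono2)
                            moreover have "t9 \<le> 60 * lt * (1 + B u) * B u + 1"
                              using a9 xs unfolding lt_def[symmetric] by (meson add_le_mono1 le_trans mult_le_mono2)
                            ultimately have "t7 + t9 \<le> 100 * lt * ((1 + B u) * (1 + B u)) + 1"
                              by (simp add: algebra_simps)
                            moreover have "100 * lt * weight B ?k' (Q - {u} \<union> Z \<inter> I) \<le> 100 * lt * (weight B k (Q - {u}) + (1 + B u) * (1 + B u))"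
                              using W W2 by (intro mult_le_mono2) (simp add: algebra_simps)
                            ultimately show ?thesis
                              using fl T4 a5 unfolding R_def wr lt_def[symmetric] by (simp add: distrib_left power2_eq_square)
                          qed
                          done
                        done
                    qed
                    done
                qed
                done
            qed
          qed
          done
      qed
    qed
    done
  then show ?thesis unfolding Post_def R_def .
qed

end

abbreviation loop_regs :: "vname set" where
  "loop_regs \<equiv> insert ''o'' turn_regs"

abbreviation insert_regs :: "vname set" where
  "insert_regs \<equiv> insert ''d'' (insert ''x'' (insert ''y'' loop_regs))"

context ram
begin

definition rflips :: "(nat \<Rightarrow> nat \<Rightarrow> bool) \<Rightarrow> (nat \<Rightarrow> nat \<Rightarrow> bool) \<Rightarrow> nat set" where
  "rflips h0 h = {v. v \<le> N \<and> rmis h0 v \<noteq> rmis h v}"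

definition members :: "(nat \<Rightarrow> nat \<Rightarrow> bool) \<Rightarrow> nat set" where
  "members h = {z. z \<le> N \<and> rmis h z}"

text \<open>Vertices are taken from the queue in increasing order of rank and nothing is queued at
  or below the current one, so each change is charged only once. \<open>F c\<close> is the part of
  the charge that belongs to ranks from \<open>c\<close> on, and the potential is the credit in the
  queue plus \<open>F c\<close>.\<close>

lemma main_loop_correct:
  assumes h: "graph h" and inv: "inv h0 h cur k I Q" and d: "ds X h k I Q s"
    and sub: "\<forall>v z. h v z \<longrightarrow> h0 v z \<or> v < cur \<or> z < cur" and h0: "\<forall>v z. h0 v z \<longrightarrow> h v z"
    and B: "rgood h0 B" "rgood h B"
  shows "wp w main_loop (\<lambda>s' t. ds X h (key h) (members h) {} s' \<and> same loop_regs turn_arrs s s' \<and>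
     t \<le> 100 * (lg + 2) * (weight B k Q + (\<Sum>v\<in>rflips h0 h. 2 * (1 + B v)\<^sup>2)) + 1) s"
proof -
  define F where "F = (\<lambda>c. \<Sum>v\<in>{v\<in>rflips h0 h. c \<le> v}. 2 * (1 + B v)\<^sup>2)"
  have finF: "finite (rflips h0 h)" by (simp add: rflips_def)
  define Inv where "Inv = (\<lambda>(c, k, I, Q) s1. cur \<le> c \<and> inv h0 h c k I Q \<and> ds X h k I Q s1 \<and> same loop_regs turn_arrs s s1)"
  define \<Phi> where "\<Phi> = (\<lambda>(c, k :: nat \<Rightarrow> nat, I :: nat set, Q). 100 * (lg + 2) * (weight B k Q + F c))"
  have Inv0: "Inv (cur, k, I, Q) s" using inv d by (simp add: Inv_def)
  have root: "bval w (Not (Less (Read ''T'' (Plus (Times (Plus (Reg ''N'') (Const (Suc 0))) (Reg ''D'')) (Const (Suc 0)))) (Const (Suc 0)))) s1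
     \<longleftrightarrow> Suc 0 \<le> row s1 (N + 1) 1" if d: "ds X h k1 I1 Q1 s1" for k1 I1 Q1 s1
  proof -
    have r: "reg s1 ''N'' = N" "reg s1 ''D'' = 2 * P" using d by (auto simp: ds_def env_def)
    have m: "(Suc N * (2 * P)) mod 2 ^ w = Suc N * (2 * P)" "Suc (Suc N * (2 * P)) mod 2 ^ w = Suc N * (2 * P) + 1"
      using index_mod[of "N + 1" 0] index_mod[of "N + 1" 1] P_gt4 by auto
    show ?thesis by (simp add: r m N1_mod row_def not_less Suc_le_eq del: mult_Suc)
  qed
  have root2: "Suc 0 \<le> row s1 (N + 1) 1 \<longleftrightarrow> Q1 \<noteq> {}" if d: "ds X h k1 I1 Q1 s1" and Q: "Q1 \<subseteq> {..N}" for k1 I1 Q1 s1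
  proof -
    have "Suc 0 \<le> row s1 (N + 1) 1 \<longleftrightarrow> (\<exists>z<P. Suc 0 \<le> lf h k1 Q1 (N + 1) z)"
      using d by (intro root_iff) (auto simp: ds_def)
    also have "\<dots> \<longleftrightarrow> Q1 \<noteq> {}" using Q P_gt by (auto simp: lf_def Suc_le_eq)
    finally show ?thesis .
  qed
  have step: "wp w (Assign ''a'' (Plus (Reg ''N'') (Const (Suc 0))) ;;
        Assign ''c'' (Const (Suc 0)) ;;
        tfirst ;;
        Assign ''o'' (Reg ''b'') ;;
        turn) (\<lambda>s' t. \<exists>g'. Inv g' s' \<and> t + 1 + \<Phi> g' \<le> \<Phi> g) s1"
    if iv: "Inv g s1" and gd: "bval w (Not (Less (Read ''T'' (Plus (Times (Plus (Reg ''N'') (Const (Suc 0))) (Reg ''D'')) (Const (Suc 0)))) (Const (Suc 0)))) s1"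
    for g s1
  proof -
    obtain c k1 I1 Q1 where g: "g = (c, k1, I1, Q1)" by (cases g)
    have i1: "inv h0 h c k1 I1 Q1" and d1: "ds X h k1 I1 Q1 s1" and cc: "cur \<le> c" and sm: "same loop_regs turn_arrs s s1"
      using iv by (auto simp: Inv_def g)
    have rN: "reg s1 ''N'' = N" using d1 by (simp add: ds_def env_def)
    note D = invD[OF i1]
    have rt: "Suc 0 \<le> row s1 (N + 1) 1" using root[OF d1] gd by blast
    let ?s2 = "set_reg ''c'' (Suc 0) (set_reg ''a'' (Suc N) s1)"
    have d2: "ds X h k1 I1 Q1 ?s2" using d1 by simp
    define Post where "Post = (\<lambda>s' t. \<exists>g'. Inv g' s' \<and> t + 1 + \<Phi> g' \<le> \<Phi> g)"
    have "wp w (Assign ''a'' (Plus (Reg ''N'') (Const (Suc 0))) ;;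
        Assign ''c'' (Const (Suc 0)) ;;
        tfirst ;;
        Assign ''o'' (Reg ''b'') ;;
        turn) Post s1"
      apply (simp add: rN N1_mod)
      apply (rule wp_SeqI[OF tfirst_correct[of ?s2 "lf h k1 Q1"]])
      using d2 apply (simp add: ds_def)
      using d2 apply (simp add: ds_def)
        apply simp
      using rt apply simp
      subgoal for s3 t3
      proof -
        assume a: "same {''b'', ''e'', ''f''} {} ?s2 s3 \<and> reg s3 ''b'' < P \<and>
          reg ?s2 ''c'' \<le> lf h k1 Q1 (reg ?s2 ''a'') (reg s3 ''b'') \<and>
          (\<forall>z<reg s3 ''b''. lf h k1 Q1 (reg ?s2 ''a'') z < reg ?s2 ''c'') \<and> t3 \<le> 5 * (lg + 2)"
        define u where "u = reg s3 ''b''"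
        have u: "u \<in> Q1" using a by (auto simp: u_def lf_def split: if_splits) (metis One_nat_def not_one_le_zero of_bool_eq_0_iff)
        \<comment> \<open>The search returns the leftmost nonzero leaf of the queue, so
          \<open>u\<close> is its least rank.\<close>
        have Q1: "\<forall>z\<in>Q1. u \<le> z"
        proof
          fix z assume z: "z \<in> Q1"
          show "u \<le> z"
          proof (rule ccontr)
            assume "\<not> u \<le> z"
            then have "lf h k1 Q1 (N + 1) z < Suc 0" using a by (simp add: u_def)
            then show False using z by (simp add: lf_def)
          qed
        qed
        have o3: "outp X I1 s3" using d1 a by (subst outp_cong[of s3 s1]) (simp_all add: ds_def same_def)
        have "ds X h k1 I1 Q1 s3"
          by (rule ds_out[OF d2, of "{''b'', ''e'', ''f''}" "{}"]) (use a o3 in simp_all)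
        then have d4: "ds X h k1 I1 Q1 (set_reg ''o'' u s3)" by simp
        have cu: "c \<le> u" using D(7)[OF u] .
        have sub': "\<forall>v z. h v z \<longrightarrow> h0 v z \<or> v < c \<or> z < c" using sub cc by (meson less_le_trans)
        have uN: "u \<le> N" using D(2) u by auto
        have Fc: "F (u + 1) + (if rmis h0 u \<noteq> rmis h u then 2 * (1 + B u)\<^sup>2 else 0) \<le> F c"
        proof (cases "rmis h0 u \<noteq> rmis h u")
          case True
          then have "F (u + 1) + 2 * (1 + B u)\<^sup>2 = (\<Sum>v\<in>insert u {v\<in>rflips h0 h. u + 1 \<le> v}. 2 * (1 + B v)\<^sup>2)"
            unfolding F_def using finF by (subst sum.insert) auto
          also have "\<dots> \<le> F c"
            unfolding F_def using finF cu True uN by (intro sum_mono2) (auto simp: rflips_def)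
          finally show ?thesis using True by simp
        next
          case False
          have "F (u + 1) \<le> F c" unfolding F_def using finF cu by (intro sum_mono2) auto
          then show ?thesis using False by simp
        qed
        have tc: "wp w turn (\<lambda>s' t. \<exists>k' I' Q'. inv h0 h (u + 1) k' I' Q' \<and> ds X h k' I' Q' s' \<and>
          same turn_regs turn_arrs (set_reg ''o'' u s3) s' \<and>
          t + 10 * (lg + 2) + 100 * (lg + 2) * weight B k' Q' \<le>
          100 * (lg + 2) * (weight B k1 Q1 + (if rmis h0 u \<noteq> rmis h u then 2 * (1 + B u)\<^sup>2 else 0))) (set_reg ''o'' u s3)"
          by (rule turn_correct[OF h i1 d4 _ u Q1 sub' h0 B]) simp
        show ?thesis
          apply (simp add: u_def[symmetric])
          apply (rule wp_mono[OF tc])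
          apply (elim exE conjE)
          subgoal for s5 t5 k' I' Q'
          proof -
            assume p: "inv h0 h (u + 1) k' I' Q'" "ds X h k' I' Q' s5" "same turn_regs turn_arrs (set_reg ''o'' u s3) s5"
              "t5 + 10 * (lg + 2) + 100 * (lg + 2) * weight B k' Q' \<le>
                100 * (lg + 2) * (weight B k1 Q1 + (if rmis h0 u \<noteq> rmis h u then 2 * (1 + B u)\<^sup>2 else 0))"
            have "Inv (u + 1, k', I', Q') s5"
              using p cc cu sm a by (simp add: Inv_def same_def)
            moreover have "Suc (Suc (Suc (t3 + t5))) + 1 + \<Phi> (u + 1, k', I', Q') \<le> \<Phi> g"
            proof -
              define lt where "lt = lg + 2"
              have lt: "2 \<le> lt" by (simp add: lt_def)
              have "100 * lt * (F (u + 1) + (if rmis h0 u \<noteq> rmis h u then 2 * (1 + B u)\<^sup>2 else 0)) \<le> 100 * lt * F c"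
                using Fc by (rule mult_le_mono2)
              then show ?thesis using p(4) a lt
                unfolding \<Phi>_def g lt_def[symmetric] by (simp add: distrib_left)
            qed
            ultimately show ?thesis unfolding Post_def by auto
          qed
          done
      qed
      done
    then show ?thesis unfolding Post_def .
  qed
  show ?thesis
    unfolding main_loop_def
    apply (rule wp_mono)
     apply (rule wp_while[where Inv = Inv and \<Phi> = \<Phi>])
      apply (rule Inv0)
     apply (erule (1) step)
    apply (elim exE conjE)
    subgoal for s' t g
    proof -
      assume a: "Inv g s'" "\<not> bval w (Not (Less (Read ''T'' (Plus (Times (Plus (Reg ''N'') (Const (Suc 0))) (Reg ''D'')) (Const (Suc 0)))) (Const (Suc 0)))) s'"
        "t + \<Phi> g \<le> \<Phi> (cur, k, I, Q) + 1"
      obtain c k1 I1 Q1 where g: "g = (c, k1, I1, Q1)" by (cases g)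
      have i1: "inv h0 h c k1 I1 Q1" and d1: "ds X h k1 I1 Q1 s'" and sm: "same loop_regs turn_arrs s s'"
        using a(1) by (auto simp: Inv_def g)
      have Q1: "Q1 = {}" using root[OF d1] root2[OF d1 invD(2)[OF i1]] a(2) by blast
      have I1: "I1 = members h" and k1: "\<And>z. z \<le> N \<Longrightarrow> k1 z = key h z"
        using inv_done[OF h i1[unfolded Q1]] by (auto simp: members_def)
      have "tree (lf h (key h) {}) s' = tree (lf h k1 {}) s'"
        using k1 graph_le[OF h] by (intro tree_cong) (simp add: lf_def)
      then have "ds X h (key h) (members h) {} s'"
        using d1 k1 unfolding Q1 I1 by (simp add: ds_def keys_def)
      moreover have "\<Phi> (cur, k, I, Q) \<le> 100 * (lg + 2) * (weight B k Q + (\<Sum>v\<in>rflips h0 h. 2 * (1 + B v)\<^sup>2))"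
        unfolding \<Phi>_def F_def prod.case using finF by (intro mult_le_mono2 add_left_mono sum_mono2) auto
      ultimately show ?thesis using sm a(3) by simp
    qed
    done
qed

lemma rmis_add_edge:
  assumes "x < y" "j < y"
  shows "rmis (add_edge h x y) j = rmis h j"
  using assms(2)
proof (induction j rule: less_induct)
  case (less j)
  have "add_edge h x y u j = h u j" if "u < j" for u
    using that less.prems assms(1) by (auto simp: add_edge_def)
  then show ?case using less by (subst (1 2) rmis_iff) auto
qed

text \<open>Ranks below \<open>y\<close> do not see the new edge, hence \<open>cur = y\<close>. The
  only key that can change is that of \<open>y\<close>, to \<open>x\<close> if \<open>x\<close> is a
  member that precedes its former dominator; and a repair is needed only if this dominates a
  member.\<close>

lemma inv_insert:
  assumes g: "graph h0" and xy: "x < y" "y \<le> N"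
    and k: "k = (if x \<in> members h0 \<and> x < key h0 y then (key h0)(y := x) else key h0)"
    and Q: "Q = (if y \<in> members h0 \<and> k y < y then {y} else {})"
  shows "inv h0 (add_edge h0 x y) y k (members h0) Q"
  unfolding inv_def
proof (intro conjI allI impI ballI)
  have ch: "x \<in> members h0" "x < key h0 y" if "k y \<noteq> key h0 y" using that by (auto simp: k split: if_splits)
  have ky: "k y = x" if "x \<in> members h0" "x < key h0 y" using that by (simp add: k)
  have ko: "k z = key h0 z" if "z \<noteq> y" for z using that by (simp add: k)
  have low: "k z \<le> key h0 z" for z by (simp add: k)
  show "members h0 \<subseteq> {..N}" "Q \<subseteq> {..N}" using xy by (auto simp: members_def Q split: if_splits)
  fix z assume z: "z \<le> N"
  show "k z \<le> z" using low[of z] key_le[of h0 z] by simp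
  {
    assume "k z < z" "z \<notin> Q - members h0"
    then have "add_edge h0 x y (k z) z \<and> k z \<in> members h0"
    proof (cases "k z = key h0 z")
      case True
      then have kz: "key h0 z < z" using \<open>k z < z\<close> by simp
      from key_less[OF kz] kz z show ?thesis by (simp add: True add_edge_def members_def)
    next
      case False
      then have zy: "z = y" using ko by blast
      then show ?thesis using False ch ky by (simp add: add_edge_def)
    qed
    then show "add_edge h0 x y (k z) z" "k z \<in> members h0" by blast+
  }
  {
    fix j assume j: "j < z" "add_edge h0 x y j z" "j \<in> members h0" "k j = j"
    show "k z \<le> j"
    proof (cases "h0 j z")
      case True
      then show ?thesis using key_le_mis[of j z h0] j low[of z] by (simp add: members_def)
    next
      case False
      then have "j = x" "z = y" using j xy by (auto simp: add_edge_def)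
      then show ?thesis using ky j low[of y] by (cases "x < key h0 y") auto
    qed
  }
  show "z \<in> members h0 \<longleftrightarrow> rmis h0 z" using z by (simp add: members_def)
  have zm: "z \<in> members h0 \<longleftrightarrow> key h0 z = z" using z by (simp add: key_eq_iff members_def)
  show "z \<in> members h0 \<longleftrightarrow> k z = z" if "z \<notin> Q"
  proof (cases "k z = key h0 z")
    case True
    then show ?thesis using zm by simp
  next
    case False
    then have zy: "z = y" using ko by blast
    then have "k y = x" using False ch ky by simp
    then show ?thesis using that xy zy by (simp add: Q split: if_splits)
  qed
  show "k z = key h0 z" if "y \<le> k z"
  proof (rule ccontr)
    assume n: "k z \<noteq> key h0 z"
    then have zy: "z = y" using ko by blast
    then have "k y = x" using n ch ky by simp
    then show False using that zy xy by simp
  qed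
next
  fix z assume "z \<in> Q"
  then have z: "z = y" "y \<in> members h0" "k y < y" by (auto simp: Q split: if_splits)
  then show "y \<le> z" "k z < z" "k z < y" by auto
qed

text \<open>Liveness at level \<open>x\<close> is decided by ranks below \<open>x\<close>. There
  both graphs have the same edges and the same members, so the old keys count neighbours in the live
  part of the new graph.\<close>

lemma card_insert_nbs:
  assumes g: "graph h0" and xy: "x < y" "y \<le> N" and ky: "x < key h0 y" and B: "rgood (add_edge h0 x y) B"
    and gr: "graph (add_edge h0 x y)"
  shows "card (nbs (add_edge h0 x y) (key h0) y (x + 1)) \<le> B x"
proof -
  let ?h = "add_edge h0 x y"
  have rl: "rlive ?h x z" if "x \<le> key h0 z" for z
  proof -
    have "rlive h0 x z" using that by (simp add: rlive_key)
    moreover have "?h j z = h0 j z" "rmis ?h j = rmis h0 j" if "j < x" for j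
      using that xy rmis_add_edge[OF xy(1), of j] by (auto simp: add_edge_def)
    ultimately show ?thesis by (auto simp: rlive_def')
  qed
  have "card (nbs ?h (key h0) y (x + 1)) \<le> card {z. ?h y z \<and> rlive ?h x z}"
    using rl by (intro card_mono finite_subset[of "{z. ?h y z \<and> rlive ?h x z}" "{..N}"])
      (auto simp: nbs_def dest: graph_le[OF gr])
  also have "\<dots> \<le> B x" using rgoodD[OF B rl[of y]] ky by simp
  finally show ?thesis .
qed

lemma graph_add_edge: "graph h0 \<Longrightarrow> x \<le> N \<Longrightarrow> y \<le> N \<Longrightarrow> x \<noteq> y \<Longrightarrow> graph (add_edge h0 x y)"
  unfolding graph_def add_edge_def by blast

lemma insert_queue_correct:
  assumes g: "graph h0" and xy: "x < y" "y \<le> N" "reg s ''y'' = y"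
    and B: "rgood h0 B" "rgood (add_edge h0 x y) B"
    and k: "k = (if x \<in> members h0 \<and> x < key h0 y then (key h0)(y := x) else key h0)"
    and d: "ds X (add_edge h0 x y) k (members h0) {} s"
  shows "wp w insert_queue (\<lambda>s' t. ds X (add_edge h0 x y) (key (add_edge h0 x y)) (members (add_edge h0 x y)) {} s' \<and>
     same loop_regs turn_arrs s s' \<and>
     t \<le> 110 * (lg + 2) * (1 + B x + (\<Sum>v\<in>rflips h0 (add_edge h0 x y). 2 * (1 + B v)\<^sup>2))) s"
proof -
  let ?h = "add_edge h0 x y"
  let ?I = "members h0"
  define lt where "lt = lg + 2"
  have lt: "2 \<le> lt" by (simp add: lt_def)
  define \<Sigma> where "\<Sigma> = (\<Sum>v\<in>rflips h0 ?h. 2 * (1 + B v)\<^sup>2)"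
  have h: "graph ?h" using g xy by (intro graph_add_edge) auto
  define Q where "Q = (if y \<in> ?I \<and> k y < y then {y} else {})"
  note inv = inv_insert[OF g xy(1,2) k Q_def]
  have sub: "\<forall>v z. ?h v z \<longrightarrow> h0 v z \<or> v < y \<or> z < y" "\<forall>v z. h0 v z \<longrightarrow> ?h v z"
    using xy by (auto simp: add_edge_def)
  \<comment> \<open>A queued \<open>y\<close> was a member with its own rank as key, so a smaller
    key can only be \<open>x\<close>.\<close>
  have WQ: "weight B k Q \<le> 1 + B x"
  proof (cases "y \<in> ?I \<and> k y < y")
    case True
    then have "key h0 y = y" by (simp add: members_def key_eq_iff)
    then have "k y = x" using True by (auto simp: k split: if_splits)
    then show ?thesis using True by (simp add: Q_def weight_def)
  qed (auto simp: Q_def weight_def)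
  have J: "0 < arr s ''J'' y \<longleftrightarrow> y \<in> ?I" and K: "arr s ''K'' y = k y"
    using d xy outp_member[of X ?I s y] by (auto simp: ds_def keys_def)
  define Post where "Post = (\<lambda>s' t. ds X ?h (key ?h) (members ?h) {} s' \<and> same loop_regs turn_arrs s s' \<and>
     t \<le> 110 * lt * (1 + B x + \<Sigma>))"
  have main: "wp w main_loop (\<lambda>s' t. ds X ?h (key ?h) (members ?h) {} s' \<and> same loop_regs turn_arrs s1 s' \<and>
     t \<le> 100 * lt * (1 + B x + \<Sigma>) + 1) s1" if "ds X ?h k ?I Q s1" for s1
    apply (rule wp_mono[OF main_loop_correct[OF h inv that sub B]])
    subgoal for s' t
      using mult_le_mono2[OF add_right_mono[OF WQ, of \<Sigma>], of "100 * lt"] unfolding lt_def \<Sigma>_def by linarith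
    done
  have fin: "100 * lt * (1 + B x + \<Sigma>) + 5 * lt + 15 \<le> 110 * lt * (1 + B x + \<Sigma>) + 11"
    using lt by (simp add: algebra_simps)
  have "wp w insert_queue Post s"
  proof (cases "y \<in> ?I \<and> k y < y")
    case True
    let ?s1 = "set_reg ''q'' y s"
    have e: "wp w enqueue (\<lambda>s' t. ds X ?h k ?I Q s' \<and>
     same {''a'', ''b'', ''c'', ''e'', ''f'', ''g''} {''T''} ?s1 s' \<and> t \<le> 5 * (lg + 2) + 3) ?s1"
      using enqueue_correct[of X ?h k ?I "{}" ?s1] d xy True by (simp add: Q_def)
    show ?thesis
      unfolding insert_queue_def
      using True
      apply (simp add: xy J K)
      apply (rule wp_SeqI[OF e])
      apply (elim conjE)
      subgoal for s1 t1
        apply (rule wp_mono[OF main], assumption)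
        unfolding Post_def using fin lt unfolding lt_def[symmetric] by (auto simp: same_def)
      done
  next
    case False
    then have d': "ds X ?h k ?I Q s" using d by (auto simp: Q_def)
    show ?thesis
      unfolding insert_queue_def
      using False
      apply (simp add: xy J K)
      apply (rule conjI, blast)
      apply (rule wp_mono[OF main[OF d']])
      unfolding Post_def using fin lt by auto
  qed
  then show ?thesis unfolding Post_def lt_def \<Sigma>_def .
qed

lemma insert_sorted_correct:
  assumes g: "graph h0" and xy: "x < y" "y \<le> N" "reg s ''x'' = x" "reg s ''y'' = y"
    and B: "rgood h0 B" "rgood (add_edge h0 x y) B"
    and d: "ds X h0 (key h0) (members h0) {} s"
  shows "wp w insert_sorted (\<lambda>s' t. ds X (add_edge h0 x y) (key (add_edge h0 x y)) (members (add_edge h0 x y)) {} s' \<and>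
     same loop_regs turn_arrs s s' \<and>
     t + 10 \<le> 200 * (lg + 2) * (1 + B x + (\<Sum>v\<in>rflips h0 (add_edge h0 x y). 2 * (1 + B v)\<^sup>2))) s"
proof -
  let ?h = "add_edge h0 x y"
  let ?I = "members h0"
  let ?k0 = "key h0"
  define lt where "lt = lg + 2"
  have lt: "2 \<le> lt" by (simp add: lt_def)
  define \<Sigma> where "\<Sigma> = (\<Sum>v\<in>rflips h0 ?h. 2 * (1 + B v)\<^sup>2)"
  have xN: "x \<le> N" using xy by simp
  have h: "graph ?h" using g xy by (intro graph_add_edge) auto
  have K: "arr s ''K'' x = ?k0 x" "arr s ''K'' y = ?k0 y" using d xy xN by (auto simp: ds_def keys_def)
  have km: "Suc (?k0 y) mod 2 ^ w = Suc (?k0 y)" "Suc (?k0 x) mod 2 ^ w = Suc (?k0 x)" "Suc x mod 2 ^ w = Suc x"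
    using key_le[of h0 y] key_le[of h0 x] xy by (auto intro!: Suc_mod)
  define c where "c = min (?k0 x) (?k0 y) + 1"
  define Post where "Post = (\<lambda>s' t. ds X ?h (key ?h) (members ?h) {} s' \<and> same loop_regs turn_arrs s s' \<and>
     t + 10 \<le> 200 * lt * (1 + B x + \<Sigma>))"
  let ?s1 = "set_reg ''b'' y (set_reg ''a'' x (set_reg ''c'' c s))"
  have d1: "ds X h0 ?k0 ?I {} ?s1" using d by simp
  let ?L1 = "(lf h0 ?k0 {})(x := (lf h0 ?k0 {} x)(y := c))"
  have L2: "?L1(y := (?L1 y)(x := c)) = lf ?h ?k0 {}"
    using xy xN by (auto simp: fun_eq_iff lf_def add_edge_def c_def min.commute)
  define rest where "rest = Cond (And (Less (Const 0) (Read ''J'' (Reg ''x''))) (Less (Reg ''x'') (Read ''K'' (Reg ''y''))))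
       (Assign ''i'' (Reg ''y'') ;;
        Assign ''t'' (Plus (Reg ''x'') (Const (Suc 0))) ;;
        Assign ''s'' (Reg ''x'') ;;
        rekey) Skip ;;
     insert_queue"
  have rest: "wp w rest (\<lambda>s' t. Post s' (t + 10 * lt + 7)) s2"
    if d2: "ds X ?h ?k0 ?I {} s2" and r2: "reg s2 ''x'' = x" "reg s2 ''y'' = y" and sm: "same loop_regs turn_arrs s s2" for s2
  proof -
    have J2: "0 < arr s2 ''J'' x \<longleftrightarrow> x \<in> ?I" and K2: "arr s2 ''K'' y = ?k0 y"
      using d2 xy xN outp_member[of X ?I s2 x] by (auto simp: ds_def keys_def)
    have fin: "110 * lt * (1 + B x + \<Sigma>) + 40 * lt * (1 + B x) + 10 * lt + 40 \<le> 200 * lt * (1 + B x + \<Sigma>)"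
      using lt by (simp add: algebra_simps)
    show ?thesis
    proof (cases "x \<in> ?I \<and> x < ?k0 y")
      case False
      have iq: "wp w insert_queue (\<lambda>s' t. ds X ?h (key ?h) (members ?h) {} s' \<and> same loop_regs turn_arrs s2 s' \<and>
        t \<le> 110 * lt * (1 + B x + \<Sigma>)) s2"
        unfolding lt_def \<Sigma>_def
        by (rule insert_queue_correct[OF g xy(1,2) r2(2) B refl]) (use d2 False in auto)
      show ?thesis
        unfolding rest_def
        using False
        apply (simp add: r2 J2 K2)
        apply (rule conjI, blast)
        apply (rule wp_mono[OF iq])
        unfolding Post_def using fin lt sm by (auto simp: same_def)
    next
      case True
      let ?s3 = "set_reg ''s'' x (set_reg ''t'' (Suc x) (set_reg ''i'' y s2))"
      define D where "D = nbs ?h ?k0 y (x + 1)"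
      have fD: "finite D" by (rule finite_subset[of _ "{..N}"]) (auto simp: D_def nbs_def dest: graph_le[OF h])
      have best: "x = Min (insert (reg ?s3 ''s'') {z \<in> D. 0 < arr ?s3 ''J'' z \<and> ?k0 z = z})"
      proof (rule Min_eqI[symmetric])
        show "finite (insert (reg ?s3 ''s'') {z \<in> D. 0 < arr ?s3 ''J'' z \<and> ?k0 z = z})" using fD by simp
      qed (auto simp: D_def nbs_def)
      have cD: "card D \<le> B x"
        unfolding D_def using True by (intro card_insert_nbs[OF g xy(1,2) _ B(2) h]) simp
      have d3: "ds X ?h ?k0 ?I {} ?s3" using d2 by simp
      have rk: "wp w rekey (\<lambda>s' t. ds X ?h (?k0(y := x)) ?I {} s' \<and>
        same {''a'', ''b'', ''c'', ''e'', ''f'', ''g'', ''j'', ''l'', ''s''} {''T'', ''F'', ''K''} ?s3 s' \<and>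
        t \<le> 40 * (lg + 2) * (1 + card D)) ?s3"
      proof -
        have i: "reg ?s3 ''i'' = y" "reg ?s3 ''t'' = x + 1" "reg ?s3 ''s'' = x" by simp_all
        have k0: "\<And>z. ?k0 z \<le> z" by (rule key_le)
        show ?thesis
          apply (rule wp_mono[OF rekey_correct[where s = ?s3 and h = ?h and k = ?k0 and Q = "{}" and D = D and best = x]])
          using d3 k0 h best xy xN True D_def unfolding ds_def i apply simp_all[12]
          subgoal for s' t
            using d3 by (auto simp: ds_def env_def same_def outp_cong[of s' ?s3])
          done
      qed
      show ?thesis
        unfolding rest_def
        using True
        apply (simp add: r2 J2 K2 km)
        apply (rule wp_SeqI[OF rk])
        apply (elim conjE)
        subgoal for s4 t4
        proof -
          assume a: "ds X ?h (?k0(y := x)) ?I {} s4"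
            "same {''a'', ''b'', ''c'', ''e'', ''f'', ''g'', ''j'', ''l'', ''s''} {''T'', ''F'', ''K''} ?s3 s4"
            "t4 \<le> 40 * (lg + 2) * (1 + card D)"
          have r4: "reg s4 ''y'' = y" using a r2 by (simp add: same_def)
          have iq: "wp w insert_queue (\<lambda>s' t. ds X ?h (key ?h) (members ?h) {} s' \<and> same loop_regs turn_arrs s4 s' \<and>
            t \<le> 110 * lt * (1 + B x + \<Sigma>)) s4"
            unfolding lt_def \<Sigma>_def
            by (rule insert_queue_correct[OF g xy(1,2) r4 B refl]) (use a(1) True in simp)
          have "t4 \<le> 40 * lt * (1 + B x)"
            using a(3) cD unfolding lt_def[symmetric] by (meson add_left_mono le_trans mult_le_mono2)
          then show ?thesis
            apply -
            apply (rule wp_mono[OF iq])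
            unfolding Post_def using fin lt sm a(2) by (auto simp: same_def)
        qed
        done
    qed
  qed
  have main: "wp w (tset ;; Assign ''a'' (Reg ''y'') ;; Assign ''b'' (Reg ''x'') ;; tset ;; rest)
     (\<lambda>s' t. Post s' (t + 5)) ?s1"
    apply (rule wp_SeqI[OF tset_correct[of ?s1 "lf h0 ?k0 {}"]])
    using d1 apply (simp add: ds_def)
    using d1 apply (simp add: ds_def)
    using xN apply simp
    using xy apply (simp add: P_gt)
    subgoal for s2 t2
    proof -
      assume a2: "same {''e'', ''f'', ''g''} {''T''} ?s1 s2 \<and>
        tree ((lf h0 ?k0 {})(reg ?s1 ''a'' := (lf h0 ?k0 {} (reg ?s1 ''a''))(reg ?s1 ''b'' := reg ?s1 ''c''))) s2 \<and> t2 \<le> 5 * (lg + 2)"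
      have r2: "reg s2 ''x'' = x" "reg s2 ''y'' = y" "reg s2 ''c'' = c" using a2 xy by (auto simp: same_def)
      have e2: "env s2" using a2 d by (simp add: ds_def env_def same_def)
      let ?s3 = "set_reg ''b'' x (set_reg ''a'' y s2)"
      show ?thesis
        apply (simp add: r2)
        apply (rule wp_SeqI[OF tset_correct[of ?s3 ?L1]])
        using e2 apply simp
        using a2 apply simp
        using xy apply simp
        using xN apply (simp add: P_gt)
        subgoal for s4 t4
        proof -
          assume a4: "same {''e'', ''f'', ''g''} {''T''} ?s3 s4 \<and>
            tree (?L1(reg ?s3 ''a'' := (?L1 (reg ?s3 ''a''))(reg ?s3 ''b'' := reg ?s3 ''c''))) s4 \<and> t4 \<le> 5 * (lg + 2)"
          have tr: "tree (lf ?h ?k0 {}) s4" using a4 by (simp add: r2 L2[symmetric])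
          have "outp X ?I s4" using d a4 a2 by (subst outp_cong[of s4 s]) (simp_all add: ds_def same_def)
          moreover have "env s4" using e2 a4 by (simp add: env_def same_def)
          moreover have "keys ?k0 s4" using d a2 a4 by (simp add: ds_def keys_def same_def)
          ultimately have d4: "ds X ?h ?k0 ?I {} s4" using tr by (simp add: ds_def)
          have r4: "reg s4 ''x'' = x" "reg s4 ''y'' = y" using a4 r2 by (auto simp: same_def)
          have sm4: "same loop_regs turn_arrs s s4" using a2 a4 by (simp add: same_def)
          show ?thesis
            apply (rule wp_mono[OF rest[OF d4 r4 sm4]])
            unfolding Post_def using a2 a4 unfolding lt_def[symmetric] by auto
        qed
        done
    qed
    done
  have "wp w insert_sorted Post s"
  proof (cases "?k0 x < ?k0 y")
    case True
    then have c: "c = Suc (?k0 x)" by (simp add: c_def)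
    show ?thesis
      unfolding insert_sorted_def rest_def[symmetric]
      using True
      apply (simp add: xy K km)
      apply (rule wp_mono[OF main[unfolded c]])
      by (simp add: Post_def)
  next
    case False
    then have c: "c = Suc (?k0 y)" by (simp add: c_def)
    show ?thesis
      unfolding insert_sorted_def rest_def[symmetric]
      using False
      apply (simp add: xy K km)
      apply (rule wp_mono[OF main[unfolded c]])
      by (simp add: Post_def)
  qed
  then show ?thesis unfolding Post_def lt_def \<Sigma>_def .
qed

lemma add_edge_commute: "add_edge h x y = add_edge h y x"
  by (auto simp: add_edge_def fun_eq_iff)

lemma insert_edge_correct:
  assumes g: "graph h0" and xy: "reg s ''x'' = x" "reg s ''y'' = y" "x \<le> N" "y \<le> N" "x \<noteq> y"
    and B: "rgood h0 B" "rgood (add_edge h0 x y) B"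
    and d: "ds X h0 (key h0) (members h0) {} s"
  shows "wp w insert_edge (\<lambda>s' t. ds X (add_edge h0 x y) (key (add_edge h0 x y)) (members (add_edge h0 x y)) {} s' \<and>
     same insert_regs turn_arrs s s' \<and>
     t \<le> 200 * (lg + 2) * (1 + B (min x y) + (\<Sum>v\<in>rflips h0 (add_edge h0 x y). 2 * (1 + B v)\<^sup>2))) s"
proof (cases "y < x")
  case True
  let ?s1 = "set_reg ''y'' x (set_reg ''x'' y (set_reg ''d'' x s))"
  have m: "min x y = y" using True by simp
  have i: "wp w insert_sorted (\<lambda>s' t. ds X (add_edge h0 y x) (key (add_edge h0 y x)) (members (add_edge h0 y x)) {} s' \<and>
     same loop_regs turn_arrs ?s1 s' \<and>
     t + 10 \<le> 200 * (lg + 2) * (1 + B y + (\<Sum>v\<in>rflips h0 (add_edge h0 y x). 2 * (1 + B v)\<^sup>2))) ?s1"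
    by (rule insert_sorted_correct[OF g True xy(3) _ _ B(1) B(2)[unfolded add_edge_commute[of h0 x y]]]) (use d in simp_all)
  show ?thesis
    unfolding insert_edge_def m add_edge_commute[of h0 x y]
    using True
    apply (simp add: xy)
    apply (rule wp_mono[OF i])
    by (auto simp: same_def)
next
  case False
  then have lt: "x < y" and m: "min x y = x" using xy by auto
  show ?thesis
    unfolding insert_edge_def m
    using False
    apply (simp add: xy)
    apply (rule wp_mono[OF insert_sorted_correct[OF g lt xy(4) xy(1,2) B d]])
    by (auto simp: same_def)
qed

end

section \<open>Random orders\<close>

text \<open>An element that does not occur gets the length of the list and so comes after all
  others.\<close>

definition rk :: "'a list \<Rightarrow> 'a \<Rightarrow> nat" where
  "rk q v = length (takeWhile (\<lambda>x. x \<noteq> v) q)"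

lemma rk_nth: "distinct q \<Longrightarrow> i < length q \<Longrightarrow> rk q (q ! i) = i"
proof -
  assume d: "distinct q" and i: "i < length q"
  have "takeWhile (\<lambda>x. x \<noteq> q ! i) q = take i q"
    using d i by (intro takeWhile_eq_take_P_nth) (auto simp: nth_eq_iff_index_eq)
  then show ?thesis using i by (simp add: rk_def)
qed

lemma rk_less: "v \<in> set q \<Longrightarrow> rk q v < length q"
  by (induction q) (auto simp: rk_def)

lemma rk_notin: "v \<notin> set q \<Longrightarrow> rk q v = length q"
  by (induction q) (auto simp: rk_def)

lemma nth_rk: "v \<in> set q \<Longrightarrow> q ! rk q v = v"
  by (induction q) (auto simp: rk_def)

lemma rk_inj: "distinct q \<Longrightarrow> inj_on (rk q) (set q)"
  by (rule inj_onI) (metis nth_rk)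

lemma rk_map: "inj f \<Longrightarrow> rk (map f q) (f v) = rk q v"
  unfolding rk_def by (simp add: takeWhile_map comp_def inj_eq)

lemma rk_Cons: "rk (a # q) v = (if a = v then 0 else Suc (rk q v))"
  by (simp add: rk_def)

lemma in_set_take_rk: "distinct q \<Longrightarrow> v \<in> set (take i q) \<longleftrightarrow> v \<in> set q \<and> rk q v < i"
proof
  assume "distinct q" "v \<in> set (take i q)"
  then show "v \<in> set q \<and> rk q v < i"
    by (auto simp: in_set_conv_nth rk_nth dest: in_set_takeD)
next
  assume "distinct q" "v \<in> set q \<and> rk q v < i"
  then show "v \<in> set (take i q)"
    using rk_less[of v q] nth_rk[of v q] by (metis in_set_conv_nth length_take min_less_iff_conj nth_take)
qed

subsection \<open>The live graph is sparse\<close>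

text \<open>Greedy selection as a recursion from the front with the current set as an argument.
  Fixing the first element of a permutation leaves an instance of the same form, which is what the
  induction in \<open>crowded_count\<close> needs.\<close>

primrec grow :: "('a \<Rightarrow> 'a \<Rightarrow> bool) \<Rightarrow> 'a set \<Rightarrow> 'a list \<Rightarrow> nat \<Rightarrow> 'a set" where
  "grow h A q 0 = A"
| "grow h A q (Suc i) = (case q of [] \<Rightarrow> A | x # q' \<Rightarrow> grow h (if \<exists>a\<in>A. h a x then A else insert x A) q' i)"

lemma grow_mono: "A \<subseteq> grow h A q i"
proof (induction i arbitrary: A q)
  case (Suc i)
  show ?case
  proof (cases q)
    case (Cons x q')
    have "A \<subseteq> (if \<exists>a\<in>A. h a x then A else insert x A)" by auto
    also have "\<dots> \<subseteq> grow h (if \<exists>a\<in>A. h a x then A else insert x A) q' i" by (rule Suc.IH)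
    finally show ?thesis by (simp add: Cons)
  qed simp
qed simp

text \<open>Unrolls the recursion at its other end, where it matches the recursion of
  \<open>mis\<close>.\<close>

lemma grow_Suc:
  "i < length q \<Longrightarrow> grow h A q (Suc i) =
     (if \<exists>a\<in>grow h A q i. h a (q ! i) then grow h A q i else insert (q ! i) (grow h A q i))"
proof (induction i arbitrary: A q)
  case 0
  then show ?case by (cases q) auto
next
  case (Suc i)
  then obtain x q' where q: "q = x # q'" by (cases q) auto
  show ?case using Suc.IH[of q'] Suc.prems unfolding q by (subst grow.simps(2)) simp
qed

lemma grow_mis:
  assumes q: "distinct q" and i: "i \<le> length q"
  shows "grow h {} q i = {v \<in> set (take i q). mis h (rk q) v}"
  using i
proof (induction i)
  case (Suc i)
  then have i: "i < length q" and IH: "grow h {} q i = {v \<in> set (take i q). mis h (rk q) v}" by simp_all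
  have r: "rk q (q ! i) = i" using q i by (simp add: rk_nth)
  have t: "set (take (Suc i) q) = insert (q ! i) (set (take i q))" using i by (simp add: take_Suc_conv_app_nth)
  have nt: "q ! i \<notin> set (take i q)" using in_set_take_rk[OF q] r by simp
  have "mis h (rk q) (q ! i) \<longleftrightarrow> \<not> (\<exists>a\<in>grow h {} q i. h a (q ! i))"
  proof -
    have "mis h (rk q) (q ! i) \<longleftrightarrow> (\<forall>u. rk q u < i \<longrightarrow> h u (q ! i) \<longrightarrow> \<not> mis h (rk q) u)"
      by (subst mis_iff) (simp add: r)
    also have "\<dots> \<longleftrightarrow> \<not> (\<exists>a\<in>grow h {} q i. h a (q ! i))"
    proof -
      have "rk q u < i \<longleftrightarrow> u \<in> set (take i q)" for u
        using in_set_take_rk[OF q, of u i] i rk_notin[of u q] by (cases "u \<in> set q") auto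
      then show ?thesis unfolding IH by auto
    qed
    finally show ?thesis .
  qed
  then show ?case unfolding grow_Suc[OF i] IH t using nt by (auto simp: IH)
qed simp

definition crowded :: "('a \<Rightarrow> 'a \<Rightarrow> bool) \<Rightarrow> 'a \<Rightarrow> nat \<Rightarrow> 'a set \<Rightarrow> 'a list \<Rightarrow> nat \<Rightarrow> bool" where
  "crowded h w d A q i \<longleftrightarrow> (\<forall>a\<in>grow h A q i. \<not> h a w) \<and>
     d \<le> card {z \<in> set (drop i q). h w z \<and> (\<forall>a\<in>grow h A q i. \<not> h a z)}"

text \<open>The permutation is exposed element by element. As long as \<open>w\<close> has to stay
  undominated, the next element cannot be an undominated neighbour of \<open>w\<close>, which would
  be selected; and at least \<open>d\<close> such neighbours are still there at the end, hence at
  all earlier times. So at most \<open>m - d\<close> of \<open>m\<close> choices survive a round,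
  and \<open>(m - d) / m \<le> (n - d) / n\<close> as \<open>m \<le> n\<close>. Both sides are
  multiplied out to remain in the natural numbers.\<close>

lemma crowded_count:
  assumes sym: "\<And>u v. h u v \<Longrightarrow> h v u" and V: "finite V" "card V \<le> n" and d: "d \<le> n"
  shows "card {q \<in> permutations_of_set V. crowded h w d A q i} * n ^ i \<le> fact (card V) * (n - d) ^ i"
  using V
proof (induction i arbitrary: A V)
  case 0
  have "card {q \<in> permutations_of_set V. crowded h w d A q 0} \<le> card (permutations_of_set V)"
    using 0 by (intro card_mono) auto
  then show ?case using 0 by simp
next
  case (Suc i)
  let ?C = "\<lambda>A V i. {q \<in> permutations_of_set V. crowded h w d A q i}"
  define L where "L = {z \<in> V. h w z \<and> (\<forall>a\<in>A. \<not> h a z)}"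
  have finL: "finite L" "L \<subseteq> V" using Suc.prems by (auto simp: L_def)
  show ?case
  proof (cases "?C A V (Suc i) = {}")
    case True
    then show ?thesis by (simp only: True card.empty)
  next
    case False
    have sub: "crowded h w d A q (Suc i) \<Longrightarrow> set q = V \<Longrightarrow> d \<le> card L" for q
    proof -
      assume c: "crowded h w d A q (Suc i)" and q: "set q = V"
      have "{z \<in> set (drop (Suc i) q). h w z \<and> (\<forall>a\<in>grow h A q (Suc i). \<not> h a z)} \<subseteq> L"
        using grow_mono[of A h q "Suc i"] q by (auto simp: L_def dest: in_set_dropD)
      then show "d \<le> card L" using c card_mono[OF finL(1)] unfolding crowded_def by (meson le_trans)
    qed
    from False obtain q0 where "q0 \<in> permutations_of_set V" "crowded h w d A q0 (Suc i)" by blast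
    then have dL: "d \<le> card L" using sub by (auto simp: permutations_of_set_def)
    have Vne: "card L \<le> card V" using finL Suc.prems by (intro card_mono) auto
    let ?A = "\<lambda>x. if \<exists>a\<in>A. h a x then A else insert x A"
    have eq: "?C A V (Suc i) \<subseteq> (\<Union>x\<in>V - L. (#) x ` ?C (?A x) (V - {x}) i) \<union> (if V = {} then {[]} else {})"
    proof
      fix q assume q: "q \<in> ?C A V (Suc i)"
      show "q \<in> (\<Union>x\<in>V - L. (#) x ` ?C (?A x) (V - {x}) i) \<union> (if V = {} then {[]} else {})"
      proof (cases q)
        case Nil
        then show ?thesis using q by (auto simp: permutations_of_set_def)
      next
        case (Cons x q')
        have x: "x \<in> V" "q' \<in> permutations_of_set (V - {x})"
          using q by (auto simp: Cons permutations_of_set_def)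
        have c: "crowded h w d (?A x) q' i" using q by (simp add: Cons crowded_def)
        \<comment> \<open>An element of \<open>L\<close> at the front would be selected and dominate
          \<open>w\<close> for good, as the set only grows.\<close>
        have "x \<notin> L"
        proof
          assume xL: "x \<in> L"
          then have "?A x = insert x A" "h w x" by (auto simp: L_def)
          then have "x \<in> grow h (?A x) q' i" "h x w" using grow_mono[of "?A x" h q' i] sym by auto
          then show False using c by (auto simp: crowded_def)
        qed
        moreover have "q \<in> (#) x ` ?C (?A x) (V - {x}) i" using x c Cons by blast
        ultimately show ?thesis using x by (intro UnI1 UN_I[of x]) auto
      qed
    qed
    show ?thesis
    proof (cases "V = {}")
      case True
      then have "d = 0" using dL finL by simp
      have "card (?C A V (Suc i)) \<le> card (permutations_of_set V)" by (intro card_mono) (auto simp: True)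
      then show ?thesis using \<open>d = 0\<close> True by simp
    next
      case False
      define m where "m = card V"
      have m: "0 < m" "m \<le> n" "d \<le> m" using False Suc.prems dL Vne by (auto simp: m_def card_gt_0_iff)
      have fP: "finite (permutations_of_set W)" if "finite W" for W :: "'a set" using that by simp
      have "card (?C A V (Suc i)) \<le> card (\<Union>x\<in>V - L. (#) x ` ?C (?A x) (V - {x}) i)"
        using eq False Suc.prems by (intro card_mono) auto
      also have "\<dots> \<le> (\<Sum>x\<in>V - L. card ((#) x ` ?C (?A x) (V - {x}) i))"
        using Suc.prems by (intro card_UN_le) simp
      also have "\<dots> = (\<Sum>x\<in>V - L. card (?C (?A x) (V - {x}) i))"
        by (intro sum.cong card_image) auto
      finally have "card (?C A V (Suc i)) * n ^ i \<le> (\<Sum>x\<in>V - L. card (?C (?A x) (V - {x}) i)) * n ^ i"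
        by (rule mult_le_mono1)
      also have "\<dots> = (\<Sum>x\<in>V - L. card (?C (?A x) (V - {x}) i) * n ^ i)"
        by (rule sum_distrib_right)
      also have "\<dots> \<le> (\<Sum>x\<in>V - L. fact (m - 1) * (n - d) ^ i)"
      proof (intro sum_mono)
        fix x assume x: "x \<in> V - L"
        then have c: "card (V - {x}) = m - 1" using Suc.prems by (simp add: m_def)
        then show "card (?C (?A x) (V - {x}) i) * n ^ i \<le> fact (m - 1) * (n - d) ^ i"
          using Suc.IH[of "V - {x}" "?A x"] Suc.prems m by simp
      qed
      also have "\<dots> = (m - card L) * (fact (m - 1) * (n - d) ^ i)"
        using finL Suc.prems by (simp add: card_Diff_subset m_def)
      also have "\<dots> \<le> (m - d) * (fact (m - 1) * (n - d) ^ i)" using dL by (intro mult_le_mono1) simp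
      finally have 1: "card (?C A V (Suc i)) * n ^ i * n \<le> (m - d) * (fact (m - 1) * (n - d) ^ i) * n"
        by (rule mult_le_mono1)
      have "(m - d) * n \<le> m * (n - d)"
        using m by (simp add: diff_mult_distrib diff_mult_distrib2 diff_le_mono2 mult.commute)
      then have "(m - d) * n * (fact (m - 1) * (n - d) ^ i) \<le> m * (n - d) * (fact (m - 1) * (n - d) ^ i)"
        by (rule mult_le_mono1)
      moreover have "m * fact (m - 1) = fact m" using m(1) by (cases m) simp_all
      then have "m * (n - d) * (fact (m - 1) * (n - d) ^ i) = fact m * (n - d) ^ Suc i"
        by (metis (no_types, lifting) mult.assoc mult.left_commute power_Suc)
      moreover have "(m - d) * (fact (m - 1) * (n - d) ^ i) * n = (m - d) * n * (fact (m - 1) * (n - d) ^ i)"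
        by (simp only: ac_simps)
      ultimately have "(m - d) * (fact (m - 1) * (n - d) ^ i) * n \<le> fact m * (n - d) ^ Suc i"
        by linarith
      with 1 have "card (?C A V (Suc i)) * n ^ i * n \<le> fact m * (n - d) ^ Suc i" by (rule le_trans)
      then show ?thesis by (simp add: m_def mult.assoc mult.commute)
    qed
  qed
qed

subsection \<open>Few vertices change\<close>

definition sgraph :: "'a set \<Rightarrow> ('a \<Rightarrow> 'a \<Rightarrow> bool) \<Rightarrow> bool" where
  "sgraph V h \<longleftrightarrow> (\<forall>u v. h u v \<longrightarrow> u \<in> V \<and> v \<in> V \<and> u \<noteq> v \<and> h v u)"

lemma sgraphD: "sgraph V h \<Longrightarrow> h u v \<Longrightarrow> u \<in> V \<and> v \<in> V \<and> u \<noteq> v"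
  and sgraph_sym: "sgraph V h \<Longrightarrow> h u v \<Longrightarrow> h v u"
  unfolding sgraph_def by blast+

text \<open>The way to identify a greedy set: any predicate that satisfies the recursion is the
  greedy set.\<close>

lemma mis_unique:
  assumes "\<And>v. M v \<longleftrightarrow> (\<forall>u. r u < r v \<longrightarrow> h u v \<longrightarrow> \<not> M u)"
  shows "mis h r v = M v"
proof (induction "r v" arbitrary: v rule: less_induct)
  case less
  then show ?case by (subst mis_iff, subst assms) blast
qed

lemma mis_indep:
  assumes h: "sgraph V h" and r: "inj_on r V" and "h u v" "mis h r u" "mis h r v"
  shows False
proof -
  have "r u \<noteq> r v" using sgraphD[OF h assms(3)] r by (auto dest: inj_onD)
  then consider "r u < r v" | "r v < r u" by linarith
  then show False
    using assms(3-5) sgraph_sym[OF h assms(3)] by cases (metis mis_iff)+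
qed

text \<open>A set remains greedy under another order as soon as each non-member keeps some dominator
  in front of it. For the members independence suffices, which does not refer to the order.\<close>

lemma mis_reorder:
  assumes h: "sgraph V h" and r: "inj_on r V" and r': "inj_on r' V"
    and dom: "\<And>v. \<not> mis h r v \<Longrightarrow> \<exists>u. h u v \<and> mis h r u \<and> r' u < r' v"
  shows "mis h r' v = mis h r v"
proof (rule mis_unique)
  fix v
  show "mis h r v \<longleftrightarrow> (\<forall>u. r' u < r' v \<longrightarrow> h u v \<longrightarrow> \<not> mis h r u)"
    using dom[of v] mis_indep[OF h r] by blast
qed

definition del :: "('a \<Rightarrow> 'a \<Rightarrow> bool) \<Rightarrow> 'a \<Rightarrow> 'a \<Rightarrow> 'a \<Rightarrow> bool" where
  "del h y u v \<longleftrightarrow> h u v \<and> u \<noteq> y \<and> v \<noteq> y"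

text \<open>All other ranks are raised by 1 so that \<open>y\<close> is alone at rank 0 and is
  selected unconditionally.\<close>

definition front :: "'a \<Rightarrow> ('a \<Rightarrow> nat) \<Rightarrow> 'a \<Rightarrow> nat" where
  "front y r v = (if v = y then 0 else Suc (r v))"

text \<open>
  The vertices whose status depends on whether \<open>y\<close> is forced into the greedy set or deleted.  This set does not
  depend on the rank of \<open>y\<close>, whereas an insertion can only expel \<open>y\<close> if \<open>y\<close> is the first vertex of the set.
\<close>

definition influence :: "('a \<Rightarrow> 'a \<Rightarrow> bool) \<Rightarrow> ('a \<Rightarrow> nat) \<Rightarrow> 'a \<Rightarrow> 'a set" where
  "influence h r y = {z. z = y \<or> mis (del h y) r z \<noteq> mis h (front y r) z}"

lemma sgraph_del: "sgraph V h \<Longrightarrow> sgraph V (del h y)"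
  unfolding sgraph_def del_def by blast

lemma inj_front: "inj_on r V \<Longrightarrow> inj_on (front y r) V"
  by (auto simp: inj_on_def front_def)

lemma mis_front_self: "mis h (front y r) y"
  by (subst mis_iff) (simp add: front_def)

lemma influence_subset:
  assumes h: "sgraph V h" and y: "y \<in> V"
  shows "influence h r y \<subseteq> V"
proof
  fix z assume z: "z \<in> influence h r y"
  show "z \<in> V"
  proof (rule ccontr)
    assume n: "z \<notin> V"
    then have "mis (del h y) r z" "mis h (front y r) z"
      by (subst mis_iff, use sgraphD[OF h] in \<open>auto simp: del_def\<close>)+
    then show False using z n y by (auto simp: influence_def)
  qed
qed

text \<open>If \<open>x\<close> and \<open>y\<close> are not both members, the old set still
  satisfies the recursion for the new graph. Otherwise \<open>y\<close> is expelled: the old set is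
  the one with \<open>y\<close> forced in, the new one the one with \<open>y\<close> deleted, and
  they differ in the influence set. Ranks before \<open>y\<close> do not notice its deletion, so
  \<open>y\<close> comes first in this set.\<close>

lemma flips_influence:
  assumes h: "sgraph V h" and r: "inj_on r V" and xy: "x \<in> V" "y \<in> V" "r x < r y"
    and ne: "flips h (add_edge h x y) r \<noteq> {}"
  shows "flips h (add_edge h x y) r = influence h r y" "\<And>z. z \<in> influence h r y \<Longrightarrow> r y \<le> r z"
proof -
  let ?h = "add_edge h x y"
  have both: "mis h r x \<and> mis h r y"
  proof (rule ccontr)
    assume n: "\<not> (mis h r x \<and> mis h r y)"
    have "mis ?h r v = mis h r v" for v
    proof (rule mis_unique)
      fix v
      have "mis h r v \<longleftrightarrow> (\<forall>u. r u < r v \<longrightarrow> h u v \<longrightarrow> \<not> mis h r u)" by (rule mis_iff)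
      also have "\<dots> \<longleftrightarrow> (\<forall>u. r u < r v \<longrightarrow> ?h u v \<longrightarrow> \<not> mis h r u)"
      proof (cases "v = y \<and> mis h r x")
        case True
        then have "\<not> mis h r v" using n by simp
        then show ?thesis by (subst (asm) mis_iff) (auto simp: add_edge_def)
      next
        case False
        then show ?thesis using xy(3) by (auto simp: add_edge_def)
      qed
      finally show "mis h r v \<longleftrightarrow> (\<forall>u. r u < r v \<longrightarrow> ?h u v \<longrightarrow> \<not> mis h r u)" .
    qed
    then show False using ne by (simp add: flips_def)
  qed
  have pre: "mis (del h y) r z = mis h r z" if "r z < r y" for z
    using that
  proof (induction "r z" arbitrary: z rule: less_induct)
    case less
    then have "del h y u z = h u z" if "r u < r z" for u using that by (auto simp: del_def)
    then show ?case using less by (subst (1 2) mis_iff) (metis less_trans)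
  qed
  have new: "mis ?h r z \<longleftrightarrow> z \<noteq> y \<and> mis (del h y) r z" for z
  proof (rule mis_unique)
    fix v
    show "(v \<noteq> y \<and> mis (del h y) r v) \<longleftrightarrow> (\<forall>u. r u < r v \<longrightarrow> ?h u v \<longrightarrow> \<not> (u \<noteq> y \<and> mis (del h y) r u))"
    proof (cases "v = y")
      case True
      have "?h x y" "x \<noteq> y" "mis (del h y) r x" using xy pre both by (auto simp: add_edge_def)
      then show ?thesis using True xy(3) by blast
    next
      case False
      have "mis (del h y) r v \<longleftrightarrow> (\<forall>u. r u < r v \<longrightarrow> del h y u v \<longrightarrow> \<not> mis (del h y) r u)" by (rule mis_iff)
      then show ?thesis using False by (auto simp: del_def add_edge_def)
    qed
  qed
  have old: "mis h (front y r) z = mis h r z" for z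
  proof (rule mis_unique)
    fix v
    show "mis h r v \<longleftrightarrow> (\<forall>u. front y r u < front y r v \<longrightarrow> h u v \<longrightarrow> \<not> mis h r u)"
    proof (cases "v = y")
      case True
      then show ?thesis using both by (simp add: front_def)
    next
      case False
      have 1: "mis h r v \<Longrightarrow> h u v \<Longrightarrow> mis h r u \<Longrightarrow> False" for u
        using mis_indep[OF h r] by blast
      have 2: "\<not> mis h r v \<Longrightarrow> \<exists>u. r u < r v \<and> h u v \<and> mis h r u" by (subst (asm) mis_iff) blast
      show ?thesis using 1 2 False by (auto simp: front_def)
    qed
  qed
  show "flips h ?h r = influence h r y"
    unfolding flips_def influence_def new old using both by auto
  show "r y \<le> r z" if "z \<in> influence h r y" for z
  proof (rule ccontr)
    assume "\<not> r y \<le> r z"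
    then have "r z < r y" by simp
    then show False using that pre[of z] unfolding influence_def old by auto
  qed
qed

text \<open>The rank of \<open>y\<close> enters neither greedy set, since \<open>y\<close> is
  deleted or forced to the front; so the exchange only moves \<open>d\<close> forward. This can do
  harm only if \<open>d\<close> is outside one of the sets and its dominator there comes after
  \<open>y\<close>. But then \<open>d\<close> is in the other set, so that dominator is not, hence
  it belongs to the influence set and precedes \<open>y\<close> by \<open>gap\<close>.\<close>

lemma influence_swap:
  assumes h: "sgraph V h" and r: "inj_on r V" and yd: "y \<in> V" "d \<in> influence h r y" "r y < r d" "r d \<le> \<theta>"
    and gap: "\<And>z. z \<in> influence h r y \<Longrightarrow> r z < r d \<Longrightarrow> r z \<le> r y"
  shows "influence h (\<lambda>z. r (Transposition.transpose y d z)) y = influence h r y"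
proof -
  let ?r = "\<lambda>z. r (Transposition.transpose y d z)"
  have dV: "d \<in> V" using influence_subset[OF h yd(1)] yd(2) by blast
  have tV: "Transposition.transpose y d z \<in> V \<longleftrightarrow> z \<in> V" for z using dV yd(1) by (auto simp: Transposition.transpose_def)
  have r': "inj_on ?r V"
    using r tV by (intro inj_onI) (metis inj_onD transpose_eq_iff)
  have dy: "d \<noteq> y" using yd by auto
  have rd: "?r y = r d" "?r d = r y" "\<And>z. z \<noteq> y \<Longrightarrow> z \<noteq> d \<Longrightarrow> ?r z = r z" by auto
  have near: "r u < r y" if "u \<in> influence h r y" "u \<noteq> y" "r u < r d" for u
  proof -
    have "r u \<le> r y" using gap that by blast
    moreover have "r u \<noteq> r y" using r that influence_subset[OF h yd(1)] yd(1) by (auto dest: inj_onD)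
    ultimately show ?thesis by simp
  qed
  have out: "mis (del h y) ?r v = mis (del h y) r v" for v
  proof (rule mis_reorder[OF sgraph_del[OF h] r r'])
    fix v assume "\<not> mis (del h y) r v"
    then obtain u where u: "r u < r v" "del h y u v" "mis (del h y) r u" by (subst (asm) mis_iff) blast
    then have uv: "u \<noteq> y" "v \<noteq> y" "h u v" by (auto simp: del_def)
    have "?r u < ?r v"
    proof (cases "v = d")
      case True
      then have "mis h (front y r) d" using yd(2) dy \<open>\<not> mis (del h y) r v\<close> by (auto simp: influence_def)
      then have "\<not> mis h (front y r) u" using mis_indep[OF h inj_front[OF r], of u d] uv True by blast
      then have "u \<in> influence h r y" using u by (simp add: influence_def)
      then have "r u < r y" using near u uv True by blast
      moreover have "u \<noteq> d" using True u by auto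
      ultimately show ?thesis using True uv rd by simp
    next
      case False
      then show ?thesis using u uv rd yd(3) by (cases "u = d") auto
    qed
    then show "\<exists>u. del h y u v \<and> mis (del h y) r u \<and> ?r u < ?r v" using u by blast
  qed
  \<comment> \<open>The same argument with the two greedy sets exchanged.\<close>
  have inn: "mis h (front y ?r) v = mis h (front y r) v" for v
  proof (rule mis_reorder[OF h inj_front[OF r] inj_front[OF r']])
    fix v assume n: "\<not> mis h (front y r) v"
    then have vy: "v \<noteq> y" using mis_front_self by metis
    from n obtain u where u: "front y r u < front y r v" "h u v" "mis h (front y r) u" by (subst (asm) mis_iff) blast
    have "front y ?r u < front y ?r v"
    proof (cases "u = y")
      case True
      then show ?thesis using vy by (simp add: front_def)
    next
      case uy: False
      then have ruv: "r u < r v" using u(1) vy by (simp add: front_def)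
      have "?r u < ?r v"
      proof (cases "v = d")
        case True
        then have "mis (del h y) r d" using yd(2) dy n by (auto simp: influence_def)
        moreover have "del h y u d" using u uy True dy by (simp add: del_def)
        ultimately have "\<not> mis (del h y) r u" using mis_indep[OF sgraph_del[OF h] r, of y u d] by blast
        then have "u \<in> influence h r y" using u by (simp add: influence_def)
        then have "r u < r y" using near ruv uy True by blast
        moreover have "u \<noteq> d" using True ruv by auto
        ultimately show ?thesis using True uy rd by simp
      next
        case False
        then show ?thesis using ruv uy vy rd yd(3) by (cases "u = d") auto
      qed
      then show ?thesis using uy vy by (simp add: front_def)
    qed
    then show "\<exists>u. h u v \<and> mis h (front y r) u \<and> front y ?r u < front y ?r v" using u by blast
  qed
  show ?thesis unfolding influence_def out inn ..
qed

section \<open>Counting orders by the position of a vertex in its influence set\<close>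

locale random_order =
  fixes a :: 'a and A :: "'a set" and h :: "'a \<Rightarrow> 'a \<Rightarrow> bool"
  assumes fin: "finite A" and a: "a \<notin> A" and h: "sgraph (insert a A) h"
begin

abbreviation \<Omega> :: "'a list set" where "\<Omega> \<equiv> permutations_of_set A"

text \<open>The root \<open>a\<close> has rank 0 in every order. The probability space consists of
  the permutations of the other vertices, and expectations are written as sums over it.\<close>

abbreviation R :: "'a list \<Rightarrow> 'a \<Rightarrow> nat" where "R p \<equiv> rk (a # p)"

lemma Omega: "p \<in> \<Omega> \<Longrightarrow> distinct (a # p)" "p \<in> \<Omega> \<Longrightarrow> set (a # p) = insert a A" "finite \<Omega>"
  using a fin finite_permutations_of_set[of A] by (auto simp: permutations_of_set_def)

lemma R_inj: "p \<in> \<Omega> \<Longrightarrow> inj_on (R p) (insert a A)"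
  using rk_inj[OF Omega(1)] Omega(2) by metis

lemma R_eq: "p \<in> \<Omega> \<Longrightarrow> u \<in> insert a A \<Longrightarrow> v \<in> insert a A \<Longrightarrow> R p u = R p v \<Longrightarrow> u = v"
  using R_inj by (meson inj_onD)

lemma R_swap:
  assumes "y \<in> A" "d \<in> A"
  shows "R (map (Transposition.transpose y d) p) z = R p (Transposition.transpose y d z)"
proof -
  have "Transposition.transpose y d a = a" using assms a by (auto simp: Transposition.transpose_def)
  then have "a # map (Transposition.transpose y d) p = map (Transposition.transpose y d) (a # p)" by simp
  then have "R (map (Transposition.transpose y d) p) (Transposition.transpose y d (Transposition.transpose y d z)) = R p (Transposition.transpose y d z)"
    by (simp only: rk_map[OF inj_transpose])
  then show ?thesis by simp
qed

lemma map_swap_Omega: "p \<in> \<Omega> \<Longrightarrow> y \<in> A \<Longrightarrow> d \<in> A \<Longrightarrow> map (Transposition.transpose y d) p \<in> \<Omega>"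
  by (auto simp: permutations_of_set_def distinct_map transpose_image_eq intro: inj_on_subset[OF inj_transpose])

definition infl :: "nat \<Rightarrow> 'a \<Rightarrow> 'a list \<Rightarrow> 'a set" where
  "infl \<theta> y p = {z \<in> influence h (R p) y. R p z \<le> \<theta>}"

definition pos :: "nat \<Rightarrow> 'a \<Rightarrow> 'a list \<Rightarrow> nat" where
  "pos \<theta> y p = card {z \<in> infl \<theta> y p. R p z < R p y}"

definition both :: "nat \<Rightarrow> 'a \<Rightarrow> 'a \<Rightarrow> 'a list set" where
  "both \<theta> x y = {p \<in> \<Omega>. R p x \<le> \<theta> \<and> R p y \<le> \<theta>}"

definition nxt :: "nat \<Rightarrow> 'a \<Rightarrow> 'a list \<Rightarrow> 'a" where
  "nxt \<theta> y p = arg_min (R p) (\<lambda>z. z \<in> infl \<theta> y p \<and> R p y < R p z)"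

text \<open>Exchanging \<open>y\<close> with its successor in the influence set moves
  \<open>y\<close> one place further inside that set while the set itself stays the same.\<close>

definition shift :: "nat \<Rightarrow> 'a \<Rightarrow> 'a list \<Rightarrow> 'a list" where
  "shift \<theta> y p = map (Transposition.transpose y (nxt \<theta> y p)) p"

lemma infl_subset: "y \<in> A \<Longrightarrow> infl \<theta> y p \<subseteq> insert a A"
  using influence_subset[OF h, of y] by (auto simp: infl_def)

lemma finite_infl: "y \<in> A \<Longrightarrow> finite (infl \<theta> y p)"
  using finite_subset[OF infl_subset] fin by auto

lemma nxt:
  assumes p: "p \<in> both \<theta> x y" and y: "y \<in> A" and less: "Suc (pos \<theta> y p) < card (infl \<theta> y p)"
  shows "nxt \<theta> y p \<in> infl \<theta> y p" "R p y < R p (nxt \<theta> y p)"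
    "\<And>z. z \<in> infl \<theta> y p \<Longrightarrow> R p z < R p (nxt \<theta> y p) \<Longrightarrow> R p z \<le> R p y"
proof -
  have "\<exists>z. z \<in> infl \<theta> y p \<and> R p y < R p z"
  proof (rule ccontr)
    assume n: "\<not> ?thesis"
    have "infl \<theta> y p \<subseteq> insert y {z \<in> infl \<theta> y p. R p z < R p y}"
    proof
      fix z assume z: "z \<in> infl \<theta> y p"
      then have "R p z \<le> R p y" using n by force
      moreover have "R p z = R p y \<Longrightarrow> z = y"
        using R_eq[of p z y] p y subsetD[OF infl_subset[OF y] z] by (simp add: both_def)
      ultimately show "z \<in> insert y {z \<in> infl \<theta> y p. R p z < R p y}" using z by force
    qed
    then have "card (infl \<theta> y p) \<le> card (insert y {z \<in> infl \<theta> y p. R p z < R p y})"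
      using finite_infl[OF y] by (intro card_mono) auto
    also have "\<dots> \<le> Suc (pos \<theta> y p)" unfolding pos_def using finite_infl[OF y] by (simp add: card_insert_if)
    finally show False using less by simp
  qed
  then obtain z0 where z0: "z0 \<in> infl \<theta> y p \<and> R p y < R p z0" by blast
  have *: "nxt \<theta> y p \<in> infl \<theta> y p \<and> R p y < R p (nxt \<theta> y p)"
    unfolding nxt_def by (rule arg_min_natI[of "\<lambda>z. z \<in> infl \<theta> y p \<and> R p y < R p z", OF z0])
  then show "nxt \<theta> y p \<in> infl \<theta> y p" "R p y < R p (nxt \<theta> y p)" by auto
  show "R p z \<le> R p y" if "z \<in> infl \<theta> y p" "R p z < R p (nxt \<theta> y p)" for z
    using arg_min_nat_le[of "\<lambda>z. z \<in> infl \<theta> y p \<and> R p y < R p z" z "R p"] that unfolding nxt_def[symmetric] by force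
qed

text \<open>Both exchanged ranks are at most \<open>\<theta>\<close>, so no vertex crosses this
  threshold. Membership in \<open>both\<close> is therefore preserved even if the exchanged vertex
  is \<open>x\<close>.\<close>

lemma shift:
  assumes p: "p \<in> both \<theta> x y" and y: "y \<in> A" and less: "Suc (pos \<theta> y p) < card (infl \<theta> y p)"
  shows "shift \<theta> y p \<in> both \<theta> x y" "infl \<theta> y (shift \<theta> y p) = infl \<theta> y p" "pos \<theta> y (shift \<theta> y p) = Suc (pos \<theta> y p)"
    "R (shift \<theta> y p) y = R p (nxt \<theta> y p)" "R (shift \<theta> y p) (nxt \<theta> y p) = R p y"
    "\<And>z. z \<noteq> y \<Longrightarrow> z \<noteq> nxt \<theta> y p \<Longrightarrow> R (shift \<theta> y p) z = R p z"
proof -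
  define d where "d = nxt \<theta> y p"
  note N = nxt[OF p y less, folded d_def]
  have pO: "p \<in> \<Omega>" and px: "R p x \<le> \<theta>" "R p y \<le> \<theta>" using p by (auto simp: both_def)
  have "R p a = 0" by (simp add: rk_Cons)
  then have dA: "d \<in> A" using N infl_subset[OF y, of \<theta> p] by (cases "d = a") auto
  have Rs: "R (shift \<theta> y p) z = R p (Transposition.transpose y d z)" for z
    unfolding shift_def d_def[symmetric] by (rule R_swap[OF y dA])
  have Rf: "R (shift \<theta> y p) = (\<lambda>z. R p (Transposition.transpose y d z))" using Rs by blast
  show Rsw: "R (shift \<theta> y p) y = R p (nxt \<theta> y p)" "R (shift \<theta> y p) (nxt \<theta> y p) = R p y"
    "\<And>z. z \<noteq> y \<Longrightarrow> z \<noteq> nxt \<theta> y p \<Longrightarrow> R (shift \<theta> y p) z = R p z"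
    unfolding Rs d_def[symmetric] by auto
  note Rsw = Rsw[folded d_def]
  have d\<theta>: "R p d \<le> \<theta>" using N(1) by (simp add: infl_def)
  have le: "R (shift \<theta> y p) z \<le> \<theta> \<longleftrightarrow> R p z \<le> \<theta>" for z
    using Rsw d\<theta> px by (cases "z = y"; cases "z = d"; simp)
  show "shift \<theta> y p \<in> both \<theta> x y"
    using map_swap_Omega[OF pO y dA] px unfolding both_def shift_def d_def[symmetric]
    by (simp add: le[unfolded shift_def d_def[symmetric]])
  have "influence h (R (shift \<theta> y p)) y = influence h (R p) y"
    unfolding Rf
  proof (rule influence_swap[OF h R_inj[OF pO] _ _ N(2) d\<theta>])
    show "y \<in> insert a A" using y by simp
    show "d \<in> influence h (R p) y" using N(1) by (simp add: infl_def)
    show "R p z \<le> R p y" if "z \<in> influence h (R p) y" "R p z < R p d" for z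
      using N(3)[of z] that d\<theta> by (simp add: infl_def)
  qed
  then show I: "infl \<theta> y (shift \<theta> y p) = infl \<theta> y p" unfolding infl_def le by simp
  have "{z \<in> infl \<theta> y p. R (shift \<theta> y p) z < R (shift \<theta> y p) y} = insert d {z \<in> infl \<theta> y p. R p z < R p y}"
  proof (intro set_eqI iffI)
    fix z assume z: "z \<in> {z \<in> infl \<theta> y p. R (shift \<theta> y p) z < R (shift \<theta> y p) y}"
    show "z \<in> insert d {z \<in> infl \<theta> y p. R p z < R p y}"
    proof (cases "z = d")
      case False
      then have zy: "z \<noteq> y" using z by auto
      then have "R p z < R p d" using z False Rsw by simp
      then have "R p z \<le> R p y" using N(3) z by blast
      moreover have "R p z \<noteq> R p y"
        using R_eq[OF pO, of z y] y zy z subsetD[OF infl_subset[OF y], of z \<theta> p] by auto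
      ultimately show ?thesis using z by simp
    qed simp
  next
    fix z assume "z \<in> insert d {z \<in> infl \<theta> y p. R p z < R p y}"
    then show "z \<in> {z \<in> infl \<theta> y p. R (shift \<theta> y p) z < R (shift \<theta> y p) y}"
      using N Rsw by (cases "z = d"; cases "z = y"; auto)
  qed
  then show "pos \<theta> y (shift \<theta> y p) = Suc (pos \<theta> y p)"
    unfolding pos_def I using finite_infl[OF y] N(2) by simp
qed

text \<open>The exchanged vertex can be read off the result: it is the last vertex of the influence
  set before \<open>y\<close>. Applying the transposition again recovers the argument.\<close>

lemma shift_inj:
  assumes p: "p \<in> both \<theta> x y" "Suc (pos \<theta> y p) < card (infl \<theta> y p)"
    and p': "p' \<in> both \<theta> x y" "Suc (pos \<theta> y p') < card (infl \<theta> y p')"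
    and y: "y \<in> A" and eq: "shift \<theta> y p = shift \<theta> y p'"
  shows "p = p'"
proof -
  let ?q = "shift \<theta> y p"
  have last: "nxt \<theta> y p \<in> infl \<theta> y (shift \<theta> y p) \<and> R (shift \<theta> y p) (nxt \<theta> y p) < R (shift \<theta> y p) y \<and>
      (\<forall>z\<in>infl \<theta> y (shift \<theta> y p). R (shift \<theta> y p) z < R (shift \<theta> y p) y \<longrightarrow>
         R (shift \<theta> y p) z \<le> R (shift \<theta> y p) (nxt \<theta> y p))"
    if p: "p \<in> both \<theta> x y" "Suc (pos \<theta> y p) < card (infl \<theta> y p)" for p
  proof -
    note S = shift[OF p(1) y p(2)] and N = nxt[OF p(1) y p(2)]
    show ?thesis
      unfolding S(2)
    proof (intro conjI ballI impI)
      show "nxt \<theta> y p \<in> infl \<theta> y p" by (rule N(1))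
      show "R (shift \<theta> y p) (nxt \<theta> y p) < R (shift \<theta> y p) y" using N(2) S(4,5) by simp
      fix z assume z: "z \<in> infl \<theta> y p" "R (shift \<theta> y p) z < R (shift \<theta> y p) y"
      then show "R (shift \<theta> y p) z \<le> R (shift \<theta> y p) (nxt \<theta> y p)"
        using N(3)[of z] S(4,5) S(6)[of z] by (cases "z = nxt \<theta> y p"; cases "z = y"; simp)
    qed
  qed
  note l = last[OF p] and l' = last[OF p', folded eq]
  have "R ?q (nxt \<theta> y p) = R ?q (nxt \<theta> y p')" using l l' by (meson antisym)
  moreover have "?q \<in> \<Omega>" using shift(1)[OF p(1) y p(2)] by (simp add: both_def)
  ultimately have "nxt \<theta> y p = nxt \<theta> y p'"
    using R_inj l l' infl_subset[OF y] by (meson inj_onD subsetD)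
  then have "map (Transposition.transpose y (nxt \<theta> y p)) ?q = p" "map (Transposition.transpose y (nxt \<theta> y p)) ?q = p'"
    unfolding shift_def using eq[unfolded shift_def] by (simp_all add: comp_def)
  then show ?thesis by simp
qed

text \<open>An order with \<open>y\<close> first in an influence set of size \<open>s\<close> starts
  a chain of \<open>s\<close> orders under \<open>shift\<close>, one for each position of
  \<open>y\<close>. The position tells the place in the chain and \<open>shift\<close> is injective,
  so different chains are disjoint. In other words, \<open>y\<close> is first with chance at most
  \<open>1 / s\<close>, which cancels the size \<open>s\<close>.\<close>

lemma sum_first_influence:
  assumes y: "y \<in> A"
  shows "(\<Sum>p | p \<in> both \<theta> x y \<and> pos \<theta> y p = 0. card (infl \<theta> y p)) \<le> card (both \<theta> x y)"
proof -
  let ?P = "{p \<in> both \<theta> x y. pos \<theta> y p = 0}"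
  have finB: "finite (both \<theta> x y)" using Omega(3) by (simp add: both_def)
  have it: "(shift \<theta> y ^^ j) p \<in> both \<theta> x y \<and> infl \<theta> y ((shift \<theta> y ^^ j) p) = infl \<theta> y p \<and> pos \<theta> y ((shift \<theta> y ^^ j) p) = j"
    if "p \<in> ?P" "j < card (infl \<theta> y p)" for p j
    using that(2)
  proof (induction j)
    case 0
    then show ?case using that by simp
  next
    case (Suc j)
    then have IH: "(shift \<theta> y ^^ j) p \<in> both \<theta> x y" "infl \<theta> y ((shift \<theta> y ^^ j) p) = infl \<theta> y p" "pos \<theta> y ((shift \<theta> y ^^ j) p) = j"
      by auto
    show ?case using shift(1,2,3)[OF IH(1) y] IH(2,3) Suc.prems by simp
  qed
  have injs: "p = p'" if "p \<in> ?P" "p' \<in> ?P" "j < card (infl \<theta> y p)" "j < card (infl \<theta> y p')"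
    "(shift \<theta> y ^^ j) p = (shift \<theta> y ^^ j) p'" for p p' j
    using that(3-5)
  proof (induction j)
    case (Suc j)
    have j: "j < card (infl \<theta> y p)" "j < card (infl \<theta> y p')" using Suc.prems(1,2) by simp_all
    note I = it[OF that(1) j(1)] and I' = it[OF that(2) j(2)]
    have "(shift \<theta> y ^^ j) p = (shift \<theta> y ^^ j) p'"
    proof (rule shift_inj[OF _ _ _ _ y])
      show "(shift \<theta> y ^^ j) p \<in> both \<theta> x y" "(shift \<theta> y ^^ j) p' \<in> both \<theta> x y" using I I' by auto
      show "Suc (pos \<theta> y ((shift \<theta> y ^^ j) p)) < card (infl \<theta> y ((shift \<theta> y ^^ j) p))"
        "Suc (pos \<theta> y ((shift \<theta> y ^^ j) p')) < card (infl \<theta> y ((shift \<theta> y ^^ j) p'))"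
        using I I' Suc.prems(1,2) by auto
      show "shift \<theta> y ((shift \<theta> y ^^ j) p) = shift \<theta> y ((shift \<theta> y ^^ j) p')" using Suc.prems(3) by simp
    qed
    then show ?case using Suc.IH j by blast
  qed simp
  have "(\<Sum>p\<in>?P. card (infl \<theta> y p)) = card (SIGMA p:?P. {..<card (infl \<theta> y p)})"
    using finB by (subst card_SigmaI) auto
  also have "\<dots> \<le> card (both \<theta> x y)"
  proof (rule card_inj_on_le[of "\<lambda>(p, j). (shift \<theta> y ^^ j) p"])
    show "inj_on (\<lambda>(p, j). (shift \<theta> y ^^ j) p) (SIGMA p:?P. {..<card (infl \<theta> y p)})"
    proof (rule inj_onI)
      fix u v assume a: "u \<in> (SIGMA p:?P. {..<card (infl \<theta> y p)})" "v \<in> (SIGMA p:?P. {..<card (infl \<theta> y p)})"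
        "(case u of (p, j) \<Rightarrow> (shift \<theta> y ^^ j) p) = (case v of (p, j) \<Rightarrow> (shift \<theta> y ^^ j) p)"
      obtain p j p' j' where uv: "u = (p, j)" "v = (p', j')" by (cases u, cases v)
      have p: "p \<in> ?P" "j < card (infl \<theta> y p)" "p' \<in> ?P" "j' < card (infl \<theta> y p')"
        and e: "(shift \<theta> y ^^ j) p = (shift \<theta> y ^^ j') p'"
        using a uv by auto
      have "j = j'" using it[OF p(1,2)] it[OF p(3,4)] e by simp
      then have "p = p'" using injs[OF p(1,3,2), of] p(4) e by simp
      then show "u = v" using uv \<open>j = j'\<close> by simp
    qed
    show "(\<lambda>(p, j). (shift \<theta> y ^^ j) p) ` (SIGMA p:?P. {..<card (infl \<theta> y p)}) \<subseteq> both \<theta> x y"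
      using it by auto
  qed (rule finB)
  finally show ?thesis by simp
qed

text \<open>If some change has rank at most \<open>\<theta>\<close>, then so has \<open>y\<close>,
  which comes first in its influence set, and so has \<open>x\<close>, which precedes
  \<open>y\<close>. Such an order is counted by \<open>sum_first_influence\<close>.\<close>

lemma sum_flips:
  assumes y: "y \<in> A" and x: "x \<in> insert a A"
  shows "(\<Sum>p | p \<in> \<Omega> \<and> R p x < R p y. card {z \<in> flips h (add_edge h x y) (R p). R p z \<le> \<theta>}) \<le> card (both \<theta> x y)"
proof -
  let ?f = "\<lambda>p. card {z \<in> flips h (add_edge h x y) (R p). R p z \<le> \<theta>}"
  let ?P = "{p \<in> both \<theta> x y. pos \<theta> y p = 0}"
  let ?S = "{p \<in> \<Omega>. R p x < R p y}"
  have fl: "p \<in> ?P \<and> ?f p = card (infl \<theta> y p)" if p: "p \<in> ?S" "?f p \<noteq> 0" for p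
  proof -
    have "flips h (add_edge h x y) (R p) \<noteq> {}" using p(2) by auto
    note F = flips_influence[OF h R_inj _ _ _ this]
    have F1: "flips h (add_edge h x y) (R p) = influence h (R p) y" using F(1) p x y by auto
    have F2: "R p y \<le> R p z" if "z \<in> influence h (R p) y" for z using F(2) p x y that by auto
    have e: "?f p = card (infl \<theta> y p)" unfolding F1 infl_def ..
    then have "infl \<theta> y p \<noteq> {}" using p(2) by auto
    then obtain z where "z \<in> infl \<theta> y p" by blast
    then have "R p y \<le> \<theta>" using F2[of z] by (auto simp: infl_def)
    moreover have "{z \<in> infl \<theta> y p. R p z < R p y} = {}" using F2 by (fastforce simp: infl_def)
    then have "pos \<theta> y p = 0" unfolding pos_def by (simp only: card.empty)
    ultimately show ?thesis using p(1) e by (auto simp: both_def)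
  qed
  have "(\<Sum>p\<in>?S. ?f p) = (\<Sum>p\<in>{p \<in> ?S. ?f p \<noteq> 0}. ?f p)"
    using Omega(3) by (intro sum.mono_neutral_right) auto
  also have "\<dots> = (\<Sum>p\<in>{p \<in> ?S. ?f p \<noteq> 0}. card (infl \<theta> y p))"
    using fl by (intro sum.cong) auto
  also have "\<dots> \<le> (\<Sum>p\<in>?P. card (infl \<theta> y p))"
    using fl Omega(3) by (intro sum_mono2) (auto simp: both_def)
  also have "\<dots> \<le> card (both \<theta> x y)" using sum_first_influence[OF y] by simp
  finally show ?thesis by simp
qed

end

subsection \<open>The expected cost of an insertion\<close>

text \<open>The single logarithmic factor of the estimates: it bounds the harmonic numbers, and
  \<open>n / \<kappa>\<close> times it bounds \<open>1 + sparse_bound n \<kappa>\<close> for ranks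
  from 1 to \<open>n\<close>.\<close>

definition qlog :: "nat \<Rightarrow> real" where
  "qlog n = 1 + 20 * ln (real n + 1)"

text \<open>The factor 20 makes the failure probability at most \<open>1 / (n + 1) ^ 10\<close> for
  each vertex and level, see \<open>crowded_rare\<close>. At level 0 nothing has been selected yet,
  and the trivial degree bound is used.\<close>

definition sparse_bound :: "nat \<Rightarrow> nat \<Rightarrow> nat" where
  "sparse_bound n \<kappa> = (if \<kappa> = 0 then n else nat \<lfloor>20 * ln (real n + 1) * real n / real \<kappa>\<rfloor>)"

lemma qlog_ge: "1 \<le> qlog n"
  by (simp add: qlog_def)

lemma harm_le_qlog: "harm n \<le> qlog n"
proof (cases "n = 0")
  case False
  obtain m where m: "n = Suc m" using False by (cases n) auto
  have "harm n \<le> ln (real n) + 1" using decseqD[OF decseq_harm_diff_ln, of 0 m] by (simp add: m harm_def)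
  also have "\<dots> \<le> qlog n"
  proof -
    have "ln (real n) \<le> ln (real n + 1)" "0 \<le> ln (real n + 1)" using False by simp_all
    then show ?thesis unfolding qlog_def by linarith
  qed
  finally show ?thesis .
qed (simp add: qlog_def harm_def)

lemma sparse_bound_le:
  assumes "1 \<le> i" "i \<le> n"
  shows "1 + real (sparse_bound n i) \<le> real n / real i * qlog n"
proof -
  have "real (sparse_bound n i) \<le> 20 * ln (real n + 1) * real n / real i"
    using assms by (simp add: sparse_bound_def)
  moreover have "1 \<le> real n / real i" using assms by simp
  ultimately show ?thesis by (simp add: qlog_def algebra_simps)
qed

text \<open>Telescoping, as \<open>1 / m\<^sup>2\<close> exceeds \<open>1 / (m + 1)\<^sup>2\<close>
  by at most \<open>2 / m ^ 3\<close>.\<close>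

lemma inverse_square_sum:
  assumes "1 \<le> i" "i \<le> n"
  shows "1 / (real i)\<^sup>2 \<le> (\<Sum>\<theta>\<in>{i..<n}. 2 / real \<theta> ^ 3) + 1 / (real n)\<^sup>2"
  using assms(2)
proof (induction rule: dec_induct)
  case (step m)
  have m: "1 \<le> m" using step assms by simp
  have "1 / (real m)\<^sup>2 \<le> 2 / real m ^ 3 + 1 / (real (Suc m))\<^sup>2"
  proof -
    have p: "0 < real m" using m by simp
    have "1 / (real m)\<^sup>2 - 1 / (real m + 1)\<^sup>2 = (2 * real m + 1) / ((real m)\<^sup>2 * (real m + 1)\<^sup>2)"
    proof -
      have "real m + 1 \<noteq> 0" using p by linarith
      then have "1 / (real m)\<^sup>2 - 1 / (real m + 1)\<^sup>2 = ((real m + 1)\<^sup>2 - (real m)\<^sup>2) / ((real m)\<^sup>2 * (real m + 1)\<^sup>2)"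
        using diff_frac_eq[of "(real m)\<^sup>2" "(real m + 1)\<^sup>2" 1 1] p by simp
      also have "(real m + 1)\<^sup>2 - (real m)\<^sup>2 = 2 * real m + 1" by (simp add: power2_eq_square algebra_simps)
      finally show ?thesis .
    qed
    also have "\<dots> \<le> (2 * (real m + 1)\<^sup>2 / real m) / ((real m)\<^sup>2 * (real m + 1)\<^sup>2)"
      using p by (intro divide_right_mono) (auto simp: field_simps power2_eq_square)
    also have "\<dots> = 2 / real m ^ 3"
    proof -
      have e: "(2 * Y\<^sup>2 / X) / (X\<^sup>2 * Y\<^sup>2) = 2 / X ^ 3" if "X \<noteq> 0" "Y \<noteq> 0" for X Y :: real
        using that by (simp add: power2_eq_square power3_eq_cube)
      show ?thesis by (rule e) (use p in linarith)+
    qed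
    finally show ?thesis by (simp add: add.commute)
  qed
  then show ?case using step by simp
qed simp

lemma inverse_sum:
  assumes "1 \<le> i" "i \<le> n"
  shows "1 / real i \<le> (\<Sum>\<theta>\<in>{i..<n}. 1 / (real \<theta>)\<^sup>2) + 1 / real n"
  using assms(2)
proof (induction rule: dec_induct)
  case (step m)
  have m: "1 \<le> m" using step assms by simp
  have "1 / real m \<le> 1 / (real m)\<^sup>2 + 1 / real (Suc m)"
  proof -
    have "1 / real m - 1 / (real m + 1) = 1 / (real m * (real m + 1))" using m by (simp add: field_simps)
    also have "\<dots> \<le> 1 / (real m)\<^sup>2" using m by (intro divide_left_mono) (auto simp: power2_eq_square)
    finally show ?thesis by (simp add: add.commute)
  qed
  then show ?case using step by simp
qed simp

text \<open>Abel summation. A decreasing weight of the rank is split into increments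
  \<open>e\<close>, and the sum over vertices becomes a sum over thresholds of the number of
  vertices up to the threshold, which is the quantity that \<open>sum_flips\<close>
  controls.\<close>

lemma sum_by_parts:
  fixes g :: "nat \<Rightarrow> real" and e :: "nat \<Rightarrow> real"
  assumes g: "\<And>i. 1 \<le> i \<Longrightarrow> i \<le> n \<Longrightarrow> g i \<le> (\<Sum>\<theta>\<in>{i..<n}. e \<theta>) + g n" and e: "\<And>\<theta>. 0 \<le> e \<theta>"
    and S: "finite S" "\<And>u. u \<in> S \<Longrightarrow> 1 \<le> r u \<and> r u \<le> n"
  shows "(\<Sum>u\<in>S. g (r u)) \<le> (\<Sum>\<theta>\<in>{1..<n}. e \<theta> * card {u \<in> S. r u \<le> \<theta>}) + g n * card {u \<in> S. r u \<le> n}"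
proof -
  have "(\<Sum>u\<in>S. g (r u)) \<le> (\<Sum>u\<in>S. (\<Sum>\<theta>\<in>{1..<n}. if r u \<le> \<theta> then e \<theta> else 0) + g n)"
  proof (intro sum_mono)
    fix u assume u: "u \<in> S"
    have "(\<Sum>\<theta>\<in>{r u..<n}. e \<theta>) = (\<Sum>\<theta>\<in>{1..<n}. if r u \<le> \<theta> then e \<theta> else 0)"
      using S(2)[OF u] by (intro sum.mono_neutral_cong_left) auto
    then show "g (r u) \<le> (\<Sum>\<theta>\<in>{1..<n}. if r u \<le> \<theta> then e \<theta> else 0) + g n"
      using g[of "r u"] S(2)[OF u] by simp
  qed
  also have "\<dots> = (\<Sum>\<theta>\<in>{1..<n}. \<Sum>u\<in>S. if r u \<le> \<theta> then e \<theta> else 0) + g n * card S"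
    by (simp add: sum.distrib) (rule sum.swap)
  also have "(\<lambda>\<theta>. \<Sum>u\<in>S. if r u \<le> \<theta> then e \<theta> else 0) = (\<lambda>\<theta>. e \<theta> * card {u \<in> S. r u \<le> \<theta>})"
    using S(1) by (auto simp: sum.If_cases Int_def mult.commute)
  finally have "(\<Sum>u\<in>S. g (r u)) \<le> (\<Sum>\<theta>\<in>{1..<n}. e \<theta> * card {u \<in> S. r u \<le> \<theta>}) + g n * card S" .
  moreover have "{u \<in> S. r u \<le> n} = S" using S(2) by auto
  ultimately show ?thesis by (simp only:)
qed

text \<open>The time of an insertion without the factor \<open>200 * (lg + 2)\<close>: the bracket
  of \<open>insert_edge_correct\<close>, with vertices and their ranks in place of ranks.\<close>

definition icost :: "(nat \<Rightarrow> nat) \<Rightarrow> ('a \<Rightarrow> 'a \<Rightarrow> bool) \<Rightarrow> ('a \<Rightarrow> nat) \<Rightarrow> 'a \<Rightarrow> 'a \<Rightarrow> nat" where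
  "icost B h r x y = 1 + B (min (r x) (r y)) + (\<Sum>v\<in>flips h (add_edge h x y) r. 2 * (1 + B (r v))\<^sup>2)"

context random_order
begin

abbreviation n :: nat where "n \<equiv> card A"

lemma R_bounds: "p \<in> \<Omega> \<Longrightarrow> y \<in> A \<Longrightarrow> 1 \<le> R p y \<and> R p y \<le> n"
proof -
  assume p: "p \<in> \<Omega>" and y: "y \<in> A"
  have "length p = n" using p fin by (simp add: length_finite_permutations_of_set)
  moreover have "y \<in> set p" using p y by (simp add: permutations_of_set_def)
  ultimately show ?thesis using rk_less[of y p] y a by (auto simp: rk_Cons)
qed

lemma R_a [simp]: "R p a = 0"
  by (simp add: rk_Cons)

definition single :: "nat \<Rightarrow> 'a \<Rightarrow> 'a list set" where
  "single \<theta> y = {p \<in> \<Omega>. R p y \<le> \<theta>}"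

lemma card_low:
  assumes p: "p \<in> \<Omega>"
  shows "card {y \<in> A. R p y \<le> \<theta>} \<le> \<theta>"
proof -
  have "card {y \<in> A. R p y \<le> \<theta>} = card (R p ` {y \<in> A. R p y \<le> \<theta>})"
    using R_inj[OF p] by (intro card_image[symmetric]) (auto intro: inj_on_subset)
  also have "\<dots> \<le> card {1..\<theta>}" using R_bounds[OF p] by (intro card_mono) auto
  finally show ?thesis by simp
qed

lemma sum_card_swap:
  assumes "finite P" "finite B"
  shows "(\<Sum>y\<in>B. card {p \<in> P. T p y}) = (\<Sum>p\<in>P. card {y \<in> B. T p y})"
proof -
  have "(\<Sum>y\<in>B. card {p \<in> P. T p y}) = (\<Sum>y\<in>B. \<Sum>p\<in>P. if T p y then 1 else 0)"
    using assms by (intro sum.cong) (auto simp: sum.If_cases Int_def)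
  also have "\<dots> = (\<Sum>p\<in>P. \<Sum>y\<in>B. if T p y then 1 else 0)" by (rule sum.swap)
  also have "\<dots> = (\<Sum>p\<in>P. card {y \<in> B. T p y})"
    using assms by (intro sum.cong) (auto simp: sum.If_cases Int_def)
  finally show ?thesis .
qed

lemma card_transfer:
  assumes yd: "y \<in> A" "d \<in> A" and T: "\<And>p. p \<in> \<Omega> \<Longrightarrow> T p \<Longrightarrow> T' (map (Transposition.transpose y d) p)"
  shows "card {p \<in> \<Omega>. T p} \<le> card {p \<in> \<Omega>. T' p}"
proof (rule card_inj_on_le[of "map (Transposition.transpose y d)"])
  show "inj_on (map (Transposition.transpose y d)) {p \<in> \<Omega>. T p}"
    using inj_mapI[OF inj_transpose] by (rule inj_on_subset) simp
  show "map (Transposition.transpose y d) ` {p \<in> \<Omega>. T p} \<subseteq> {p \<in> \<Omega>. T' p}"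
    using T map_swap_Omega yd by auto
qed (use Omega(3) in simp)

text \<open>By transpositions every vertex of \<open>A\<close> has rank at most
  \<open>\<theta>\<close> in the same number of orders, and a single order gives such a rank to at
  most \<open>\<theta>\<close> of them.\<close>

lemma card_single:
  assumes y: "y \<in> A"
  shows "n * card (single \<theta> y) \<le> \<theta> * fact n"
proof -
  have "card (single \<theta> y) \<le> card (single \<theta> y')" if "y' \<in> A" for y'
    unfolding single_def by (rule card_transfer[OF y that]) (simp add: R_swap y that)
  then have "n * card (single \<theta> y) \<le> (\<Sum>y'\<in>A. card (single \<theta> y'))"
    using sum_mono[of A "\<lambda>_. card (single \<theta> y)"] by simp
  also have "\<dots> = (\<Sum>p\<in>\<Omega>. card {y' \<in> A. R p y' \<le> \<theta>})"
    unfolding single_def using Omega(3) fin by (rule sum_card_swap)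
  also have "\<dots> \<le> (\<Sum>p\<in>\<Omega>. \<theta>)" by (intro sum_mono card_low)
  finally show ?thesis using fin by (simp add: mult.commute)
qed

text \<open>The double count of \<open>card_single\<close> over the second vertex only: if
  \<open>x\<close> is low, at most \<open>\<theta> - 1\<close> others are. Replacing the exact
  fraction by the square of \<open>\<theta> / n\<close> uses
  \<open>n * (\<theta> - 1) \<le> (n - 1) * \<theta>\<close>, which needs
  \<open>\<theta> \<le> n\<close>.\<close>

lemma card_both:
  assumes xy: "x \<in> A" "y \<in> A" "x \<noteq> y" and \<theta>: "\<theta> \<le> n"
  shows "n\<^sup>2 * card (both \<theta> x y) \<le> \<theta>\<^sup>2 * fact n"
proof -
  have "card (both \<theta> x y) \<le> card (both \<theta> x y')" if y': "y' \<in> A - {x}" for y'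
    unfolding both_def
  proof (rule card_transfer[OF xy(2)])
    show "y' \<in> A" using y' by simp
    fix p assume "p \<in> \<Omega>" "R p x \<le> \<theta> \<and> R p y \<le> \<theta>"
    moreover have "Transposition.transpose y y' x = x" using xy y' by (intro transpose_apply_other) auto
    ultimately show "R (map (Transposition.transpose y y') p) x \<le> \<theta> \<and> R (map (Transposition.transpose y y') p) y' \<le> \<theta>"
      using xy(2) y' by (simp add: R_swap)
  qed
  then have "(n - 1) * card (both \<theta> x y) \<le> (\<Sum>y'\<in>A - {x}. card (both \<theta> x y'))"
    using sum_mono[of "A - {x}" "\<lambda>_. card (both \<theta> x y)"] xy fin by simp
  also have "\<dots> = (\<Sum>y'\<in>A - {x}. card {p \<in> single \<theta> x. R p y' \<le> \<theta>})"
    unfolding both_def single_def by (intro sum.cong refl arg_cong[where f = card]) auto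
  also have "\<dots> = (\<Sum>p\<in>single \<theta> x. card {y' \<in> A - {x}. R p y' \<le> \<theta>})"
    using Omega(3) fin by (intro sum_card_swap) (auto simp: single_def)
  also have "\<dots> \<le> (\<Sum>p\<in>single \<theta> x. \<theta> - 1)"
  proof (intro sum_mono)
    fix p assume p: "p \<in> single \<theta> x"
    have "{y' \<in> A. R p y' \<le> \<theta>} = insert x {y' \<in> A - {x}. R p y' \<le> \<theta>}"
      using p xy by (auto simp: single_def)
    then have "card {y' \<in> A. R p y' \<le> \<theta>} = Suc (card {y' \<in> A - {x}. R p y' \<le> \<theta>})" using fin by simp
    then show "card {y' \<in> A - {x}. R p y' \<le> \<theta>} \<le> \<theta> - 1"
      using card_low[of p \<theta>] p by (simp add: single_def)
  qed
  finally have 1: "(n - 1) * card (both \<theta> x y) \<le> card (single \<theta> x) * (\<theta> - 1)" by simp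
  have n: "2 \<le> n"
    using card_mono[of A "{x, y}"] fin xy by auto
  have "(n - 1) * (n\<^sup>2 * card (both \<theta> x y)) \<le> n * (n * card (single \<theta> x)) * (\<theta> - 1)"
    using mult_le_mono2[OF 1, of "n\<^sup>2"] by (simp add: power2_eq_square ac_simps)
  also have "\<dots> \<le> n * (\<theta> * fact n) * (\<theta> - 1)"
    using card_single[OF xy(1)] by (intro mult_le_mono1 mult_le_mono2)
  also have "\<dots> = n * (\<theta> - 1) * \<theta> * fact n" by (simp add: ac_simps)
  also have "\<dots> \<le> (n - 1) * \<theta> * \<theta> * fact n"
    using \<theta> n by (intro mult_le_mono1) (auto simp: diff_mult_distrib diff_mult_distrib2 diff_le_mono2)
  finally have "(n - 1) * (n\<^sup>2 * card (both \<theta> x y)) \<le> (n - 1) * (\<theta>\<^sup>2 * fact n)"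
    by (simp add: power2_eq_square ac_simps)
  then show ?thesis using n by simp
qed

lemma card_V: "card (insert a A) = n + 1"
  using a fin by simp

lemma nbrs_le:
  assumes g: "sgraph (insert a A) g"
  shows "card {z. g v z \<and> T z} \<le> n"
proof (cases "v \<in> insert a A")
  case True
  have "{z. g v z \<and> T z} \<subseteq> insert a A - {v}" using sgraphD[OF g] by auto
  then have "card {z. g v z \<and> T z} \<le> card (insert a A - {v})" using fin by (intro card_mono) auto
  then show ?thesis using True card_V fin by (simp only: card_Diff_singleton)
next
  case False
  then have "{z. g v z \<and> T z} = {}" using sgraphD[OF g] by auto
  then show ?thesis by (simp only: card.empty)
qed

text \<open>A violated level is at least 1, because at level 0 the bound is trivial, and at most
  \<open>n\<close>, because a live vertex has at least that rank. The first \<open>\<kappa>\<close>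
  ranks are the root and \<open>\<kappa> - 1\<close> elements of \<open>p\<close>; hence the
  starting set \<open>{a}\<close> and the shifted index.\<close>

lemma bad_crowded:
  assumes p: "p \<in> \<Omega>" and bad: "\<not> good h (R p) (sparse_bound n)"
  shows "\<exists>v\<in>insert a A. \<exists>\<kappa>\<in>{1..n}. crowded h v (Suc (sparse_bound n \<kappa>)) {a} p (\<kappa> - 1)"
proof -
  obtain v \<kappa> where l: "live h (R p) \<kappa> v" and c: "sparse_bound n \<kappa> < card {z. h v z \<and> live h (R p) \<kappa> z}"
    using bad unfolding good_def by (auto simp: not_le)
  have \<kappa>0: "\<kappa> \<noteq> 0" using c nbrs_le[OF h, of v "live h (R p) \<kappa>"] by (auto simp: sparse_bound_def split: if_splits)
  have vV: "v \<in> insert a A"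
  proof (rule ccontr)
    assume "v \<notin> insert a A"
    then have "{z. h v z \<and> live h (R p) \<kappa> z} = {}" using sgraphD[OF h] by auto
    then show False using c by (simp only: card.empty)
  qed
  have \<kappa>n: "\<kappa> \<le> n"
    using l vV R_bounds[OF p, of v] by (cases "v = a") (auto simp: live_def)
  obtain j where j: "\<kappa> = Suc j" using \<kappa>0 by (cases \<kappa>) auto
  have len: "length p = n" using p fin by (simp add: length_finite_permutations_of_set)
  have gr: "grow h {a} p j = {u \<in> set (take \<kappa> (a # p)). mis h (R p) u}"
    using grow_mis[OF Omega(1)[OF p], of \<kappa> h] \<kappa>n len unfolding j by simp
  have low: "R p u < \<kappa>" if "u \<in> set (take \<kappa> (a # p))" for u
    using in_set_take_rk[OF Omega(1)[OF p]] that by blast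
  have sub: "{z. h v z \<and> live h (R p) \<kappa> z} \<subseteq> {z \<in> set (drop j p). h v z \<and> (\<forall>b\<in>grow h {a} p j. \<not> h b z)}"
  proof
    fix z assume z: "z \<in> {z. h v z \<and> live h (R p) \<kappa> z}"
    have zV: "z \<in> set (a # p)" using z sgraphD[OF h] Omega(2)[OF p] by blast
    have "\<kappa> \<le> R p z" using z by (simp add: live_def)
    then have "z \<notin> set (take \<kappa> (a # p))" using low by force
    then have "z \<notin> set (take j p)" "z \<noteq> a" unfolding j by auto
    then have "z \<in> set (drop j p)" using zV by (metis UnE append_take_drop_id set_ConsD set_append)
    then show "z \<in> {z \<in> set (drop j p). h v z \<and> (\<forall>b\<in>grow h {a} p j. \<not> h b z)}"
      using z low unfolding gr by (auto simp: live_def)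
  qed
  have "card {z. h v z \<and> live h (R p) \<kappa> z} \<le> card {z \<in> set (drop j p). h v z \<and> (\<forall>b\<in>grow h {a} p j. \<not> h b z)}"
    using sub by (intro card_mono) auto
  then have "crowded h v (Suc (sparse_bound n \<kappa>)) {a} p (\<kappa> - 1)"
    using c l low unfolding crowded_def gr j by (auto simp: live_def gr[unfolded j])
  then show ?thesis using vV \<kappa>0 \<kappa>n by (intro bexI[of _ v] bexI[of _ \<kappa>]) auto
qed

text \<open>By \<open>crowded_count\<close> the probability is at most
  \<open>(1 - d / n) ^ (\<kappa> - 1)\<close>, hence at most
  \<open>exp (- d * (\<kappa> - 1) / n)\<close>. Estimating \<open>\<kappa> - 1\<close> by
  \<open>\<kappa> / 2\<close> halves the 20 of \<open>sparse_bound\<close>, which gives the exponent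
  10.\<close>

lemma crowded_rare:
  assumes n: "1 \<le> n" and \<kappa>: "\<kappa> \<in> {1..n}"
  shows "real (card {p \<in> \<Omega>. crowded h v (Suc (sparse_bound n \<kappa>)) {a} p (\<kappa> - 1)}) \<le> fact n / (real n + 1) ^ 10"
proof -
  define d where "d = Suc (sparse_bound n \<kappa>)"
  define q where "q = ln (real n + 1)"
  have q: "0 < q" "1 / 2 \<le> q"
  proof -
    have "ln 2 \<le> q" unfolding q_def using n by simp
    then show "0 < q" "1 / 2 \<le> q" using ln2_ge_two_thirds by linarith+
  qed
  have dq: "20 * q * real n / real \<kappa> < real d"
    using \<kappa> by (simp add: d_def sparse_bound_def q_def) linarith
  show ?thesis
  proof (cases "d \<le> n")
    case False
    have e: "{p \<in> \<Omega>. crowded h v d {a} p (\<kappa> - 1)} = {}"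
    proof (rule ccontr)
      assume "{p \<in> \<Omega>. crowded h v d {a} p (\<kappa> - 1)} \<noteq> {}"
      then obtain p where p: "p \<in> \<Omega>" "crowded h v d {a} p (\<kappa> - 1)" by blast
      have "d \<le> card {z \<in> set (drop (\<kappa> - 1) p). h v z \<and> (\<forall>b\<in>grow h {a} p (\<kappa> - 1). \<not> h b z)}"
        using p(2) by (simp add: crowded_def)
      also have "\<dots> \<le> card (set p)" by (intro card_mono) (auto dest: in_set_dropD)
      also have "\<dots> = n" using p(1) by (simp add: permutations_of_set_def)
      finally show False using False by simp
    qed
    show ?thesis unfolding d_def[symmetric] e by simp
  next
    case True
    \<comment> \<open>At level 1 the number \<open>d\<close> would exceed \<open>10 * n\<close>,
      contrary to \<open>d \<le> n\<close>. The estimate of \<open>\<kappa> - 1\<close> by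
      \<open>\<kappa> / 2\<close> needs this case excluded.\<close>
    have \<kappa>2: "2 \<le> \<kappa>"
    proof (rule ccontr)
      assume "\<not> 2 \<le> \<kappa>"
      then have "\<kappa> = 1" using \<kappa> by auto
      then have "20 * q * real n < real d" using dq by simp
      moreover have "10 * real n \<le> 20 * q * real n" using q by (intro mult_right_mono) auto
      ultimately show False using True n by simp
    qed
    define i where "i = \<kappa> - 1"
    define c where "c = card {p \<in> \<Omega>. crowded h v d {a} p i}"
    have "c * n ^ i \<le> fact n * (n - d) ^ i"
      unfolding c_def using sgraph_sym[OF h] fin True by (intro crowded_count) auto
    then have "real c * real n ^ i \<le> fact n * real (n - d) ^ i"
      by (metis (mono_tags, lifting) of_nat_fact of_nat_le_iff of_nat_mult of_nat_power)
    then have "real c \<le> fact n * (real (n - d) / real n) ^ i"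
      using n by (simp add: field_simps power_divide)
    also have "(real (n - d) / real n) ^ i \<le> exp (- (real d / real n)) ^ i"
    proof (intro power_mono)
      have "real (n - d) / real n = 1 - real d / real n" using True n by (simp add: of_nat_diff diff_divide_distrib)
      also have "\<dots> \<le> exp (- (real d / real n))" using exp_ge_add_one_self[of "- (real d / real n)"] by simp
      finally show "real (n - d) / real n \<le> exp (- (real d / real n))" .
    qed simp
    also have "\<dots> = exp (- (real i * (real d / real n)))" by (simp add: exp_of_nat_mult[symmetric])
    also have "\<dots> \<le> exp (- (10 * q))"
    proof -
      have "real \<kappa> \<le> 2 * real i" using \<kappa>2 by (simp add: i_def)
      moreover have "20 * q \<le> real d / real n * real \<kappa>" using dq \<kappa> n by (simp add: field_simps)
      moreover have "real d / real n * real \<kappa> \<le> real d / real n * (2 * real i)"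
        using calculation(1) by (intro mult_left_mono) auto
      ultimately have "20 * q \<le> real d / real n * (2 * real i)" by linarith
      also have "\<dots> = 2 * (real i * (real d / real n))" by simp
      finally have "10 * q \<le> real i * (real d / real n)" by linarith
      then show ?thesis by simp
    qed
    also have "exp (- (10 * q)) = 1 / (real n + 1) ^ 10"
    proof -
      have "exp (10 * q) = exp q ^ 10" using exp_of_nat_mult[of 10 q] by simp
      then show ?thesis by (simp add: exp_minus q_def field_simps)
    qed
    finally show ?thesis unfolding c_def i_def d_def by (simp add: mult_left_mono)
  qed
qed

text \<open>Union bound over the \<open>n + 1\<close> vertices and the \<open>n\<close> levels,
  which costs at most two of the ten powers.\<close>

lemma bad_rare:
  assumes n: "1 \<le> n"
  shows "real (card {p \<in> \<Omega>. \<not> good h (R p) (sparse_bound n)}) \<le> fact n / (real n + 1) ^ 8"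
proof -
  let ?C = "\<lambda>v \<kappa>. {p \<in> \<Omega>. crowded h v (Suc (sparse_bound n \<kappa>)) {a} p (\<kappa> - 1)}"
  have "{p \<in> \<Omega>. \<not> good h (R p) (sparse_bound n)} \<subseteq> (\<Union>v\<in>insert a A. \<Union>\<kappa>\<in>{1..n}. ?C v \<kappa>)"
    using bad_crowded by blast
  then have "card {p \<in> \<Omega>. \<not> good h (R p) (sparse_bound n)} \<le> card (\<Union>v\<in>insert a A. \<Union>\<kappa>\<in>{1..n}. ?C v \<kappa>)"
    using fin Omega(3) by (intro card_mono) auto
  also have "\<dots> \<le> (\<Sum>v\<in>insert a A. card (\<Union>\<kappa>\<in>{1..n}. ?C v \<kappa>))" using fin by (intro card_UN_le) simp
  also have "\<dots> \<le> (\<Sum>v\<in>insert a A. \<Sum>\<kappa>\<in>{1..n}. card (?C v \<kappa>))" by (intro sum_mono card_UN_le) simp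
  finally have "real (card {p \<in> \<Omega>. \<not> good h (R p) (sparse_bound n)}) \<le> (\<Sum>v\<in>insert a A. \<Sum>\<kappa>\<in>{1..n}. real (card (?C v \<kappa>)))"
    by (metis (mono_tags, lifting) of_nat_le_iff of_nat_sum sum.cong)
  also have "\<dots> \<le> (\<Sum>v\<in>insert a A. \<Sum>\<kappa>\<in>{1..n}. fact n / (real n + 1) ^ 10)"
    using n by (intro sum_mono crowded_rare)
  also have "\<dots> = (real n + 1) * real n * (fact n / (real n + 1) ^ 10)"
    using card_V by simp
  also have "\<dots> \<le> (real n + 1) * (real n + 1) * (fact n / (real n + 1) ^ 10)"
    by (intro mult_right_mono mult_left_mono) auto
  also have "\<dots> = fact n / (real n + 1) ^ 8"
  proof -
    define X where "X = real n + 1"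
    have "X \<noteq> 0" by (simp add: X_def)
    moreover have "X ^ 10 = X * X * X ^ 8" by (simp add: power_numeral_reduce)
    ultimately show ?thesis unfolding X_def[symmetric] by simp
  qed
  finally show ?thesis .
qed

text \<open>The time bound of the program requires goodness of both graphs in every order, so the
  rare exceptional orders fall back on the trivial degree bound.\<close>

definition ibound :: "'a \<Rightarrow> 'a \<Rightarrow> 'a list \<Rightarrow> nat \<Rightarrow> nat" where
  "ibound x y p = (if good h (R p) (sparse_bound n) \<and> good (add_edge h x y) (R p) (sparse_bound n)
     then sparse_bound n else (\<lambda>_. n))"

lemma sgraph_add_edge: "x \<in> insert a A \<Longrightarrow> y \<in> insert a A \<Longrightarrow> x \<noteq> y \<Longrightarrow> sgraph (insert a A) (add_edge h x y)"
  using h unfolding sgraph_def add_edge_def by blast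

lemma good_ibound:
  assumes "x \<in> insert a A" "y \<in> insert a A" "x \<noteq> y"
  shows "good h (R p) (ibound x y p)" "good (add_edge h x y) (R p) (ibound x y p)"
proof -
  have "good g (R p) (\<lambda>_. n)" if "sgraph (insert a A) g" for g
    unfolding good_def using nbrs_le[OF that] by blast
  then show "good h (R p) (ibound x y p)" "good (add_edge h x y) (R p) (ibound x y p)"
    using h sgraph_add_edge[OF assms] by (auto simp: ibound_def)
qed

lemma flips_subset:
  assumes p: "p \<in> \<Omega>" and xy: "x \<in> insert a A" "y \<in> insert a A" "x \<noteq> y"
  shows "flips h (add_edge h x y) (R p) \<subseteq> A"
proof
  fix z assume z: "z \<in> flips h (add_edge h x y) (R p)"
  have "mis h (R p) a" "mis (add_edge h x y) (R p) a" by (subst mis_iff, simp)+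
  then have "z \<noteq> a" using z by (auto simp: flips_def)
  moreover have "z \<in> insert a A"
  proof (rule ccontr)
    assume "z \<notin> insert a A"
    then have "\<not> h u z" "\<not> add_edge h x y u z" for u
      using sgraphD[OF h] sgraphD[OF sgraph_add_edge[OF xy]] by blast+
    then have "mis h (R p) z" "mis (add_edge h x y) (R p) z" by (subst mis_iff, simp)+
    then show False using z by (simp add: flips_def)
  qed
  ultimately show "z \<in> A" by simp
qed

text \<open>\<open>sum_flips\<close> covers the orders with \<open>x\<close> before
  \<open>y\<close>. The others are covered by exchanging the endpoints, and there are none if
  \<open>x\<close> is the root.\<close>

lemma sum_flips_both:
  assumes y: "y \<in> A" and x: "x \<in> insert a A" "x \<noteq> y"
  shows "(\<Sum>p\<in>\<Omega>. card {z \<in> flips h (add_edge h x y) (R p). R p z \<le> \<theta>}) \<le> 2 * card (both \<theta> x y)"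
proof -
  let ?f = "\<lambda>p. card {z \<in> flips h (add_edge h x y) (R p). R p z \<le> \<theta>}"
  have "\<Omega> = {p \<in> \<Omega>. R p x < R p y} \<union> {p \<in> \<Omega>. R p y < R p x}"
  proof (intro set_eqI iffI)
    fix p assume p: "p \<in> \<Omega>"
    then have "R p x \<noteq> R p y" using R_eq[OF p, of x y] x y by auto
    then show "p \<in> {p \<in> \<Omega>. R p x < R p y} \<union> {p \<in> \<Omega>. R p y < R p x}"
      using p by (cases "R p x < R p y") auto
  qed auto
  then have "(\<Sum>p\<in>\<Omega>. ?f p) = (\<Sum>p\<in>{p \<in> \<Omega>. R p x < R p y} \<union> {p \<in> \<Omega>. R p y < R p x}. ?f p)" by simp
  also have "\<dots> = (\<Sum>p | p \<in> \<Omega> \<and> R p x < R p y. ?f p) + (\<Sum>p | p \<in> \<Omega> \<and> R p y < R p x. ?f p)"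
    using Omega(3) by (intro sum.union_disjoint) auto
  also have "(\<Sum>p | p \<in> \<Omega> \<and> R p x < R p y. ?f p) \<le> card (both \<theta> x y)" by (rule sum_flips[OF y x(1)])
  also have "(\<Sum>p | p \<in> \<Omega> \<and> R p y < R p x. ?f p) \<le> card (both \<theta> x y)"
  proof (cases "x = a")
    case True
    then have "{p. p \<in> \<Omega> \<and> R p y < R p x} = {}" by simp
    then show ?thesis by (simp only: sum.empty)
  next
    case False
    then have "x \<in> A" using x by simp
    moreover have "add_edge h x y = add_edge h y x" by (auto simp: add_edge_def fun_eq_iff)
    moreover have "both \<theta> x y = both \<theta> y x" by (auto simp: both_def)
    ultimately show ?thesis using sum_flips[of x y \<theta>] y by simp
  qed
  finally show ?thesis by simp
qed

text \<open>A change at rank \<open>i\<close> costs at most \<open>2 * (n * q / i)\<^sup>2\<close>.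
  After summation by parts the increment \<open>2 / \<theta> ^ 3\<close> meets a number of changes
  proportional to \<open>\<theta>\<^sup>2 / n\<^sup>2\<close>, which leaves a harmonic sum and the
  third factor \<open>q\<close>. At the root the number is proportional to
  \<open>\<theta> / n\<close> only, and a factor \<open>n\<close> is lost.\<close>

lemma sum_weighted_flips:
  assumes y: "y \<in> A" and x: "x \<in> insert a A" "x \<noteq> y"
  shows "(\<Sum>p\<in>\<Omega>. real (\<Sum>v\<in>flips h (add_edge h x y) (R p). 2 * (1 + sparse_bound n (R p v))\<^sup>2))
     \<le> fact n * (if x = a then real n else 1) * (12 * qlog n ^ 3)"
proof -
  define q where "q = qlog n"
  have q: "1 \<le> q" by (simp add: q_def qlog_ge)
  have n: "1 \<le> n" using y fin by (auto simp: Suc_le_eq card_gt_0_iff)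
  let ?F = "\<lambda>p. flips h (add_edge h x y) (R p)"
  let ?c = "\<lambda>p \<theta>. real (card {z \<in> ?F p. R p z \<le> \<theta>})"
  \<comment> \<open>Bounds the fraction of orders in which both ends have rank at most
    \<open>\<theta>\<close>, multiplied by \<open>n\<^sup>2\<close>; the root always has such a
    rank.\<close>
  define \<beta> where "\<beta> = (\<lambda>\<theta>. if x = a then real \<theta> * real n else (real \<theta>)\<^sup>2)"
  have xV: "x \<in> insert a A" "y \<in> insert a A" "x \<noteq> y" using x y by auto
  have C: "(\<Sum>p\<in>\<Omega>. ?c p \<theta>) \<le> 2 * fact n * \<beta> \<theta> / (real n)\<^sup>2" if \<theta>: "\<theta> \<le> n" for \<theta>
  proof -
    have "(\<Sum>p\<in>\<Omega>. ?c p \<theta>) \<le> 2 * real (card (both \<theta> x y))"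
      using sum_flips_both[OF y x, of \<theta>] by (metis (mono_tags, lifting) of_nat_le_iff of_nat_mult of_nat_numeral of_nat_sum sum.cong)
    moreover have "(real n)\<^sup>2 * real (card (both \<theta> x y)) \<le> fact n * \<beta> \<theta>"
    proof (cases "x = a")
      case True
      then have "both \<theta> x y = single \<theta> y" by (auto simp: both_def single_def)
      then have "real n * real (card (both \<theta> x y)) \<le> real \<theta> * fact n"
        using card_single[OF y, of \<theta>] by (metis (mono_tags, lifting) of_nat_fact of_nat_le_iff of_nat_mult)
      then have "real n * (real n * real (card (both \<theta> x y))) \<le> real n * (real \<theta> * fact n)"
        by (rule mult_left_mono) simp
      then show ?thesis using True by (simp add: \<beta>_def power2_eq_square ac_simps)
    next
      case False
      then have "n\<^sup>2 * card (both \<theta> x y) \<le> \<theta>\<^sup>2 * fact n" using x y \<theta> by (intro card_both) auto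
      then have "real (n\<^sup>2 * card (both \<theta> x y)) \<le> real (\<theta>\<^sup>2 * fact n)" by (simp only: of_nat_le_iff)
      then show ?thesis using False by (simp add: \<beta>_def ac_simps)
    qed
    ultimately have "(real n)\<^sup>2 * (\<Sum>p\<in>\<Omega>. ?c p \<theta>) \<le> 2 * (fact n * \<beta> \<theta>)"
      using mult_left_mono[of "\<Sum>p\<in>\<Omega>. ?c p \<theta>" "2 * real (card (both \<theta> x y))" "(real n)\<^sup>2"] by simp
    then show ?thesis using n by (simp add: field_simps)
  qed
  have 1: "real (\<Sum>v\<in>?F p. 2 * (1 + sparse_bound n (R p v))\<^sup>2) \<le>
     2 * (real n)\<^sup>2 * q\<^sup>2 * ((\<Sum>\<theta>\<in>{1..<n}. 2 / real \<theta> ^ 3 * ?c p \<theta>) + 1 / (real n)\<^sup>2 * ?c p n)" if p: "p \<in> \<Omega>" for p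
  proof -
    have FA: "?F p \<subseteq> A" by (rule flips_subset[OF p xV])
    have "real (\<Sum>v\<in>?F p. 2 * (1 + sparse_bound n (R p v))\<^sup>2) = (\<Sum>v\<in>?F p. 2 * (1 + real (sparse_bound n (R p v)))\<^sup>2)"
      by simp
    also have "\<dots> \<le> (\<Sum>v\<in>?F p. 2 * (real n)\<^sup>2 * q\<^sup>2 * (1 / (real (R p v))\<^sup>2))"
    proof (intro sum_mono)
      fix v assume "v \<in> ?F p"
      then have b: "1 \<le> R p v \<and> R p v \<le> n" using FA R_bounds[OF p] by blast
      have "(1 + real (sparse_bound n (R p v)))\<^sup>2 \<le> (real n / real (R p v) * q)\<^sup>2"
        using sparse_bound_le[of "R p v" n] b by (intro power_mono) (auto simp: q_def)
      then show "2 * (1 + real (sparse_bound n (R p v)))\<^sup>2 \<le> 2 * (real n)\<^sup>2 * q\<^sup>2 * (1 / (real (R p v))\<^sup>2)"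
        by (simp add: power_mult_distrib power_divide)
    qed
    also have "\<dots> = 2 * (real n)\<^sup>2 * q\<^sup>2 * (\<Sum>v\<in>?F p. 1 / (real (R p v))\<^sup>2)" by (simp only: sum_distrib_left)
    also have "\<dots> \<le> 2 * (real n)\<^sup>2 * q\<^sup>2 * ((\<Sum>\<theta>\<in>{1..<n}. 2 / real \<theta> ^ 3 * ?c p \<theta>) + 1 / (real n)\<^sup>2 * ?c p n)"
      using FA R_bounds[OF p] finite_subset[OF FA fin]
      by (intro mult_left_mono sum_by_parts[where g = "\<lambda>i. 1 / (real i)\<^sup>2"] inverse_square_sum) auto
    finally show ?thesis .
  qed
  have "(\<Sum>p\<in>\<Omega>. real (\<Sum>v\<in>?F p. 2 * (1 + sparse_bound n (R p v))\<^sup>2)) \<le>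
     (\<Sum>p\<in>\<Omega>. 2 * (real n)\<^sup>2 * q\<^sup>2 * ((\<Sum>\<theta>\<in>{1..<n}. 2 / real \<theta> ^ 3 * ?c p \<theta>) + 1 / (real n)\<^sup>2 * ?c p n))"
    by (intro sum_mono 1)
  also have "\<dots> = 2 * (real n)\<^sup>2 * q\<^sup>2 * ((\<Sum>\<theta>\<in>{1..<n}. 2 / real \<theta> ^ 3 * (\<Sum>p\<in>\<Omega>. ?c p \<theta>)) + 1 / (real n)\<^sup>2 * (\<Sum>p\<in>\<Omega>. ?c p n))"
    unfolding sum_distrib_left[symmetric] sum.distrib by (subst sum.swap) (simp add: sum_distrib_left)
  also have "\<dots> \<le> 2 * (real n)\<^sup>2 * q\<^sup>2 * ((\<Sum>\<theta>\<in>{1..<n}. 2 / real \<theta> ^ 3 * (2 * fact n * \<beta> \<theta> / (real n)\<^sup>2)) + 1 / (real n)\<^sup>2 * (2 * fact n * \<beta> n / (real n)\<^sup>2))"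
    by (intro mult_left_mono add_mono sum_mono C) auto
  also have "\<dots> = 2 * q\<^sup>2 * fact n * ((\<Sum>\<theta>\<in>{1..<n}. 4 * \<beta> \<theta> / real \<theta> ^ 3) + 2 * \<beta> n / (real n)\<^sup>2)"
  proof -
    have "(\<Sum>\<theta>\<in>{1..<n}. 2 / real \<theta> ^ 3 * (2 * fact n * \<beta> \<theta> / (real n)\<^sup>2)) = fact n / (real n)\<^sup>2 * (\<Sum>\<theta>\<in>{1..<n}. 4 * \<beta> \<theta> / real \<theta> ^ 3)"
      unfolding sum_distrib_left by (intro sum.cong) (auto simp: ac_simps)
    then have e: "(\<Sum>\<theta>\<in>{1..<n}. 2 / real \<theta> ^ 3 * (2 * fact n * \<beta> \<theta> / (real n)\<^sup>2)) = fact n / (real n)\<^sup>2 * T"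
      if "T = (\<Sum>\<theta>\<in>{1..<n}. 4 * \<beta> \<theta> / real \<theta> ^ 3)" for T using that by simp
    show ?thesis unfolding e[OF refl] using n by (simp add: field_simps)
  qed
  also have "\<dots> \<le> 2 * q\<^sup>2 * fact n * ((if x = a then real n else 1) * (6 * q))"
  proof (intro mult_left_mono)
    have harm: "(\<Sum>\<theta>\<in>{1..<n}. 1 / real \<theta>) \<le> q"
    proof -
      have "(\<Sum>\<theta>\<in>{1..<n}. 1 / real \<theta>) \<le> (\<Sum>\<theta>\<in>{1..n}. 1 / real \<theta>)" by (intro sum_mono2) auto
      also have "\<dots> = harm n" by (simp add: harm_def inverse_eq_divide)
      finally show ?thesis using harm_le_qlog[of n] by (simp add: q_def)
    qed
    have "(\<Sum>\<theta>\<in>{1..<n}. 4 * \<beta> \<theta> / real \<theta> ^ 3) \<le> (\<Sum>\<theta>\<in>{1..<n}. 4 * (if x = a then real n else 1) * (1 / real \<theta>))"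
    proof (intro sum_mono)
      fix \<theta> assume \<theta>: "\<theta> \<in> {1..<n}"
      show "4 * \<beta> \<theta> / real \<theta> ^ 3 \<le> 4 * (if x = a then real n else 1) * (1 / real \<theta>)"
      proof (cases "x = a")
        case True
        have "1 / (real \<theta>)\<^sup>2 \<le> 1 / real \<theta>" using \<theta> by (intro divide_left_mono) (auto simp: power2_eq_square)
        then have "4 * real n * (1 / (real \<theta>)\<^sup>2) \<le> 4 * real n * (1 / real \<theta>)" by (intro mult_left_mono) auto
        moreover have "4 * \<beta> \<theta> / real \<theta> ^ 3 = 4 * real n * (1 / (real \<theta>)\<^sup>2)"
          using True \<theta> by (simp add: \<beta>_def power2_eq_square power3_eq_cube)
        ultimately show ?thesis using True by simp
      next
        case False
        then show ?thesis using \<theta> by (simp add: \<beta>_def power2_eq_square power3_eq_cube)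
      qed
    qed
    also have "\<dots> = 4 * (if x = a then real n else 1) * (\<Sum>\<theta>\<in>{1..<n}. 1 / real \<theta>)" by (simp only: sum_distrib_left)
    also have "\<dots> \<le> 4 * (if x = a then real n else 1) * q" using harm by (intro mult_left_mono) auto
    finally have s: "(\<Sum>\<theta>\<in>{1..<n}. 4 * \<beta> \<theta> / real \<theta> ^ 3) \<le> (if x = a then real n else 1) * (4 * q)" by (simp add: ac_simps)
    have "2 * \<beta> n / (real n)\<^sup>2 = 2" using n by (simp add: \<beta>_def power2_eq_square)
    also have "\<dots> \<le> (if x = a then real n else 1) * (2 * q)"
    proof -
      have "1 * 2 \<le> (if x = a then real n else 1) * (2 * q)" using n q by (intro mult_mono) auto
      then show ?thesis by simp
    qed
    finally show "(\<Sum>\<theta>\<in>{1..<n}. 4 * \<beta> \<theta> / real \<theta> ^ 3) + 2 * \<beta> n / (real n)\<^sup>2 \<le> (if x = a then real n else 1) * (6 * q)"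
      using s by (simp add: algebra_simps split: if_splits)
  qed simp
  also have "\<dots> = fact n * (if x = a then real n else 1) * (12 * qlog n ^ 3)"
    by (simp add: q_def power2_eq_square power3_eq_cube)
  finally show ?thesis .
qed

text \<open>Serves the search at the earlier endpoint of a new edge, which costs about
  \<open>n / i\<close> at rank \<open>i\<close>.\<close>

lemma sum_inverse_rank:
  assumes y: "y \<in> A"
  shows "(\<Sum>p\<in>\<Omega>. 1 / real (R p y)) \<le> 2 * qlog n * fact n / real n"
proof -
  have n: "1 \<le> n" using y fin by (auto simp: Suc_le_eq card_gt_0_iff)
  have 1: "1 / real (R p y) \<le> (\<Sum>\<theta>\<in>{1..<n}. 1 / (real \<theta>)\<^sup>2 * real (card {u \<in> {y}. R p u \<le> \<theta>})) + 1 / real n" if p: "p \<in> \<Omega>" for p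
  proof -
    have "(\<Sum>u\<in>{y}. 1 / real (R p u)) \<le> (\<Sum>\<theta>\<in>{1..<n}. 1 / (real \<theta>)\<^sup>2 * real (card {u \<in> {y}. R p u \<le> \<theta>})) + 1 / real n * real (card {u \<in> {y}. R p u \<le> n})"
      using R_bounds[OF p y] by (intro sum_by_parts[where g = "\<lambda>i. 1 / real i"] inverse_sum) auto
    moreover have "{u \<in> {y}. R p u \<le> n} = {y}" using R_bounds[OF p y] by auto
    ultimately show ?thesis by simp
  qed
  have c: "(\<Sum>p\<in>\<Omega>. real (card {u \<in> {y}. R p u \<le> \<theta>})) \<le> real \<theta> * fact n / real n" for \<theta>
  proof -
    have "(\<Sum>p\<in>\<Omega>. card {u \<in> {y}. R p u \<le> \<theta>}) = card (single \<theta> y)"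
      using sum_card_swap[OF Omega(3), of "{y}" "\<lambda>p u. R p u \<le> \<theta>"] by (simp add: single_def)
    moreover have "real (n * card (single \<theta> y)) \<le> real (\<theta> * fact n)" using card_single[OF y] by (simp only: of_nat_le_iff)
    ultimately have "real n * (\<Sum>p\<in>\<Omega>. real (card {u \<in> {y}. R p u \<le> \<theta>})) \<le> real \<theta> * fact n"
      by (simp only: of_nat_sum[symmetric] of_nat_mult of_nat_fact)
    then show ?thesis using n by (simp add: field_simps)
  qed
  have "(\<Sum>p\<in>\<Omega>. 1 / real (R p y)) \<le> (\<Sum>p\<in>\<Omega>. (\<Sum>\<theta>\<in>{1..<n}. 1 / (real \<theta>)\<^sup>2 * real (card {u \<in> {y}. R p u \<le> \<theta>})) + 1 / real n)"
    by (intro sum_mono 1)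
  also have "\<dots> = (\<Sum>\<theta>\<in>{1..<n}. 1 / (real \<theta>)\<^sup>2 * (\<Sum>p\<in>\<Omega>. real (card {u \<in> {y}. R p u \<le> \<theta>}))) + fact n / real n"
    unfolding sum.distrib by (subst sum.swap) (simp add: sum_distrib_left fin)
  also have "\<dots> \<le> (\<Sum>\<theta>\<in>{1..<n}. 1 / (real \<theta>)\<^sup>2 * (real \<theta> * fact n / real n)) + fact n / real n"
    by (intro add_right_mono sum_mono mult_left_mono c) auto
  also have "\<dots> = (\<Sum>\<theta>\<in>{1..<n}. 1 / real \<theta>) * (fact n / real n) + fact n / real n"
    unfolding sum_distrib_right by (intro arg_cong2[where f = "(+)"] sum.cong) (auto simp: power2_eq_square)
  also have "\<dots> \<le> qlog n * (fact n / real n) + qlog n * (fact n / real n)"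
  proof (intro add_mono)
    have "(\<Sum>\<theta>\<in>{1..<n}. 1 / real \<theta>) \<le> (\<Sum>\<theta>\<in>{1..n}. 1 / real \<theta>)" by (intro sum_mono2) auto
    also have "\<dots> = harm n" by (simp add: harm_def inverse_eq_divide)
    finally show "(\<Sum>\<theta>\<in>{1..<n}. 1 / real \<theta>) * (fact n / real n) \<le> qlog n * (fact n / real n)"
      using harm_le_qlog[of n] by (intro mult_right_mono) auto
    show "fact n / real n \<le> qlog n * (fact n / real n)" using mult_right_mono[OF qlog_ge[of n], of "fact n / real n"] by simp
  qed
  also have "\<dots> = 2 * qlog n * fact n / real n" by (simp add: ac_simps)
  finally show ?thesis .
qed

text \<open>In multiples of \<open>q ^ 3\<close> the four contributions are 1 for the constant term,
  4 for the search at the earlier endpoint, 12 for the changes and 4 for the exceptional orders.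
  These cost at most \<open>2 * (n + 1) ^ 3\<close> each, which their probability of order
  \<open>1 / (n + 1) ^ 8\<close> outweighs.\<close>

lemma expected_icost:
  assumes y: "y \<in> A" and x: "x \<in> insert a A" "x \<noteq> y"
  shows "(\<Sum>p\<in>\<Omega>. real (icost (ibound x y p) h (R p) x y)) \<le> fact n * (if x = a then real n else 1) * (23 * qlog n ^ 3)"
proof -
  define q where "q = qlog n"
  define m where "m = (if x = a then real n else 1)"
  have q: "1 \<le> q" by (simp add: q_def qlog_ge)
  have n: "1 \<le> n" using y fin by (auto simp: Suc_le_eq card_gt_0_iff)
  have m: "1 \<le> m" using n by (simp add: m_def)
  have q3: "1 \<le> q ^ 3" "q\<^sup>2 \<le> q ^ 3" using q by (auto intro: one_le_power power_increasing)
  have xV: "x \<in> insert a A" "y \<in> insert a A" "x \<noteq> y" using x y by auto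
  let ?b = "sparse_bound n"
  let ?F = "\<lambda>p. flips h (add_edge h x y) (R p)"
  let ?W = "\<lambda>p. \<Sum>v\<in>?F p. 2 * (1 + ?b (R p v))\<^sup>2"
  let ?bad = "{p \<in> \<Omega>. \<not> (good h (R p) ?b \<and> good (add_edge h x y) (R p) ?b)}"
  have 1: "real (icost (ibound x y p) h (R p) x y) \<le>
     1 + real (?b (min (R p x) (R p y))) + real (?W p) + (if p \<in> ?bad then 2 * (real n + 1) ^ 3 else 0)" if p: "p \<in> \<Omega>" for p
  proof (cases "p \<in> ?bad")
    case False
    then have "ibound x y p = ?b" using p by (simp add: ibound_def)
    then show ?thesis using False by (simp add: icost_def)
  next
    case True
    then have "ibound x y p = (\<lambda>_. n)" by (auto simp: ibound_def)
    then have "real (icost (ibound x y p) h (R p) x y) = 1 + real n + real (card (?F p)) * (2 * (1 + real n)\<^sup>2)"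
      by (simp add: icost_def)
    also have "\<dots> \<le> 1 + real n + real n * (2 * (1 + real n)\<^sup>2)"
      using card_mono[OF fin flips_subset[OF p xV]] by (intro add_left_mono mult_right_mono) auto
    also have "\<dots> \<le> 2 * (real n + 1) ^ 3" by (simp add: power2_eq_square power3_eq_cube algebra_simps)
    finally have F: "real (icost (ibound x y p) h (R p) x y) \<le> 2 * (real n + 1) ^ 3" .
    have "0 \<le> real (?b (min (R p x) (R p y)))" "0 \<le> real (?W p)" by (rule of_nat_0_le_iff)+
    then show ?thesis unfolding if_P[OF True] using F by linarith
  qed
  have bad: "real (card ?bad) \<le> 2 * (fact n / (real n + 1) ^ 8)"
  proof -
    \<comment> \<open>The new graph satisfies the same assumptions, so \<open>bad_rare\<close>
      applies to it as well.\<close>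
    interpret h': random_order a A "add_edge h x y"
      using fin a sgraph_add_edge[OF xV] by unfold_locales
    have "?bad = {p \<in> \<Omega>. \<not> good h (R p) ?b} \<union> {p \<in> \<Omega>. \<not> good (add_edge h x y) (R p) ?b}" by auto
    then have "card ?bad \<le> card {p \<in> \<Omega>. \<not> good h (R p) ?b} + card {p \<in> \<Omega>. \<not> good (add_edge h x y) (R p) ?b}"
      by (simp only: card_Un_le)
    then show ?thesis using bad_rare[OF n] h'.bad_rare[OF n] by linarith
  qed
  have sb: "(\<Sum>p\<in>\<Omega>. real (?b (min (R p x) (R p y)))) \<le> fact n * m * (4 * q ^ 3)"
  proof (cases "x = a")
    case True
    then have "(\<Sum>p\<in>\<Omega>. real (?b (min (R p x) (R p y)))) = fact n * real n"
      using fin by (simp add: sparse_bound_def)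
    also have "\<dots> \<le> fact n * real n * (4 * q ^ 3)" 
    proof -
      have "1 \<le> 4 * q ^ 3" using q3 by linarith
      then have "fact n * real n * 1 \<le> fact n * real n * (4 * q ^ 3)" by (intro mult_left_mono) auto
      then show ?thesis by simp
    qed
    finally show ?thesis using True by (simp add: m_def)
  next
    case False
    then have xA: "x \<in> A" using x by simp
    have "(\<Sum>p\<in>\<Omega>. real (?b (min (R p x) (R p y)))) \<le> (\<Sum>p\<in>\<Omega>. real n * q * (1 / real (R p x)) + real n * q * (1 / real (R p y)))"
    proof (intro sum_mono)
      fix p assume p: "p \<in> \<Omega>"
      have b: "real (?b (R p z)) \<le> real n * q * (1 / real (R p z))" if "z \<in> A" for z
        using sparse_bound_le[of "R p z" n] R_bounds[OF p that] by (simp add: q_def)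
      have nn: "0 \<le> real n * q * (1 / real (R p z))" for z using q by simp
      show "real (?b (min (R p x) (R p y))) \<le> real n * q * (1 / real (R p x)) + real n * q * (1 / real (R p y))"
        using b[OF xA] b[OF y] nn[of x] nn[of y] by (simp only: min_def split: if_splits) auto
    qed
    also have "\<dots> = real n * q * (\<Sum>p\<in>\<Omega>. 1 / real (R p x)) + real n * q * (\<Sum>p\<in>\<Omega>. 1 / real (R p y))"
      by (simp only: sum.distrib sum_distrib_left)
    also have "\<dots> \<le> real n * q * (2 * q * fact n / real n) + real n * q * (2 * q * fact n / real n)"
      using sum_inverse_rank[OF xA] sum_inverse_rank[OF y] q by (intro add_mono mult_left_mono) (auto simp: q_def)
    also have "\<dots> = fact n * (4 * q\<^sup>2)" using n by (simp add: power2_eq_square)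
    also have "\<dots> \<le> fact n * (4 * q ^ 3)" using q3 by (intro mult_left_mono) auto
    finally show ?thesis using False by (simp add: m_def)
  qed
  have "(\<Sum>p\<in>\<Omega>. real (icost (ibound x y p) h (R p) x y)) \<le>
    (\<Sum>p\<in>\<Omega>. 1 + real (?b (min (R p x) (R p y))) + real (?W p) + (if p \<in> ?bad then 2 * (real n + 1) ^ 3 else 0))"
    by (intro sum_mono 1)
  also have "\<dots> = fact n + (\<Sum>p\<in>\<Omega>. real (?b (min (R p x) (R p y)))) + (\<Sum>p\<in>\<Omega>. real (?W p)) + real (card ?bad) * (2 * (real n + 1) ^ 3)"
  proof -
    have e: "(\<Sum>p\<in>W. if p \<in> B then c else 0) = real (card B) * c" if "finite W" "B \<subseteq> W" for W B :: "'a list set" and c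
      using that by (subst sum.inter_restrict[symmetric]) (simp_all add: Int_absorb1)
    have "(\<Sum>p\<in>\<Omega>. (1 :: real)) = fact n" using fin by simp
    moreover have sub: "?bad \<subseteq> \<Omega>" by blast
    ultimately show ?thesis by (simp only: sum.distrib e[OF Omega(3) sub])
  qed
  also have "\<dots> \<le> fact n * m * q ^ 3 + fact n * m * (4 * q ^ 3) + fact n * m * (12 * q ^ 3) + fact n * m * (4 * q ^ 3)"
  proof (intro add_mono)
    have mq: "1 \<le> m * q ^ 3" using mult_mono[OF m q3(1)] m by simp
    then show f: "fact n \<le> fact n * m * q ^ 3" using mult_left_mono[OF mq, of "fact n"] by simp
    show "(\<Sum>p\<in>\<Omega>. real (?W p)) \<le> fact n * m * (12 * q ^ 3)" using sum_weighted_flips[OF y x] by (simp only: m_def q_def)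
    have "real (card ?bad) * (2 * (real n + 1) ^ 3) \<le> 2 * (fact n / (real n + 1) ^ 8) * (2 * (real n + 1) ^ 3)"
      using bad by (intro mult_right_mono) auto
    also have "\<dots> \<le> 4 * fact n"
    proof -
      have "(real n + 1) ^ 3 \<le> (real n + 1) ^ 8" by (intro power_increasing) auto
      then have "(real n + 1) ^ 3 / (real n + 1) ^ 8 \<le> 1" by simp
      then have "4 * fact n * ((real n + 1) ^ 3 / (real n + 1) ^ 8) \<le> 4 * fact n * 1" by (intro mult_left_mono) auto
      then show ?thesis by simp
    qed
    finally have F: "real (card ?bad) * (2 * (real n + 1) ^ 3) \<le> 4 * fact n" .
    have "fact n * m * (4 * q ^ 3) = 4 * (fact n * m * q ^ 3)" by (simp only: ac_simps)
    with F f show "real (card ?bad) * (2 * (real n + 1) ^ 3) \<le> fact n * m * (4 * q ^ 3)" by linarith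
  qed (rule sb)
  also have "\<dots> = fact n * m * (21 * q ^ 3)" by (simp add: algebra_simps)
  also have "\<dots> \<le> fact n * m * (23 * q ^ 3)" using q m by (intro mult_left_mono) auto
  finally show ?thesis unfolding m_def q_def .
qed

end

section \<open>From ranks to vertices\<close>

text \<open>\<open>R\<close> holds ranks plus 1, so the zeroed memory marks the vertices that were
  not adjacent to the root at the start. A deletion at such a vertex does not concern the clique and
  is skipped.\<close>

definition update_prog :: com where
  "update_prog =
     Assign ''x'' (Read ''R'' (Reg ''u'')) ;;
     Assign ''y'' (Read ''R'' (Reg ''v'')) ;;
     Cond (And (Less (Const 0) (Reg ''x'')) (Less (Const 0) (Reg ''y'')))
       (Assign ''x'' (Minus (Reg ''x'') (Const (Suc 0))) ;;
        Assign ''y'' (Minus (Reg ''y'') (Const (Suc 0))) ;;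
        insert_edge) Skip"

definition edges_of :: "('a \<times> 'a) list \<Rightarrow> 'a \<Rightarrow> 'a \<Rightarrow> bool" where
  "edges_of ps u v \<longleftrightarrow> (u, v) \<in> set ps \<or> (v, u) \<in> set ps"

lemma edges_of_snoc: "edges_of (ps @ [(x, y)]) = add_edge (edges_of ps) x y"
  by (auto simp: edges_of_def add_edge_def fun_eq_iff)

locale ranked = ram w N lg for w N lg :: nat +
  fixes X :: "nat \<Rightarrow> nat" and r :: "nat \<Rightarrow> nat"
  assumes r_X: "\<And>i. i \<le> N \<Longrightarrow> r (X i) = i"
begin

abbreviation verts :: "nat set" where "verts \<equiv> X ` {..N}"

definition rgraph :: "(nat \<Rightarrow> nat \<Rightarrow> bool) \<Rightarrow> nat \<Rightarrow> nat \<Rightarrow> bool" where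
  "rgraph H i j \<longleftrightarrow> i \<le> N \<and> j \<le> N \<and> H (X i) (X j)"

definition vgraph :: "(nat \<Rightarrow> nat \<Rightarrow> bool) \<Rightarrow> bool" where
  "vgraph H \<longleftrightarrow> (\<forall>u v. H u v \<longrightarrow> u \<in> verts \<and> v \<in> verts \<and> u \<noteq> v \<and> H v u)"

lemma X_r: "v \<in> verts \<Longrightarrow> X (r v) = v" "v \<in> verts \<Longrightarrow> r v \<le> N"
  using r_X by auto

lemma X_inj: "i \<le> N \<Longrightarrow> j \<le> N \<Longrightarrow> X i = X j \<longleftrightarrow> i = j"
  using r_X by metis

lemma graph_rgraph: "vgraph H \<Longrightarrow> graph (rgraph H)"
  unfolding vgraph_def graph_def rgraph_def by blast

lemma rgraph_add_edge:
  "x \<le> N \<Longrightarrow> y \<le> N \<Longrightarrow> rgraph (add_edge H (X x) (X y)) = add_edge (rgraph H) x y"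
  using X_inj by (auto simp: rgraph_def add_edge_def fun_eq_iff)

lemma rmis_rgraph:
  assumes H: "vgraph H" and i: "i \<le> N"
  shows "rmis (rgraph H) i = mis H r (X i)"
proof -
  have "rmis (rgraph H) i = (i \<le> N \<longrightarrow> mis H r (X i))" for i
  proof (induction i rule: less_induct)
    case (less i)
    show ?case
    proof (cases "i \<le> N")
      case True
      have "mis H r (X i) \<longleftrightarrow> (\<forall>j<i. H (X j) (X i) \<longrightarrow> \<not> mis H r (X j))"
      proof -
        have "mis H r (X i) \<longleftrightarrow> (\<forall>u. r u < i \<longrightarrow> H u (X i) \<longrightarrow> \<not> mis H r u)"
          by (subst mis_iff) (simp add: r_X True)
        also have "\<dots> \<longleftrightarrow> (\<forall>j<i. H (X j) (X i) \<longrightarrow> \<not> mis H r (X j))"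
        proof (intro iffI allI impI)
          fix j assume "\<forall>u. r u < i \<longrightarrow> H u (X i) \<longrightarrow> \<not> mis H r u" "j < i" "H (X j) (X i)"
          then show "\<not> mis H r (X j)" using r_X[of j] True by simp
        next
          fix u assume a: "\<forall>j<i. H (X j) (X i) \<longrightarrow> \<not> mis H r (X j)" "r u < i" "H u (X i)"
          then have "u \<in> verts" using H by (auto simp: vgraph_def)
          then show "\<not> mis H r u" using a X_r(1)[of u] by (metis)
        qed
        finally show ?thesis .
      qed
      moreover have "rmis (rgraph H) i \<longleftrightarrow> (\<forall>j<i. H (X j) (X i) \<longrightarrow> \<not> mis H r (X j))"
      proof -
        have "rmis (rgraph H) j = mis H r (X j)" if "j < i" for j using less[OF that] that True by simp
        then show ?thesis using True by (subst rmis_iff) (simp add: rgraph_def conj_commute cong: imp_cong)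
      qed
      ultimately show ?thesis using True by simp
    next
      case False
      then show ?thesis by (subst rmis_iff) (simp add: rgraph_def)
    qed
  qed
  then show ?thesis using i by simp
qed

lemma rlive_rgraph:
  assumes H: "vgraph H" and i: "i \<le> N" and l: "rlive (rgraph H) \<kappa> i"
  shows "live H r \<kappa> (X i)"
  unfolding live_def
proof (intro conjI allI impI)
  show "\<kappa> \<le> r (X i)" using l r_X[OF i] by (simp add: rlive_def')
  fix u assume u: "r u < \<kappa>" "H u (X i)"
  then have v: "u \<in> verts" using H by (auto simp: vgraph_def)
  have "rgraph H (r u) i" using u v X_r[OF v] i by (simp add: rgraph_def)
  then have "\<not> rmis (rgraph H) (r u)" using l u by (simp add: rlive_def')
  then show "\<not> mis H r u" using rmis_rgraph[OF H X_r(2)[OF v]] X_r(1)[OF v] by simp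
qed

lemma rgood_rgraph:
  assumes H: "vgraph H" and B: "good H r B"
  shows "rgood (rgraph H) B"
  unfolding rgood_def'
proof (intro allI impI)
  fix i \<kappa> assume l: "rlive (rgraph H) \<kappa> i"
  show "card {z. rgraph H i z \<and> rlive (rgraph H) \<kappa> z} \<le> B \<kappa>"
  proof (cases "i \<le> N")
    case True
    have "card {z. rgraph H i z \<and> rlive (rgraph H) \<kappa> z} \<le> card {v. H (X i) v \<and> live H r \<kappa> v}"
    proof (rule card_inj_on_le[of X])
      show "inj_on X {z. rgraph H i z \<and> rlive (rgraph H) \<kappa> z}" using X_inj by (auto simp: inj_on_def rgraph_def)
      show "X ` {z. rgraph H i z \<and> rlive (rgraph H) \<kappa> z} \<subseteq> {v. H (X i) v \<and> live H r \<kappa> v}"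
        using rlive_rgraph[OF H] unfolding rgraph_def by blast
      show "finite {v. H (X i) v \<and> live H r \<kappa> v}"
      proof (rule finite_subset[of _ verts])
        show "{v. H (X i) v \<and> live H r \<kappa> v} \<subseteq> verts" using H unfolding vgraph_def by blast
      qed simp
    qed
    also have "\<dots> \<le> B \<kappa>" using B rlive_rgraph[OF H True l] by (simp add: good_def)
    finally show ?thesis .
  next
    case False
    then have "{z. rgraph H i z \<and> rlive (rgraph H) \<kappa> z} = {}" by (simp add: rgraph_def)
    then show ?thesis by (simp only: card.empty)
  qed
qed

text \<open>A vertex outside \<open>verts\<close> has no edges in either graph and is thus a member
  of both greedy sets, so \<open>X\<close> and \<open>r\<close> are bijections between the two index
  sets.\<close>

lemma sum_rflips:
  assumes H: "vgraph H" and H': "vgraph H'"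
  shows "(\<Sum>v\<in>rflips (rgraph H) (rgraph H'). f v) = (\<Sum>v\<in>flips H H' r. f (r v) :: nat)"
proof (rule sum.reindex_bij_witness[of _ r X])
  fix v assume "v \<in> flips H H' r"
  then have v: "v \<in> verts"
  proof -
    have "v \<in> verts" if "mis H r v \<noteq> mis H' r v"
    proof (rule ccontr)
      assume "v \<notin> verts"
      then have "mis H r v" "mis H' r v" using H H' by (subst mis_iff, auto simp: vgraph_def)+
      then show False using that by simp
    qed
    then show ?thesis using \<open>v \<in> flips H H' r\<close> by (simp add: flips_def)
  qed
  show "X (r v) = v" by (rule X_r(1)[OF v])
  show "r v \<in> rflips (rgraph H) (rgraph H')"
    using \<open>v \<in> flips H H' r\<close> rmis_rgraph[OF H X_r(2)[OF v]] rmis_rgraph[OF H' X_r(2)[OF v]] X_r[OF v]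
    by (simp add: rflips_def flips_def)
qed (auto simp: rflips_def flips_def r_X rmis_rgraph[OF H] rmis_rgraph[OF H'])

definition vstate :: "(nat \<Rightarrow> nat \<Rightarrow> bool) \<Rightarrow> store \<Rightarrow> bool" where
  "vstate H s \<longleftrightarrow> vgraph H \<and> ds X (rgraph H) (key (rgraph H)) (members (rgraph H)) {} s \<and>
     (\<forall>v. arr s ''R'' v = (if v \<in> verts then Suc (r v) else 0))"

lemma vstate_set_reg [simp]: "x \<notin> {''P'', ''D'', ''N'', ''k''} \<Longrightarrow> vstate H (set_reg x y s) = vstate H s"
  by (simp add: vstate_def)

lemma vgraph_add_edge: "vgraph H \<Longrightarrow> u \<in> verts \<Longrightarrow> v \<in> verts \<Longrightarrow> u \<noteq> v \<Longrightarrow> vgraph (add_edge H u v)"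
  unfolding vgraph_def add_edge_def by blast

lemma update_correct:
  assumes st: "vstate H s" and uv: "reg s ''u'' = u" "reg s ''v'' = v" "u \<in> verts" "v \<in> verts" "u \<noteq> v"
    and B: "good H r B" "good (add_edge H u v) r B"
  shows "wp w update_prog (\<lambda>s' t. vstate (add_edge H u v) s' \<and> same insert_regs turn_arrs s s' \<and>
     t \<le> 200 * (lg + 2) * (1 + B (min (r u) (r v)) + (\<Sum>z\<in>flips H (add_edge H u v) r. 2 * (1 + B (r z))\<^sup>2)) + 5) s"
proof -
  let ?H = "add_edge H u v"
  have H: "vgraph H" and H': "vgraph ?H" using st uv vgraph_add_edge by (auto simp: vstate_def)
  have R: "arr s ''R'' z = (if z \<in> verts then Suc (r z) else 0)" for z using st by (simp add: vstate_def)
  have ruv: "r u \<le> N" "r v \<le> N" "r u \<noteq> r v" using X_r[OF uv(3)] X_r[OF uv(4)] uv(5) by auto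
  let ?s1 = "set_reg ''y'' (r v) (set_reg ''x'' (r u) s)"
  have eq: "add_edge (rgraph H) (r u) (r v) = rgraph ?H"
    using rgraph_add_edge[OF ruv(1,2), of H] X_r[OF uv(3)] X_r[OF uv(4)] by simp
  have d: "ds X (rgraph H) (key (rgraph H)) (members (rgraph H)) {} ?s1" using st by (simp add: vstate_def)
  have i: "wp w insert_edge (\<lambda>s' t. ds X (rgraph ?H) (key (rgraph ?H)) (members (rgraph ?H)) {} s' \<and>
     same insert_regs turn_arrs ?s1 s' \<and>
     t \<le> 200 * (lg + 2) * (1 + B (min (r u) (r v)) + (\<Sum>v\<in>rflips (rgraph H) (rgraph ?H). 2 * (1 + B v)\<^sup>2))) ?s1"
    by (rule insert_edge_correct[OF graph_rgraph[OF H], of ?s1 "r u" "r v" B, unfolded eq])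
      (use ruv rgood_rgraph[OF H B(1)] rgood_rgraph[OF H' B(2)] d in simp_all)
  have sw: "set_reg ''x'' p (set_reg ''y'' q t) = set_reg ''y'' q (set_reg ''x'' p t)" for p q t
    by (simp add: set_reg_def fun_upd_twist)
  show ?thesis
    unfolding update_prog_def
    using uv
    apply (simp add: R sw)
    apply (rule wp_mono[OF i[unfolded sum_rflips[OF H H']]])
    using st H' by (auto simp: vstate_def same_def)
qed

lemma update_skip:
  assumes st: "vstate H s" and uv: "reg s ''u'' \<notin> verts \<or> reg s ''v'' \<notin> verts"
  shows "wp w update_prog (\<lambda>s' t. vstate H s' \<and> same insert_regs turn_arrs s s' \<and> t \<le> 5) s"
proof -
  have R: "arr s ''R'' z = (if z \<in> verts then Suc (r z) else 0)" for z using st by (simp add: vstate_def)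
  show ?thesis
    unfolding update_prog_def using uv st
    by (simp add: R)
qed

lemma outp_list:
  assumes "outp X I s"
  shows "distinct (output_list s)" "set (output_list s) = X ` I"
proof -
  have IN: "I \<subseteq> {..N}" and k: "reg s ''k'' = card I"
    and Zp: "\<And>p. p < card I \<Longrightarrow> arr s ''Z'' p \<in> I" "\<And>p. p < card I \<Longrightarrow> arr s ''J'' (arr s ''Z'' p) = Suc p"
      "\<And>p. p < card I \<Longrightarrow> arr s ''C'' p = X (arr s ''Z'' p)"
    using assms by (auto simp: outp_def)
  have injZ: "inj_on (arr s ''Z'') {..<card I}"
    using Zp(2) by (intro inj_onI) (metis Suc_inject lessThan_iff)
  have fin: "finite I" using IN finite_subset by blast
  have ZI: "arr s ''Z'' ` {..<card I} = I"
    using Zp(1) fin injZ by (intro card_subset_eq) (auto simp: card_image)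
  have C: "map (arr s ''C'') [0..<card I] = map (\<lambda>p. X (arr s ''Z'' p)) [0..<card I]"
    using Zp(3) by (intro map_cong) auto
  have injX: "inj_on X I" using IN X_inj by (auto simp: inj_on_def subset_iff)
  have "inj_on (\<lambda>p. X (arr s ''Z'' p)) {0..<card I}"
    using comp_inj_on[OF injZ, of X] injX ZI by (simp add: comp_def atLeast0LessThan)
  then show "distinct (output_list s)" unfolding output_list_def k C by (simp add: distinct_map)
  have "set (output_list s) = X ` arr s ''Z'' ` {..<card I}"
    unfolding output_list_def k C by (auto simp: image_image atLeast0LessThan)
  then show "set (output_list s) = X ` I" unfolding ZI .
qed

lemma vstate_output:
  assumes st: "vstate H s"
  shows "distinct (output_list s)" "set (output_list s) = {v \<in> verts. mis H r v}"
proof -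
  have o: "outp X (members (rgraph H)) s" and H: "vgraph H" using st by (auto simp: vstate_def ds_def)
  show "distinct (output_list s)" by (rule outp_list(1)[OF o])
  have "X ` members (rgraph H) = {v \<in> verts. mis H r v}"
    by (auto simp: members_def rmis_rgraph[OF H])
  then show "set (output_list s) = {v \<in> verts. mis H r v}" using outp_list(2)[OF o] by simp
qed

end

section \<open>Randomised programs\<close>

text \<open>A coupling of \<open>D\<close> with the outcome of the program transports supports, losslessness and
  expectations, without the result being a function of the sample.\<close>

definition cpl :: "nat \<Rightarrow> com \<Rightarrow> 'x spmf \<Rightarrow> ('x \<Rightarrow> store \<Rightarrow> nat \<Rightarrow> bool) \<Rightarrow> store \<Rightarrow> bool" where
  "cpl w c D Q s \<longleftrightarrow> rel_spmf (\<lambda>x z. Q x (fst z) (snd z)) D (exec w c s)"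

lemma cpl_mono: "cpl w c D Q s \<Longrightarrow> (\<And>x s' t. Q x s' t \<Longrightarrow> Q' x s' t) \<Longrightarrow> cpl w c D Q' s"
  unfolding cpl_def by (erule rel_spmf_mono) blast

lemma cpl_SeqI:
  assumes "cpl w c D R s" "\<And>x s' t. R x s' t \<Longrightarrow> cpl w d (D' x) (\<lambda>y s'' t'. Q y s'' (t + t')) s'"
  shows "cpl w (c ;; d) (bind_spmf D D') Q s"
  unfolding cpl_def exec.simps
proof (rule rel_spmf_bindI[OF assms(1)[unfolded cpl_def]])
  fix x z assume "R x (fst z) (snd z)"
  from assms(2)[OF this] have "rel_spmf (\<lambda>y z'. Q y (fst z') (snd z + snd z')) (D' x) (exec w d (fst z))"
    by (simp add: cpl_def)
  then have "rel_spmf (\<lambda>y z'. Q y (fst z') (snd z')) (bind_spmf (D' x) return_spmf)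
      (bind_spmf (exec w d (fst z)) (\<lambda>z'. return_spmf (fst z', snd z + snd z')))"
    by (rule rel_spmf_bindI) (simp add: rel_spmf_return_spmf2)
  then show "rel_spmf (\<lambda>y z'. Q y (fst z') (snd z')) (D' x)
      (case z of (s', t) \<Rightarrow> bind_spmf (exec w d s') (\<lambda>(s'', t'). return_spmf (s'', t + t')))"
    by (simp add: case_prod_unfold)
qed

lemma cpl_wp: "wp w c (Q x) s \<Longrightarrow> cpl w c (return_spmf x) Q s"
  by (auto simp: wp_def cpl_def rel_spmf_return_spmf2)

lemma cpl_map: "cpl w c D (\<lambda>x. Q (h x)) s \<Longrightarrow> cpl w c (map_spmf h D) Q s"
  by (simp add: cpl_def spmf_rel_map)

lemma wp_Seq_cpl:
  assumes "wp w c R s" "\<And>s' t. R s' t \<Longrightarrow> cpl w d D (\<lambda>y s'' t'. Q y s'' (t + t')) s'"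
  shows "cpl w (c ;; d) D Q s"
  using cpl_SeqI[OF cpl_wp[of w c "\<lambda>_. R" "()" s], of d "\<lambda>_. D" Q] assms by (simp add: return_bind_spmf)

lemma cpl_Seq_wp:
  assumes "cpl w c D R s" "\<And>x s' t. R x s' t \<Longrightarrow> wp w d (\<lambda>s'' t'. Q x s'' (t + t')) s'"
  shows "cpl w (c ;; d) D Q s"
proof -
  have "cpl w (c ;; d) (bind_spmf D return_spmf) Q s"
    by (rule cpl_SeqI[OF assms(1)], rule cpl_wp, rule assms(2))
  then show ?thesis by simp
qed

lemma cpl_assoc: "cpl w (c ;; d ;; e) D Q s \<Longrightarrow> cpl w ((c ;; d) ;; e) D Q s"
  by (simp add: cpl_def case_prod_unfold add.assoc)

lemma cpl_Random:
  assumes "aval w e s = k" "0 < k"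
  shows "cpl w (Random x e) (spmf_of_set {..<k}) (\<lambda>j s' t. j < k \<and> s' = set_reg x j s \<and> t = 1) s"
  using assms by (auto simp: cpl_def uniform_below_def spmf_rel_map intro!: rel_spmf_reflI)

lemma cpl_While:
  assumes "bval w b s" "cpl w (c ;; While b c) D (\<lambda>x s' t. Q x s' (1 + t)) s"
  shows "cpl w (While b c) D Q s"
proof -
  have "exec w (While b c) s = map_spmf (\<lambda>(s', t). (s', 1 + t)) (exec w (c ;; While b c) s)"
    using assms(1)
    by (simp add: map_spmf_conv_bind_spmf case_prod_unfold) (subst while_steps.simps, simp add: case_prod_unfold)
  then show ?thesis using assms(2) by (simp add: cpl_def spmf_rel_map case_prod_unfold)
qed

text \<open>The counterpart of \<open>wp_while\<close> for a loop whose cost is known as a sum over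
  the iterations done so far: \<open>tc\<close> bounds the time already spent, and
  \<open>\<mu>\<close> alone provides termination.\<close>

lemma wp_while_acc:
  fixes tc \<mu> :: "'g \<Rightarrow> nat"
  assumes "Inv g s"
    and step: "\<And>g s. Inv g s \<Longrightarrow> bval w b s \<Longrightarrow> wp w c (\<lambda>s' t. \<exists>g'. Inv g' s' \<and> \<mu> g' < \<mu> g \<and> t + 1 + tc g \<le> tc g') s"
  shows "wp w (While b c) (\<lambda>s' t. \<exists>g'. Inv g' s' \<and> \<not> bval w b s' \<and> t + tc g \<le> tc g' + 1) s"
  using assms(1)
proof (induction "\<mu> g" arbitrary: g s rule: less_induct)
  case less
  have unf: "exec w (While b c) s = (if bval w b s then
        bind_spmf (exec w c s) (\<lambda>(s', t). bind_spmf (exec w (While b c) s') (\<lambda>(s'', t').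
        return_spmf (s'', 1 + t + t'))) else return_spmf (s, 1))"
    by (subst exec.simps(7), subst while_steps.simps) simp
  show ?case
  proof (cases "bval w b s")
    case False
    with less.prems show ?thesis
      unfolding wp_def unf by auto
  next
    case True
    from step[OF less.prems True] obtain s1 t1 g1 where 1: "exec w c s = return_spmf (s1, t1)"
      "Inv g1 s1" "\<mu> g1 < \<mu> g" "t1 + 1 + tc g \<le> tc g1"
      unfolding wp_def by blast
    from less.hyps[OF 1(3,2)] obtain s2 t2 g2 where 2: "exec w (While b c) s1 = return_spmf (s2, t2)"
      "Inv g2 s2" "\<not> bval w b s2" "t2 + tc g1 \<le> tc g2 + 1"
      unfolding wp_def by blast
    have "exec w (While b c) s = return_spmf (s2, 1 + t1 + t2)"
      unfolding unf using True by (simp add: 1 2 bind_return_spmf del: exec.simps)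
    with 2 1(4) show ?thesis
      unfolding wp_def by (intro exI[of _ s2] exI[of _ "1 + t1 + t2"]) (auto intro!: exI[of _ g2])
  qed
qed

section \<open>A random permutation\<close>

definition shuffle_body :: com where
  "shuffle_body =
     Assign ''j'' (Plus (Reg ''j'') (Reg ''i'')) ;;
     Assign ''d'' (Read ''X'' (Reg ''i'')) ;;
     Write ''X'' (Reg ''i'') (Read ''X'' (Reg ''j'')) ;;
     Write ''X'' (Reg ''j'') (Reg ''d'') ;;
     Assign ''i'' (Plus (Reg ''i'') (Const (Suc 0)))"

text \<open>The Fisher-Yates shuffle; the random number is an offset, to which the body adds
  \<open>i\<close>. It is started at index 1, so that the root stays in front.\<close>

definition shuffle :: com where
  "shuffle = While (Less (Reg ''i'') (Plus (Reg ''N'') (Const (Suc 0))))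
     (Random ''j'' (Minus (Plus (Reg ''N'') (Const (Suc 0))) (Reg ''i'')) ;; shuffle_body)"

lemma shuffle_body_correct:
  assumes "Suc N < 2 ^ w" "i + j \<le> N" "reg s ''i'' = i" "reg s ''j'' = j"
  shows "wp w shuffle_body (\<lambda>s' t. reg s' ''i'' = Suc i \<and> arr s' ''X'' = arr s ''X'' \<circ> Transposition.transpose i (i + j) \<and>
     same {''i'', ''j'', ''d''} {''X''} s s' \<and> t = 5) s"
proof -
  have w: "0 < w" by (rule gr0I) (use assms(1) in simp)
  have m: "(j + i) mod 2 ^ w = i + j" "Suc i mod 2 ^ w = Suc i" "Suc 0 mod 2 ^ w = Suc 0"
    using assms(1,2) w by (simp_all add: add.commute)
  have "f(i := f (j + i), j + i := f i) = f \<circ> Transposition.transpose i (i + j)" for f :: "nat \<Rightarrow> nat"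
    by (auto simp: fun_eq_iff Transposition.transpose_def add.commute)
  then show ?thesis
    unfolding shuffle_body_def using assms by (simp add: m w numeral_eq_Suc)
qed

text \<open>The recursive description of a uniform permutation by its first element, with the
  element drawn through its position, as the program does.\<close>

lemma random_permutation_step:
  assumes xs: "distinct xs" "xs \<noteq> []"
  shows "spmf_of_set (permutations_of_set (set xs)) =
    bind_spmf (spmf_of_set {..<length xs}) (\<lambda>j. map_spmf ((#) (xs ! j)) (spmf_of_set (permutations_of_set (set xs - {xs ! j}))))"
proof -
  have perm: "spmf_of_set (permutations_of_set B) = spmf_of_pmf (pmf_of_set (permutations_of_set B))" if "finite B" for B :: "'a set"
    using that by (subst spmf_of_pmf_pmf_of_set) auto
  have im: "set xs = (!) xs ` {..<length xs}" by (auto simp: set_conv_nth)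
  have "pmf_of_set (set xs) = map_pmf ((!) xs) (pmf_of_set {..<length xs})"
    using xs by (subst map_pmf_of_set_inj) (auto simp: im[symmetric] inj_on_def nth_eq_iff_index_eq)
  then have "pmf_of_set (permutations_of_set (set xs)) =
     bind_pmf (pmf_of_set {..<length xs}) (\<lambda>j. map_pmf ((#) (xs ! j)) (pmf_of_set (permutations_of_set (set xs - {xs ! j}))))"
    using xs by (subst random_permutation_of_set) (auto simp: map_pmf_def bind_assoc_pmf bind_return_pmf)
  moreover have "spmf_of_set {..<length xs} = spmf_of_pmf (pmf_of_set {..<length xs})"
    using xs by (subst spmf_of_pmf_pmf_of_set) auto
  ultimately show ?thesis
    by (simp add: perm spmf_of_pmf_bind bind_spmf_of_pmf del: spmf_of_pmf_pmf_of_set)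
qed

text \<open>The target distribution depends only on the set of entries from \<open>i\<close> on.
  After an exchange the rest of the array enumerates the remaining set in some order, which is all
  that the induction hypothesis requires.\<close>

lemma shuffle_correct:
  assumes N: "Suc N < 2 ^ w" and "distinct (map (arr s ''X'') [i..<Suc N])" "reg s ''i'' = i" "reg s ''N'' = N" "i \<le> Suc N"
  shows "cpl w shuffle (spmf_of_set (permutations_of_set (arr s ''X'' ` {i..<Suc N})))
    (\<lambda>p s' t. map (arr s' ''X'') [i..<Suc N] = p \<and> (\<forall>k<i. arr s' ''X'' k = arr s ''X'' k) \<and>
      same {''i'', ''j'', ''d''} {''X''} s s' \<and> t \<le> 7 * (Suc N - i) + 1) s"
proof -
  have w: "0 < w" by (rule gr0I) (use N in simp)
  note upt_Suc [simp del]
  show ?thesis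
    using assms(2-)
  proof (induction "Suc N - i" arbitrary: i s)
    case 0
    then have i: "i = Suc N" by simp
    have "wp w shuffle (\<lambda>s' t. map (arr s' ''X'') [i..<Suc N] = [] \<and> (\<forall>k<i. arr s' ''X'' k = arr s ''X'' k) \<and>
        same {''i'', ''j'', ''d''} {''X''} s s' \<and> t \<le> 7 * (Suc N - i) + 1) s"
      unfolding wp_def shuffle_def by (subst exec.simps(7), subst while_steps.simps) (use 0 i N w in simp)
    then show ?case using i by (simp add: spmf_of_set_singleton cpl_wp)
  next
    case (Suc l)
    let ?X = "arr s ''X''" and ?k = "Suc N - i"
    let ?xs = "map ?X [i..<Suc N]"
    have i: "i \<le> N" using Suc by simp
    have setxs: "set ?xs = ?X ` {i..<Suc N}" by (simp only: set_map set_upt)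
    have b: "bval w (Less (Reg ''i'') (Plus (Reg ''N'') (Const (Suc 0)))) s" using Suc i N w by simp
    have D: "spmf_of_set (permutations_of_set (?X ` {i..<Suc N})) = bind_spmf (spmf_of_set {..<?k})
       (\<lambda>j. map_spmf ((#) (?xs ! j)) (spmf_of_set (permutations_of_set (?X ` {i..<Suc N} - {?xs ! j}))))"
    proof -
      have "length ?xs = ?k" "?xs \<noteq> []" using i by auto
      then show ?thesis using random_permutation_step[OF Suc.prems(1)] unfolding setxs by metis
    qed
    show ?case
      unfolding shuffle_def
    proof (rule cpl_While[OF b], rule cpl_assoc, subst D, rule cpl_SeqI, rule cpl_Random)
      show "aval w (Minus (Plus (Reg ''N'') (Const (Suc 0))) (Reg ''i'')) s = ?k" using Suc.prems N w by simp
      show "0 < ?k" using i by simp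
      fix j s1 and t1 :: nat assume 1: "j < ?k \<and> s1 = set_reg ''j'' j s \<and> t1 = 1"
      then have j: "i + j \<le> N" using i by linarith
      have xj: "?xs ! j = ?X (i + j)" using 1 j nth_upt[of i j "Suc N"] by simp
      let ?Y = "?X \<circ> Transposition.transpose i (i + j)"
      have inj: "inj_on ?X {i..<Suc N}" using Suc.prems(1) by (simp add: distinct_map)
      have tr: "Transposition.transpose i (i + j) ` {i..<Suc N} = {i..<Suc N}"
        using j by (intro transpose_image_eq) auto
      have im: "?Y ` {i..<Suc N} = ?X ` {i..<Suc N}" using tr by (simp only: image_comp[symmetric])
      have injY: "inj_on ?Y {i..<Suc N}" 
      proof (rule comp_inj_on)
        show "inj_on (Transposition.transpose i (i + j)) {i..<Suc N}" by (metis inj_on_def transpose_involutory)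
        show "inj_on ?X (Transposition.transpose i (i + j) ` {i..<Suc N})" using inj tr by simp
      qed
      have ins: "{i..<Suc N} = insert i {Suc i..<Suc N}" using i by auto
      have Yi: "?Y i = ?xs ! j" unfolding xj by simp
      have Yim: "?Y ` {Suc i..<Suc N} = ?X ` {i..<Suc N} - {?xs ! j}"
        using im injY unfolding Yi[symmetric] ins by (auto simp: inj_on_def)
      have Yinj: "inj_on ?Y {Suc i..<Suc N}" using injY by (rule inj_on_subset) auto
      show "cpl w (shuffle_body ;; While (Less (Reg ''i'') (Plus (Reg ''N'') (Const (Suc 0))))
          (Random ''j'' (Minus (Plus (Reg ''N'') (Const (Suc 0))) (Reg ''i'')) ;; shuffle_body))
        (map_spmf ((#) (?xs ! j)) (spmf_of_set (permutations_of_set (?X ` {i..<Suc N} - {?xs ! j}))))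
        (\<lambda>p s' t'. map (arr s' ''X'') [i..<Suc N] = p \<and> (\<forall>k<i. arr s' ''X'' k = ?X k) \<and>
           same {''i'', ''j'', ''d''} {''X''} s s' \<and> 1 + (t1 + t') \<le> 7 * (Suc N - i) + 1) s1"
      proof (rule cpl_map, rule wp_Seq_cpl, rule shuffle_body_correct[OF N j])
        show "reg s1 ''i'' = i" "reg s1 ''j'' = j" using 1 Suc.prems by auto
        fix s2 and t2 :: nat
        assume "reg s2 ''i'' = Suc i \<and> arr s2 ''X'' = arr s1 ''X'' \<circ> Transposition.transpose i (i + j) \<and>
           same {''i'', ''j'', ''d''} {''X''} s1 s2 \<and> t2 = 5"
        then have 2: "reg s2 ''i'' = Suc i" "arr s2 ''X'' = ?Y" "same {''i'', ''j'', ''d''} {''X''} s s2" "t2 = 5"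
          using 1 by auto
        have N2: "reg s2 ''N'' = N" using same_reg[OF 2(3), of "''N''"] Suc.prems by simp
        have IH: "cpl w shuffle (spmf_of_set (permutations_of_set (?Y ` {Suc i..<Suc N})))
          (\<lambda>p s' t. map (arr s' ''X'') [Suc i..<Suc N] = p \<and> (\<forall>k<Suc i. arr s' ''X'' k = ?Y k) \<and>
            same {''i'', ''j'', ''d''} {''X''} s2 s' \<and> t \<le> 7 * (Suc N - Suc i) + 1) s2"
          using Suc.hyps(1)[of "Suc i" s2] Suc.hyps(2) Suc.prems i 2 N2 Yinj by (simp add: distinct_map)
        show "cpl w (While (Less (Reg ''i'') (Plus (Reg ''N'') (Const (Suc 0))))
            (Random ''j'' (Minus (Plus (Reg ''N'') (Const (Suc 0))) (Reg ''i'')) ;; shuffle_body))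
          (spmf_of_set (permutations_of_set (?X ` {i..<Suc N} - {?xs ! j})))
          (\<lambda>x s'' t'. map (arr s'' ''X'') [i..<Suc N] = ?xs ! j # x \<and> (\<forall>k<i. arr s'' ''X'' k = ?X k) \<and>
            same {''i'', ''j'', ''d''} {''X''} s s'' \<and> 1 + (t1 + (t2 + t')) \<le> 7 * (Suc N - i) + 1) s2"
          unfolding Yim[symmetric] shuffle_def[symmetric]
        proof (rule cpl_mono[OF IH])
          fix p s3 and t3 :: nat
          assume 3: "map (arr s3 ''X'') [Suc i..<Suc N] = p \<and> (\<forall>k<Suc i. arr s3 ''X'' k = ?Y k) \<and>
            same {''i'', ''j'', ''d''} {''X''} s2 s3 \<and> t3 \<le> 7 * (Suc N - Suc i) + 1"
          have "[i..<Suc N] = i # [Suc i..<Suc N]" using i by (simp add: upt_conv_Cons)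
          moreover have "arr s3 ''X'' i = ?xs ! j" using 3 Yi by simp
          ultimately have "map (arr s3 ''X'') [i..<Suc N] = ?xs ! j # p" using 3 by (simp only: list.map)
          moreover have "arr s3 ''X'' k = ?X k" if "k < i" for k using 3 that by (simp add: Transposition.transpose_def)
          moreover have "same {''i'', ''j'', ''d''} {''X''} s s3" using same_trans[OF 2(3)] 3 by blast
          moreover have "1 + (t1 + (t2 + t3)) \<le> 7 * (Suc N - i) + 1" using 1 2(4) 3 i by (auto simp: Suc_diff_le)
          ultimately show "map (arr s3 ''X'') [i..<Suc N] = ?xs ! j # p \<and> (\<forall>k<i. arr s3 ''X'' k = ?X k) \<and>
            same {''i'', ''j'', ''d''} {''X''} s s3 \<and> 1 + (t1 + (t2 + t3)) \<le> 7 * (Suc N - i) + 1" by blast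
        qed
      qed
    qed
  qed
qed

section \<open>Initialization\<close>

definition nbl :: "'a \<Rightarrow> ('a \<times> 'a) list \<Rightarrow> 'a list" where
  "nbl a es = concat (map (\<lambda>(u, v). if u = a then [v] else if v = a then [u] else []) es)"

lemma nbl_simps [simp]:
  "nbl a [] = []"
  "nbl a (es @ [(u, v)]) = nbl a es @ (if u = a then [v] else if v = a then [u] else [])"
  by (simp_all add: nbl_def)

lemma undirected_Pair [simp]: "undirected (u, v) = {u, v}"
  by (simp add: undirected_def)

lemma nbl_set: "set (nbl a es) = {v. {a, v} \<in> undirected ` set es}"
proof (induction es rule: rev_induct)
  case (snoc e es)
  obtain u v where e: "e = (u, v)" by fastforce
  show ?case unfolding e nbl_simps set_append snoc image_Un by (auto simp: doubleton_eq_iff)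
qed simp

lemma nbl_distinct: "distinct (map undirected es) \<Longrightarrow> distinct (nbl a es)"
proof (induction es rule: rev_induct)
  case (snoc e es)
  obtain u v where e: "e = (u, v)" by fastforce
  have "distinct (nbl a es)" "{u, v} \<notin> undirected ` set es" using snoc e by auto
  then show ?case by (auto simp: e nbl_set insert_commute)
qed simp

text \<open>The adjacency matrix \<open>M\<close> has \<open>n * n\<close> entries but is written
  only at the edges; the rest relies on zeroed memory, so no quadratic time is spent.
  \<open>Y\<close> keeps the neighbours of the root in input order, whereas \<open>X\<close> will be
  shuffled.\<close>

definition scan_body :: com where
  "scan_body =
     Assign ''u'' (Read ''U'' (Reg ''i'')) ;;
     Assign ''v'' (Read ''V'' (Reg ''i'')) ;;
     Write ''M'' (Plus (Times (Reg ''u'') (Reg ''n'')) (Reg ''v'')) (Const (Suc 0)) ;;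
     Write ''M'' (Plus (Times (Reg ''v'') (Reg ''n'')) (Reg ''u'')) (Const (Suc 0)) ;;
     Assign ''i'' (Plus (Reg ''i'') (Const (Suc 0))) ;;
     Cond (Equal (Reg ''u'') (Reg ''r''))
       (Assign ''N'' (Plus (Reg ''N'') (Const (Suc 0))) ;;
        Write ''X'' (Reg ''N'') (Reg ''v'') ;; Write ''Y'' (Reg ''N'') (Reg ''v''))
       (Cond (Equal (Reg ''v'') (Reg ''r''))
         (Assign ''N'' (Plus (Reg ''N'') (Const (Suc 0))) ;;
          Write ''X'' (Reg ''N'') (Reg ''u'') ;; Write ''Y'' (Reg ''N'') (Reg ''u''))
         Skip)"

definition scan :: com where
  "scan = While (Less (Reg ''i'') (Reg ''m'')) scan_body"

definition double :: com where
  "double = While (Not (Less (Reg ''N'') (Reg ''P''))) (Assign ''P'' (Plus (Reg ''P'') (Reg ''P'')))"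

definition fill_body :: com where
  "fill_body =
     Write ''K'' (Reg ''i'') (Reg ''i'') ;;
     Write ''Z'' (Reg ''i'') (Reg ''i'') ;;
     Write ''C'' (Reg ''i'') (Read ''X'' (Reg ''i'')) ;;
     Write ''J'' (Reg ''i'') (Plus (Reg ''i'') (Const (Suc 0))) ;;
     Write ''R'' (Read ''X'' (Reg ''i'')) (Plus (Reg ''i'') (Const (Suc 0))) ;;
     Assign ''i'' (Plus (Reg ''i'') (Const (Suc 0)))"

definition fill :: com where
  "fill = While (Less (Reg ''i'') (Plus (Reg ''N'') (Const (Suc 0)))) fill_body"

text \<open>The pairs are read from \<open>Y\<close> and not from \<open>X\<close>, so the sequence
  of insertions depends on the input and the root but not on the shuffle, as
  \<open>sum_icosts\<close> requires. Two nested loops are flattened into one; \<open>z\<close>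
  restarts at 1 on reaching \<open>h\<close>.\<close>

definition pairs_body :: com where
  "pairs_body =
     Cond (Less (Reg ''z'') (Reg ''h''))
       (Assign ''u'' (Read ''Y'' (Reg ''h'')) ;;
        Assign ''v'' (Read ''Y'' (Reg ''z'')) ;;
        Assign ''z'' (Plus (Reg ''z'') (Const (Suc 0))) ;;
        Cond (Equal (Read ''M'' (Plus (Times (Reg ''u'') (Reg ''n'')) (Reg ''v''))) (Const 0)) update_prog Skip)
       (Assign ''z'' (Const (Suc 0)) ;;
        Assign ''h'' (Plus (Reg ''h'') (Const (Suc 0))))"

definition pairs :: com where
  "pairs = While (Less (Reg ''h'') (Plus (Reg ''N'') (Const (Suc 0)))) pairs_body"

text \<open>Starts with the edgeless graph, in which each vertex is a member and its own key, so the
  output list has \<open>N + 1\<close> entries and all trees are zero. The non-adjacent pairs are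
  then inserted with the update program.\<close>

definition build :: com where
  "build =
     Assign ''P'' (Const (Suc 0)) ;; double ;;
     Assign ''D'' (Plus (Reg ''P'') (Reg ''P'')) ;;
     Assign ''i'' (Const 0) ;; fill ;;
     Assign ''k'' (Plus (Reg ''N'') (Const (Suc 0))) ;;
     Assign ''h'' (Const (Suc 0)) ;; Assign ''z'' (Const (Suc 0)) ;; pairs"

definition init_prog :: com where
  "init_prog =
     Random ''r'' (Reg ''n'') ;;
     (scan ;; Write ''X'' (Const 0) (Reg ''r'') ;; Assign ''i'' (Const (Suc 0))) ;; shuffle ;; build"

text \<open>Once the root is fixed here, and the permutation in \<open>ordered_input\<close>, the
  program is deterministic. The fourth power of \<open>n + 1\<close> leaves room for the indices of
  the matrix and of the trees.\<close>

locale rooted_input =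
  fixes n :: nat and E :: "nat set set" and es :: "(nat \<times> nat) list" and w r :: nat
  assumes simple: "simple_graph {..<n} E" and enum: "enumerates es E"
    and word: "(n + 1) ^ 4 < 2 ^ w" and r: "r < n"
begin

abbreviation ys :: "nat list" where "ys \<equiv> nbl r es"

abbreviation N :: nat where "N \<equiv> length (nbl r es)"

lemma E_eq: "E = undirected ` set es"
  using enum by (simp add: enumerates_def)

lemma edgeD: "{a, b} \<in> E \<Longrightarrow> a < n \<and> b < n \<and> a \<noteq> b"
proof -
  assume e: "{a, b} \<in> E"
  have "\<forall>e\<in>E. e \<subseteq> {..<n} \<and> card e = 2" using simple by (simp add: simple_graph_def)
  from bspec[OF this e] show ?thesis by (cases "a = b") simp_all
qed

lemma set_es: "(a, b) \<in> set es \<Longrightarrow> a < n \<and> b < n \<and> a \<noteq> b"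
  using edgeD[of a b] imageI[of "(a, b)" "set es" undirected] unfolding E_eq by simp

lemma ys_set: "set ys = {v. {r, v} \<in> E}" and ys_distinct: "distinct ys"
  unfolding E_eq using enum by (simp_all add: nbl_set nbl_distinct enumerates_def)

lemma r_notin: "r \<notin> set ys"
  using edgeD[of r r] by (auto simp: ys_set)

lemma N_less: "N < n"
proof -
  have "set ys \<subseteq> {..<n} - {r}" using edgeD r_notin by (auto simp: ys_set)
  then have "card (set ys) \<le> card ({..<n} - {r})" by (intro card_mono) auto
  then show ?thesis using r by (simp add: distinct_card[OF ys_distinct])
qed

lemma card_es: "length es = card E"
  unfolding E_eq using enum distinct_card[of "map undirected es"] by (simp add: enumerates_def)

lemma m_less: "card E < 2 ^ w"
proof -
  have "E \<subseteq> undirected ` ({..<n} \<times> {..<n})"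
    unfolding E_eq using set_es by (intro image_mono) auto
  then have "card E \<le> card (undirected ` ({..<n} \<times> {..<n}))" by (intro card_mono) auto
  also have "\<dots> \<le> n * n" by (rule order_trans[OF card_image_le]) auto
  also have "n * n \<le> (n + 1) ^ 2" by (simp add: power2_eq_square)
  also have "\<dots> \<le> (n + 1) ^ 4" by (rule power_increasing) auto
  finally show ?thesis using word by simp
qed

lemma nn_word: "n * n + 2 < 2 ^ w"
proof -
  have "n * n + 2 \<le> (n + 1) ^ 2" using r by (cases n) (auto simp: power2_eq_square)
  also have "\<dots> \<le> (n + 1) ^ 4" by (rule power_increasing) auto
  finally show ?thesis using word by simp
qed

lemma index_less: "a < n \<Longrightarrow> b < n \<Longrightarrow> a * n + b < n * n"
proof -
  assume "a < n" "b < n"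
  then have "a * n + b < Suc a * n" by simp
  also have "Suc a * n \<le> n * n" using \<open>a < n\<close> by (intro mult_le_mono1) simp
  finally show ?thesis .
qed

lemma index_mod: "a < n \<Longrightarrow> b < n \<Longrightarrow> (a * n mod 2 ^ w + b) mod 2 ^ w = a * n + b"
  using index_less[of a b] nn_word by (simp add: mod_add_left_eq)

lemma index_eq: "b < n \<Longrightarrow> b' < n \<Longrightarrow> a * n + b = a' * n + b' \<longleftrightarrow> a = a' \<and> b = b'"
proof (intro iffI)
  assume b: "b < n" "b' < n" and eq: "a * n + b = a' * n + b'"
  have "(a * n + b) div n = a" "(a' * n + b') div n = a'" using b by simp_all
  then have "a = a'" using eq by simp
  then show "a = a' \<and> b = b'" using eq by simp
qed simp

lemma small: "i \<le> n \<Longrightarrow> i mod 2 ^ w = i" "i \<le> n \<Longrightarrow> Suc i mod 2 ^ w = Suc i" "Suc 0 mod 2 ^ w = Suc 0" "0 < w"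
proof -
  have "n \<le> n * n" by simp
  with nn_word have *: "n + 2 < 2 ^ w" by linarith
  then show w: "0 < w" by (intro gr0I) simp
  show "i \<le> n \<Longrightarrow> i mod 2 ^ w = i" "i \<le> n \<Longrightarrow> Suc i mod 2 ^ w = Suc i" "Suc 0 mod 2 ^ w = Suc 0" using * w by simp_all
qed

definition scanned :: "nat \<Rightarrow> store \<Rightarrow> bool" where
  "scanned g s \<longleftrightarrow> reg s ''N'' = length (nbl r (take g es)) \<and>
     (\<forall>j<length (nbl r (take g es)). arr s ''X'' (Suc j) = nbl r (take g es) ! j \<and> arr s ''Y'' (Suc j) = nbl r (take g es) ! j) \<and>
     (\<forall>a<n. \<forall>b<n. arr s ''M'' (a * n + b) = of_bool ({a, b} \<in> undirected ` set (take g es)))"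

abbreviation scan_regs :: "vname set" where "scan_regs \<equiv> {''u'', ''v'', ''i'', ''N''}"

abbreviation scan_arrs :: "vname set" where "scan_arrs \<equiv> {''M'', ''X'', ''Y''}"

lemma take_nbl: "length (nbl r (take g es)) \<le> N"
proof -
  have "nbl r es = nbl r (take g es) @ nbl r (drop g es)"
    unfolding nbl_def concat_append[symmetric] map_append[symmetric] append_take_drop_id by (rule refl)
  from arg_cong[OF this, of length] show ?thesis by simp
qed

lemma scan_body_correct:
  assumes s: "scanned g s" and g: "g < length es"
    and regs: "reg s ''i'' = g" "reg s ''n'' = n" "reg s ''r'' = r"
      "arr s ''U'' g = fst (es ! g)" "arr s ''V'' g = snd (es ! g)"
  shows "wp w scan_body (\<lambda>s' t. scanned (Suc g) s' \<and> reg s' ''i'' = Suc g \<and> same scan_regs scan_arrs s s' \<and> t \<le> 11) s"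
proof -
  define Post where "Post = (\<lambda>s' t. scanned (Suc g) s' \<and> reg s' ''i'' = Suc g \<and> same scan_regs scan_arrs s s' \<and> t \<le> (11 :: nat))"
  obtain a b where ab: "es ! g = (a, b)" by fastforce
  then have abn: "a < n" "b < n" "a \<noteq> b" using set_es[of a b] nth_mem[OF g] by auto
  have tk: "take (Suc g) es = take g es @ [(a, b)]" using ab g by (simp add: take_Suc_conv_app_nth)
  let ?l = "nbl r (take g es)"
  have l: "length ?l \<le> n" using take_nbl[of g] N_less by linarith
  have gm: "Suc g mod 2 ^ w = Suc g" using g m_less card_es by simp
  have N: "reg s ''N'' = length ?l"
    and XY: "\<And>j. j < length ?l \<Longrightarrow> arr s ''X'' (Suc j) = ?l ! j \<and> arr s ''Y'' (Suc j) = ?l ! j"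
    and M: "\<And>a b. a < n \<Longrightarrow> b < n \<Longrightarrow> arr s ''M'' (a * n + b) = of_bool ({a, b} \<in> undirected ` set (take g es))"
    using s unfolding scanned_def by blast+
  let ?M = "(arr s ''M'')(a * n + b := 1, b * n + a := 1)"
  have M': "?M (c * n + d) = of_bool ({c, d} \<in> undirected ` set (take (Suc g) es))" if "c < n" "d < n" for c d
  proof -
    let ?P = "c = a \<and> d = b \<or> c = b \<and> d = a"
    have 1: "?M (c * n + d) = (if ?P then 1 else arr s ''M'' (c * n + d))"
      unfolding fun_upd_apply index_eq[OF that(2) abn(2)] index_eq[OF that(2) abn(1)] by argo
    have 2: "{c, d} \<in> undirected ` set (take (Suc g) es) \<longleftrightarrow> ?P \<or> {c, d} \<in> undirected ` set (take g es)"
      unfolding tk set_append image_Un by (simp add: doubleton_eq_iff disj_assoc)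
    show ?thesis unfolding 1 2 M[OF that]
      by (cases ?P) (simp_all only: if_True if_False simp_thms of_bool_eq)
  qed
  let ?L = "nbl r (take (Suc g) es)"
  have sc: "scanned (Suc g) s'" if "reg s' ''N'' = length ?L" "arr s' ''M'' = ?M"
    "\<And>j. j < length ?L \<Longrightarrow> arr s' ''X'' (Suc j) = ?L ! j \<and> arr s' ''Y'' (Suc j) = ?L ! j" for s'
    using that(1,3) M' unfolding scanned_def that(2) by blast
  define s1 where "s1 = set_arr ''M'' (b * n + a) (Suc 0) (set_arr ''M'' (a * n + b) (Suc 0) (set_reg ''v'' b (set_reg ''u'' a s)))"
  have s1: "reg s1 = (reg s)(''u'' := a, ''v'' := b)" "arr s1 ''M'' = ?M" "arr s1 ''X'' = arr s ''X''" "arr s1 ''Y'' = arr s ''Y''"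
    "same scan_regs scan_arrs s s1"
    by (simp_all add: s1_def fun_eq_iff)
  have app: "Post (set_arr ''Y'' (Suc (length ?l)) c (set_arr ''X'' (Suc (length ?l)) c
      (set_reg ''N'' (Suc (length ?l)) (set_reg ''i'' (Suc g) s1)))) t"
    if L: "?L = ?l @ [c]" and t: "t \<le> 11" for c t
  proof -
    let ?s = "set_arr ''Y'' (Suc (length ?l)) c (set_arr ''X'' (Suc (length ?l)) c
      (set_reg ''N'' (Suc (length ?l)) (set_reg ''i'' (Suc g) s1)))"
    have "scanned (Suc g) ?s"
    proof (rule sc)
      show "reg ?s ''N'' = length ?L" by (simp add: L)
      show "arr ?s ''M'' = ?M" using s1(2) by simp
      fix j assume "j < length ?L"
      then have "j < length ?l \<or> j = length ?l" by (auto simp: L)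
      then show "arr ?s ''X'' (Suc j) = ?L ! j \<and> arr ?s ''Y'' (Suc j) = ?L ! j"
        using XY[of j] unfolding L by (elim disjE) (simp_all add: nth_append s1)
    qed
    then show ?thesis unfolding Post_def using t s1(5) by simp
  qed
  have skp: "Post (set_reg ''i'' (Suc g) s1) t" if L: "?L = ?l" and t: "t \<le> 11" for t
  proof -
    have "scanned (Suc g) (set_reg ''i'' (Suc g) s1)"
      by (rule sc) (use XY N s1 in \<open>simp_all add: L\<close>)
    then show ?thesis unfolding Post_def using t s1(5) by simp
  qed
  have x: "(a * n mod 2 ^ w + b) mod 2 ^ w = a * n + b" "(b * n mod 2 ^ w + a) mod 2 ^ w = b * n + a"
    "Suc (length ?l) mod 2 ^ w = Suc (length ?l)"
    using index_mod abn small(2)[OF l] by auto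
  have "wp w scan_body Post s"
  proof (cases "a = r")
    case True
    then have L: "?L = ?l @ [b]" and "reg s ''r'' = a" using regs by (simp_all add: tk)
    then show ?thesis unfolding scan_body_def using regs(1,2,4,5)
      by (simp add: ab x gm small(3,4) N s1 s1_def[symmetric] app[OF L])
  next
    case a: False
    show ?thesis
    proof (cases "b = r")
      case True
      then have L: "?L = ?l @ [a]" and "reg s ''r'' = b" using a regs by (simp_all add: tk)
      then show ?thesis unfolding scan_body_def using abn(3) regs(1,2,4,5)
        by (simp add: ab x gm small(3,4) N s1 s1_def[symmetric] app[OF L])
    next
      case False
      then have L: "?L = ?l" using a by (simp add: tk)
      show ?thesis unfolding scan_body_def using False a regs
        by (simp add: ab x gm small(3,4) N s1 s1_def[symmetric] skp[OF L])
    qed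
  qed
  then show ?thesis unfolding Post_def .
qed

lemma scan_correct:
  assumes s0: "s0 = set_reg ''r'' r (initial_store n es)"
  shows "wp w scan (\<lambda>s t. scanned (length es) s \<and> same scan_regs scan_arrs s0 s \<and> t \<le> 12 * length es + 1) s0"
proof -
  let ?Inv = "\<lambda>g s. g \<le> length es \<and> scanned g s \<and> reg s ''i'' = g \<and> same scan_regs scan_arrs s0 s"
  have "wp w scan (\<lambda>s t. \<exists>g. ?Inv g s \<and> \<not> bval w (Less (Reg ''i'') (Reg ''m'')) s \<and>
      t + 12 * (length es - g) \<le> 12 * (length es - 0) + 1) s0"
    unfolding scan_def
  proof (rule wp_while[where Inv = ?Inv and \<Phi> = "\<lambda>g. 12 * (length es - g)"])
    show "?Inv 0 s0" by (simp add: s0 scanned_def initial_store_def)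
    fix g s assume I: "?Inv g s" and b: "bval w (Less (Reg ''i'') (Reg ''m'')) s"
    have sm: "same scan_regs scan_arrs s0 s" using I by blast
    have regs: "reg s ''m'' = length es" "reg s ''n'' = n" "reg s ''r'' = r"
      "arr s ''U'' = arr s0 ''U''" "arr s ''V'' = arr s0 ''V''"
      using same_reg[OF sm, of "''m''"] same_reg[OF sm, of "''n''"] same_reg[OF sm, of "''r''"]
        same_arr[OF sm, of "''U''"] same_arr[OF sm, of "''V''"] by (simp_all add: s0 initial_store_def)
    have g: "g < length es" using I b regs by simp
    show "wp w scan_body (\<lambda>s' t. \<exists>g'. ?Inv g' s' \<and> t + 1 + 12 * (length es - g') \<le> 12 * (length es - g)) s"
    proof (rule wp_mono[OF scan_body_correct[of g s]])
      show "scanned g s" "g < length es" "reg s ''i'' = g" "reg s ''n'' = n" "reg s ''r'' = r"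
        "arr s ''U'' g = fst (es ! g)" "arr s ''V'' g = snd (es ! g)"
        using I g regs by (simp_all add: s0 initial_store_def)
      fix s' and t :: nat assume 1: "scanned (Suc g) s' \<and> reg s' ''i'' = Suc g \<and> same scan_regs scan_arrs s s' \<and> t \<le> 11"
      then have "same scan_regs scan_arrs s0 s'" using same_trans[OF sm] by blast
      then show "\<exists>g'. ?Inv g' s' \<and> t + 1 + 12 * (length es - g') \<le> 12 * (length es - g)"
        using 1 g by (intro exI[of _ "Suc g"]) auto
    qed
  qed
  then show ?thesis
  proof (rule wp_mono)
    fix s t assume "\<exists>g. ?Inv g s \<and> \<not> bval w (Less (Reg ''i'') (Reg ''m'')) s \<and> t + 12 * (length es - g) \<le> 12 * (length es - 0) + 1"
    then obtain g where g: "?Inv g s" "\<not> bval w (Less (Reg ''i'') (Reg ''m'')) s" "t \<le> 12 * length es + 1" by auto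
    have sm: "same scan_regs scan_arrs s0 s" using g by blast
    have "reg s ''m'' = length es" using same_reg[OF sm, of "''m''"] by (simp add: s0 initial_store_def)
    then have "g = length es" using g by simp
    then show "scanned (length es) s \<and> same scan_regs scan_arrs s0 s \<and> t \<le> 12 * length es + 1" using g by blast
  qed
qed

end

section \<open>The sequence of insertions for a fixed root\<close>

context rooted_input
begin

definition lg :: nat where "lg = floorlog 2 N"

lemma lg_bounds: "N < 2 ^ lg" "2 ^ lg \<le> 2 * n"
proof -
  show "N < 2 ^ lg" using floorlog_bounds[of N 2] by (cases "N = 0") (auto simp: lg_def)
  show "2 ^ lg \<le> 2 * n"
  proof (cases "N = 0")
    case True
    then show ?thesis using r by (simp add: lg_def floorlog_def)
  next
    case False
    then have "2 ^ (lg - 1) \<le> N" using floorlog_bounds[of N 2] by (simp add: lg_def)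
    moreover have "lg \<noteq> 0" using False by (simp add: lg_def floorlog_eq_zero_iff)
    then have "(2 :: nat) ^ lg = 2 * 2 ^ (lg - 1)" by (cases lg) auto
    ultimately show ?thesis using N_less by linarith
  qed
qed

lemma ram_word: "(N + 3) * (2 * 2 ^ lg) < 2 ^ w"
proof -
  have "(N + 3) * (2 * 2 ^ lg) \<le> (n + 2) * (4 * n)" 
  proof (rule mult_le_mono)
    show "N + 3 \<le> n + 2" using N_less by simp
    show "2 * 2 ^ lg \<le> 4 * n" using lg_bounds(2) by linarith
  qed
  also have "\<dots> \<le> (n + 1)\<^sup>2 * (n + 1)\<^sup>2"
  proof (rule mult_le_mono)
    show "n + 2 \<le> (n + 1)\<^sup>2" using r by (cases n) (auto simp: power2_eq_square)
    have "(int n - 1) ^ 2 \<ge> 0" by simp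
    then have "int (4 * n) \<le> int ((n + 1)\<^sup>2)" by (simp add: power2_eq_square algebra_simps)
    then show "4 * n \<le> (n + 1)\<^sup>2" by (simp only: of_nat_le_iff)
  qed
  also have "\<dots> = (n + 1) ^ 4" by (simp flip: power_add)
  finally show ?thesis using word by simp
qed

lemma double_correct:
  assumes s0: "reg s0 ''N'' = N" "reg s0 ''P'' = 1"
  shows "wp w double (\<lambda>s t. reg s ''P'' = 2 ^ lg \<and> same {''P''} {} s0 s \<and> t \<le> 2 * lg + 1) s0"
proof -
  let ?Inv = "\<lambda>g s. g \<le> lg \<and> reg s ''P'' = 2 ^ g \<and> same {''P''} {} s0 s"
  let ?b = "Not (Less (Reg ''N'') (Reg ''P''))"
  have less: "\<not> N < 2 ^ g \<Longrightarrow> g < lg" if "g \<le> lg" for g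
    using lg_bounds(1) that by (cases "g = lg") auto
  have "wp w double (\<lambda>s t. \<exists>g. ?Inv g s \<and> \<not> bval w ?b s \<and> t + 2 * (lg - g) \<le> 2 * (lg - 0) + 1) s0"
    unfolding double_def
  proof (rule wp_while[where Inv = ?Inv and \<Phi> = "\<lambda>g. 2 * (lg - g)"])
    show "?Inv 0 s0" using s0 by simp
    fix g s assume I: "?Inv g s" and b: "bval w ?b s"
    have "reg s ''N'' = N" using I s0 by (simp add: same_def)
    then have g: "g < lg" using I b less[of g] by simp
    have "(2 :: nat) ^ Suc g \<le> 2 ^ lg" using g by (intro power_increasing) auto
    also have "\<dots> \<le> (N + 3) * (2 * 2 ^ lg)" by (simp add: algebra_simps)
    finally have "(2 ^ g + 2 ^ g) mod 2 ^ w = (2 :: nat) ^ Suc g" using ram_word by simp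
    then show "wp w (Assign ''P'' (Plus (Reg ''P'') (Reg ''P'')))
      (\<lambda>s' t. \<exists>g'. ?Inv g' s' \<and> t + 1 + 2 * (lg - g') \<le> 2 * (lg - g)) s"
      using I g by (simp, intro exI[of _ "Suc g"]) auto
  qed
  then show ?thesis
  proof (rule wp_mono)
    fix s t assume "\<exists>g. ?Inv g s \<and> \<not> bval w ?b s \<and> t + 2 * (lg - g) \<le> 2 * (lg - 0) + 1"
    then obtain g where g: "?Inv g s" "\<not> bval w ?b s" "t + 2 * (lg - g) \<le> 2 * lg + 1" by auto
    have "reg s ''N'' = N" using g s0 by (simp add: same_def)
    then have "N < 2 ^ g" using g by simp
    then have "0 < g \<or> N = 0" by (cases g) auto
    have "g = lg"
    proof (rule ccontr)
      assume "g \<noteq> lg"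
      then have "g < lg" using g(1) by simp
      then have "N \<noteq> 0" by (auto simp: lg_def floorlog_def)
      then have "2 ^ (lg - 1) \<le> N" using floorlog_bounds[of N 2] by (simp add: lg_def)
      moreover have "(2 :: nat) ^ g \<le> 2 ^ (lg - 1)" using \<open>g < lg\<close> by (intro power_increasing) auto
      ultimately show False using \<open>N < 2 ^ g\<close> by linarith
    qed
    then show "reg s ''P'' = 2 ^ lg \<and> same {''P''} {} s0 s \<and> t \<le> 2 * lg + 1" using g by simp
  qed
qed

abbreviation V :: "nat set" where "V \<equiv> insert r (set ys)"

text \<open>Puts the root into the first component, where \<open>expected_icost\<close>
  distinguishes it; the second component is then never the root.\<close>

definition norm :: "nat \<times> nat \<Rightarrow> nat \<times> nat" where
  "norm e = (if snd e = r then (snd e, fst e) else e)"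

definition valid :: "(nat \<times> nat) list \<Rightarrow> bool" where
  "valid ps \<longleftrightarrow> (\<forall>e\<in>set ps. fst e \<in> V \<and> snd e \<in> set ys \<and> fst e \<noteq> snd e)"

definition step_cost :: "nat list \<Rightarrow> (nat \<times> nat) list \<Rightarrow> nat \<times> nat \<Rightarrow> nat" where
  "step_cost p ps e = icost (random_order.ibound r (set ys) (edges_of ps) (fst e) (snd e) p) (edges_of ps) (rk (r # p)) (fst e) (snd e)"

definition icosts :: "nat list \<Rightarrow> (nat \<times> nat) list \<Rightarrow> nat" where
  "icosts p ps = (\<Sum>i<length ps. step_cost p (take i ps) (ps ! i))"

lemma icosts_Nil [simp]: "icosts p [] = 0"
  and icosts_snoc [simp]: "icosts p (ps @ [e]) = icosts p ps + step_cost p ps e"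
  by (simp_all add: icosts_def nth_append)

lemma valid_norm: "u \<in> V \<Longrightarrow> v \<in> V \<Longrightarrow> u \<noteq> v \<Longrightarrow> valid ps \<Longrightarrow> valid (ps @ [norm (u, v)])"
  by (auto simp: valid_def norm_def)

lemma edges_norm: "edges_of (ps @ [norm (u, v)]) = add_edge (edges_of ps) u v"
  by (auto simp: norm_def edges_of_snoc add_edge_def fun_eq_iff)

lemma random_order: "valid ps \<Longrightarrow> random_order r (set ys) (edges_of ps)"
proof
  assume "valid ps"
  then show "sgraph V (edges_of ps)" unfolding sgraph_def edges_of_def valid_def by force
qed (use r_notin in auto)

definition nf :: "(nat \<times> nat) list \<Rightarrow> (nat \<times> nat) list" where
  "nf us = map norm (filter (\<lambda>(u, v). u \<in> V \<and> v \<in> V) us)"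

text \<open>The index pairs that the loop \<open>pairs\<close> has dealt with when its counters are
  \<open>h\<close> and \<open>z\<close>. Indices start at 1 as in \<open>Y\<close>.\<close>

definition plist :: "nat \<Rightarrow> nat \<Rightarrow> (nat \<times> nat) list" where
  "plist h z = concat (map (\<lambda>a. map (Pair a) [1..<a]) [1..<h]) @ map (Pair h) [1..<z]"

definition ql :: "nat \<Rightarrow> nat \<Rightarrow> (nat \<times> nat) list" where
  "ql h z = filter (\<lambda>(u, v). {u, v} \<notin> E) (map (\<lambda>(a, b). (ys ! (a - 1), ys ! (b - 1))) (plist h z))"

lemma ql_Suc: "1 \<le> z \<Longrightarrow> ql h (Suc z) = ql h z @ (if {ys ! (h - 1), ys ! (z - 1)} \<in> E then [] else [(ys ! (h - 1), ys ! (z - 1))])"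
  by (simp add: ql_def plist_def)

lemma ql_next: "1 \<le> h \<Longrightarrow> ql (Suc h) 1 = ql h h"
  by (simp add: ql_def plist_def)

lemma ql_1: "ql 1 1 = []"
  by (simp add: ql_def plist_def)

lemma ql_valid: "h \<le> Suc N \<Longrightarrow> z \<le> h \<Longrightarrow> h \<le> N \<or> z \<le> 1 \<Longrightarrow> valid (ql h z)"
  unfolding valid_def
proof
  fix e assume hz: "h \<le> Suc N" "z \<le> h" "h \<le> N \<or> z \<le> 1" and "e \<in> set (ql h z)"
  then obtain a b where ab: "(a, b) \<in> set (plist h z)" "e = (ys ! (a - 1), ys ! (b - 1))" by (auto simp: ql_def)
  then have "1 \<le> b" "b < a" "a \<le> N" using hz by (auto simp: plist_def)
  then have "a - 1 < N" "b - 1 < N" "a - 1 \<noteq> b - 1" by auto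
  then show "fst e \<in> V \<and> snd e \<in> set ys \<and> fst e \<noteq> snd e" using ab ys_distinct by (simp add: nth_eq_iff_index_eq)
qed

end

section \<open>The deterministic run for a fixed root and a fixed order\<close>

locale ordered_input = rooted_input +
  fixes p :: "nat list"
  assumes p: "p \<in> permutations_of_set (set ys)"
begin

abbreviation q :: "nat list" where "q \<equiv> r # p"

lemma q: "length q = Suc N" "distinct q" "set q = V" "length p = N"
proof -
  have "distinct p" "set p = set ys" using p by (auto simp: permutations_of_set_def)
  moreover have "length p = N" using calculation ys_distinct by (metis distinct_card)
  ultimately show "length q = Suc N" "distinct q" "set q = V" "length p = N" using r_notin by auto
qed

sublocale rd: ranked w N lg "(!) q" "rk q"
proof
  show "N < 2 ^ lg" by (rule lg_bounds(1))
  show "(N + 3) * (2 * 2 ^ lg) < 2 ^ w" by (rule ram_word)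
  fix i assume "i \<le> N"
  then show "rk q (q ! i) = i" using q by (intro rk_nth) auto
qed

lemma verts: "(!) q ` {..N} = V"
proof -
  have "(!) q ` {..N} = (!) q ` {..<length q}" unfolding q(1) by (simp only: lessThan_Suc_atMost)
  also have "\<dots> = set q" by (auto simp: set_conv_nth)
  finally show ?thesis using q by simp
qed

lemma insert_pair:
  assumes ps: "valid ps" and st: "rd.vstate (edges_of ps) s"
    and uv: "reg s ''u'' = u" "reg s ''v'' = v" "u \<in> V" "v \<in> V" "u \<noteq> v"
  shows "wp w update_prog (\<lambda>s' t. rd.vstate (edges_of (ps @ [norm (u, v)])) s' \<and> same insert_regs turn_arrs s s' \<and>
    t \<le> 200 * (lg + 2) * step_cost p ps (norm (u, v)) + 5) s"
proof -
  interpret ro: random_order r "set ys" "edges_of ps" by (rule random_order[OF ps])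
  obtain x y where xy: "norm (u, v) = (x, y)" by fastforce
  have x: "x \<in> insert r (set ys)" "y \<in> insert r (set ys)" "x \<noteq> y" and e: "add_edge (edges_of ps) u v = add_edge (edges_of ps) x y"
    and m: "min (rk q u) (rk q v) = min (rk q x) (rk q y)"
    using uv xy by (auto simp: norm_def add_edge_def fun_eq_iff min.commute split: if_splits)
  show ?thesis
    using rd.update_correct[OF st uv(1,2) uv(3,4,5)[folded verts], of "ro.ibound x y p"] ro.good_ibound[OF x, of p]
    unfolding edges_norm edges_of_snoc step_cost_def xy fst_conv snd_conv icost_def e m by blast
qed

text \<open>Deletions that leave the initial neighbourhood of the root take constant time and are
  dropped by \<open>nf\<close>. The other costs telescope along the growing sequence of
  insertions.\<close>

lemma run_updates_correct:
  assumes "valid ps" "rd.vstate (edges_of ps) s" "\<forall>(u, v)\<in>set us. u \<noteq> v"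
  shows "\<exists>outs t. run_updates w update_prog us s = return_spmf (outs, t) \<and> length outs = length us \<and>
    (\<forall>i<length us. distinct (outs ! i) \<and> set (outs ! i) = {v \<in> V. mis (edges_of (ps @ nf (take (Suc i) us))) (rk q) v}) \<and>
    t + 200 * (lg + 2) * icosts p ps \<le> 200 * (lg + 2) * icosts p (ps @ nf us) + 5 * length us"
  using assms
proof (induction us arbitrary: ps s)
  case Nil
  then show ?case by (simp add: nf_def)
next
  case (Cons e us)
  obtain u v where e: "e = (u, v)" by fastforce
  define ps' where "ps' = ps @ nf [e]"
  have app: "ps @ nf (e # l) = ps' @ nf l" for l by (simp add: ps'_def nf_def)
  let ?s = "load_update e s"
  have st: "rd.vstate (edges_of ps) ?s" and uv: "reg ?s ''u'' = u" "reg ?s ''v'' = v"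
    using Cons.prems by (simp_all add: load_update_def e)
  have uv': "u \<noteq> v" using Cons.prems e by simp
  have 1: "valid ps' \<and> wp w update_prog (\<lambda>s' t. rd.vstate (edges_of ps') s' \<and> t + 200 * (lg + 2) * icosts p ps \<le> 200 * (lg + 2) * icosts p ps' + 5) ?s"
  proof (cases "u \<in> V \<and> v \<in> V")
    case True
    then have ps': "ps' = ps @ [norm (u, v)]" by (simp add: ps'_def nf_def e)
    then have "valid ps'" using valid_norm True uv' Cons.prems by simp
    moreover have "wp w update_prog (\<lambda>s' t. rd.vstate (edges_of ps') s' \<and> t + 200 * (lg + 2) * icosts p ps \<le> 200 * (lg + 2) * icosts p ps' + 5) ?s"
      by (rule wp_mono[OF insert_pair[OF Cons.prems(1) st uv]])
        (use True uv' in \<open>auto simp: ps' add_mult_distrib2\<close>)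
    ultimately show ?thesis by blast
  next
    case False
    then have ps': "ps' = ps" by (auto simp: ps'_def nf_def e)
    have "wp w update_prog (\<lambda>s' t. rd.vstate (edges_of ps') s' \<and> t + 200 * (lg + 2) * icosts p ps \<le> 200 * (lg + 2) * icosts p ps' + 5) ?s"
      by (rule wp_mono[OF rd.update_skip[OF st]]) (use False uv verts in \<open>auto simp: ps'\<close>)
    then show ?thesis using Cons.prems ps' by simp
  qed
  then obtain s1 t1 where 2: "exec w update_prog ?s = return_spmf (s1, t1)" "rd.vstate (edges_of ps') s1"
    "t1 + 200 * (lg + 2) * icosts p ps \<le> 200 * (lg + 2) * icosts p ps' + 5" unfolding wp_def by blast
  obtain outs t where 3: "run_updates w update_prog us s1 = return_spmf (outs, t)" "length outs = length us"
    "\<forall>i<length us. distinct (outs ! i) \<and> set (outs ! i) = {v \<in> V. mis (edges_of (ps' @ nf (take (Suc i) us))) (rk q) v}"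
    "t + 200 * (lg + 2) * icosts p ps' \<le> 200 * (lg + 2) * icosts p (ps' @ nf us) + 5 * length us"
    using Cons.IH[OF _ 2(2)] 1 Cons.prems(3) by (auto simp del: mult_Suc)
  have "run_updates w update_prog (e # us) s = return_spmf (output_list s1 # outs, t1 + t)"
    by (simp add: 2(1) 3(1))
  moreover have "distinct ((output_list s1 # outs) ! i) \<and>
      set ((output_list s1 # outs) ! i) = {v \<in> V. mis (edges_of (ps @ nf (take (Suc i) (e # us)))) (rk q) v}"
    if "i < length (e # us)" for i
  proof (cases i)
    case 0
    then show ?thesis using rd.vstate_output[OF 2(2)] verts by (simp add: ps'_def)
  next
    case (Suc j)
    then show ?thesis using 3(3) that by (simp add: app)
  qed
  moreover have "t1 + t + 200 * (lg + 2) * icosts p ps \<le> 200 * (lg + 2) * icosts p (ps @ nf (e # us)) + 5 * length (e # us)"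
    unfolding app using 2(3) 3(4) by simp
  ultimately show ?case using 3(2) by (intro exI[of _ "output_list s1 # outs"] exI[of _ "t1 + t"]) (simp del: mult_Suc)
qed

definition filled :: "nat \<Rightarrow> store \<Rightarrow> bool" where
  "filled g s \<longleftrightarrow> (\<forall>j<g. arr s ''K'' j = j \<and> arr s ''Z'' j = j \<and> arr s ''C'' j = q ! j \<and> arr s ''J'' j = Suc j) \<and>
     (\<forall>v. arr s ''R'' v = (if v \<in> set (take g q) then Suc (rk q v) else 0))"

lemma fill_correct:
  assumes s0: "reg s0 ''N'' = N" "reg s0 ''i'' = 0" "\<forall>j\<le>N. arr s0 ''X'' j = q ! j" "arr s0 ''R'' = (\<lambda>_. 0)"
  shows "wp w fill (\<lambda>s t. filled (Suc N) s \<and> same {''i''} {''K'', ''Z'', ''C'', ''J'', ''R''} s0 s \<and> t \<le> 7 * Suc N + 1) s0"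
proof -
  let ?A = "{''K'', ''Z'', ''C'', ''J'', ''R''}"
  let ?Inv = "\<lambda>g s. g \<le> Suc N \<and> reg s ''i'' = g \<and> filled g s \<and> same {''i''} ?A s0 s"
  let ?b = "Less (Reg ''i'') (Plus (Reg ''N'') (Const (Suc 0)))"
  have bv: "bval w ?b s \<longleftrightarrow> reg s ''i'' < Suc N" if "same {''i''} ?A s0 s" for s
    using same_reg[OF that, of "''N''"] s0 small N_less by simp
  have "wp w fill (\<lambda>s t. \<exists>g. ?Inv g s \<and> \<not> bval w ?b s \<and> t + 7 * (Suc N - g) \<le> 7 * (Suc N - 0) + 1) s0"
    unfolding fill_def
  proof (rule wp_while[where Inv = ?Inv and \<Phi> = "\<lambda>g. 7 * (Suc N - g)"])
    show "?Inv 0 s0" using s0 by (simp add: filled_def)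
    fix g s assume I: "?Inv g s" and b: "bval w ?b s"
    have g: "g \<le> N" using I b bv by auto
    have sm: "same {''i''} ?A s0 s" using I by blast
    have X: "arr s ''X'' g = q ! g" using same_arr[OF sm, of "''X''"] s0(3) g by simp
    let ?s = "set_reg ''i'' (Suc g) (set_arr ''R'' (q ! g) (Suc g) (set_arr ''J'' g (Suc g) (set_arr ''C'' g (q ! g) (set_arr ''Z'' g g (set_arr ''K'' g g s)))))"
    have tk: "take (Suc g) q = take g q @ [q ! g]" using g q(1) by (simp add: take_Suc_conv_app_nth del: take_Suc_Cons)
    have rk: "rk q (q ! g) = g" using rd.r_X[OF g] .
    have F: "\<And>j. j < g \<Longrightarrow> arr s ''K'' j = j \<and> arr s ''Z'' j = j \<and> arr s ''C'' j = q ! j \<and> arr s ''J'' j = Suc j"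
      "\<And>v. arr s ''R'' v = (if v \<in> set (take g q) then Suc (rk q v) else 0)"
      using I unfolding filled_def by blast+
    have "filled (Suc g) ?s"
      unfolding filled_def
    proof (intro conjI allI impI)
      fix v show "arr ?s ''R'' v = (if v \<in> set (take (Suc g) q) then Suc (rk q v) else 0)"
        unfolding tk using F(2)[of v] rk by (cases "v = q ! g") (simp_all del: take_Suc_Cons)
    qed (use F(1) in \<open>auto simp: less_Suc_eq\<close>)
    then have I': "?Inv (Suc g) ?s" using sm g by simp
    have "Suc g mod 2 ^ w = Suc g" using small(2)[of g] g N_less by simp
    then show "wp w fill_body (\<lambda>s' t. \<exists>g'. ?Inv g' s' \<and> t + 1 + 7 * (Suc N - g') \<le> 7 * (Suc N - g)) s"
      unfolding fill_body_def using I
      apply (simp add: X small(3,4) del: Suc_diff_le)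
      using I' g by (simp add: Suc_diff_le)
  qed
  then show ?thesis
  proof (rule wp_mono)
    fix s t assume "\<exists>g. ?Inv g s \<and> \<not> bval w ?b s \<and> t + 7 * (Suc N - g) \<le> 7 * (Suc N - 0) + 1"
    then obtain g where g: "?Inv g s" "\<not> bval w ?b s" "t \<le> 7 * Suc N + 1" by auto
    then have "g = Suc N" using bv by auto
    then show "filled (Suc N) s \<and> same {''i''} ?A s0 s \<and> t \<le> 7 * Suc N + 1" using g by blast
  qed
qed

lemma empty_vstate:
  assumes s: "filled (Suc N) s" "rd.env s" "arr s ''T'' = (\<lambda>_. 0)" "reg s ''k'' = Suc N" "\<forall>j\<le>N. arr s ''X'' j = q ! j"
  shows "rd.vstate (edges_of []) s"
proof -
  have H: "edges_of [] = (\<lambda>_ _. False)" by (simp add: edges_of_def fun_eq_iff)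
  have h: "rd.rgraph (\<lambda>_ _. False) = (\<lambda>_ _. False)" by (simp add: rd.rgraph_def fun_eq_iff)
  have mem: "rd.members (\<lambda>_ _. False) = {..N}" unfolding rd.members_def by (subst rmis_iff) auto
  have key: "key (\<lambda>_ _. False) z = z" for z using key_less[of "\<lambda>_ _. False" z] key_le[of "\<lambda>_ _. False" z] by fastforce
  have F: "\<And>j. j \<le> N \<Longrightarrow> arr s ''K'' j = j \<and> arr s ''Z'' j = j \<and> arr s ''C'' j = q ! j \<and> arr s ''J'' j = Suc j"
    "\<And>v. arr s ''R'' v = (if v \<in> V then Suc (rk q v) else 0)"
    using s(1) q(1,3) unfolding filled_def less_Suc_eq_le by (auto simp del: take_Suc_Cons)
  have "rd.tree (rd.lf (\<lambda>_ _. False) (key (\<lambda>_ _. False)) {}) s"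
    using s(3) by (simp add: rd.tree_def rd.row_def rd.heap_def rd.lf_def)
  moreover have "rd.keys (key (\<lambda>_ _. False)) s" using F(1) by (simp add: rd.keys_def key)
  moreover have "rd.outp ((!) q) {..N} s" using F(1) s(4,5) by (auto simp: rd.outp_def less_Suc_eq_le)
  ultimately show ?thesis
    unfolding rd.vstate_def H h mem rd.ds_def verts using s(2) F(2) by (simp add: rd.vgraph_def)
qed

end

text \<open>Describes the whole run in terms of the state after initialization. Since the updates
  draw no random numbers, they are a point mass from there on.\<close>

definition final :: "nat \<Rightarrow> nat set set \<Rightarrow> nat \<Rightarrow> (nat \<times> nat) list \<Rightarrow> nat \<Rightarrow> store \<Rightarrow> nat \<Rightarrow> bool" where
  "final n E w us b s t \<longleftrightarrow> (\<exists>outs t'. run_updates w update_prog us s = return_spmf (outs, t') \<and>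
     maintains_maximal_clique n E us (output_list s # outs) \<and> t + t' \<le> b)"

lemma final_mono: "final n E w us b s t \<Longrightarrow> t' + b \<le> b' + t \<Longrightarrow> final n E w us b' s t'"
  unfolding final_def by (elim exE conjE) (intro exI conjI, assumption+, linarith)

lemma edges_of_undirected: "edges_of ps u v \<longleftrightarrow> {u, v} \<in> undirected ` set ps"
  unfolding edges_of_def
proof
  assume "(u, v) \<in> set ps \<or> (v, u) \<in> set ps"
  then show "{u, v} \<in> undirected ` set ps"
    using imageI[of "(u, v)" "set ps" undirected] imageI[of "(v, u)" "set ps" undirected]
    by (auto simp: insert_commute simp del: image_eqI)
next
  assume "{u, v} \<in> undirected ` set ps"
  then obtain e where e: "{u, v} = undirected e" "e \<in> set ps" by (rule imageE)
  obtain a b where "e = (a, b)" by (rule prod.exhaust)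
  with e show "(u, v) \<in> set ps \<or> (v, u) \<in> set ps" by (auto simp: doubleton_eq_iff)
qed

section \<open>The maintained complement graph and the cost averaged over the orders\<close>

context rooted_input
begin

lemma no_loops:
  assumes "undirected ` set us \<subseteq> E"
  shows "\<forall>(u, v)\<in>set us. u \<noteq> v"
proof
  fix e assume e: "e \<in> set us"
  obtain u v where uv: "e = (u, v)" by (rule prod.exhaust)
  have "undirected e \<in> E" using assms e by blast
  then have "u \<noteq> v" using edgeD[of u v] by (simp add: uv)
  then show "case e of (u, v) \<Rightarrow> u \<noteq> v" by (simp add: uv)
qed

definition all_pairs :: "(nat \<times> nat) list \<Rightarrow> (nat \<times> nat) list" where
  "all_pairs us = ql (Suc N) 1 @ nf us"

lemma edges_ql:
  assumes u: "u \<in> V" and v: "v \<in> V"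
  shows "edges_of (ql (Suc N) 1) u v \<longleftrightarrow> u \<noteq> v \<and> {u, v} \<notin> E"
proof
  assume e: "edges_of (ql (Suc N) 1) u v"
  have "u \<noteq> v" using e ql_valid[of "Suc N" 1] by (force simp: edges_of_def valid_def)
  moreover have "{u, v} \<notin> E" using e by (auto simp: edges_of_def ql_def insert_commute)
  ultimately show "u \<noteq> v \<and> {u, v} \<notin> E" ..
next
  assume e: "u \<noteq> v \<and> {u, v} \<notin> E"
  have uv: "u \<in> set ys" "v \<in> set ys" using u v e by (auto simp: ys_set insert_commute)
  have *: "edges_of (ql (Suc N) 1) (ys ! i) (ys ! j)" if "j < i" "i < N" "{ys ! i, ys ! j} \<notin> E" for i j
  proof -
    have "(Suc i, Suc j) \<in> set (plist (Suc N) 1)"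
    proof -
      have "(Suc i, Suc j) \<in> (\<Union>a\<in>{1..<Suc N}. Pair a ` {1..<a})" using that by (intro UN_I[of "Suc i"] imageI) auto
      then show ?thesis by (simp add: plist_def del: upt_Suc)
    qed
    then have "(ys ! i, ys ! j) \<in> set (ql (Suc N) 1)" using that(3) unfolding ql_def by force
    then show ?thesis by (simp add: edges_of_def)
  qed
  obtain i j where ij: "i < N" "j < N" "u = ys ! i" "v = ys ! j" using uv by (auto simp: in_set_conv_nth)
  then have "i \<noteq> j" using e by auto
  then consider "i < j" | "j < i" by linarith
  then show "edges_of (ql (Suc N) 1) u v"
  proof cases
    case 1
    then show ?thesis using *[of i j] ij e by (simp add: edges_of_def insert_commute disj_commute)
  next
    case 2
    then show ?thesis using *[of j i] ij e by simp
  qed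
qed

lemma edges_nf: "u \<in> V \<Longrightarrow> v \<in> V \<Longrightarrow> edges_of (nf us) u v \<longleftrightarrow> {u, v} \<in> undirected ` set us"
proof -
  assume uv: "u \<in> V" "v \<in> V"
  have n: "undirected (norm e) = undirected e" for e by (auto simp: norm_def undirected_def)
  have "edges_of (nf us) u v \<longleftrightarrow> {u, v} \<in> undirected ` {e \<in> set us. fst e \<in> V \<and> snd e \<in> V}"
    unfolding edges_of_undirected nf_def set_map set_filter image_image n by (simp add: case_prod_unfold)
  also have "\<dots> \<longleftrightarrow> {u, v} \<in> undirected ` set us"
  proof
    assume "{u, v} \<in> undirected ` set us"
    then obtain e where e: "{u, v} = undirected e" "e \<in> set us" by (rule imageE)
    obtain a b where ab: "e = (a, b)" by (rule prod.exhaust)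
    have "fst e \<in> V \<and> snd e \<in> V" using e(1) uv unfolding ab undirected_Pair doubleton_eq_iff fst_conv snd_conv by metis
    then show "{u, v} \<in> undirected ` {e \<in> set us. fst e \<in> V \<and> snd e \<in> V}"
      using e by (intro image_eqI[of _ _ e]) simp_all
  qed (rule subsetD[OF image_mono], auto)
  finally show ?thesis .
qed

lemma edges_all_pairs:
  assumes "undirected ` set us \<subseteq> E" "u \<in> V" "v \<in> V"
  shows "edges_of (all_pairs us) u v \<longleftrightarrow> u \<noteq> v \<and> {u, v} \<notin> graph_after E us"
proof -
  have "edges_of (all_pairs us) u v \<longleftrightarrow> edges_of (ql (Suc N) 1) u v \<or> edges_of (nf us) u v"
    by (auto simp: all_pairs_def edges_of_def)
  also have "\<dots> \<longleftrightarrow> u \<noteq> v \<and> {u, v} \<notin> E \<or> {u, v} \<in> undirected ` set us"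
    unfolding edges_ql[OF assms(2,3)] edges_nf[OF assms(2,3)] ..
  also have "\<dots> \<longleftrightarrow> u \<noteq> v \<and> {u, v} \<notin> graph_after E us"
    using assms(1) edgeD[of u v] unfolding graph_after_def by blast
  finally show ?thesis .
qed

lemma valid_all_pairs:
  assumes "\<forall>(u, v)\<in>set us. u \<noteq> v"
  shows "valid (all_pairs us)"
proof -
  have "valid (nf us)" using assms by (auto simp: valid_def nf_def norm_def)
  then show ?thesis using ql_valid[of "Suc N" 1] by (auto simp: valid_def all_pairs_def)
qed

text \<open>The factor of \<open>expected_icost\<close>, added up over the insertions: insertions at
  the root are \<open>N\<close> times as expensive.\<close>

definition weight :: "(nat \<times> nat) list \<Rightarrow> nat" where
  "weight ps = sum_list (map (\<lambda>e. if fst e = r then N else 1) ps)"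

lemma card_ys: "card (set ys) = N"
  by (rule distinct_card[OF ys_distinct])

text \<open>Here obliviousness is used: \<open>ps\<close> is the same for all orders, so the sum
  over orders can be taken insertion by insertion, with the graph before each insertion
  fixed.\<close>

lemma sum_icosts:
  "valid ps \<Longrightarrow> (\<Sum>p\<in>permutations_of_set (set ys). real (icosts p ps)) \<le> fact N * real (weight ps) * (23 * qlog N ^ 3)"
proof (induction ps rule: rev_induct)
  case Nil
  then show ?case by (simp add: weight_def)
next
  case (snoc e ps)
  have v: "valid ps" and e: "fst e \<in> V" "snd e \<in> set ys" "fst e \<noteq> snd e" using snoc.prems by (auto simp: valid_def)
  interpret ro: random_order r "set ys" "edges_of ps" by (rule random_order[OF v])
  have 1: "(\<Sum>p\<in>permutations_of_set (set ys). real (step_cost p ps e)) \<le> fact N * (if fst e = r then real N else 1) * (23 * qlog N ^ 3)"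
    using ro.expected_icost[OF e(2,1,3)] unfolding step_cost_def card_ys .
  have "(\<Sum>p\<in>permutations_of_set (set ys). real (icosts p (ps @ [e]))) =
      (\<Sum>p\<in>permutations_of_set (set ys). real (icosts p ps)) + (\<Sum>p\<in>permutations_of_set (set ys). real (step_cost p ps e))"
    by (simp add: sum.distrib)
  also have "\<dots> \<le> fact N * real (weight ps) * (23 * qlog N ^ 3) + fact N * (if fst e = r then real N else 1) * (23 * qlog N ^ 3)"
    by (rule add_mono[OF snoc.IH[OF v] 1])
  also have "\<dots> = fact N * real (weight (ps @ [e])) * (23 * qlog N ^ 3)"
    by (simp add: weight_def algebra_simps)
  finally show ?case .
qed

text \<open>One share of \<open>N * N\<close> is for the initial pairs, which avoid the root, one
  for at most \<open>N\<close> deletions at the root of weight \<open>N\<close> each, and one for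
  the remaining deletions.\<close>

lemma weight_all_pairs:
  assumes us: "distinct (map undirected us)" "\<forall>(u, v)\<in>set us. u \<noteq> v"
  shows "weight (all_pairs us) \<le> 3 * (N * N)"
proof -
  have "weight (ql (Suc N) 1) = length (ql (Suc N) 1)"
  proof -
    have "fst e \<noteq> r" if e: "e \<in> set (ql (Suc N) 1)" for e
    proof -
      obtain a b where "(a, b) \<in> set (plist (Suc N) 1)" "e = (ys ! (a - 1), ys ! (b - 1))" using e by (auto simp: ql_def)
      moreover from this have "a - 1 < N" by (auto simp: plist_def)
      then have "ys ! (a - 1) \<in> set ys" by (rule nth_mem)
      ultimately show ?thesis using r_notin by (metis fst_conv)
    qed
    then have eq: "map (\<lambda>e. if fst e = r then N else 1) (ql (Suc N) 1) = map (\<lambda>_. 1) (ql (Suc N) 1)" by (intro map_cong) auto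
    show ?thesis unfolding weight_def eq by (simp add: sum_list_triv)
  qed
  also have "\<dots> \<le> length (plist (Suc N) 1)" unfolding ql_def by (rule order_trans[OF length_filter_le]) simp
  also have "\<dots> = sum_list (map (\<lambda>a. a - 1) [1..<Suc N])" by (simp add: plist_def length_concat comp_def del: upt_Suc)
  also have "\<dots> \<le> sum_list (map (\<lambda>_. N) [1..<Suc N])" by (rule sum_list_mono) auto
  also have "\<dots> = N * N" by (simp add: sum_list_triv del: upt_Suc)
  finally have 1: "weight (ql (Suc N) 1) \<le> N * N" .
  have "undirected (norm e) = undirected e" for e by (auto simp: norm_def undirected_def)
  then have "map undirected (nf us) = map undirected (filter (\<lambda>(u, v). u \<in> V \<and> v \<in> V) us)" by (simp add: nf_def)
  then have "distinct (nf us)" using distinct_map_filter[OF us(1)] by (metis distinct_map)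
  then have "weight (nf us) = (\<Sum>e\<in>set (nf us). if fst e = r then N else 1)"
    unfolding weight_def by (rule sum_list_distinct_conv_sum_set)
  also have "\<dots> \<le> (\<Sum>e\<in>V \<times> set ys. if fst e = r then N else 1)"
  proof (rule sum_mono2)
    show "set (nf us) \<subseteq> V \<times> set ys"
    proof
      fix e assume "e \<in> set (nf us)"
      then have e: "e \<in> set (all_pairs us)" by (simp add: all_pairs_def)
      have "fst e \<in> V \<and> snd e \<in> set ys \<and> fst e \<noteq> snd e"
        using bspec[OF valid_all_pairs[OF us(2), unfolded valid_def] e] .
      then show "e \<in> V \<times> set ys" by (simp only: mem_Times_iff simp_thms)
    qed
  qed auto
  also have "\<dots> = (\<Sum>x\<in>V. \<Sum>y\<in>set ys. if x = r then N else 1)"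
    unfolding sum.cartesian_product by (rule sum.cong) auto
  also have "\<dots> = N * N + (\<Sum>x\<in>set ys. \<Sum>y\<in>set ys. if x = r then N else 1)"
    using r_notin by (simp add: card_ys)
  also have "(\<Sum>x\<in>set ys. \<Sum>y\<in>set ys. if x = r then N else 1) = (\<Sum>x\<in>set ys. \<Sum>y\<in>set ys. 1)"
    using r_notin by (intro sum.cong) auto
  also have "N * N + \<dots> = 2 * (N * N)" by (simp add: card_ys)
  finally show ?thesis using 1 by (simp add: all_pairs_def weight_def)
qed

end

section \<open>From greedy sets to maximal cliques, and the build phase\<close>

context ordered_input
begin

text \<open>The greedy set contains the root, so every vertex of a larger clique is adjacent to the
  root and lies in \<open>V\<close>. But a vertex of \<open>V\<close> outside the set has a
  neighbour in \<open>H\<close> inside it, that is, a member to which it is not adjacent in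
  \<open>G\<close>.\<close>

lemma mis_maximal:
  assumes G: "G \<subseteq> E" and H: "\<And>u v. u \<in> V \<Longrightarrow> v \<in> V \<Longrightarrow> H u v \<longleftrightarrow> u \<noteq> v \<and> {u, v} \<notin> G"
  shows "maximal_clique {..<n} G {v \<in> V. mis H (rk q) v}"
proof -
  let ?C = "{v \<in> V. mis H (rk q) v}"
  have inj: "inj_on (rk q) V" using rk_inj[OF q(2)] unfolding q(3) .
  have adj: "{x, y} \<in> G" if "x \<in> ?C" "y \<in> ?C" "rk q x < rk q y" for x y
    using that H[of x y] mis_iff[of H "rk q" y] by auto
  have Vn: "V \<subseteq> {..<n}" using r edgeD by (auto simp: ys_set)
  have "clique {..<n} G ?C"
    unfolding clique_def
  proof (intro conjI ballI impI)
    fix x y assume xy: "x \<in> ?C" "y \<in> ?C" "x \<noteq> y"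
    have "x \<in> V" "y \<in> V" using xy by blast+
    then have "rk q x \<noteq> rk q y" using inj_on_eq_iff[OF inj] xy(3) by blast
    then consider "rk q x < rk q y" | "rk q y < rk q x" by linarith
    then show "{x, y} \<in> G" using adj[of x y] adj[of y x] xy by cases (simp_all add: insert_commute)
  qed (use Vn in auto)
  moreover have False if D: "clique {..<n} G D" and CD: "?C \<subset> D" for D
  proof -
    have rC: "r \<in> ?C" using mis_iff[of H "rk q" r] by (simp add: rk_Cons)
    obtain d where d: "d \<in> D" "d \<notin> ?C" using CD by auto
    then have "{r, d} \<in> G" using D CD rC unfolding clique_def by (metis (no_types, lifting) psubsetD)
    then have dV: "d \<in> V" using G by (auto simp: ys_set)
    then have "\<not> mis H (rk q) d" using d by simp
    then obtain u where u: "rk q u < rk q d" "H u d" "mis H (rk q) u" by (subst (asm) mis_iff) auto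
    have "u \<in> V"
    proof (rule ccontr)
      assume "u \<notin> V"
      then have "rk q u = length q" using rk_notin[of u q] unfolding q(3) by blast
      moreover have "rk q d < length q" using rk_less[of d q] dV unfolding q(3) by blast
      ultimately show False using u(1) by simp
    qed
    then have "u \<in> D" "u \<noteq> d" "{u, d} \<notin> G" using u CD H[OF _ dV, of u] by auto
    then show False using D d(1) unfolding clique_def by blast
  qed
  ultimately show ?thesis unfolding maximal_clique_def by blast
qed

lemma pairs_correct:
  assumes s0: "rd.vstate (edges_of []) s0" "reg s0 ''n'' = n" "reg s0 ''h'' = 1" "reg s0 ''z'' = 1"
    and Y: "\<forall>j<N. arr s0 ''Y'' (Suc j) = ys ! j" and M: "\<forall>a<n. \<forall>b<n. arr s0 ''M'' (a * n + b) = of_bool ({a, b} \<in> E)"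
  shows "wp w pairs (\<lambda>s t. rd.vstate (edges_of (ql (Suc N) 1)) s \<and>
    t \<le> 20 * (N * (N + 2)) + 1 + 200 * (lg + 2) * icosts p (ql (Suc N) 1)) s0"
proof -
  let ?Inv = "\<lambda>g s. rd.vstate (edges_of (ql (fst g) (snd g))) s \<and> reg s ''h'' = fst g \<and> reg s ''z'' = snd g \<and> reg s ''n'' = n \<and>
    1 \<le> snd g \<and> snd g \<le> fst g \<and> fst g \<le> Suc N \<and> (fst g \<le> N \<or> snd g = 1) \<and> arr s ''Y'' = arr s0 ''Y'' \<and> arr s ''M'' = arr s0 ''M''"
  let ?tc = "\<lambda>g. 20 * ((fst g - 1) * (N + 2) + snd g) + 200 * (lg + 2) * icosts p (ql (fst g) (snd g))"
  \<comment> \<open>Lexicographic in the two counters: \<open>N + 2\<close> exceeds every value of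
    the second summand.\<close>
  let ?\<mu> = "\<lambda>g. (N + 1 - fst g) * (N + 2) + (N + 1 - snd g)"
  let ?b = "Less (Reg ''h'') (Plus (Reg ''N'') (Const (Suc 0)))"
  have bv: "bval w ?b s \<longleftrightarrow> reg s ''h'' < Suc N" if "rd.vstate H s" for H s
  proof -
    have "reg s ''N'' = N" using that by (simp add: rd.vstate_def rd.ds_def rd.env_def)
    then show ?thesis using small N_less by simp
  qed
  have "wp w pairs (\<lambda>s t. \<exists>g. ?Inv g s \<and> \<not> bval w ?b s \<and> t + ?tc (1, 1) \<le> ?tc g + 1) s0"
    unfolding pairs_def
  proof (rule wp_while_acc[where Inv = ?Inv and tc = ?tc and \<mu> = ?\<mu>])
    show "?Inv (1, 1) s0" using s0 by (simp add: ql_1[unfolded One_nat_def])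
    fix g s assume I: "?Inv g s" and b: "bval w ?b s"
    obtain h z where g: "g = (h, z)" by (rule prod.exhaust)
    have st: "rd.vstate (edges_of (ql h z)) s" and regs: "reg s ''h'' = h" "reg s ''z'' = z" "reg s ''n'' = n"
      and hz: "1 \<le> z" "z \<le> h" and ar: "arr s ''Y'' = arr s0 ''Y''" "arr s ''M'' = arr s0 ''M''" using I g by auto
    have h: "h \<le> N" using b bv[OF st] regs by simp
    define Post where "Post = (\<lambda>s' t. \<exists>g'. ?Inv g' s' \<and> ?\<mu> g' < ?\<mu> g \<and> t + 1 + ?tc g \<le> ?tc g')"
    have "wp w pairs_body Post s"
    proof (cases "z < h")
      case True
      define u v where "u = ys ! (h - 1)" and "v = ys ! (z - 1)"
      have ix: "h - 1 < N" "z - 1 < N" using hz h by auto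
      have uv: "u \<in> set ys" "v \<in> set ys" unfolding u_def v_def using ix nth_mem by blast+
      then have un: "u < n" "v < n" using edgeD by (auto simp: ys_set)
      have neq: "u \<noteq> v" using ix True hz ys_distinct by (simp add: u_def v_def nth_eq_iff_index_eq)
      have Yh: "arr s ''Y'' h = u" "arr s ''Y'' z = v" 
        using spec[OF Y, of "h - 1"] spec[OF Y, of "z - 1"] ar ix hz by (simp_all add: u_def v_def)
      have Mu: "arr s ''M'' (u * n + v) = of_bool ({u, v} \<in> E)" using M ar un by simp
      have zm: "Suc z mod 2 ^ w = Suc z" using small(2)[of z] True h N_less by simp
      define s1 where "s1 = set_reg ''z'' (Suc z) (set_reg ''v'' v (set_reg ''u'' u s))"
      have st1: "rd.vstate (edges_of (ql h z)) s1" unfolding s1_def using st by simp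
      have \<mu>: "?\<mu> (h, Suc z) < ?\<mu> g" using True h by (simp add: g)
      have body: "wp w pairs_body Post s = (if {u, v} \<in> E then Post s1 (Suc (Suc (Suc (Suc (Suc (Suc 0)))))) else
          wp w update_prog (\<lambda>s' t. Post s' (Suc (Suc (Suc (Suc (Suc t)))))) s1)"
        unfolding pairs_body_def
        using True by (simp add: regs Yh index_mod un Mu zm small(3,4) s1_def)
      show ?thesis
      proof (cases "{u, v} \<in> E")
        case e: True
        then have "ql h (Suc z) = ql h z" using ql_Suc[OF hz(1), of h] by (simp add: u_def v_def)
        then have "?Inv (h, Suc z) s1" using st1 regs hz h True ar by (simp add: s1_def)
        then have "Post s1 t" if "t \<le> 6" for t unfolding Post_def using \<mu> \<open>ql h (Suc z) = ql h z\<close>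
that
          by (intro exI[of _ "(h, Suc z)"]) (simp add: g)
        then show ?thesis unfolding body by (simp add: e)
      next
        case e: False
        then have ql: "ql h (Suc z) = ql h z @ [(u, v)]" using ql_Suc[OF hz(1), of h] by (simp add: u_def v_def)
        have nm: "norm (u, v) = (u, v)" using uv r_notin by (auto simp: norm_def)
        have "wp w update_prog (\<lambda>s' t. Post s' (Suc (Suc (Suc (Suc (Suc t)))))) s1"
        proof (rule wp_mono[OF insert_pair[OF _ st1]])
          show "valid (ql h z)" using ql_valid[of h z] h hz by simp
          show "reg s1 ''u'' = u" "reg s1 ''v'' = v" by (simp_all add: s1_def)
          show "u \<in> V" "v \<in> V" "u \<noteq> v" using uv neq by auto
          fix s' t assume 1: "rd.vstate (edges_of (ql h z @ [norm (u, v)])) s' \<and> same insert_regs turn_arrs s1 s' \<and>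
            t \<le> 200 * (lg + 2) * step_cost p (ql h z) (norm (u, v)) + 5"
          then have sm: "same insert_regs turn_arrs s1 s'" by blast
          have "reg s' ''h'' = h" "reg s' ''z'' = Suc z" "reg s' ''n'' = n" "arr s' ''Y'' = arr s ''Y''" "arr s' ''M'' = arr s ''M''"
            using same_reg[OF sm, of "''h''"] same_reg[OF sm, of "''z''"] same_reg[OF sm, of "''n''"]
              same_arr[OF sm, of "''Y''"] same_arr[OF sm, of "''M''"] regs by (simp_all add: s1_def)
          then have I': "?Inv (h, Suc z) s'" using 1 hz h True ar by (simp add: ql nm)
          have t': "Suc (Suc (Suc (Suc (Suc t)))) + 1 + ?tc g \<le> ?tc (h, Suc z)" using 1 by (simp add: g ql nm add_mult_distrib2)
          show "Post s' (Suc (Suc (Suc (Suc (Suc t)))))" unfolding Post_def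
            by (rule exI[of _ "(h, Suc z)"]) (rule conjI[OF I' conjI[OF \<mu> t']])
        qed
        then show ?thesis unfolding body by (simp add: e)
      qed
    next
      case False
      then have z: "z = h" using hz by simp
      have hm: "Suc h mod 2 ^ w = Suc h" using small(2)[of h] h N_less by simp
      let ?s1 = "set_reg ''h'' (Suc h) (set_reg ''z'' 1 s)"
      have ql: "ql (Suc h) 1 = ql h z" using ql_next[of h] hz z by simp
      have I': "?Inv (Suc h, 1) ?s1" using st regs h ar by (simp only: ql fst_conv snd_conv) simp
      have \<mu>: "?\<mu> (Suc h, 1) < ?\<mu> g"
      proof -
        have "N + 1 - h = Suc (N - h)" using h by simp
        then show ?thesis unfolding g z fst_conv snd_conv by (simp add: add_mult_distrib)
      qed
      have t': "Suc (Suc (Suc 0)) + 1 + ?tc g \<le> ?tc (Suc h, 1)"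
      proof -
        have "h * (N + 2) = (h - 1) * (N + 2) + (N + 2)" using hz by (cases h) auto
        then show ?thesis unfolding g fst_conv snd_conv ql diff_Suc_1 using h z by simp
      qed
      have "Post ?s1 (Suc (Suc (Suc 0)))" unfolding Post_def
        by (rule exI[of _ "(Suc h, 1)"]) (rule conjI[OF I' conjI[OF \<mu> t']])
      then show ?thesis unfolding pairs_body_def using False by (simp add: regs hm small(3,4))
    qed
    then show "wp w pairs_body (\<lambda>s' t. \<exists>g'. ?Inv g' s' \<and> ?\<mu> g' < ?\<mu> g \<and> t + 1 + ?tc g \<le> ?tc g') s"
      unfolding Post_def .
  qed
  then show ?thesis
  proof (rule wp_mono)
    fix s t assume "\<exists>g. ?Inv g s \<and> \<not> bval w ?b s \<and> t + ?tc (1, 1) \<le> ?tc g + 1"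
    then obtain g where g: "?Inv g s" "\<not> bval w ?b s" "t + ?tc (1, 1) \<le> ?tc g + 1" by blast
    have "fst g = Suc N" using g(1,2) bv[of _ s] by auto
    then have "g = (Suc N, 1)" using g(1) by (cases g) auto
    then show "rd.vstate (edges_of (ql (Suc N) 1)) s \<and> t \<le> 20 * (N * (N + 2)) + 1 + 200 * (lg + 2) * icosts p (ql (Suc N) 1)"
      using g by (simp add: ql_1[unfolded One_nat_def])
  qed
qed

abbreviation build_time :: nat where "build_time \<equiv> 2 * lg + 7 * Suc N + 20 * (N * (N + 2)) + 20"

lemma build_correct:
  assumes us: "deletion_sequence us E"
    and s0: "reg s0 ''N'' = N" "reg s0 ''n'' = n" "\<forall>j\<le>N. arr s0 ''X'' j = q ! j" "arr s0 ''R'' = (\<lambda>_. 0)" "arr s0 ''T'' = (\<lambda>_. 0)"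
    and Y: "\<forall>j<N. arr s0 ''Y'' (Suc j) = ys ! j" and M: "\<forall>a<n. \<forall>b<n. arr s0 ''M'' (a * n + b) = of_bool ({a, b} \<in> E)"
  shows "wp w build (final n E w us (build_time + 200 * (lg + 2) * icosts p (all_pairs us) + 5 * length us)) s0"
proof -
  define Post where "Post = final n E w us (build_time + 200 * (lg + 2) * icosts p (all_pairs us) + 5 * length us)"
  have usE: "undirected ` set us \<subseteq> E" using us by (simp add: deletion_sequence_def)
  have neq: "\<forall>(u, v)\<in>set us. u \<noteq> v" by (rule no_loops[OF usE])
  have max: "maximal_clique {..<n} (graph_after E us') {v \<in> V. mis (edges_of (all_pairs us')) (rk q) v}"
    if "undirected ` set us' \<subseteq> E" for us'
    by (rule mis_maximal) (use edges_all_pairs[OF that] in \<open>auto simp: graph_after_def\<close>)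
  have fin: "Post s t" if st: "rd.vstate (edges_of (ql (Suc N) 1)) s"
    and t: "t \<le> build_time + 200 * (lg + 2) * icosts p (ql (Suc N) 1)" for s t
  proof -
    obtain outs t' where run: "run_updates w update_prog us s = return_spmf (outs, t')" "length outs = length us"
      "\<forall>i<length us. distinct (outs ! i) \<and> set (outs ! i) = {v \<in> V. mis (edges_of (all_pairs (take (Suc i) us))) (rk q) v}"
      "t' + 200 * (lg + 2) * icosts p (ql (Suc N) 1) \<le> 200 * (lg + 2) * icosts p (all_pairs us) + 5 * length us"
      using run_updates_correct[OF ql_valid[of "Suc N" 1] st neq] unfolding all_pairs_def by auto
    have "maintains_maximal_clique n E us (output_list s # outs)"
      unfolding maintains_maximal_clique_def
    proof (intro conjI allI impI)
      fix i assume i: "i \<le> length us"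
      have sub: "undirected ` set (take i us) \<subseteq> E" using usE set_take_subset[of i us] by blast
      have o: "distinct ((output_list s # outs) ! i) \<and> set ((output_list s # outs) ! i) = {v \<in> V. mis (edges_of (all_pairs (take i us))) (rk q) v}"
      proof (cases i)
        case 0
        then show ?thesis using rd.vstate_output[OF st] by (simp add: verts all_pairs_def nf_def)
      next
        case (Suc j)
        then show ?thesis using run(3) i by simp
      qed
      then show "distinct ((output_list s # outs) ! i)" "maximal_clique {..<n} (graph_after E (take i us)) (set ((output_list s # outs) ! i))"
        using max[OF sub] by simp_all
    qed (use run in simp)
    moreover have "t + t' \<le> build_time + 200 * (lg + 2) * icosts p (all_pairs us) + 5 * length us" using run(4) t by linarith
    ultimately show ?thesis unfolding Post_def final_def using run(1) by blast
  qed
  have P2: "2 ^ lg + 2 ^ lg < (2 :: nat) ^ w"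
  proof -
    have "2 ^ lg + 2 ^ lg \<le> (N + 3) * (2 * 2 ^ lg)" by (simp add: algebra_simps)
    then show ?thesis using ram_word by simp
  qed
  have Nm: "Suc N mod 2 ^ w = Suc N" using small(2)[of N] N_less by simp
  have "wp w build Post s0"
    unfolding build_def wp_Seq_simps aval.simps small(3)
  proof (rule wp_SeqI, rule double_correct)
    show "reg (set_reg ''P'' (Suc 0) s0) ''N'' = N" "reg (set_reg ''P'' (Suc 0) s0) ''P'' = 1" using s0 by simp_all
    fix s1 t1 assume 1: "reg s1 ''P'' = 2 ^ lg \<and> same {''P''} {} (set_reg ''P'' (Suc 0) s0) s1 \<and> t1 \<le> 2 * lg + 1"
    then have r1: "reg s1 x = reg s0 x" if "x \<noteq> ''P''" for x using that by (simp add: same_def)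
    have a1: "arr s1 = arr s0" using 1 by (simp add: same_def fun_eq_iff)
    define s2 where "s2 = set_reg ''i'' 0 (set_reg ''D'' (2 * 2 ^ lg) s1)"
    have s2: "reg s2 ''N'' = N" "reg s2 ''i'' = 0" "\<forall>j\<le>N. arr s2 ''X'' j = q ! j" "arr s2 ''R'' = (\<lambda>_. 0)"
      using s0 r1 a1 by (simp_all add: s2_def)
    have "wp w (fill ;; Assign ''k'' (Plus (Reg ''N'') (Const (Suc 0))) ;; Assign ''h'' (Const (Suc 0)) ;; Assign ''z'' (Const (Suc 0)) ;; pairs)
      (\<lambda>s'' t'. Post s'' (1 + (t1 + (1 + (1 + t'))))) s2"
    proof (rule wp_SeqI, rule fill_correct[OF s2])
      fix s3 t3 assume 3: "filled (Suc N) s3 \<and> same {''i''} {''K'', ''Z'', ''C'', ''J'', ''R''} s2 s3 \<and> t3 \<le> 7 * Suc N + 1"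
      then have sm: "same {''i''} {''K'', ''Z'', ''C'', ''J'', ''R''} s2 s3" by blast
      have r3: "reg s3 ''N'' = N" "reg s3 ''n'' = n" "reg s3 ''P'' = 2 ^ lg" "reg s3 ''D'' = 2 * 2 ^ lg"
        using same_reg[OF sm] r1 s0 1 by (simp_all add: s2_def)
      have a3: "arr s3 ''X'' = arr s0 ''X''" "arr s3 ''T'' = arr s0 ''T''" "arr s3 ''Y'' = arr s0 ''Y''" "arr s3 ''M'' = arr s0 ''M''"
        using same_arr[OF sm] a1 by (simp_all add: s2_def)
      define s4 where "s4 = set_reg ''z'' (Suc 0) (set_reg ''h'' (Suc 0) (set_reg ''k'' (Suc N) s3))"
      have "rd.vstate (edges_of []) s4"
        by (rule empty_vstate) (use 3 r3 a3 s0 in \<open>simp_all add: s4_def rd.env_def filled_def del: take_Suc_Cons\<close>)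
      then have "wp w pairs (\<lambda>s t. rd.vstate (edges_of (ql (Suc N) 1)) s \<and>
          t \<le> 20 * (N * (N + 2)) + 1 + 200 * (lg + 2) * icosts p (ql (Suc N) 1)) s4"
        by (rule pairs_correct) (use r3 a3 Y M in \<open>simp_all add: s4_def\<close>)
      then have "wp w pairs (\<lambda>s t. Post s (1 + (t1 + (1 + (1 + (t3 + (1 + (1 + (1 + t))))))))) s4"
        by (rule wp_mono) (rule fin, blast, use 1 3 in linarith)
      then show "wp w (Assign ''k'' (Plus (Reg ''N'') (Const (Suc 0))) ;; Assign ''h'' (Const (Suc 0)) ;; Assign ''z'' (Const (Suc 0)) ;; pairs)
        (\<lambda>s'' t'. Post s'' (1 + (t1 + (1 + (1 + (t3 + t')))))) s3"
        unfolding s4_def wp_Seq_simps aval.simps reg_set_reg r3(1) small(3) by (simp add: Nm)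
    qed
    then show "wp w (Assign ''D'' (Plus (Reg ''P'') (Reg ''P'')) ;; Assign ''i'' (Const 0) ;; fill ;;
        Assign ''k'' (Plus (Reg ''N'') (Const (Suc 0))) ;; Assign ''h'' (Const (Suc 0)) ;; Assign ''z'' (Const (Suc 0)) ;; pairs)
      (\<lambda>s'' t'. Post s'' (1 + (t1 + t'))) s1"
      unfolding s2_def wp_Seq_simps aval.simps using 1 P2 by (simp add: mult_2)
  qed
  then show ?thesis unfolding Post_def .
qed

end

lemma cpl_support: "cpl w c D Q s \<Longrightarrow> cpl w c D (\<lambda>x s t. x \<in> set_spmf D \<and> Q x s t) s"
  unfolding cpl_def by (erule rel_spmf_mono_strong) blast

section \<open>Initialization with a random order and the expected time for a fixed root\<close>

context rooted_input
begin

abbreviation prepare :: com where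
  "prepare \<equiv> scan ;; Write ''X'' (Const 0) (Reg ''r'') ;; Assign ''i'' (Const (Suc 0))"

definition total_time :: "(nat \<times> nat) list \<Rightarrow> nat list \<Rightarrow> nat" where
  "total_time us p = 12 * length es + 4 + 7 * N + (2 * lg + 7 * Suc N + 20 * (N * (N + 2)) + 20) +
     200 * (lg + 2) * icosts p (all_pairs us) + 5 * length us"

lemma prepare_correct:
  assumes s0: "s0 = set_reg ''r'' r (initial_store n es)"
  shows "wp w prepare (\<lambda>s t. reg s ''N'' = N \<and> reg s ''n'' = n \<and> reg s ''i'' = 1 \<and> arr s ''X'' 0 = r \<and>
    (\<forall>j<N. arr s ''X'' (Suc j) = ys ! j) \<and> (\<forall>j<N. arr s ''Y'' (Suc j) = ys ! j) \<and>
    (\<forall>a<n. \<forall>b<n. arr s ''M'' (a * n + b) = of_bool ({a, b} \<in> E)) \<and> arr s ''R'' = (\<lambda>_. 0) \<and> arr s ''T'' = (\<lambda>_. 0) \<and>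
    t \<le> 12 * length es + 3) s0"
proof (rule wp_SeqI[OF scan_correct[OF s0]])
  fix s and t :: nat assume 1: "scanned (length es) s \<and> same scan_regs scan_arrs s0 s \<and> t \<le> 12 * length es + 1"
  then have sm: "same scan_regs scan_arrs s0 s" by blast
  have 2: "reg s ''r'' = r" "reg s ''n'' = n" "arr s ''R'' = (\<lambda>_. 0)" "arr s ''T'' = (\<lambda>_. 0)"
    using same_reg[OF sm, of "''r''"] same_reg[OF sm, of "''n''"] same_arr[OF sm, of "''R''"] same_arr[OF sm, of "''T''"]
    by (simp_all add: s0 initial_store_def)
  have 3: "reg s ''N'' = N" "\<forall>j<N. arr s ''X'' (Suc j) = ys ! j" "\<forall>j<N. arr s ''Y'' (Suc j) = ys ! j"
    "\<forall>a<n. \<forall>b<n. arr s ''M'' (a * n + b) = of_bool ({a, b} \<in> E)"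
    using 1 by (simp_all add: scanned_def E_eq)
  show "wp w (Write ''X'' (Const 0) (Reg ''r'') ;; Assign ''i'' (Const (Suc 0)))
     (\<lambda>s'' t'. reg s'' ''N'' = N \<and> reg s'' ''n'' = n \<and> reg s'' ''i'' = 1 \<and> arr s'' ''X'' 0 = r \<and>
      (\<forall>j<N. arr s'' ''X'' (Suc j) = ys ! j) \<and> (\<forall>j<N. arr s'' ''Y'' (Suc j) = ys ! j) \<and>
      (\<forall>a<n. \<forall>b<n. arr s'' ''M'' (a * n + b) = of_bool ({a, b} \<in> E)) \<and> arr s'' ''R'' = (\<lambda>_. 0) \<and> arr s'' ''T'' = (\<lambda>_. 0) \<and>
      t + t' \<le> 12 * length es + 3) s"
    using 1 2 3 by (simp add: small(3,4))
qed

lemma root_correct: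
  assumes us: "deletion_sequence us E" and s0: "s0 = set_reg ''r'' r (initial_store n es)"
  shows "cpl w (prepare ;; shuffle ;; build) (spmf_of_set (permutations_of_set (set ys)))
    (\<lambda>p. final n E w us (total_time us p)) s0"
proof (rule wp_Seq_cpl[OF prepare_correct[OF s0]])
  fix s1 :: store and t1 :: nat
  assume 1: "reg s1 ''N'' = N \<and> reg s1 ''n'' = n \<and> reg s1 ''i'' = 1 \<and> arr s1 ''X'' 0 = r \<and>
    (\<forall>j<N. arr s1 ''X'' (Suc j) = ys ! j) \<and> (\<forall>j<N. arr s1 ''Y'' (Suc j) = ys ! j) \<and>
    (\<forall>a<n. \<forall>b<n. arr s1 ''M'' (a * n + b) = of_bool ({a, b} \<in> E)) \<and> arr s1 ''R'' = (\<lambda>_. 0) \<and> arr s1 ''T'' = (\<lambda>_. 0) \<and>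
    t1 \<le> 12 * length es + 3"
  have Xys: "map (arr s1 ''X'') [1..<Suc N] = ys"
    using 1 by (intro nth_equalityI) (simp_all del: upt_Suc)
  then have im: "arr s1 ''X'' ` {1..<Suc N} = set ys" by (metis set_map set_upt)
  have Nw: "Suc N < 2 ^ w" using nn_word N_less by (cases n) auto
  have sh: "cpl w shuffle (spmf_of_set (permutations_of_set (arr s1 ''X'' ` {1..<Suc N})))
    (\<lambda>p s' t. map (arr s' ''X'') [1..<Suc N] = p \<and> (\<forall>k<1. arr s' ''X'' k = arr s1 ''X'' k) \<and>
      same {''i'', ''j'', ''d''} {''X''} s1 s' \<and> t \<le> 7 * (Suc N - 1) + 1) s1"
    by (rule shuffle_correct[OF Nw]) (use 1 ys_distinct in \<open>simp_all add: Xys[unfolded One_nat_def] del: upt_Suc\<close>)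
  show "cpl w (shuffle ;; build) (spmf_of_set (permutations_of_set (set ys)))
     (\<lambda>p s'' t'. final n E w us (total_time us p) s'' (t1 + t')) s1"
  proof (rule cpl_Seq_wp[OF cpl_support[OF sh[unfolded im]]])
    fix p and s2 :: store and t2 :: nat
    assume 2: "p \<in> set_spmf (spmf_of_set (permutations_of_set (set ys))) \<and> map (arr s2 ''X'') [1..<Suc N] = p \<and>
      (\<forall>k<1. arr s2 ''X'' k = arr s1 ''X'' k) \<and> same {''i'', ''j'', ''d''} {''X''} s1 s2 \<and> t2 \<le> 7 * (Suc N - 1) + 1"
    then have p: "p \<in> permutations_of_set (set ys)" by (simp add: set_spmf_of_set)
    interpret o: ordered_input n E es w r p by unfold_locales (rule p)
    have sm: "same {''i'', ''j'', ''d''} {''X''} s1 s2" using 2 by blast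
    have X: "arr s2 ''X'' j = (r # p) ! j" if "j \<le> N" for j
    proof (cases j)
      case 0
      then show ?thesis using 1 2 by simp
    next
      case (Suc k)
      have "p ! k = map (arr s2 ''X'') [1..<Suc N] ! k" using 2 by simp
      also have "\<dots> = arr s2 ''X'' (Suc k)" using that Suc by (simp del: upt_Suc)
      finally show ?thesis using Suc by simp
    qed
    have s2: "reg s2 ''N'' = N" "reg s2 ''n'' = n" "arr s2 ''R'' = (\<lambda>_. 0)" "arr s2 ''T'' = (\<lambda>_. 0)"
      "arr s2 ''Y'' = arr s1 ''Y''" "arr s2 ''M'' = arr s1 ''M''"
      using same_reg[OF sm, of "''N''"] same_reg[OF sm, of "''n''"] same_arr[OF sm, of "''R''"] same_arr[OF sm, of "''T''"]
        same_arr[OF sm, of "''Y''"] same_arr[OF sm, of "''M''"] 1 by simp_all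
    have "wp w build (final n E w us (o.build_time + 200 * (lg + 2) * icosts p (all_pairs us) + 5 * length us)) s2"
      by (rule o.build_correct[OF us]) (use s2 X 1 in simp_all)
    then show "wp w build (\<lambda>s'' t'. final n E w us (total_time us p) s'' (t1 + (t2 + t'))) s2"
      by (rule wp_mono) (erule final_mono, use 1 2 in \<open>simp add: total_time_def\<close>)
  qed
qed

lemma lg_le: "real lg + 2 \<le> 4 * log 2 (real n + 1)"
proof -
  have "2 ^ lg \<le> 2 * real n" using lg_bounds(2) by (metis of_nat_le_iff of_nat_mult of_nat_numeral of_nat_power)
  then have "log 2 (2 ^ lg) \<le> log 2 (2 * (real n + 1))" by (subst log_le_cancel_iff) auto
  moreover have "log 2 (2 * (real n + 1)) = 1 + log 2 (real n + 1)" by (subst log_mult) simp_all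
  ultimately have "real lg \<le> 1 + log 2 (real n + 1)" by simp
  moreover have "1 \<le> log 2 (real n + 1)" using r by (subst one_le_log_cancel_iff) auto
  ultimately show ?thesis by linarith
qed

lemma qlog_le: "qlog N \<le> 21 * log 2 (real n + 1)"
proof -
  have "ln (real N + 1) \<le> ln (real n + 1)" using N_less by simp
  also have "\<dots> = ln 2 * log 2 (real n + 1)" by (simp add: log_def)
  also have "\<dots> \<le> 1 * log 2 (real n + 1)"
    by (rule mult_right_mono) (use ln_2_less_1 in \<open>auto intro: less_imp_le\<close>)
  finally have "ln (real N + 1) \<le> log 2 (real n + 1)" by simp
  moreover have "1 \<le> log 2 (real n + 1)" using r by (subst one_le_log_cancel_iff) auto
  ultimately show ?thesis unfolding qlog_def by linarith
qed

lemma deletions_le: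
  assumes us: "deletion_sequence us E"
  shows "length us \<le> card E" "\<forall>(u, v)\<in>set us. u \<noteq> v" "distinct (map undirected us)"
proof -
  have 1: "distinct (map undirected us)" "undirected ` set us \<subseteq> E" using us by (simp_all add: deletion_sequence_def)
  have "finite E" unfolding E_eq by simp
  then have "card (set (map undirected us)) \<le> card E" using 1(2) by (intro card_mono) simp_all
  then show "length us \<le> card E" using distinct_card[OF 1(1)] by simp
  show "\<forall>(u, v)\<in>set us. u \<noteq> v" by (rule no_loops[OF 1(2)])
  show "distinct (map undirected us)" by (rule 1)
qed

text \<open>The constants: \<open>13800 = 200 * 3 * 23\<close> from the cost of an update,
  \<open>weight_all_pairs\<close> and \<open>expected_icost\<close>;
  \<open>37044 = 4 * 21 ^ 3\<close> from \<open>lg_le\<close> and \<open>qlog_le\<close>; and 60 for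
  the overhead outside insertions. Together \<open>37044 * (13800 + 60) = 513429840\<close>.\<close>

lemma sum_total_time:
  assumes us: "deletion_sequence us E"
  shows "(\<Sum>p\<in>permutations_of_set (set ys). real (total_time us p)) \<le>
    fact N * (17 * real (card E) + 513429840 * (real N + 1)\<^sup>2 * log 2 (real n + 1) ^ 4)"
proof -
  define L where "L = log 2 (real n + 1)"
  define a where "a = 12 * length es + 4 + 7 * N + (2 * lg + 7 * Suc N + 20 * (N * (N + 2)) + 20) + 5 * length us"
  have L: "1 \<le> L" unfolding L_def using r by (subst one_le_log_cancel_iff) auto
  have "a \<le> 17 * card E + 60 * (N + 1)\<^sup>2 * (lg + 2)"
    using deletions_le(1)[OF us] by (simp add: a_def card_es power2_eq_square algebra_simps)
  then have "real a \<le> real (17 * card E + 60 * (N + 1)\<^sup>2 * (lg + 2))" by (simp only: of_nat_le_iff)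
  then have a: "real a \<le> 17 * real (card E) + 60 * (real N + 1)\<^sup>2 * (real lg + 2)" by (simp add: algebra_simps)
  have cp: "card (permutations_of_set (set ys)) = fact N" by (simp add: card_ys)
  have "(\<Sum>p\<in>permutations_of_set (set ys). real (total_time us p)) =
      (\<Sum>p\<in>permutations_of_set (set ys). real a + 200 * (real lg + 2) * real (icosts p (all_pairs us)))"
    by (rule sum.cong) (simp_all add: total_time_def a_def)
  also have "\<dots> = fact N * real a + 200 * (real lg + 2) * (\<Sum>p\<in>permutations_of_set (set ys). real (icosts p (all_pairs us)))"
    by (simp add: sum.distrib sum_distrib_left cp)
  also have "\<dots> \<le> fact N * real a + 200 * (real lg + 2) * (fact N * real (weight (all_pairs us)) * (23 * qlog N ^ 3))"
    by (intro add_left_mono mult_left_mono sum_icosts valid_all_pairs deletions_le(2)[OF us]) simp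
  also have "\<dots> \<le> fact N * real a + 200 * (real lg + 2) * (fact N * (3 * (real N + 1)\<^sup>2) * (23 * qlog N ^ 3))"
  proof (intro add_left_mono mult_left_mono mult_right_mono)
    have "real (weight (all_pairs us)) \<le> real (3 * (N * N))"
      using weight_all_pairs[OF deletions_le(3,2)[OF us]] by (simp only: of_nat_le_iff)
    also have "\<dots> \<le> 3 * (real N + 1)\<^sup>2" by (simp add: power2_eq_square algebra_simps)
    finally show "real (weight (all_pairs us)) \<le> 3 * (real N + 1)\<^sup>2" .
  qed (use qlog_ge[of N] in auto)
  also have "\<dots> = fact N * (real a + 13800 * (real N + 1)\<^sup>2 * ((real lg + 2) * qlog N ^ 3))"
    by (simp add: algebra_simps)
  also have "\<dots> \<le> fact N * (17 * real (card E) + 513429840 * (real N + 1)\<^sup>2 * L ^ 4)"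
  proof (rule mult_left_mono)
    have q3: "1 \<le> qlog N ^ 3" using qlog_ge[of N] by (rule one_le_power)
    have "(real lg + 2) * qlog N ^ 3 \<le> (4 * L) * (21 * L) ^ 3"
      using lg_le qlog_le qlog_ge[of N] L unfolding L_def[symmetric] by (intro mult_mono power_mono) auto
    also have "\<dots> = 37044 * L ^ 4" by (simp add: power_mult_distrib eval_nat_numeral)
    finally have b: "(real lg + 2) * qlog N ^ 3 \<le> 37044 * L ^ 4" .
    have "real lg + 2 \<le> (real lg + 2) * qlog N ^ 3" using mult_left_mono[OF q3, of "real lg + 2"] by simp
    then have b': "real lg + 2 \<le> 37044 * L ^ 4" using b by linarith
    have "60 * (real N + 1)\<^sup>2 * (real lg + 2) \<le> 60 * (real N + 1)\<^sup>2 * (37044 * L ^ 4)"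
      by (rule mult_left_mono[OF b']) simp
    moreover have "13800 * (real N + 1)\<^sup>2 * ((real lg + 2) * qlog N ^ 3) \<le> 13800 * (real N + 1)\<^sup>2 * (37044 * L ^ 4)"
      by (rule mult_left_mono[OF b]) simp
    moreover have "60 * (real N + 1)\<^sup>2 * (37044 * L ^ 4) + 13800 * (real N + 1)\<^sup>2 * (37044 * L ^ 4) = 513429840 * (real N + 1)\<^sup>2 * L ^ 4"
      by simp
    ultimately show "real a + 13800 * (real N + 1)\<^sup>2 * ((real lg + 2) * qlog N ^ 3) \<le> 17 * real (card E) + 513429840 * (real N + 1)\<^sup>2 * L ^ 4"
      using a by linarith
  qed simp
  finally show ?thesis unfolding L_def .
qed

lemma root_exists:
  assumes us: "deletion_sequence us E"
  shows "\<exists>T. cpl w ((scan ;; Write ''X'' (Const 0) (Reg ''r'') ;; Assign ''i'' (Const (Suc 0))) ;; shuffle ;; build)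
      (spmf_of_set (permutations_of_set (set (nbl r es)))) (\<lambda>p. final n E w us (T p)) (set_reg ''r'' r (initial_store n es)) \<and>
    (\<Sum>p\<in>permutations_of_set (set (nbl r es)). real (T p)) \<le>
      fact (length (nbl r es)) * (17 * real (card E) + 513429840 * (real (length (nbl r es)) + 1)\<^sup>2 * log 2 (real n + 1) ^ 4) \<and>
    card (permutations_of_set (set (nbl r es))) = fact (length (nbl r es)) \<and> length (nbl r es) < n"
  using root_correct[OF us refl] sum_total_time[OF us] card_ys N_less by (intro exI[of _ "total_time us"]) simp

end

section \<open>Averaging over the root\<close>

lemma sum_degrees: "(\<Sum>r<n. length (nbl r es)) \<le> 2 * length (es :: (nat \<times> nat) list)"
proof (induction es rule: rev_induct)
  case (snoc e es)
  obtain u v where e: "e = (u, v)" by fastforce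
  have "(\<Sum>r<n. length (nbl r (es @ [e]))) \<le> (\<Sum>r<n. length (nbl r es) + (of_bool (r = u) + of_bool (r = v)))"
    unfolding e nbl_simps by (rule sum_mono) auto
  also have "\<dots> = (\<Sum>r<n. length (nbl r es)) + (of_bool (u < n) + of_bool (v < n))"
    by (simp add: sum.distrib of_bool_def sum.delta)
  also have "\<dots> \<le> 2 * length es + 2" using snoc by (intro add_mono) auto
  finally show ?case by simp
qed simp

lemma nn_integral_spmf_of_set_le:
  assumes A: "finite A" "A \<noteq> {}" and f: "\<And>x. x \<in> A \<Longrightarrow> f x \<le> ennreal (g x)" "\<And>x. x \<in> A \<Longrightarrow> 0 \<le> g x"
    and b: "(\<Sum>x\<in>A. g x) \<le> real (card A) * b"
  shows "nn_integral (measure_spmf (spmf_of_set A)) f \<le> ennreal b"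
proof -
  have c: "0 < real (card A)" using A by (simp add: card_gt_0_iff)
  have "sum f A \<le> (\<Sum>x\<in>A. ennreal (g x))" by (rule sum_mono) (rule f)
  also have "\<dots> = ennreal (\<Sum>x\<in>A. g x)" using f(2) by (rule sum_ennreal)
  finally have "sum f A / of_nat (card A) \<le> ennreal (\<Sum>x\<in>A. g x) / ennreal (real (card A))"
    unfolding ennreal_of_nat_eq_real_of_nat by (rule divide_right_mono_ennreal)
  also have "\<dots> = ennreal ((\<Sum>x\<in>A. g x) / real (card A))" using c f(2) by (intro divide_ennreal sum_nonneg) auto
  also have "\<dots> \<le> ennreal b" using b c by (intro ennreal_leI) (simp add: divide_le_eq mult.commute)
  finally show ?thesis by (simp add: nn_integral_spmf_of_set)
qed

lemma nn_integral_bind_spmf: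
  "nn_integral (measure_spmf (bind_spmf p f)) g = nn_integral (measure_spmf p) (\<lambda>x. nn_integral (measure_spmf (f x)) g)"
  unfolding measure_spmf_bind
  by (subst nn_integral_bind[where B = "count_space UNIV"]) (simp_all add: comp_def)

lemma coupled_time:
  assumes "rel_spmf (\<lambda>x z. P (fst z) \<and> snd z \<le> T x) D M"
  shows "expected_total_time M \<le> nn_integral (measure_spmf D) (\<lambda>x. of_nat (T x))"
    "\<forall>(outs, t) \<in> set_spmf M. P outs" "lossless_spmf D \<Longrightarrow> lossless_spmf M"
proof -
  obtain pq where pq: "\<And>x z. (x, z) \<in> set_spmf pq \<Longrightarrow> P (fst z) \<and> snd z \<le> T x" "D = map_spmf fst pq" "M = map_spmf snd pq"
    using assms by (elim rel_spmfE) blast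
  show "\<forall>(outs, t) \<in> set_spmf M. P outs" using pq(1) unfolding pq(3) by fastforce
  show "lossless_spmf D \<Longrightarrow> lossless_spmf M" unfolding pq(2,3) by simp
  show "expected_total_time M \<le> nn_integral (measure_spmf D) (\<lambda>x. of_nat (T x))"
    unfolding expected_total_time_def pq(2,3) nn_integral_map_spmf comp_def
    by (rule nn_integral_mono_AE) (use pq(1) in \<open>auto simp: AE_measure_spmf_iff\<close>)
qed

text \<open>As \<open>d r + 1 \<le> n\<close>, one of the two factors \<open>d r + 1\<close> is
  replaced by \<open>n\<close>, and the other sums to at most \<open>2 * m + n\<close>. The factor
  \<open>n\<close> cancels in the average over the roots.\<close>

lemma average_bound:
  fixes d :: "nat \<Rightarrow> nat" and L m K :: real
  assumes "\<And>r. r < n \<Longrightarrow> d r < n" "(\<Sum>r<n. real (d r)) \<le> 2 * m" "0 \<le> K" "0 \<le> L"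
  shows "(\<Sum>r<n. 1 + (17 * m + K * (real (d r) + 1)\<^sup>2 * L)) \<le> real n * (1 + 17 * m + K * L * (2 * m + real n))"
proof -
  have "(\<Sum>r<n. 1 + (17 * m + K * (real (d r) + 1)\<^sup>2 * L)) \<le> (\<Sum>r<n. (1 + 17 * m + K * L * real n) + K * L * real n * real (d r))"
  proof (rule sum_mono)
    fix r assume "r \<in> {..<n}"
    then have "d r < n" using assms(1) by simp
    then have "(real (d r) + 1) * (real (d r) + 1) \<le> real n * (real (d r) + 1)" by (intro mult_right_mono) auto
    then have "K * L * (real (d r) + 1)\<^sup>2 \<le> K * L * (real n * (real (d r) + 1))"
      using assms(3,4) by (intro mult_left_mono) (simp_all add: power2_eq_square)
    then show "1 + (17 * m + K * (real (d r) + 1)\<^sup>2 * L) \<le> (1 + 17 * m + K * L * real n) + K * L * real n * real (d r)"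
      by (simp add: algebra_simps)
  qed
  also have "\<dots> = real n * (1 + 17 * m + K * L * real n) + K * L * real n * (\<Sum>r<n. real (d r))"
    by (simp add: sum.distrib sum_distrib_left)
  also have "\<dots> \<le> real n * (1 + 17 * m + K * L * real n) + K * L * real n * (2 * m)"
    using assms by (intro add_left_mono mult_left_mono) auto
  also have "\<dots> = real n * (1 + 17 * m + K * L * (2 * m + real n))" by (simp add: algebra_simps)
  finally show ?thesis .
qed

theorem theorem5p2:
  "\<exists>(A :: dynamic_algorithm) (\<kappa> :: nat) (c :: real) (d :: nat).
     \<forall>(n :: nat) (E :: nat set set) es us (w :: nat).
       n \<ge> 1 \<longrightarrow> simple_graph {..<n} E \<longrightarrow> enumerates es E \<longrightarrow> deletion_sequence us E \<longrightarrow>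
       w \<ge> \<kappa> * floorlog 2 n \<longrightarrow>
         lossless_spmf (run w A n es us) \<and>
         (\<forall>(outs, t) \<in> set_spmf (run w A n es us). maintains_maximal_clique n E us outs) \<and>
         expected_total_time (run w A n es us)
           \<le> ennreal (c * (real n + real (card E)) * log 2 (real n + 1) ^ d)"
proof (intro exI allI impI)
  fix n w :: nat and E :: "nat set set" and es us :: "(nat \<times> nat) list"
  let ?A = "\<lparr>initialize = init_prog, update = update_prog\<rparr>"
  let ?K = "513429840 :: real" and ?L = "log 2 (real n + 1)"
  assume n: "1 \<le> n" and simple: "simple_graph {..<n} E" and enum: "enumerates es E"
    and us: "deletion_sequence us E" and w: "8 * floorlog 2 n \<le> w"
  \<comment> \<open>\<open>floorlog 2 n\<close> is the bit length of \<open>n\<close>, so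
    \<open>n + 1\<close> is at most \<open>2 ^ floorlog 2 n\<close>. The factor 8 in the word size
    is twice the exponent 4, which makes the inequality strict.\<close>
  have "(n + 1) ^ 4 < 2 ^ w"
  proof -
    have fl: "n < 2 ^ floorlog 2 n" "0 < floorlog 2 n"
      using floorlog_bounds[of n 2] n floorlog_eq_zero_iff[of 2 n] by auto
    then have "(n + 1) ^ 4 \<le> (2 ^ floorlog 2 n) ^ 4" by (intro power_mono) auto
    also have "\<dots> = 2 ^ (4 * floorlog 2 n)" by (simp add: power_mult mult.commute flip: power_mult)
    also have "\<dots> < 2 ^ w" using w fl(2) by (intro power_strict_increasing) auto
    finally show ?thesis .
  qed
  then have root: "rooted_input n E es w r" if "r < n" for r
    using simple enum that by unfold_locales
  let ?D = "\<lambda>r. spmf_of_set (permutations_of_set (set (nbl r es)))"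
  let ?c = "(scan ;; Write ''X'' (Const 0) (Reg ''r'') ;; Assign ''i'' (Const (Suc 0))) ;; shuffle ;; build"
  \<comment> \<open>Each root comes with a time function of its own; \<open>bchoice\<close> joins
    them into one function of root and order, as the coupling needs.\<close>
  have "\<forall>r\<in>{..<n}. \<exists>T. cpl w ?c (?D r) (\<lambda>p. final n E w us (T p)) (set_reg ''r'' r (initial_store n es)) \<and>
    (\<Sum>p\<in>permutations_of_set (set (nbl r es)). real (T p)) \<le>
      fact (length (nbl r es)) * (17 * real (card E) + ?K * (real (length (nbl r es)) + 1)\<^sup>2 * ?L ^ 4) \<and>
    card (permutations_of_set (set (nbl r es))) = fact (length (nbl r es)) \<and> length (nbl r es) < n"
    using rooted_input.root_exists[OF root us] by blast
  from bchoice[OF this] obtain T where T: "\<forall>r\<in>{..<n}. cpl w ?c (?D r) (\<lambda>p. final n E w us (T r p)) (set_reg ''r'' r (initial_store n es)) \<and>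
    (\<Sum>p\<in>permutations_of_set (set (nbl r es)). real (T r p)) \<le>
      fact (length (nbl r es)) * (17 * real (card E) + ?K * (real (length (nbl r es)) + 1)\<^sup>2 * ?L ^ 4) \<and>
    card (permutations_of_set (set (nbl r es))) = fact (length (nbl r es)) \<and> length (nbl r es) < n" by blast
  define D where "D = bind_spmf (spmf_of_set {..<n}) (\<lambda>r. map_spmf (Pair r) (?D r))"
  have lossless: "lossless_spmf D" unfolding D_def using n by (auto simp: lessThan_empty_iff)
  have C: "cpl w init_prog D (\<lambda>x. final n E w us (1 + T (fst x) (snd x))) (initial_store n es)"
    unfolding init_prog_def D_def
  proof (rule cpl_SeqI, rule cpl_Random)
    show "aval w (Reg ''n'') (initial_store n es) = n" by (simp add: initial_store_def)
    show "0 < n" using n by simp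
    fix r s1 and t1 :: nat assume 1: "r < n \<and> s1 = set_reg ''r'' r (initial_store n es) \<and> t1 = 1"
    then have c: "cpl w ?c (?D r) (\<lambda>p. final n E w us (T r p)) s1" using T by blast
    show "cpl w ?c (map_spmf (Pair r) (?D r)) (\<lambda>x s'' t'. final n E w us (1 + T (fst x) (snd x)) s'' (t1 + t')) s1"
      by (rule cpl_map, rule cpl_mono[OF c], erule final_mono) (use 1 in simp)
  qed
  \<comment> \<open>The coupling of \<open>D\<close> with the state after initialization extends to
    the whole run, because the updates are deterministic from that state on.\<close>
  have "rel_spmf (\<lambda>x z. maintains_maximal_clique n E us (fst z) \<and> snd z \<le> 1 + T (fst x) (snd x))
      (bind_spmf D return_spmf) (run w ?A n es us)"
    unfolding run_def
  proof (rule rel_spmf_bindI)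
    show "rel_spmf (\<lambda>x z. final n E w us (1 + T (fst x) (snd x)) (fst z) (snd z)) D (exec w (initialize ?A) (initial_store n es))"
      using C by (simp add: cpl_def)
    fix x and z :: "store \<times> nat" assume "final n E w us (1 + T (fst x) (snd x)) (fst z) (snd z)"
    then obtain outs t' where "run_updates w update_prog us (fst z) = return_spmf (outs, t')"
      "maintains_maximal_clique n E us (output_list (fst z) # outs)" "snd z + t' \<le> 1 + T (fst x) (snd x)"
      unfolding final_def by blast
    then show "rel_spmf (\<lambda>x z. maintains_maximal_clique n E us (fst z) \<and> snd z \<le> 1 + T (fst x) (snd x)) (return_spmf x)
        (case z of (s, t) \<Rightarrow> bind_spmf (run_updates w (update ?A) us s) (\<lambda>(outs, t'). return_spmf (output_list s # outs, t + t')))"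
      by (simp add: case_prod_unfold rel_spmf_return_spmf2)
  qed
  then have rel: "rel_spmf (\<lambda>x z. maintains_maximal_clique n E us (fst z) \<and> snd z \<le> 1 + T (fst x) (snd x)) D (run w ?A n es us)"
    by simp
  have deg: "(\<Sum>r<n. real (length (nbl r es))) \<le> 2 * real (card E)"
  proof -
    have "length es = card E" using n rooted_input.card_es[OF root[of 0]] by simp
    then have "real (\<Sum>r<n. length (nbl r es)) \<le> real (2 * card E)" using sum_degrees[of es n] by (simp only: of_nat_le_iff)
    then show ?thesis by simp
  qed
  have L: "1 \<le> ?L" using n by (subst one_le_log_cancel_iff) auto
  have "expected_total_time (run w ?A n es us) \<le> nn_integral (measure_spmf D) (\<lambda>x. of_nat (1 + T (fst x) (snd x)))"
    by (rule coupled_time(1)[OF rel])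
  also have "\<dots> = nn_integral (measure_spmf (spmf_of_set {..<n})) (\<lambda>r. nn_integral (measure_spmf (?D r)) (\<lambda>p. of_nat (1 + T r p)))"
    unfolding D_def nn_integral_bind_spmf nn_integral_map_spmf comp_def fst_conv snd_conv ..
  also have "\<dots> \<le> ennreal (1 + 17 * real (card E) + ?K * ?L ^ 4 * (2 * real (card E) + real n))"
  proof (rule nn_integral_spmf_of_set_le)
    fix r assume "r \<in> {..<n}"
    then have t: "(\<Sum>p\<in>permutations_of_set (set (nbl r es)). real (T r p)) \<le>
        fact (length (nbl r es)) * (17 * real (card E) + ?K * (real (length (nbl r es)) + 1)\<^sup>2 * ?L ^ 4)"
      and c: "card (permutations_of_set (set (nbl r es))) = fact (length (nbl r es))" using T by blast+
    show "nn_integral (measure_spmf (?D r)) (\<lambda>p. of_nat (1 + T r p)) \<le>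
        ennreal (1 + (17 * real (card E) + ?K * (real (length (nbl r es)) + 1)\<^sup>2 * ?L ^ 4))"
    proof (rule nn_integral_spmf_of_set_le)
      show "(\<Sum>p\<in>permutations_of_set (set (nbl r es)). real (1 + T r p)) \<le>
        real (card (permutations_of_set (set (nbl r es)))) * (1 + (17 * real (card E) + ?K * (real (length (nbl r es)) + 1)\<^sup>2 * ?L ^ 4))"
        using t unfolding of_nat_add sum.distrib by (simp add: c distrib_left)
    qed (auto simp: ennreal_of_nat_eq_real_of_nat)
  next
    show "(\<Sum>r<n. 1 + (17 * real (card E) + ?K * (real (length (nbl r es)) + 1)\<^sup>2 * ?L ^ 4)) \<le>
      real (card {..<n}) * (1 + 17 * real (card E) + ?K * ?L ^ 4 * (2 * real (card E) + real n))"
      unfolding card_lessThan by (rule average_bound) (use T deg L in auto)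
  qed (use n L in \<open>auto simp: lessThan_empty_iff\<close>)
  also have "\<dots> \<le> ennreal (1026859698 * (real n + real (card E)) * ?L ^ 4)"
  proof (rule ennreal_leI)
    have L4: "1 \<le> ?L ^ 4" using L by (rule one_le_power)
    have n1: "1 \<le> real n" using n by simp
    have f1: "(1 + 17 * real (card E)) * 1 \<le> (18 * (real n + real (card E))) * ?L ^ 4"
      by (rule mult_mono) (use L4 n1 in auto)
    have f2: "?K * ?L ^ 4 * (2 * real (card E) + real n) \<le> ?K * ?L ^ 4 * (2 * (real n + real (card E)))"
      by (rule mult_left_mono) (use L4 in auto)
    \<comment> \<open>The coefficient is \<open>18 + 2 * 513429840\<close>; the 18 absorbs the
      drawing of the root and the \<open>17 * card E\<close> for reading and for skipping
      updates.\<close>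
    have eq: "(18 * (real n + real (card E))) * ?L ^ 4 + ?K * ?L ^ 4 * (2 * (real n + real (card E))) =
      1026859698 * (real n + real (card E)) * ?L ^ 4" by (simp add: algebra_simps)
    show "1 + 17 * real (card E) + ?K * ?L ^ 4 * (2 * real (card E) + real n) \<le> 1026859698 * (real n + real (card E)) * ?L ^ 4"
      using add_mono[OF f1 f2] unfolding eq mult_1_right .
  qed
  finally show "lossless_spmf (run w ?A n es us) \<and>
    (\<forall>(outs, t) \<in> set_spmf (run w ?A n es us). maintains_maximal_clique n E us outs) \<and>
    expected_total_time (run w ?A n es us) \<le> ennreal (1026859698 * (real n + real (card E)) * ?L ^ 4)"
    using coupled_time(2,3)[OF rel] lossless by blast
qed

end
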